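(* Let $n\ge2$, $\rho=\frac n2$, $\rho_H=\frac{n-1}2$. The renormalized distribution $$\widetilde K^{\mathbb A,-}_{\lambda,\nu}(x)=\frac{K^{\mathbb A,-}_{\lambda,\nu}(x)}{\Gamma(\frac12(\lambda+\nu+\frac32))\,\Gamma(\frac12(\lambda-\nu+\frac32))}$$ on $\mathbb R^n$ depends holomorphically on $(\lambda,\nu)\in\mathbb C^2$ and vanishes only for $(\lambda,\nu)\in L_{\mathrm{odd}}$. More precisely: 1. For $(\lambda,\nu)\in\mathbb C^2\setminus(X^-\cup Y^-)$ we have $\mathrm{supp}\,\widetilde K^{\mathbb A,-}_{\lambda,\nu}=\mathbb R^n$. 2. For $(\lambda,\nu)\in X^-\setminus Y^-$ with $\lambda+\nu=-\frac32-2k$, $k\in\mathbb N$, $$\widetilde K^{\mathbb A,-}_{\lambda,\nu}=\frac{(-1)^{k+1}k!}{(2k+1)!}\widetilde K^{\mathbb B,-}_{\lambda,\nu};$$ in particular $\mathrm{supp}\,\widetilde K^{\mathbb A,-}_{\lambda,\nu}=\mathbb R^{n-1}$. 3. For $(\lambda,\nu)\in Y^-\setminus L_{\mathrm{odd}}$ with $\lambda-\nu=-\frac32-2\ell$, $\ell\in\mathbb N$, $$\widetilde K^{\mathbb A,-}_{\lambda,\nu}=\frac{(-1)^{\ell+1}\ell!\,\pi^{\frac{n-1}2}}{2^{2\ell}\Gamma(\nu+\frac{n-1}2)}\widetilde K^{\mathbb C,-}_{\lambda,\nu};$$ in particular $\mathrm{supp}\,\widetilde K^{\mathbb A,-}_{\lambda,\nu}=\{0\}$.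 4. For $(-\rho-i,-\rho_H-j)\in L_{\mathrm{odd}}$, $2\ell=i-j-1$, restricting $(\lambda,\nu)\mapsto\widetilde K^{\mathbb A,-}_{\lambda,\nu}$ to two different complex hyperplanes in $\mathbb C^2$ through $(-\rho-i,-\rho_H-j)$ and renormalizing gives two holomorphic families of distributions: $$\widetilde K^{\mathbb C,-}_{\lambda,\nu}=\frac{(-1)^{\ell+1}2^{2\ell}}{\ell!\,\pi^{\frac{n-1}2}}\Gamma(\nu+\rho_H)\widetilde K^{\mathbb A,-}_{\lambda,\nu}\quad(\lambda-\nu=-\tfrac32-2\ell),$$ $$\widetilde{\widetilde K}{}^{\mathbb A,-}_{\lambda,\nu}=\Gamma(\tfrac12(\lambda-\nu+\tfrac32))\widetilde K^{\mathbb A,-}_{\lambda,\nu}\quad(\nu=-\rho_H-j).$$ Their special values at $(-\rho-i,-\rho_H-j)$ satisfy $\mathrm{supp}\,\widetilde K^{\mathbb C,-}_{-\rho-i,-\rho_H-j}=\{0\}$ and $\mathrm{supp}\,\widetilde{\widetilde K}{}^{\mathbb A,-}_{-\rho-i,-\rho_H-j}=\mathbb R^n$ for $n$ even, $=\mathbb R^{n-1}$ for $n$ odd; more precisely, for $n$ odd and $2k=n+i+j-2$, $$\widetilde{\widetilde K}{}^{\mathbb A,-}_{-\rho-i,-\rho_H-j}(x)=\frac{(-1)^{k+1}k!}{(2k+1)!}(|x'|^2+x_n^2)^j\delta^{(2k+1)}(x_n).$$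
   Context: $\mathbb N=\{0,1,2,\dots\}$; $(a)_m=a(a+1)\cdots(a+m-1)$; $x=(x',x_n)\in\mathbb R^{n-1}\times\mathbb R=\mathbb R^n$; $\mathbb R^{n-1}$ is identified with $\{x_n=0\}\subseteq\mathbb R^n$; $\delta$ is the Dirac distribution. $$K^{\mathbb A,-}_{\lambda,\nu}(x)=\mathrm{sgn}(x_n)|x_n|^{\lambda+\nu-\frac12}(|x'|^2+x_n^2)^{-\nu-\frac{n-1}2},$$ extended meromorphically in $(\lambda,\nu)\in\mathbb C^2$ as a family in $\mathcal D'(\mathbb R^n)$. $$X^-=\{(\lambda,\nu):\lambda+\nu=-\tfrac32-2k,\,k\in\mathbb N\},\quad Y^-=\{(\lambda,\nu):\lambda-\nu=-\tfrac32-2\ell,\,\ell\in\mathbb N\},$$ $$L_{\mathrm{odd}}=\{(-\rho-i,-\rho_H-j):i,j\in\mathbb N,\ i-j\in2\mathbb N+1\}\subseteq Y^-.$$ For $\lambda+\nu=-\frac32-2k$, $$\widetilde K^{\mathbb B,-}_{\lambda,\nu}(x)=\frac{(|x'|^2+x_n^2)^{-\nu-\frac{n-1}2}\delta^{(2k+1)}(x_n)}{\Gamma(\frac12(\lambda-\nu+\frac32))}=\sum_{i=0}^k\frac{(-1)^i(2k+1)!(\nu+\frac{n-1}2)_i}{i!(2k-2i+1)!\,\Gamma(\frac12(\lambda-\nu+\frac32))}|x'|^{1-n-2\nu-2i}\delta^{(2k-2i+1)}(x_n)$$ (holomorphic in $\nu$ by analytic continuation), and for $\lambda-\nu=-\frac32-2\ell$,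 $$\widetilde K^{\mathbb C,-}_{\lambda,\nu}(x)=\sum_{j=0}^\ell\frac{2^{2\ell-2j}(\nu-\ell)_{\ell-j}}{j!(2\ell-2j+1)!}\big(\Delta_{\mathbb R^{n-1}}^j\partial_n^{2\ell-2j+1}\delta\big)(x).$$ *)

theory Defs
  imports "HOL-Complex_Analysis.Complex_Analysis"
begin

section \<open>Test functions and distributions\<close>

type_synonym 'a functional = "('a \<Rightarrow> complex) \<Rightarrow> complex"

definition pderiv_along :: "'a::euclidean_space \<Rightarrow> ('a \<Rightarrow> complex) \<Rightarrow> 'a \<Rightarrow> complex" where
  "pderiv_along v f x = frechet_derivative f (at x) v"

primrec pderivs :: "'a::euclidean_space list \<Rightarrow> ('a \<Rightarrow> complex) \<Rightarrow> 'a \<Rightarrow> complex" where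
  "pderivs [] f = f"
| "pderivs (v # vs) f = pderiv_along v (pderivs vs f)"

text \<open>All iterated partial derivatives exist as (Frechet) differentiable functions; they are
  then automatically continuous, so this is $C^\infty$.\<close>

definition smooth :: "('a::euclidean_space \<Rightarrow> complex) \<Rightarrow> bool" where
  "smooth f \<longleftrightarrow> (\<forall>vs x. set vs \<subseteq> Basis \<longrightarrow> pderivs vs f differentiable (at x))"

definition fun_supp :: "('a::euclidean_space \<Rightarrow> complex) \<Rightarrow> 'a set" where
  "fun_supp f = closure {x. f x \<noteq> 0}"

definition test_functions :: "('a::euclidean_space \<Rightarrow> complex) set" where
  "test_functions = {\<phi>. smooth \<phi> \<and> compact (fun_supp \<phi>)}"

text \<open>Continuity is the usual seminorm estimate on every compact set; \<open>B\<close> ranges over the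
  upper bounds of the $C^N$-norm of the test function. Values of a functional outside the test
  functions are irrelevant, so two distributions are equal if they agree on all test
  functions.\<close>

definition distribution :: "'a::euclidean_space functional \<Rightarrow> bool" where
  "distribution T \<longleftrightarrow>
     (\<forall>\<phi>\<in>test_functions. \<forall>\<psi>\<in>test_functions. T (\<lambda>x. \<phi> x + \<psi> x) = T \<phi> + T \<psi>) \<and>
     (\<forall>c. \<forall>\<phi>\<in>test_functions. T (\<lambda>x. c * \<phi> x) = c * T \<phi>) \<and>
     (\<forall>K. compact K \<longrightarrow> (\<exists>C N. \<forall>\<phi>\<in>test_functions. fun_supp \<phi> \<subseteq> K \<longrightarrow>
        (\<forall>B. (\<forall>vs x. set vs \<subseteq> Basis \<and> length vs \<le> N \<longrightarrow> norm (pderivs vs \<phi> x) \<le> B)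
             \<longrightarrow> norm (T \<phi>) \<le> C * B)))"

definition deq :: "'a::euclidean_space functional \<Rightarrow> 'a functional \<Rightarrow> bool" where
  "deq S T \<longleftrightarrow> (\<forall>\<phi>\<in>test_functions. S \<phi> = T \<phi>)"

definition dsupp :: "'a::euclidean_space functional \<Rightarrow> 'a set" where
  "dsupp T = - \<Union> {U. open U \<and> (\<forall>\<phi>\<in>test_functions. fun_supp \<phi> \<subseteq> U \<longrightarrow> T \<phi> = 0)}"

definition dscale :: "complex \<Rightarrow> 'a functional \<Rightarrow> 'a functional" where
  "dscale c T = (\<lambda>\<phi>. c * T \<phi>)"

definition dmult :: "('a \<Rightarrow> complex) \<Rightarrow> 'a functional \<Rightarrow> 'a functional" where
  "dmult f T = (\<lambda>\<phi>. T (\<lambda>x. f x * \<phi> x))"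

definition dderiv :: "'a::euclidean_space \<Rightarrow> 'a functional \<Rightarrow> 'a functional" where
  "dderiv v T = (\<lambda>\<phi>. - T (pderiv_along v \<phi>))"


section \<open>Holomorphic and meromorphic families of distributions\<close>

text \<open>Holomorphy of a family in $\mathcal D'$ is weak holomorphy (equivalent to strong
  holomorphy in $\mathcal D'$).\<close>

definition holo_family :: "complex set \<Rightarrow> (complex \<Rightarrow> 'a::euclidean_space functional) \<Rightarrow> bool" where
  "holo_family U F \<longleftrightarrow> (\<forall>z\<in>U. distribution (F z)) \<and>
     (\<forall>\<phi>\<in>test_functions. (\<lambda>z. F z \<phi>) holomorphic_on U)"

definition holo2_on :: "(complex \<times> complex \<Rightarrow> complex) \<Rightarrow> (complex \<times> complex) set \<Rightarrow> bool" where
  "holo2_on f U \<longleftrightarrow>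
     (\<forall>p\<in>U. \<exists>a b. (f has_derivative (\<lambda>w. a * fst w + b * snd w)) (at p within U))"

definition holo2_family ::
  "(complex \<times> complex) set \<Rightarrow> (complex \<times> complex \<Rightarrow> 'a::euclidean_space functional) \<Rightarrow> bool" where
  "holo2_family U F \<longleftrightarrow> (\<forall>p\<in>U. distribution (F p)) \<and>
     (\<forall>\<phi>\<in>test_functions. holo2_on (\<lambda>p. F p \<phi>) U)"

text \<open>Locally a quotient of a holomorphic family by a scalar holomorphic function that does not
  vanish identically; the values on the polar set are arbitrary.\<close>

definition mero2_family :: "(complex \<times> complex \<Rightarrow> 'a::euclidean_space functional) \<Rightarrow> bool" where
  "mero2_family F \<longleftrightarrow> (\<forall>p. \<exists>V G h. open V \<and> connected V \<and> p \<in> V \<and>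
     holo2_family V G \<and> holo2_on h V \<and> (\<exists>q\<in>V. h q \<noteq> 0) \<and>
     (\<forall>q\<in>V. h q \<noteq> 0 \<longrightarrow> deq (F q) (dscale (1 / h q) (G q))))"

definition regular_points ::
  "(complex \<times> complex \<Rightarrow> 'a::euclidean_space functional) \<Rightarrow> (complex \<times> complex) set" where
  "regular_points F = {p. \<exists>V. open V \<and> p \<in> V \<and> holo2_family V F}"


section \<open>The kernels\<close>

text \<open>$\mathbb R^n$ with $n \ge 2$ is the product of $\mathbb R^{n-1}$, of dimension
  \<open>CARD('m) = n - 1 \<ge> 1\<close>, and the last coordinate axis.\<close>

type_synonym 'm space = "(real ^ 'm) \<times> real"

abbreviation e_n :: "'m::finite space" where
  "e_n \<equiv> (0, 1)"

definition dirac :: "'m::finite space functional" where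
  "dirac = (\<lambda>\<phi>. \<phi> 0)"

definition dlaplace' :: "'m::finite space functional \<Rightarrow> 'm space functional" where
  "dlaplace' T = (\<lambda>\<phi>. \<Sum>b\<in>(Basis :: (real ^ 'm) set). dderiv (b, 0) (dderiv (b, 0) T) \<phi>)"

definition delta_xn :: "nat \<Rightarrow> 'm::finite space functional" where
  "delta_xn m = (dderiv e_n ^^ m) (\<lambda>\<phi>. \<integral>x'. \<phi> (x', 0) \<partial>lborel)"

text \<open>$|x'|^s \delta^{(m)}(x_n)$; $|x'|^s$ does not depend on $x_n$ and therefore commutes
  with the derivatives in $x_n$. Meaningful for $\mathrm{Re}\, s > -(n-1)$.\<close>

definition pow_delta_xn :: "complex \<Rightarrow> nat \<Rightarrow> 'm::finite space functional" where
  "pow_delta_xn s m =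
     (dderiv e_n ^^ m) (\<lambda>\<phi>. \<integral>x'. of_real (norm x') powr s * \<phi> (x', 0) \<partial>lborel)"

definition KA_fun :: "complex \<Rightarrow> complex \<Rightarrow> 'm::finite space \<Rightarrow> complex" where
  "KA_fun lam nu x =
     of_real (sgn (snd x)) * of_real \<bar>snd x\<bar> powr (lam + nu - 1/2)
       * of_real ((norm (fst x))\<^sup>2 + (snd x)\<^sup>2) powr (- nu - of_nat CARD('m) / 2)"

text \<open>The set of parameters for which \<open>KA_fun\<close> is locally integrable: the first condition is
  integrability along $x_n = 0$, the second one integrability at the origin
  (\<open>KA_fun\<close> is homogeneous of degree $\lambda - \nu - n + \frac12$).\<close>

definition KA_dom :: "(complex \<times> complex) set" where
  "KA_dom = {(lam, nu). Re (lam + nu) > - 1/2 \<and> Re (lam - nu) > - 1/2}"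

definition KA_int :: "complex \<Rightarrow> complex \<Rightarrow> 'm::finite space functional" where
  "KA_int lam nu = (\<lambda>\<phi>. \<integral>x. KA_fun lam nu x * \<phi> x \<partial>lborel)"

text \<open>The meromorphic extension; it is unique up to its values on the polar set.\<close>

definition KA :: "complex \<times> complex \<Rightarrow> 'm::finite space functional" where
  "KA = (SOME F. mero2_family F \<and>
     (\<forall>lam nu. (lam, nu) \<in> KA_dom \<longrightarrow> deq (F (lam, nu)) (KA_int lam nu)))"

text \<open>The quotient of \<open>KA\<close> by the two Gamma factors is formed at the regular points of \<open>KA\<close>
  (\<open>rGamma\<close> is the entire function $1/\Gamma$) and is read as its continuous extension
  at the other points.\<close>

definition KA_tilde :: "complex \<times> complex \<Rightarrow> 'm::finite space functional" where
  "KA_tilde p = (\<lambda>\<phi>. Lim (at p within regular_points (KA :: complex \<times> complex \<Rightarrow> 'm space functional))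
     (\<lambda>(lam, nu). KA (lam, nu) \<phi> * rGamma ((lam + nu + 3/2) / 2) * rGamma ((lam - nu + 3/2) / 2)))"

text \<open>\<open>KB_sum\<close>, \<open>KB_tilde\<close> are $\widetilde K^{\mathbb B,-}_{\lambda,\nu}$ on the line
  $\lambda + \nu = -\frac32 - 2k$ with coordinate $\nu$. All the powers of $|x'|$ in the sum are
  locally integrable on $\mathbb R^{n-1}$ if and only if $\mathrm{Re}\,\nu < -k$.\<close>

definition KB_sum :: "nat \<Rightarrow> complex \<Rightarrow> 'm::finite space functional" where
  "KB_sum k nu = (\<lambda>\<phi>. let lam = - 3/2 - 2 * of_nat k - nu in
     \<Sum>i\<le>k. (-1) ^ i * fact (2*k+1) * pochhammer (nu + of_nat CARD('m) / 2) i
              / (fact i * fact (2*k - 2*i + 1)) * rGamma ((lam - nu + 3/2) / 2)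
              * pow_delta_xn (- of_nat CARD('m) - 2 * nu - 2 * of_nat i) (2*k - 2*i + 1) \<phi>)"

definition KB_tilde :: "nat \<Rightarrow> complex \<Rightarrow> 'm::finite space functional" where
  "KB_tilde k nu = (\<lambda>\<phi>. (THE g. g holomorphic_on UNIV \<and>
     (\<forall>z. Re z < - real k \<longrightarrow> g z = KB_sum k z \<phi>)) nu)"

text \<open>$\widetilde K^{\mathbb C,-}_{\lambda,\nu}$ on the line $\lambda - \nu = -\frac32 - 2\ell$
  with coordinate $\nu$.\<close>

definition KC_tilde :: "nat \<Rightarrow> complex \<Rightarrow> 'm::finite space functional" where
  "KC_tilde l nu = (\<lambda>\<phi>. \<Sum>j\<le>l.
     2 ^ (2*l - 2*j) * pochhammer (nu - of_nat l) (l - j) / (fact j * fact (2*l - 2*j + 1))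
       * (dlaplace' ^^ j) ((dderiv e_n ^^ (2*l - 2*j + 1)) dirac) \<phi>)"

text \<open>The family $\Gamma(\frac12(\lambda-\nu+\frac32)) \widetilde K^{\mathbb A,-}_{\lambda,\nu}$
  on the line $\nu = -\rho_H - j$ with coordinate $\lambda$, continuously extended to the poles
  of the Gamma function.\<close>

definition KAA_tilde :: "nat \<Rightarrow> complex \<Rightarrow> 'm::finite space functional" where
  "KAA_tilde j lam = (\<lambda>\<phi>. let nu = - of_nat CARD('m) / 2 - of_nat j in
     Lim (at lam) (\<lambda>z. Gamma ((z - nu + 3/2) / 2) * KA_tilde (z, nu) \<phi>))"


section \<open>Parameter sets\<close>

definition X_minus :: "(complex \<times> complex) set" where
  "X_minus = {(lam, nu). \<exists>k::nat. lam + nu = - 3/2 - 2 * of_nat k}"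

definition Y_minus :: "(complex \<times> complex) set" where
  "Y_minus = {(lam, nu). \<exists>l::nat. lam - nu = - 3/2 - 2 * of_nat l}"

definition L_odd :: "nat \<Rightarrow> (complex \<times> complex) set" where
  "L_odd n = {(- of_nat n / 2 - of_nat i, - (of_nat n - 1) / 2 - of_nat j) | i j :: nat.
                \<exists>m::nat. int i - int j = 2 * int m + 1}"

end

theory Submission
  imports Defs
begin

text \<open>
  Put $\alpha = \frac12(\lambda+\nu+\frac32)$, $\beta = \frac12(\lambda-\nu+\frac32)$. The kernel is even
  in $x'$ (under $x' \mapsto -x'$) and odd in $x_n$, so only the part of a test function with the same
  parities matters; for such $f$ put $Qf(x) = \int_0^1 s\,(\partial_n^2 f)(x', s x_n)\,ds$, so that
  $x_n^2\, Q f = (x_n\partial_n - 1) f$. Write $J(\alpha,\beta) f$ for the integral of the kernel against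
  $f$ divided by $\Gamma(\alpha)\Gamma(\beta)$. Integration by parts gives
  $J(\alpha,\beta) f = \mu J(\alpha+1,\beta) f - \frac\beta2 J(\alpha+1,\beta+1)(Q f)$ with
  $\mu = \nu + \frac{n-1}2$, which continues $J$ in $\alpha$, while the Euler operator removes Taylor terms
  at the origin and continues $J$ in $\beta$. The same identity reduces the line $\alpha = -k$ to
  $\alpha = 0$, a boundary integral over $x_n = 0$. On $\beta = -\ell$ one starts from a Gaussian limit
  at $\beta = 0$ and steps with a second order operator $L$ satisfying
  $J(\alpha,\beta+1)(L f) = 4(1-\mu) J(\alpha,\beta) f$. The identity theorem in two variables identifies
  $J$ with the renormalized meromorphic extension. For the supports, the kernel and the boundary
  densities are continuous and nonzero away from their singular sets, so small bumps detect them.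
\<close>

text \<open>On the parity class the Taylor terms at the origin have odd degree only. The Euler
  factors E - 1, E - 3, ... therefore meet exactly the poles of Gamma(beta): the factor E - (2M + 1)
  multiplies the integral by -2(beta + M). Integration by parts is carried out only where Re alpha
  is large and Re mu very negative. There the kernel is differentiable, no boundary terms arise, and
  each identity is then carried to all parameters by continuation.

  Two obstacles come from the definitions. The meromorphic extension is specified only up to
  arbitrary values on its polar set, so J is compared with it on a dense open set first and at
  regular points by continuity. On the lines nu = -rho_H - j the second renormalization has to
  remove the factor 1/Gamma(beta) that is built into J. There mu = -j, so |x|^(2j) is a polynomial
  and moves into the test function. What remains is mu = 0, where the recursion has a single term
  and can be divided by 1/Gamma(beta).

  The residue formulas are inductions in which the weights of two shifted sums add up to a constant;
  this produces k! and l!.\<close>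

type_synonym 'a cfun = "'a \<Rightarrow> complex"

section \<open>Smooth functions\<close>

lemma pderivs_append: "pderivs (us @ vs) f = pderivs us (pderivs vs f)"
  by (induction us) auto

text \<open>\<open>frechet_derivative\<close> chooses among the derivatives at a point, so the two
  choices agree as soon as the sets of derivatives do. This covers points where neither function is
  differentiable.\<close>

lemma pderiv_along_cong:
  assumes "open U" "x \<in> U" "\<And>y. y \<in> U \<Longrightarrow> f y = g y"
  shows "pderiv_along v f x = pderiv_along v g x"
proof -
  have "(f has_derivative D) (at x) \<longleftrightarrow> (g has_derivative D) (at x)" for D
    using has_derivative_transform_within_open[OF _ assms(1,2)] assms(3) by metis
  then show ?thesis by (simp add: pderiv_along_def frechet_derivative_def)
qed

lemma differentiable_cong_open:
  assumes "open U" "x \<in> U" "\<And>y. y \<in> U \<Longrightarrow> f y = g y"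
  shows "f differentiable (at x) \<longleftrightarrow> g differentiable (at x)"
  unfolding differentiable_def
  using has_derivative_transform_within_open[OF _ assms(1,2)] assms(3) by metis

lemma pderivs_cong:
  assumes "open U" "\<And>y. y \<in> U \<Longrightarrow> f y = g y" "x \<in> U"
  shows "pderivs vs f x = pderivs vs g x"
  using assms(3)
proof (induction vs arbitrary: x)
  case Nil then show ?case using assms by simp
next
  case (Cons v vs)
  show ?case unfolding pderivs.simps
    by (rule pderiv_along_cong[OF assms(1) Cons.prems Cons.IH])
qed

text \<open>Bounding the order makes induction through products and compositions possible;
  \<open>smooth\<close> is the case of all orders on the whole space.\<close>

definition smooth_upto :: "nat \<Rightarrow> 'a::euclidean_space set \<Rightarrow> ('a \<Rightarrow> complex) \<Rightarrow> bool" where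
  "smooth_upto k U f \<longleftrightarrow>
     (\<forall>vs x. set vs \<subseteq> Basis \<and> length vs \<le> k \<and> x \<in> U \<longrightarrow> pderivs vs f differentiable (at x))"

lemma smooth_iff_upto: "smooth f \<longleftrightarrow> (\<forall>k. smooth_upto k UNIV f)"
  unfolding smooth_def smooth_upto_def by blast

lemma smooth_upto_differentiable: "smooth_upto k U f \<Longrightarrow> x \<in> U \<Longrightarrow> f differentiable (at x)"
  unfolding smooth_upto_def by (drule spec[of _ "[]"]) auto

lemma smooth_upto_0: "smooth_upto 0 U f \<longleftrightarrow> (\<forall>x\<in>U. f differentiable (at x))"
  unfolding smooth_upto_def by auto

text \<open>The derivative split off here is the one applied first, the last entry of the list,
  whereas \<open>pderivs\<close> recurses on the one applied last. In this form the product and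
  chain rules can be applied to \<open>f\<close> itself.\<close>

lemma smooth_upto_Suc:
  "smooth_upto (Suc k) U f \<longleftrightarrow>
     (\<forall>x\<in>U. f differentiable (at x)) \<and> (\<forall>b\<in>Basis. smooth_upto k U (pderiv_along b f))"
proof
  assume L: "smooth_upto (Suc k) U f"
  have "smooth_upto k U (pderiv_along b f)" if "b \<in> Basis" for b
    unfolding smooth_upto_def
  proof (intro allI impI)
    fix vs :: "'a list" and x assume "set vs \<subseteq> Basis \<and> length vs \<le> k \<and> x \<in> U"
    then have "pderivs (vs @ [b]) f differentiable at x"
      using L that unfolding smooth_upto_def by auto
    then show "pderivs vs (pderiv_along b f) differentiable at x" by (simp add: pderivs_append)
  qed
  with L show "(\<forall>x\<in>U. f differentiable (at x)) \<and> (\<forall>b\<in>Basis. smooth_upto k U (pderiv_along b f))"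
    using smooth_upto_differentiable by blast
next
  assume R: "(\<forall>x\<in>U. f differentiable (at x)) \<and> (\<forall>b\<in>Basis. smooth_upto k U (pderiv_along b f))"
  show "smooth_upto (Suc k) U f"
    unfolding smooth_upto_def
  proof (intro allI impI)
    fix vs :: "'a list" and x assume vs: "set vs \<subseteq> Basis \<and> length vs \<le> Suc k \<and> x \<in> U"
    show "pderivs vs f differentiable at x"
    proof (cases vs rule: rev_cases)
      case Nil then show ?thesis using R vs by simp
    next
      case (snoc us b)
      then show ?thesis using R vs unfolding smooth_upto_def by (simp add: pderivs_append)
    qed
  qed
qed

lemma smooth_upto_mono: "smooth_upto k U f \<Longrightarrow> j \<le> k \<Longrightarrow> V \<subseteq> U \<Longrightarrow> smooth_upto j V f"
  unfolding smooth_upto_def by (meson order_trans subsetD)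

lemma smooth_upto_cong:
  assumes "open U" "\<And>y. y \<in> U \<Longrightarrow> f y = g y" "smooth_upto k U f"
  shows "smooth_upto k U g"
  unfolding smooth_upto_def
proof (intro allI impI)
  fix vs :: "'a list" and x assume vs: "set vs \<subseteq> Basis \<and> length vs \<le> k \<and> x \<in> U"
  have eq: "pderivs vs f y = pderivs vs g y" if "y \<in> U" for y
    by (rule pderivs_cong[OF assms(1,2) that])
  have "pderivs vs f differentiable at x" using vs assms(3) unfolding smooth_upto_def by blast
  with differentiable_cong_open[OF assms(1), of x "pderivs vs f" "pderivs vs g"] eq vs
  show "pderivs vs g differentiable at x" by blast
qed

lemma pderiv_along_eqI: "(f has_derivative D) (at x) \<Longrightarrow> pderiv_along v f x = D v"
  using frechet_derivative_at pderiv_along_def by metis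

lemma pderiv_along_works: "f differentiable (at x) \<Longrightarrow> (f has_derivative (\<lambda>v. pderiv_along v f x)) (at x)"
  unfolding pderiv_along_def using frechet_derivative_works by blast

lemma pderiv_along_const [simp]: "pderiv_along v (\<lambda>x. c) = (\<lambda>x. 0)"
  by (rule ext, rule pderiv_along_eqI[of _ "\<lambda>_. 0"]) auto

lemma pderiv_along_add:
  "f differentiable (at x) \<Longrightarrow> g differentiable (at x) \<Longrightarrow>
   pderiv_along v (\<lambda>x. f x + g x) x = pderiv_along v f x + pderiv_along v g x"
  by (rule pderiv_along_eqI[of _ "\<lambda>v. pderiv_along v f x + pderiv_along v g x"])
    (auto intro!: has_derivative_add pderiv_along_works)

lemma pderiv_along_mult:
  "f differentiable (at x) \<Longrightarrow> g differentiable (at x) \<Longrightarrow>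
   pderiv_along v (\<lambda>x. f x * g x) x = f x * pderiv_along v g x + pderiv_along v f x * g x"
  by (rule pderiv_along_eqI[of _ "\<lambda>v. f x * pderiv_along v g x + pderiv_along v f x * g x"])
    (auto intro!: has_derivative_mult pderiv_along_works)

lemma pderiv_along_cmult:
  "f differentiable (at x) \<Longrightarrow> pderiv_along v (\<lambda>x. c * f x) x = c * pderiv_along v f x"
  using pderiv_along_mult[of "\<lambda>_. c" x f v] by simp

lemma pderiv_along_sum:
  "finite I \<Longrightarrow> (\<And>i. i \<in> I \<Longrightarrow> f i differentiable (at x)) \<Longrightarrow>
   pderiv_along v (\<lambda>x. \<Sum>i\<in>I. f i x) x = (\<Sum>i\<in>I. pderiv_along v (f i) x)"
  by (rule pderiv_along_eqI[of _ "\<lambda>v. \<Sum>i\<in>I. pderiv_along v (f i) x"])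
    (auto intro!: has_derivative_sum pderiv_along_works)

lemma has_derivative_coord: "((\<lambda>x. complex_of_real (x \<bullet> b)) has_derivative (\<lambda>h. of_real (h \<bullet> b))) (at x)"
  by (intro has_derivative_of_real has_derivative_inner_left has_derivative_ident)

lemma pderiv_along_coord: "pderiv_along v (\<lambda>x. complex_of_real (x \<bullet> b)) = (\<lambda>x. of_real (v \<bullet> b))"
  by (rule ext, rule pderiv_along_eqI, rule has_derivative_coord)

lemma differentiable_coord: "(\<lambda>x. complex_of_real (x \<bullet> b)) differentiable (at x)"
  using has_derivative_coord differentiable_def by blast

lemma smooth_upto_const [simp]: "smooth_upto k U (\<lambda>x. c)"
  by (induction k arbitrary: c) (auto simp: smooth_upto_Suc smooth_upto_0)

lemma smooth_upto_add:
  assumes U: "open U"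
  shows "smooth_upto k U f \<Longrightarrow> smooth_upto k U g \<Longrightarrow> smooth_upto k U (\<lambda>x. f x + g x)"
proof (induction k arbitrary: f g)
  case 0 then show ?case by (auto simp: smooth_upto_0)
next
  case (Suc k)
  have d: "\<And>x. x \<in> U \<Longrightarrow> f differentiable (at x)" "\<And>x. x \<in> U \<Longrightarrow> g differentiable (at x)"
    using Suc.prems smooth_upto_Suc by blast+
  show ?case unfolding smooth_upto_Suc
  proof safe
    fix b :: 'a assume b: "b \<in> Basis"
    have "smooth_upto k U (\<lambda>x. pderiv_along b f x + pderiv_along b g x)"
      using Suc b by (auto simp: smooth_upto_Suc)
    then show "smooth_upto k U (pderiv_along b (\<lambda>x. f x + g x))"
      by (rule smooth_upto_cong[OF U, rotated]) (simp add: pderiv_along_add d)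
  qed (use d in auto)
qed

lemma smooth_upto_mult:
  assumes U: "open U"
  shows "smooth_upto k U f \<Longrightarrow> smooth_upto k U g \<Longrightarrow> smooth_upto k U (\<lambda>x. f x * g x)"
proof (induction k arbitrary: f g)
  case 0 then show ?case by (auto simp: smooth_upto_0)
next
  case (Suc k)
  have d: "\<And>x. x \<in> U \<Longrightarrow> f differentiable (at x)" "\<And>x. x \<in> U \<Longrightarrow> g differentiable (at x)"
    using Suc.prems smooth_upto_Suc by blast+
  have k: "smooth_upto k U f" "smooth_upto k U g" using Suc.prems smooth_upto_mono by (meson le_SucI order_refl)+
  show ?case unfolding smooth_upto_Suc
  proof safe
    fix b :: 'a assume b: "b \<in> Basis"
    have "smooth_upto k U (\<lambda>x. f x * pderiv_along b g x + pderiv_along b f x * g x)"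
      using Suc b k by (intro smooth_upto_add[OF U] Suc.IH) (auto simp: smooth_upto_Suc)
    then show "smooth_upto k U (pderiv_along b (\<lambda>x. f x * g x))"
      by (rule smooth_upto_cong[OF U, rotated]) (simp add: pderiv_along_mult d)
  qed (use d in auto)
qed

lemma smooth_upto_sum:
  assumes "open U" "finite I" "\<And>i. i \<in> I \<Longrightarrow> smooth_upto k U (f i)"
  shows "smooth_upto k U (\<lambda>x. \<Sum>i\<in>I. f i x)"
  using assms(2,3) by (induction I rule: finite_induct) (auto intro!: smooth_upto_add[OF assms(1)])

lemma smooth_upto_coord [simp]: "smooth_upto k U (\<lambda>x. complex_of_real (x \<bullet> b))"
  by (cases k) (auto simp: smooth_upto_Suc smooth_upto_0 differentiable_coord pderiv_along_coord)

text \<open>The outer functions form a family closed under differentiation, so the induction on the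
  order runs over the whole family and higher derivatives of a single function of one variable never
  appear. The bump functions use it with \<open>range bump0\<close>.\<close>

lemma smooth_upto_compose_family:
  fixes q :: "'a::euclidean_space \<Rightarrow> real" and F :: "(real \<Rightarrow> complex) set"
  assumes U: "open U" and q: "\<And>k. smooth_upto k U (\<lambda>x. complex_of_real (q x))"
    and qT: "\<And>x. x \<in> U \<Longrightarrow> q x \<in> T"
    and F: "\<And>f. f \<in> F \<Longrightarrow> \<exists>f'\<in>F. \<forall>t\<in>T. (f has_vector_derivative f' t) (at t)"
    and f: "f \<in> F"
  shows "smooth_upto k U (\<lambda>x. f (q x))"
proof -
  have "\<exists>f'\<in>F. \<forall>x\<in>U. ((\<lambda>x. f (q x)) has_derivative
      (\<lambda>v. f' (q x) * pderiv_along v (\<lambda>x. of_real (q x)) x)) (at x)" if f: "f \<in> F" for f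
  proof -
    obtain f' where f': "f' \<in> F" "\<And>t. t \<in> T \<Longrightarrow> (f has_vector_derivative f' t) (at t)"
      using F[OF f] by blast
    have "((\<lambda>x. f (q x)) has_derivative
      (\<lambda>v. f' (q x) * pderiv_along v (\<lambda>x. of_real (q x)) x)) (at x)" if x: "x \<in> U" for x
    proof -
      have d: "((\<lambda>x. complex_of_real (q x)) has_derivative (\<lambda>v. pderiv_along v (\<lambda>x. of_real (q x)) x)) (at x)"
        using q[of 0] x by (intro pderiv_along_works) (simp add: smooth_upto_0)
      then have dq: "(q has_derivative (\<lambda>v. Re (pderiv_along v (\<lambda>x. of_real (q x)) x))) (at x)"
        using has_derivative_Re[OF d] by simp
      \<comment> \<open>The derivative of a real-valued function is real. This turns the real
        multiple of \<open>f' (q x)\<close> into the complex product that the induction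
        needs.\<close>
      have im: "Im (pderiv_along v (\<lambda>x. of_real (q x)) x) = 0" for v
      proof -
        have "((\<lambda>x. complex_of_real (q x)) has_derivative (\<lambda>v. of_real (Re (pderiv_along v (\<lambda>x. of_real (q x)) x)))) (at x)"
          by (rule has_derivative_of_real[OF dq])
        from pderiv_along_eqI[OF this] show ?thesis by (metis Im_complex_of_real)
      qed
      have "((\<lambda>x. f (q x)) has_derivative (\<lambda>v. Re (pderiv_along v (\<lambda>x. of_real (q x)) x) *\<^sub>R f' (q x))) (at x)"
        using has_derivative_compose[OF dq f'(2)[OF qT[OF x], unfolded has_vector_derivative_def]] .
      then show ?thesis
        by (rule has_derivative_eq_rhs) (auto simp: scaleR_conv_of_real complex_eq_iff im intro!: ext)
    qed
    then show ?thesis using f' by blast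
  qed note step = this
  show ?thesis using f
  proof (induction k arbitrary: f)
    case 0
    then show ?case using step[of f] unfolding smooth_upto_0 differentiable_def by blast
  next
    case (Suc k)
    then obtain f' where f': "f' \<in> F" "\<And>x. x \<in> U \<Longrightarrow> ((\<lambda>x. f (q x)) has_derivative
      (\<lambda>v. f' (q x) * pderiv_along v (\<lambda>x. of_real (q x)) x)) (at x)" using step by blast
    have "smooth_upto k U (pderiv_along b (\<lambda>x. f (q x)))" if b: "b \<in> Basis" for b
    proof -
      have "smooth_upto k U (\<lambda>x. f' (q x) * pderiv_along b (\<lambda>x. of_real (q x)) x)"
        using q[of "Suc k"] b by (intro smooth_upto_mult[OF U] Suc.IH f') (auto simp: smooth_upto_Suc)
      then show ?thesis
        by (rule smooth_upto_cong[OF U, rotated]) (use pderiv_along_eqI[OF f'(2)] in auto)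
    qed
    moreover have "(\<lambda>x. f (q x)) differentiable at x" if "x \<in> U" for x
      using f'(2)[OF that] differentiable_def by blast
    ultimately show ?case unfolding smooth_upto_Suc by blast
  qed
qed

lemma smoothI_upto: "(\<And>k. smooth_upto k UNIV f) \<Longrightarrow> smooth f"
  by (simp add: smooth_iff_upto)

lemma smooth_upto_smooth: "smooth f \<Longrightarrow> smooth_upto k U f"
  using smooth_iff_upto smooth_upto_mono by blast

lemma smooth_differentiable: "smooth f \<Longrightarrow> f differentiable (at x)"
  using smooth_upto_smooth smooth_upto_differentiable by blast

lemma smooth_pderiv: "smooth f \<Longrightarrow> b \<in> Basis \<Longrightarrow> smooth (pderiv_along b f)"
  using smooth_iff_upto smooth_upto_Suc by blast

lemma smooth_pderivs: "smooth f \<Longrightarrow> set vs \<subseteq> Basis \<Longrightarrow> smooth (pderivs vs f)"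
  by (induction vs) (auto intro: smooth_pderiv)

lemma smooth_const [simp]: "smooth (\<lambda>x. c)"
  and smooth_coord [simp]: "smooth (\<lambda>x. complex_of_real (x \<bullet> b))"
  by (simp_all add: smooth_iff_upto)

lemma smooth_add: "smooth f \<Longrightarrow> smooth g \<Longrightarrow> smooth (\<lambda>x. f x + g x)"
  and smooth_mult: "smooth f \<Longrightarrow> smooth g \<Longrightarrow> smooth (\<lambda>x. f x * g x)"
  by (simp_all add: smooth_iff_upto smooth_upto_add smooth_upto_mult)

lemma smooth_cmult: "smooth f \<Longrightarrow> smooth (\<lambda>x. c * f x)"
  by (simp add: smooth_mult)

lemma smooth_diff: "smooth f \<Longrightarrow> smooth g \<Longrightarrow> smooth (\<lambda>x. f x - g x)"
  using smooth_add[of f "\<lambda>x. (- 1) * g x"] smooth_cmult[of g "- 1"] by simp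

lemma smooth_sum: "finite I \<Longrightarrow> (\<And>i. i \<in> I \<Longrightarrow> smooth (f i)) \<Longrightarrow> smooth (\<lambda>x. \<Sum>i\<in>I. f i x)"
  by (simp add: smooth_iff_upto smooth_upto_sum)

lemma smooth_continuous: "smooth f \<Longrightarrow> continuous_on S f"
  by (meson continuous_at_imp_continuous_on differentiable_imp_continuous_within smooth_differentiable)

lemma smooth_has_derivative:
  fixes f :: "'a::euclidean_space cfun"
  assumes "f differentiable (at x)"
  shows "(f has_derivative (\<lambda>h. \<Sum>b\<in>Basis. (h \<bullet> b) *\<^sub>R pderiv_along b f x)) (at x)"
proof -
  note D = pderiv_along_works[OF assms]
  then have lin: "linear (\<lambda>v. pderiv_along v f x)" using has_derivative_linear by blast
  have "(\<lambda>v. pderiv_along v f x) = (\<lambda>h. \<Sum>b\<in>Basis. (h \<bullet> b) *\<^sub>R pderiv_along b f x)"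
  proof
    fix h
    have "pderiv_along (\<Sum>b\<in>Basis. (h \<bullet> b) *\<^sub>R b) f x = (\<Sum>b\<in>Basis. (h \<bullet> b) *\<^sub>R pderiv_along b f x)"
      by (simp only: linear_sum[OF lin] linear_scale[OF lin])
    then show "pderiv_along h f x = (\<Sum>b\<in>Basis. (h \<bullet> b) *\<^sub>R pderiv_along b f x)"
      by (simp only: euclidean_representation)
  qed
  with D show ?thesis by (simp only:)
qed

lemma smooth_line_derivative:
  assumes "smooth f"
  shows "((\<lambda>t. f (x + t *\<^sub>R v)) has_vector_derivative pderiv_along v f (x + t *\<^sub>R v)) (at t within S)"
proof -
  have 1: "((\<lambda>t. x + t *\<^sub>R v) has_derivative (\<lambda>s. s *\<^sub>R v)) (at t within S)"
    by (auto intro!: derivative_eq_intros)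
  note D = pderiv_along_works[OF smooth_differentiable[OF assms]]
  have lin: "linear (\<lambda>v. pderiv_along v f (x + t *\<^sub>R v'))" for v' using has_derivative_linear[OF D] by blast
  have "((\<lambda>t. f (x + t *\<^sub>R v)) has_derivative (\<lambda>s. pderiv_along (s *\<^sub>R v) f (x + t *\<^sub>R v))) (at t within S)"
    using has_derivative_compose[OF 1 D] by simp
  then show ?thesis unfolding has_vector_derivative_def
    by (simp only: linear_scale[OF lin])
qed

text \<open>The integral of the derivative along \<open>b\<close> is f(x + tb + ua) - f(x + ua).
  Differentiating under the integral at u = 0 expresses the derivative along \<open>a\<close> at x +
  tb as an integral up to t; its derivative at t = 0 is the mixed derivative in the other
  order.\<close>

lemma pderiv_commute:
  fixes f :: "'a::euclidean_space cfun"
  assumes f: "smooth f" and ab: "a \<in> Basis" "b \<in> Basis"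
  shows "pderiv_along a (pderiv_along b f) = pderiv_along b (pderiv_along a f)"
proof
  fix x
  note sb = smooth_pderiv[OF f ab(2)] and sa = smooth_pderiv[OF f ab(1)]
  have sab: "smooth (pderiv_along a (pderiv_along b f))" by (rule smooth_pderiv[OF sb ab(1)])
  have cont: "continuous_on S (\<lambda>p. g (x + fst p *\<^sub>R a + snd p *\<^sub>R b))" if "smooth g" for g :: "'a cfun" and S
    by (rule continuous_on_compose2[OF smooth_continuous[OF that, of UNIV]]) (auto intro!: continuous_intros)
  have contb: "continuous_on S (\<lambda>s. g (x + u *\<^sub>R a + s *\<^sub>R b))" if "smooth g" for g :: "'a cfun" and u S
    by (rule continuous_on_compose2[OF smooth_continuous[OF that, of UNIV]]) (auto intro!: continuous_intros)
  have eq: "pderiv_along a f (x + t *\<^sub>R b) = pderiv_along a f x +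
      integral {0..t} (\<lambda>s. pderiv_along a (pderiv_along b f) (x + s *\<^sub>R b))" if t: "t \<in> {0..1}" for t
  proof -
    have 1: "((\<lambda>u. integral (cbox 0 t) (\<lambda>s. pderiv_along b f ((x + s *\<^sub>R b) + u *\<^sub>R a))) has_vector_derivative
        integral (cbox 0 t) (\<lambda>s. pderiv_along a (pderiv_along b f) ((x + s *\<^sub>R b) + 0 *\<^sub>R a))) (at 0 within UNIV)"
    proof (rule leibniz_rule_vector_derivative)
      show "((\<lambda>u. pderiv_along b f ((x + s *\<^sub>R b) + u *\<^sub>R a)) has_vector_derivative
          pderiv_along a (pderiv_along b f) ((x + s *\<^sub>R b) + u *\<^sub>R a)) (at u within UNIV)" for u s
        by (rule smooth_line_derivative[OF sb])
      show "(\<lambda>s. pderiv_along b f ((x + s *\<^sub>R b) + u *\<^sub>R a)) integrable_on cbox 0 t" for u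
        using contb[OF sb, of "cbox 0 t" u] by (intro integrable_continuous) (simp add: ac_simps)
      show "continuous_on (UNIV \<times> cbox 0 t) (\<lambda>(u, s). pderiv_along a (pderiv_along b f) ((x + s *\<^sub>R b) + u *\<^sub>R a))"
        using cont[OF sab] by (simp add: ac_simps case_prod_beta)
    qed auto
    have 2: "integral (cbox 0 t) (\<lambda>s. pderiv_along b f ((x + s *\<^sub>R b) + u *\<^sub>R a)) =
        f ((x + t *\<^sub>R b) + u *\<^sub>R a) - f (x + u *\<^sub>R a)" for u
    proof -
      have "((\<lambda>s. pderiv_along b f ((x + u *\<^sub>R a) + s *\<^sub>R b)) has_integral
         f ((x + u *\<^sub>R a) + t *\<^sub>R b) - f ((x + u *\<^sub>R a) + 0 *\<^sub>R b)) {0..t}"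
        using t by (intro fundamental_theorem_of_calculus smooth_line_derivative[OF f]) auto
      then show ?thesis by (simp add: ac_simps integral_unique)
    qed
    have 3: "((\<lambda>u. f ((x + t *\<^sub>R b) + u *\<^sub>R a) - f (x + u *\<^sub>R a)) has_vector_derivative
        pderiv_along a f ((x + t *\<^sub>R b) + 0 *\<^sub>R a) - pderiv_along a f (x + 0 *\<^sub>R a)) (at 0 within UNIV)"
      by (intro has_vector_derivative_diff smooth_line_derivative[OF f])
    have "integral (cbox 0 t) (\<lambda>s. pderiv_along a (pderiv_along b f) ((x + s *\<^sub>R b) + 0 *\<^sub>R a))
      = pderiv_along a f ((x + t *\<^sub>R b) + 0 *\<^sub>R a) - pderiv_along a f (x + 0 *\<^sub>R a)"
      using vector_derivative_unique_at[OF 1[unfolded 2] 3] .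
    then show ?thesis by simp
  qed
  have c: "continuous_on {0..1} (\<lambda>s. pderiv_along a (pderiv_along b f) (x + s *\<^sub>R b))"
    using contb[OF sab, of _ 0] by simp
  have "((\<lambda>t. pderiv_along a f x + integral {0..t} (\<lambda>s. pderiv_along a (pderiv_along b f) (x + s *\<^sub>R b)))
     has_vector_derivative 0 + pderiv_along a (pderiv_along b f) (x + 0 *\<^sub>R b)) (at 0 within {0..1})"
    by (intro has_vector_derivative_add has_vector_derivative_const integral_has_vector_derivative[OF c]) auto
  then have "((\<lambda>t. pderiv_along a f (x + t *\<^sub>R b)) has_vector_derivative
      0 + pderiv_along a (pderiv_along b f) (x + 0 *\<^sub>R b)) (at 0 within {0..1})"
    by (rule has_vector_derivative_transform[rotated 2]) (auto simp: eq)
  moreover have "((\<lambda>t. pderiv_along a f (x + t *\<^sub>R b)) has_vector_derivative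
      pderiv_along b (pderiv_along a f) (x + 0 *\<^sub>R b)) (at 0 within {0..1})"
    by (rule smooth_line_derivative[OF sa])
  ultimately show "pderiv_along a (pderiv_along b f) x = pderiv_along b (pderiv_along a f) x"
    using vector_derivative_unique_within_closed_interval[of 0 1 0] by fastforce
qed

lemma pderiv_along_diag:
  assumes "f differentiable (at (L x))" "bounded_linear L" "L b = c *\<^sub>R b"
  shows "pderiv_along b (\<lambda>x. f (L x)) x = c *\<^sub>R pderiv_along b f (L x)"
proof -
  have D: "((\<lambda>x. f (L x)) has_derivative (\<lambda>v. pderiv_along (L v) f (L x))) (at x)"
    using has_derivative_compose[OF bounded_linear_imp_has_derivative[OF assms(2)] pderiv_along_works[OF assms(1)]] .
  have lin: "linear (\<lambda>v. pderiv_along v f (L x))" using has_derivative_linear[OF pderiv_along_works[OF assms(1)]] .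
  show ?thesis using pderiv_along_eqI[OF D, of b] by (simp add: assms(3) linear_scale[OF lin])
qed

text \<open>A diagonal map multiplies each partial derivative by its eigenvalue, so iterated
  derivatives along \<open>Basis\<close> keep their form. The reflections in x' and in x_n are of
  this kind.\<close>

lemma pderivs_diag:
  fixes f :: "'a::euclidean_space cfun"
  assumes f: "smooth f" and L: "bounded_linear L" "\<And>b. b \<in> Basis \<Longrightarrow> L b = c b *\<^sub>R b"
  shows "set vs \<subseteq> Basis \<Longrightarrow> pderivs vs (\<lambda>x. f (L x)) = (\<lambda>x. prod_list (map c vs) *\<^sub>R pderivs vs f (L x))"
proof (induction vs)
  case (Cons b vs)
  let ?g = "\<lambda>x. complex_of_real (prod_list (map c vs)) * pderivs vs f x"
  have sg: "smooth ?g" using Cons by (intro smooth_cmult smooth_pderivs[OF f]) auto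
  have "pderivs (b # vs) (\<lambda>x. f (L x)) = pderiv_along b (\<lambda>x. ?g (L x))"
    using Cons by (simp add: scaleR_conv_of_real)
  also have "... = (\<lambda>x. c b *\<^sub>R pderiv_along b ?g (L x))"
    using Cons by (intro ext pderiv_along_diag[OF smooth_differentiable[OF sg] L(1) L(2)]) auto
  also have "... = (\<lambda>x. prod_list (map c (b # vs)) *\<^sub>R pderivs (b # vs) f (L x))"
    using Cons by (subst pderiv_along_cmult)
      (auto simp: scaleR_conv_of_real intro!: ext smooth_differentiable smooth_pderivs[OF f])
  finally show ?case .
qed auto

lemma smooth_diag:
  fixes f :: "'a::euclidean_space cfun"
  assumes f: "smooth f" and L: "bounded_linear L" "\<And>b. b \<in> Basis \<Longrightarrow> L b = c b *\<^sub>R b"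
  shows "smooth (\<lambda>x. f (L x))"
  unfolding smooth_def
proof (intro allI impI)
  fix vs :: "'a list" and x assume vs: "set vs \<subseteq> Basis"
  have "(\<lambda>x. pderivs vs f (L x)) differentiable at x"
    by (rule differentiable_compose[of "pderivs vs f" L])
      (simp_all add: smooth_differentiable[OF smooth_pderivs[OF f vs]] bounded_linear_imp_differentiable[OF L(1)])
  then show "pderivs vs (\<lambda>x. f (L x)) differentiable at x"
    using pderivs_diag[OF f L vs] by (simp add: scaleR_conv_of_real)
qed

section \<open>Test functions on a fixed ball and bounds for their C^N norms\<close>

definition testR :: "real \<Rightarrow> ('a::euclidean_space cfun) set" where
  "testR R = {\<phi>. smooth \<phi> \<and> (\<forall>x. R < norm x \<longrightarrow> \<phi> x = 0)}"

text \<open>As in \<open>distribution\<close>, \<open>B\<close> is any upper bound of the C^N norm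
  and not the norm itself, so bounds are added and multiplied without suprema.\<close>

definition cbound :: "nat \<Rightarrow> real \<Rightarrow> ('a::euclidean_space cfun) \<Rightarrow> bool" where
  "cbound N B \<phi> \<longleftrightarrow> (\<forall>vs x. set vs \<subseteq> Basis \<and> length vs \<le> N \<longrightarrow> norm (pderivs vs \<phi> x) \<le> B)"

lemma testR_smooth: "\<phi> \<in> testR R \<Longrightarrow> smooth \<phi>" and testR_zero: "\<phi> \<in> testR R \<Longrightarrow> R < norm x \<Longrightarrow> \<phi> x = 0"
  by (auto simp: testR_def)

lemma testR_mono: "\<phi> \<in> testR R \<Longrightarrow> R \<le> R' \<Longrightarrow> \<phi> \<in> testR R'"
  by (auto simp: testR_def)

lemma fun_supp_imp_zero: "x \<notin> fun_supp \<phi> \<Longrightarrow> \<phi> x = 0"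
  unfolding fun_supp_def using closure_subset[of "{x. \<phi> x \<noteq> 0}"] by blast

lemma fun_supp_minimal: "closed S \<Longrightarrow> (\<And>x. x \<notin> S \<Longrightarrow> \<phi> x = 0) \<Longrightarrow> fun_supp \<phi> \<subseteq> S"
  unfolding fun_supp_def by (rule closure_minimal) blast+

lemma testR_imp_test: 
  assumes "\<phi> \<in> testR R" shows "\<phi> \<in> test_functions"
proof -
  have "fun_supp \<phi> \<subseteq> cball 0 R"
    by (rule fun_supp_minimal) (use assms in \<open>auto simp: testR_def\<close>)
  moreover have "closed (fun_supp \<phi>)" by (simp add: fun_supp_def)
  ultimately have "compact (fun_supp \<phi>)"
    using bounded_cball bounded_subset compact_eq_bounded_closed by metis
  then show ?thesis using assms by (simp add: testR_def test_functions_def)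
qed

lemma test_imp_testR:
  assumes "\<phi> \<in> test_functions" "fun_supp \<phi> \<subseteq> cball 0 R" shows "\<phi> \<in> testR R"
proof -
  have "\<phi> x = 0" if "R < norm x" for x
    using that assms(2) by (intro fun_supp_imp_zero) (auto simp: subset_iff)
  then show ?thesis using assms by (auto simp: testR_def test_functions_def)
qed

lemma compact_subset_cball: "compact K \<Longrightarrow> \<exists>R. 0 < R \<and> K \<subseteq> cball (0::'a::euclidean_space) R"
  by (meson bounded_pos compact_imp_bounded mem_cball_0 subsetI)

lemma test_obtain_testR:
  assumes "\<phi> \<in> test_functions" obtains R where "R > 0" "\<phi> \<in> testR R"
proof -
  have "compact (fun_supp \<phi>)" using assms by (simp add: test_functions_def)
  then obtain R where "0 < R" "fun_supp \<phi> \<subseteq> cball 0 R" using compact_subset_cball by blast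
  then show ?thesis using that test_imp_testR[OF assms] by blast
qed

lemma pderivs_zero: "pderivs vs (\<lambda>x. 0) = (\<lambda>x. 0)"
  by (induction vs) auto

lemma pderivs_vanish_outside:
  assumes "\<phi> \<in> testR R" "R < norm x" shows "pderivs vs \<phi> x = 0"
proof -
  have "pderivs vs \<phi> x = pderivs vs (\<lambda>x. 0) x"
    using assms by (intro pderivs_cong[of "{x. R < norm x}"])
      (auto simp: testR_def intro!: open_Collect_less continuous_intros)
  then show ?thesis by (simp add: pderivs_zero)
qed

lemma testR_pderivs: "\<phi> \<in> testR R \<Longrightarrow> set vs \<subseteq> Basis \<Longrightarrow> pderivs vs \<phi> \<in> testR R"
  using pderivs_vanish_outside[of \<phi> R _ vs] smooth_pderivs[of \<phi> vs] by (simp add: testR_def)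

lemma testR_pderiv: "\<phi> \<in> testR R \<Longrightarrow> b \<in> Basis \<Longrightarrow> pderiv_along b \<phi> \<in> testR R"
  using testR_pderivs[of \<phi> R "[b]"] by simp

lemma testR_add: "\<phi> \<in> testR R \<Longrightarrow> \<psi> \<in> testR R \<Longrightarrow> (\<lambda>x. \<phi> x + \<psi> x) \<in> testR R"
  by (auto simp: testR_def smooth_add)
lemma testR_diff: "\<phi> \<in> testR R \<Longrightarrow> \<psi> \<in> testR R \<Longrightarrow> (\<lambda>x. \<phi> x - \<psi> x) \<in> testR R"
  by (auto simp: testR_def smooth_diff)
lemma testR_mult: "smooth f \<Longrightarrow> \<psi> \<in> testR R \<Longrightarrow> (\<lambda>x. f x * \<psi> x) \<in> testR R"
  by (auto simp: testR_def smooth_mult)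
lemma testR_cmult: "\<psi> \<in> testR R \<Longrightarrow> (\<lambda>x. c * \<psi> x) \<in> testR R"
  by (auto simp: testR_def smooth_cmult)
lemma testR_sum: "finite I \<Longrightarrow> (\<And>i. i \<in> I \<Longrightarrow> f i \<in> testR R) \<Longrightarrow> (\<lambda>x. \<Sum>i\<in>I. f i x) \<in> testR R"
  by (auto simp: testR_def smooth_sum)

lemma pderivs_add:
  "smooth f \<Longrightarrow> smooth g \<Longrightarrow> set vs \<subseteq> Basis \<Longrightarrow> pderivs vs (\<lambda>x. f x + g x) = (\<lambda>x. pderivs vs f x + pderivs vs g x)"
  by (induction vs) (auto intro!: ext pderiv_along_add smooth_differentiable smooth_pderivs)

lemma pderivs_cmult:
  "smooth f \<Longrightarrow> set vs \<subseteq> Basis \<Longrightarrow> pderivs vs (\<lambda>x. c * f x) = (\<lambda>x. c * pderivs vs f x)"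
  by (induction vs) (auto intro!: ext pderiv_along_cmult smooth_differentiable smooth_pderivs)

lemma pderivs_sum:
  "finite I \<Longrightarrow> (\<And>i. i \<in> I \<Longrightarrow> smooth (f i)) \<Longrightarrow> set vs \<subseteq> Basis \<Longrightarrow>
   pderivs vs (\<lambda>x. \<Sum>i\<in>I. f i x) = (\<lambda>x. \<Sum>i\<in>I. pderivs vs (f i) x)"
  by (induction vs) (auto intro!: ext pderiv_along_sum smooth_differentiable smooth_pderivs)

lemma cbound_mono: "cbound N B \<phi> \<Longrightarrow> N' \<le> N \<Longrightarrow> B \<le> B' \<Longrightarrow> cbound N' B' \<phi>"
  unfolding cbound_def by (meson order_trans)

lemma cboundD: "cbound N B \<phi> \<Longrightarrow> set vs \<subseteq> Basis \<Longrightarrow> length vs \<le> N \<Longrightarrow> norm (pderivs vs \<phi> x) \<le> B"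
  unfolding cbound_def by blast

lemma cbound_nonneg: "cbound N B \<phi> \<Longrightarrow> 0 \<le> B"
  using cboundD[of N B \<phi> "[]" 0] norm_ge_zero[of "\<phi> 0"] by (simp del: norm_ge_zero)

lemma cbound_pderiv: "cbound (Suc N) B \<phi> \<Longrightarrow> b \<in> Basis \<Longrightarrow> cbound N B (pderiv_along b \<phi>)"
  unfolding cbound_def
proof (intro allI impI)
  fix vs :: "'a list" and x
  assume A: "\<forall>vs x. set vs \<subseteq> Basis \<and> length vs \<le> Suc N \<longrightarrow> norm (pderivs vs \<phi> x) \<le> B" "b \<in> Basis"
    and vs: "set vs \<subseteq> Basis \<and> length vs \<le> N"
  then have "norm (pderivs (vs @ [b]) \<phi> x) \<le> B" by (intro A(1)[rule_format]) auto
  then show "norm (pderivs vs (pderiv_along b \<phi>) x) \<le> B" by (simp add: pderivs_append)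
qed

lemma cbound_add:
  assumes "cbound N B f" "cbound N C g" "smooth f" "smooth g"
  shows "cbound N (B + C) (\<lambda>x. f x + g x)"
  unfolding cbound_def
  by (auto simp: pderivs_add assms(3,4) intro!: norm_triangle_le add_mono cboundD[OF assms(1)] cboundD[OF assms(2)])

lemma cbound_cmult:
  assumes "cbound N B f" "smooth f"
  shows "cbound N (norm c * B) (\<lambda>x. c * f x)"
  unfolding cbound_def
  by (auto simp: pderivs_cmult assms(2) norm_mult intro!: mult_left_mono cboundD[OF assms(1)])

lemma cbound_sum:
  assumes "finite I" "\<And>i. i \<in> I \<Longrightarrow> cbound N (B i) (f i)" "\<And>i. i \<in> I \<Longrightarrow> smooth (f i)"
  shows "cbound N (\<Sum>i\<in>I. B i) (\<lambda>x. \<Sum>i\<in>I. f i x)"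
  unfolding cbound_def
  using assms(2) by (auto simp: pderivs_sum assms(1,3) intro!: sum_norm_le cboundD)

lemma cbound_diag:
  fixes f :: "'a::euclidean_space cfun"
  assumes "cbound N B f" "smooth f" "bounded_linear L" "\<And>b. b \<in> Basis \<Longrightarrow> L b = c b *\<^sub>R b"
    and c: "\<And>b. b \<in> Basis \<Longrightarrow> \<bar>c b\<bar> \<le> 1"
  shows "cbound N B (\<lambda>x. f (L x))"
  unfolding cbound_def
proof (intro allI impI)
  fix vs :: "'a list" and x assume vs: "set vs \<subseteq> Basis \<and> length vs \<le> N"
  then have "set vs \<subseteq> Basis" by simp
  then have p: "\<bar>prod_list (map c vs)\<bar> \<le> 1"
    by (induction vs) (auto simp: abs_mult intro!: mult_le_one c)
  have "\<bar>prod_list (map c vs)\<bar> * norm (pderivs vs f (L x)) \<le> 1 * B"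
    using vs p by (intro mult_mono cboundD[OF assms(1)]) auto
  then show "norm (pderivs vs (\<lambda>x. f (L x)) x) \<le> B"
    using vs pderivs_diag[OF assms(2,3,4), of vs] by simp
qed

lemma ex_cbound:
  assumes "\<phi> \<in> testR R" shows "\<exists>B. cbound N B \<phi>"
proof -
  let ?L = "{vs. set vs \<subseteq> (Basis :: 'a set) \<and> length vs \<le> N}"
  have fin: "finite ?L" by (rule finite_lists_length_le) auto
  have "\<exists>B. \<forall>x. norm (pderivs vs \<phi> x) \<le> B" if "vs \<in> ?L" for vs
  proof -
    have "compact (pderivs vs \<phi> ` cball 0 R)"
      using assms that by (intro compact_continuous_image smooth_continuous smooth_pderivs) (auto simp: testR_def)
    then obtain B where B: "\<And>x. x \<in> cball 0 R \<Longrightarrow> norm (pderivs vs \<phi> x) \<le> B"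
      by (meson bounded_iff compact_imp_bounded imageI)
    have "norm (pderivs vs \<phi> x) \<le> max B 0" for x
    proof (cases "R < norm x")
      case False
      then have "norm (pderivs vs \<phi> x) \<le> B" by (intro B) auto
      then show ?thesis by linarith
    qed (simp add: pderivs_vanish_outside[OF assms])
    then show ?thesis by blast
  qed
  then obtain B where B: "\<And>vs x. vs \<in> ?L \<Longrightarrow> norm (pderivs vs \<phi> x) \<le> B vs" by metis
  have "cbound N (\<Sum>vs\<in>?L. \<bar>B vs\<bar>) \<phi>" unfolding cbound_def
  proof (intro allI impI)
    fix vs :: "'a list" and x assume vs: "set vs \<subseteq> Basis \<and> length vs \<le> N"
    then have "norm (pderivs vs \<phi> x) \<le> \<bar>B vs\<bar>" using B[of vs x] by auto
    also have "... \<le> (\<Sum>vs\<in>?L. \<bar>B vs\<bar>)" using vs by (intro member_le_sum fin) auto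
    finally show "norm (pderivs vs \<phi> x) \<le> (\<Sum>vs\<in>?L. \<bar>B vs\<bar>)" .
  qed
  then show ?thesis by blast
qed

text \<open>By the product rule either all derivatives fall on \<open>f\<close>, and the coordinate
  is at most R on the support, or one of them (at most N choices) falls on the coordinate, whose
  derivative is 0 or 1.\<close>

lemma cbound_coord_mult:
  fixes f :: "'a::euclidean_space cfun"
  assumes b: "b \<in> Basis" and "f \<in> testR R" "0 \<le> R" "cbound N B f"
  shows "cbound N ((R + real N) * B) (\<lambda>x. of_real (x \<bullet> b) * f x)"
proof -
  have B0: "B \<ge> 0" using cbound_nonneg assms by blast
  have "norm (pderivs vs (\<lambda>x. of_real (x \<bullet> b) * f x) x) \<le> (R + length vs) * B"
    if "f \<in> testR R" "cbound N B f" "set vs \<subseteq> Basis" "length vs \<le> N" for vs N x and f :: "'a cfun"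
    using that
  proof (induction vs arbitrary: f N rule: rev_induct)
    case Nil
    show ?case
    proof (cases "R < norm x")
      case False
      have "\<bar>x \<bullet> b\<bar> \<le> R" using Basis_le_norm[OF b, of x] False by linarith
      then have "\<bar>x \<bullet> b\<bar> * norm (f x) \<le> R * B" using cboundD[OF Nil(2), of "[]" x] assms(3)
        by (intro mult_mono) auto
      then show ?thesis by (simp add: norm_mult)
    qed (use Nil B0 \<open>0 \<le> R\<close> in \<open>simp add: testR_def\<close>)
  next
    case (snoc v vs)
    then obtain N' where N': "N = Suc N'" by (cases N) auto
    note sf = testR_smooth[OF snoc.prems(1)]
    have v: "v \<in> Basis" "set vs \<subseteq> Basis" using snoc by auto
    have "pderiv_along v (\<lambda>x. of_real (x \<bullet> b) * f x) = (\<lambda>x. of_real (x \<bullet> b) * pderiv_along v f x + of_real (v \<bullet> b) * f x)"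
      by (intro ext) (simp add: pderiv_along_mult differentiable_coord smooth_differentiable sf pderiv_along_coord)
    then have eq: "pderivs (vs @ [v]) (\<lambda>x. of_real (x \<bullet> b) * f x) x =
        pderivs vs (\<lambda>x. of_real (x \<bullet> b) * pderiv_along v f x) x + of_real (v \<bullet> b) * pderivs vs f x"
      using v sf by (simp add: pderivs_append pderivs_add pderivs_cmult smooth_mult smooth_pderiv)
    have "norm (pderivs vs (\<lambda>x. of_real (x \<bullet> b) * pderiv_along v f x) x) \<le> (R + length vs) * B"
      using snoc v cbound_pderiv[of N' B f v] by (intro snoc.IH[of _ N']) (auto simp: testR_pderiv N')
    moreover have "norm (of_real (v \<bullet> b) * pderivs vs f x :: complex) \<le> 1 * B"
      unfolding norm_mult using v snoc b by (intro mult_mono cboundD[OF snoc.prems(2)]) (auto simp: inner_Basis)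
    ultimately have "norm (pderivs (vs @ [v]) (\<lambda>x. of_real (x \<bullet> b) * f x) x) \<le> (R + length vs) * B + 1 * B"
      unfolding eq by (rule norm_triangle_le[OF add_mono])
    then show ?case by (simp add: algebra_simps)
  qed
  then have "norm (pderivs vs (\<lambda>x. of_real (x \<bullet> b) * f x) x) \<le> (R + length vs) * B"
    if "set vs \<subseteq> Basis" "length vs \<le> N" for vs x using assms that by blast
  moreover have "(R + real (length vs)) * B \<le> (R + real N) * B" if "length vs \<le> N" for vs :: "'a list"
    using that B0 by (intro mult_right_mono) auto
  ultimately show ?thesis unfolding cbound_def by (meson order_trans)
qed

text \<open>The mean value inequality is applied q + 1 times on balls around 0. Each application
  sums over the partial derivatives, which produces the power of the dimension.\<close>

lemma vanishing_order_bound: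
  fixes f :: "'a::euclidean_space cfun"
  assumes "smooth f" "cbound (Suc q) B f"
    and "\<And>vs. set vs \<subseteq> Basis \<Longrightarrow> length vs \<le> q \<Longrightarrow> pderivs vs f 0 = 0"
  shows "norm (f x) \<le> real DIM('a) ^ Suc q * B * norm x ^ Suc q"
proof -
  have gen: "norm (f x) \<le> real DIM('a) ^ k * B * norm x ^ k"
    if "smooth f" "cbound k B f" "\<And>vs. set vs \<subseteq> Basis \<Longrightarrow> length vs < k \<Longrightarrow> pderivs vs f 0 = 0" for f :: "'a cfun" and k and x :: 'a
    using that
  proof (induction k arbitrary: f x)
    case 0 then show ?case using cboundD[of 0 B f "[]"] by simp
  next
    case (Suc k)
    have B0: "B \<ge> 0" using cbound_nonneg Suc by blast
    define M where "M = real DIM('a) ^ Suc k * B * norm x ^ k"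
    have "norm (f x - f 0) \<le> M * norm (x - 0)"
    proof (rule differentiable_bound[of "cball 0 (norm x)" _ "\<lambda>y h. \<Sum>b\<in>Basis. (h \<bullet> b) *\<^sub>R pderiv_along b f y"])
      fix y :: 'a assume y: "y \<in> cball 0 (norm x)"
      show "(f has_derivative (\<lambda>h. \<Sum>b\<in>Basis. (h \<bullet> b) *\<^sub>R pderiv_along b f y)) (at y within cball 0 (norm x))"
        by (rule has_derivative_at_withinI[OF smooth_has_derivative[OF smooth_differentiable[OF Suc.prems(1)]]])
      have pb: "norm (pderiv_along b f y) \<le> real DIM('a) ^ k * B * norm x ^ k" if b: "b \<in> Basis" for b
      proof -
        have z: "pderivs vs (pderiv_along b f) 0 = 0" if "set vs \<subseteq> Basis" "length vs < k" for vs
          using Suc.prems(3)[of "vs @ [b]"] that b by (simp add: pderivs_append)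
        have "norm (pderiv_along b f y) \<le> real DIM('a) ^ k * B * norm y ^ k"
          using b Suc.prems z by (intro Suc.IH smooth_pderiv cbound_pderiv) auto
        also have "... \<le> real DIM('a) ^ k * B * norm x ^ k"
          using y B0 by (intro mult_left_mono power_mono) auto
        finally show ?thesis .
      qed
      show "onorm (\<lambda>h. \<Sum>b\<in>Basis. (h \<bullet> b) *\<^sub>R pderiv_along b f y) \<le> M"
      proof (rule onorm_le)
        fix h :: 'a
        have "norm (\<Sum>b\<in>Basis. (h \<bullet> b) *\<^sub>R pderiv_along b f y) \<le> (\<Sum>b\<in>(Basis::'a set). norm h * (real DIM('a) ^ k * B * norm x ^ k))"
          by (intro sum_norm_le) (auto intro!: mult_mono pb Basis_le_norm simp: norm_scaleR)
        also have "... = M * norm h" by (simp add: M_def)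
        finally show "norm (\<Sum>b\<in>Basis. (h \<bullet> b) *\<^sub>R pderiv_along b f y) \<le> M * norm h" .
      qed
    qed auto
    moreover have "f 0 = 0" using Suc.prems(3)[of "[]"] by simp
    ultimately show ?case by (simp add: M_def algebra_simps)
  qed
  show ?thesis using assms by (intro gen) auto
qed

section \<open>The parity class of test functions\<close>

declare split_paired_All [simp del] split_paired_Ex [simp del]

section \<open>Reflections and averages along the last coordinate\<close>

definition scl :: "real \<Rightarrow> real \<Rightarrow> 'm::finite space \<Rightarrow> 'm space" where
  "scl s t x = (s *\<^sub>R fst x, t * snd x)"

definition scl_coeff :: "real \<Rightarrow> real \<Rightarrow> 'm::finite space \<Rightarrow> real" where
  "scl_coeff s t b = (if b = e_n then t else s)"

lemma e_n_Basis [simp]: "(e_n :: 'm::finite space) \<in> Basis"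
  by (auto simp: Basis_prod_def)

lemma Basis_space_cases:
  assumes "b \<in> (Basis :: 'm::finite space set)"
  obtains "b = e_n" | u where "u \<in> Basis" "b = (u, 0)"
  using assms by (auto simp: Basis_prod_def)

lemma inner_e_n [simp]: "x \<bullet> (e_n :: 'm::finite space) = snd x"
  by (simp add: inner_prod_def)

lemma bounded_linear_scl [simp]: "bounded_linear (scl s t)"
proof -
  have "linear (scl s t :: 'm::finite space \<Rightarrow> _)"
    by (auto intro!: linearI simp: scl_def algebra_simps)
  then show "bounded_linear (scl s t :: 'm::finite space \<Rightarrow> _)" by (simp add: linear_conv_bounded_linear)
qed

lemma scl_Basis: "b \<in> Basis \<Longrightarrow> scl s t b = scl_coeff s t b *\<^sub>R b"
  by (erule Basis_space_cases) (auto simp: scl_def scl_coeff_def)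

lemma scl_scl: "scl s t (scl s' t' x) = scl (s * s') (t * t') x"
  by (simp add: scl_def)

lemma scl_minus: "scl (- 1) (- 1) x = - x"
  by (simp add: scl_def prod_eq_iff)

lemma scl_1 [simp]: "scl 1 1 x = x"
  by (simp add: scl_def)

lemma norm_space: "norm (x :: 'm::finite space) = sqrt ((norm (fst x))\<^sup>2 + (snd x)\<^sup>2)"
  by (simp add: norm_prod_def)

lemma norm_scl_flip: "norm (scl 1 (- 1) x) = norm x" "norm (scl (- 1) 1 x) = norm x"
  by (auto simp: scl_def norm_space)

lemma smooth_scl: "smooth f \<Longrightarrow> smooth (\<lambda>x. f (scl s t x))"
  by (rule smooth_diag[OF _ bounded_linear_scl scl_Basis])

lemma pderivs_scl:
  "smooth f \<Longrightarrow> set vs \<subseteq> Basis \<Longrightarrow>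
   pderivs vs (\<lambda>x. f (scl s t x)) = (\<lambda>x. prod_list (map (scl_coeff s t) vs) *\<^sub>R pderivs vs f (scl s t x))"
  by (rule pderivs_diag[OF _ bounded_linear_scl scl_Basis])

text \<open>Both quotients by powers of x_n are averages of this form: weight 1 applied to
  \<open>Dn f\<close> gives (f(x) - f(x',0)) / x_n, see \<open>av_one_mult\<close>, and weight s
  applied to the second derivative gives \<open>Qop\<close>.\<close>

definition av :: "(real \<Rightarrow> real) \<Rightarrow> 'm::finite space cfun \<Rightarrow> 'm space cfun" where
  "av w f x = integral {0..1} (\<lambda>s. w s *\<^sub>R f (scl 1 s x))"

lemma continuous_on_av_integrand:
  assumes "smooth f" "continuous_on {0..1} w"
  shows "continuous_on (U \<times> {0..1}) (\<lambda>p. w (snd p) *\<^sub>R f (scl 1 (snd p) (fst p)))"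
proof (intro continuous_on_scaleR)
  show "continuous_on (U \<times> {0..1}) (\<lambda>p. w (snd p))"
    by (rule continuous_on_compose2[OF assms(2)]) (auto intro!: continuous_intros)
  show "continuous_on (U \<times> {0..1}) (\<lambda>p. f (scl 1 (snd p) (fst p)))"
    by (rule continuous_on_compose2[OF smooth_continuous[OF assms(1), of UNIV]])
      (auto simp: scl_def intro!: continuous_intros)
qed

lemma av_integrable:
  assumes "smooth f" "continuous_on {0..1} w"
  shows "(\<lambda>s. w s *\<^sub>R f (scl 1 s x)) integrable_on {0..1}"
proof (rule integrable_continuous_real)
  have "continuous_on {0..1} (\<lambda>s. (x, s))" by (intro continuous_intros)
  from continuous_on_compose2[OF continuous_on_av_integrand[OF assms, of "{x}"] this]
  show "continuous_on {0..1} (\<lambda>s. w s *\<^sub>R f (scl 1 s x))" by auto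
qed

text \<open>A partial derivative of an average is again an average, of the partial derivative, and
  the weight gains a factor s exactly in the direction \<open>e_n\<close>. Smoothness of averages
  thus follows by iteration.\<close>

lemma av_has_pderiv:
  fixes f :: "'m::finite space cfun"
  assumes f: "smooth f" and w: "continuous_on {0..1} w"
  shows "av w f differentiable (at x)"
    and "b \<in> Basis \<Longrightarrow> pderiv_along b (av w f) x = av (\<lambda>s. w s * scl_coeff 1 s b) (pderiv_along b f) x"
proof -
  let ?B = "Basis :: 'm space set"
  \<comment> \<open>The total derivative of the integrand as a bounded linear map. The Leibniz rule
    integrates in the space of such maps; evaluating the integral at \<open>b\<close> gives the
    partial derivative.\<close>
  let ?fx = "\<lambda>x t. \<Sum>c\<in>?B. blinfun_scaleR_left ((w t * scl_coeff 1 t c) *\<^sub>R pderiv_along c f (scl 1 t x)) o\<^sub>L blinfun_inner_left c"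
  have wc: "continuous_on {0..1} (\<lambda>s. w s * scl_coeff 1 s c)" for c :: "'m space"
    by (cases "c = e_n") (auto simp: scl_coeff_def intro!: continuous_intros w)
  have cont: "continuous_on (UNIV \<times> cbox 0 1) (\<lambda>(x, t). ?fx x t)"
    unfolding case_prod_beta
    by (intro continuous_on_sum bounded_bilinear.continuous_on[OF bounded_bilinear_blinfun_compose]
        bounded_linear.continuous_on[OF bounded_linear_blinfun_scaleR_left] continuous_on_const)
      (use continuous_on_av_integrand[OF smooth_pderiv[OF f] wc] in \<open>auto simp del: scaleR_scaleR\<close>)
  have D: "((\<lambda>x. integral (cbox 0 1) (\<lambda>s. w s *\<^sub>R f (scl 1 s x))) has_derivative integral (cbox 0 1) (?fx x)) (at x within UNIV)"
  proof (rule leibniz_rule[where fx = ?fx])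
    fix y :: "'m space" and t :: real
    have "((\<lambda>x. f (scl 1 t x)) has_derivative (\<lambda>h. \<Sum>c\<in>Basis. (scl 1 t h \<bullet> c) *\<^sub>R pderiv_along c f (scl 1 t y))) (at y)"
      by (rule has_derivative_compose[OF bounded_linear_imp_has_derivative[OF bounded_linear_scl]
            smooth_has_derivative[OF smooth_differentiable[OF f]]])
    then have "((\<lambda>x. w t *\<^sub>R f (scl 1 t x)) has_derivative (\<lambda>h. w t *\<^sub>R (\<Sum>c\<in>Basis. (scl 1 t h \<bullet> c) *\<^sub>R pderiv_along c f (scl 1 t y)))) (at y)"
      by (rule has_derivative_scaleR_right)
    moreover have "w t *\<^sub>R (\<Sum>c\<in>?B. (scl 1 t h \<bullet> c) *\<^sub>R pderiv_along c f (scl 1 t y)) = blinfun_apply (?fx y t) h" for h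
    proof -
      have "scl 1 t h \<bullet> c = scl_coeff 1 t c * (h \<bullet> c)" if "c \<in> ?B" for c
        using that by (rule Basis_space_cases) (auto simp: scl_def scl_coeff_def inner_prod_def)
      then show ?thesis
        by (simp add: blinfun.sum_left scaleR_sum_right ac_simps cong: sum.cong)
    qed
    ultimately show "((\<lambda>x. w t *\<^sub>R f (scl 1 t x)) has_derivative blinfun_apply (?fx y t)) (at y within UNIV)"
      by simp
  next
    show "(\<lambda>s. w s *\<^sub>R f (scl 1 s y)) integrable_on cbox 0 1" for y
      using av_integrable[OF f w] by simp
  qed (use cont in auto)
  then have D': "(av w f has_derivative integral (cbox 0 1) (?fx x)) (at x)"
    by (simp add: av_def[abs_def])
  then show "av w f differentiable (at x)" unfolding differentiable_def by blast
  assume b: "b \<in> Basis"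
  have int: "?fx x integrable_on cbox 0 1"
  proof (rule integrable_continuous)
    have "continuous_on (cbox 0 1) (\<lambda>s::real. (x, s))" by (intro continuous_intros)
    from continuous_on_compose2[OF cont this] show "continuous_on (cbox 0 1) (?fx x)" by (simp add: image_subset_iff)
  qed
  have "pderiv_along b (av w f) x = blinfun_apply (integral (cbox 0 1) (?fx x)) b"
    by (rule pderiv_along_eqI[OF D'])
  also have "... = integral (cbox 0 1) (\<lambda>t. blinfun_apply (?fx x t) b)"
    by (rule blinfun_apply_integral[OF int])
  also have "... = av (\<lambda>s. w s * scl_coeff 1 s b) (pderiv_along b f) x"
  proof -
    have "(\<Sum>c\<in>?B. (b \<bullet> c) *\<^sub>R g c) = g b" for g :: "_ \<Rightarrow> complex"
    proof -
      have "(\<Sum>c\<in>?B. (b \<bullet> c) *\<^sub>R g c) = (\<Sum>c\<in>?B. if c = b then g c else 0)"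
        using b by (intro sum.cong) (auto simp: inner_Basis)
      then show ?thesis using b by simp
    qed
    then show ?thesis unfolding av_def by (simp add: blinfun.sum_left del: scaleR_scaleR)
  qed
  finally show "pderiv_along b (av w f) x = av (\<lambda>s. w s * scl_coeff 1 s b) (pderiv_along b f) x" .
qed

lemma continuous_on_scl_coeffs:
  "continuous_on S (\<lambda>s. prod_list (map (scl_coeff 1 s) vs))"
proof (induction vs)
  case (Cons v vs)
  then show ?case by (cases "v = e_n") (auto simp: scl_coeff_def intro!: continuous_intros)
qed auto

lemma pderivs_av:
  assumes f: "smooth f" and w: "continuous_on {0..1} w"
  shows "set vs \<subseteq> Basis \<Longrightarrow> pderivs vs (av w f) = av (\<lambda>s. w s * prod_list (map (scl_coeff 1 s) vs)) (pderivs vs f)"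
proof (induction vs)
  case (Cons b vs)
  have c: "continuous_on {0..1} (\<lambda>s. w s * prod_list (map (scl_coeff 1 s) vs))"
    by (intro continuous_intros w continuous_on_scl_coeffs)
  have "pderivs (b # vs) (av w f) = pderiv_along b (av (\<lambda>s. w s * prod_list (map (scl_coeff 1 s) vs)) (pderivs vs f))"
    using Cons by simp
  also have "... = av (\<lambda>s. w s * prod_list (map (scl_coeff 1 s) vs) * scl_coeff 1 s b) (pderivs (b # vs) f)"
    using Cons.prems by (intro ext, subst av_has_pderiv(2)[OF _ c]) (auto intro: smooth_pderivs f)
  finally show ?case by (simp add: ac_simps)
qed auto

lemma smooth_av:
  assumes f: "smooth f" and w: "continuous_on {0..1} w"
  shows "smooth (av w f)"
  unfolding smooth_def
proof (intro allI impI)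
  fix vs :: "'a space list" and x assume vs: "set vs \<subseteq> Basis"
  show "pderivs vs (av w f) differentiable at x"
    unfolding pderivs_av[OF f w vs]
    by (intro av_has_pderiv(1) smooth_pderivs[OF f vs] continuous_intros w continuous_on_scl_coeffs)
qed

lemma norm_av_le:
  assumes f: "smooth f" and w: "continuous_on {0..1} w" "\<And>s. s \<in> {0..1} \<Longrightarrow> \<bar>w s\<bar> \<le> 1"
    and B: "\<And>y. norm (f y) \<le> B"
  shows "norm (av w f x) \<le> B"
proof -
  have B0: "0 \<le> B" using B norm_ge_zero order_trans by blast
  have "norm (integral {0..1} (\<lambda>s. w s *\<^sub>R f (scl 1 s x))) \<le> integral {0..1} (\<lambda>s::real. B)"
  proof (rule integral_norm_bound_integral[OF av_integrable[OF f w(1)]])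
    fix s :: real assume "s \<in> {0..1}"
    then have "\<bar>w s\<bar> * norm (f (scl 1 s x)) \<le> 1 * B" by (intro mult_mono w B) auto
    then show "norm (w s *\<^sub>R f (scl 1 s x)) \<le> B" by simp
  qed auto
  then show ?thesis by (simp add: av_def)
qed

abbreviation Dn :: "'m::finite space cfun \<Rightarrow> 'm space cfun" where
  "Dn \<equiv> pderiv_along e_n"

text \<open>For \<open>f\<close> odd in $x_n$, \<open>Qop f\<close> is $x_n^{-2}(x_n\partial_n - 1)f$; the integral shows that the
  quotient is smooth.\<close>
definition Qop :: "'m::finite space cfun \<Rightarrow> 'm space cfun" where
  "Qop f = av (\<lambda>s. s) (Dn (Dn f))"

text \<open>The function s x_n (D_n f)(x', s x_n) - f(x', s x_n) of s has derivative s x_n^2 (D_n^2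
  f)(x', s x_n). Its value at s = 0 leaves the term f(x', 0), which is zero on the parity
  class.\<close>

lemma Qop_eq:
  fixes f :: "'m::finite space cfun"
  assumes f: "smooth f"
  shows "of_real ((snd x)\<^sup>2) * Qop f x = of_real (snd x) * Dn f x - f x + f (fst x, 0)"
proof -
  define y where "y = (fst x, 0::real)"
  define xn where "xn = snd x"
  note s1 = smooth_pderiv[OF f e_n_Basis] note s2 = smooth_pderiv[OF s1 e_n_Basis]
  have scl: "scl 1 s x = y + (s * xn) *\<^sub>R e_n" for s by (simp add: scl_def y_def xn_def prod_eq_iff)
  have ch: "((\<lambda>s. g (y + (s * xn) *\<^sub>R e_n)) has_vector_derivative xn *\<^sub>R Dn g (y + (s * xn) *\<^sub>R e_n)) (at s within S)"
    if "smooth g" for g :: "'m space cfun" and s S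
  proof -
    have "((\<lambda>s. s * xn) has_real_derivative xn) (at s within S)" by (auto intro!: derivative_eq_intros)
    from vector_diff_chain_within[OF this[unfolded has_real_derivative_iff_has_vector_derivative]
        smooth_line_derivative[OF that, of y "e_n" "s * xn"]]
    show ?thesis by (simp add: o_def)
  qed
  have "((\<lambda>s. (s * xn) *\<^sub>R Dn f (y + (s * xn) *\<^sub>R e_n) - f (y + (s * xn) *\<^sub>R e_n)) has_vector_derivative
     (s * xn) *\<^sub>R (xn *\<^sub>R Dn (Dn f) (y + (s * xn) *\<^sub>R e_n)) + xn *\<^sub>R Dn f (y + (s * xn) *\<^sub>R e_n)
       - xn *\<^sub>R Dn f (y + (s * xn) *\<^sub>R e_n)) (at s within {0..1})" for s
    by (intro has_vector_derivative_diff has_vector_derivative_scaleR ch f s1)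
      (auto intro!: derivative_eq_intros)
  then have "((\<lambda>s. (s * xn) *\<^sub>R (xn *\<^sub>R Dn (Dn f) (y + (s * xn) *\<^sub>R e_n)) + xn *\<^sub>R Dn f (y + (s * xn) *\<^sub>R e_n)
       - xn *\<^sub>R Dn f (y + (s * xn) *\<^sub>R e_n)) has_integral
     (((1 * xn) *\<^sub>R Dn f (y + (1 * xn) *\<^sub>R e_n) - f (y + (1 * xn) *\<^sub>R e_n)) - ((0 * xn) *\<^sub>R Dn f (y + (0 * xn) *\<^sub>R e_n) - f (y + (0 * xn) *\<^sub>R e_n)))) {0..1}"
    by (intro fundamental_theorem_of_calculus) auto
  moreover have "y + xn *\<^sub>R e_n = x" by (simp add: y_def xn_def prod_eq_iff)
  ultimately have 1: "((\<lambda>s. xn\<^sup>2 *\<^sub>R (s *\<^sub>R Dn (Dn f) (scl 1 s x))) has_integral (xn *\<^sub>R Dn f x - f x + f y)) {0..1}"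
    by (simp add: scl power2_eq_square ac_simps zero_prod_def[symmetric])
  have "((\<lambda>s. s *\<^sub>R Dn (Dn f) (scl 1 s x)) has_integral Qop f x) {0..1}"
    unfolding Qop_def av_def by (intro integrable_integral av_integrable s2 continuous_intros)
  from has_integral_unique[OF 1 has_integral_cmul[OF this]]
  show ?thesis by (simp add: xn_def y_def scaleR_conv_of_real)
qed

text \<open>Oddness under x -> -x and under x_n -> -x_n together give evenness in x'. The first of
  the two makes all derivatives of even order vanish at 0.\<close>

definition odd_test :: "real \<Rightarrow> 'm::finite space cfun set" where
  "odd_test R = {\<phi> \<in> testR R. (\<forall>x. \<phi> (- x) = - \<phi> x) \<and> (\<forall>x. \<phi> (scl 1 (- 1) x) = - \<phi> x)}"

lemma odd_testD:
  assumes "\<phi> \<in> odd_test R"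
  shows "\<phi> \<in> testR R" "smooth \<phi>" "\<phi> (- x) = - \<phi> x" "\<phi> (scl 1 (- 1) x) = - \<phi> x"
    "\<phi> (y, 0) = 0"
proof -
  show "\<phi> (y, 0) = 0" using assms by (force simp: odd_test_def scl_def dest: spec[of _ "(y, 0)"])
qed (use assms in \<open>auto simp: odd_test_def testR_def\<close>)

lemma odd_test_pderivs_parity:
  assumes "\<phi> \<in> odd_test R" "set vs \<subseteq> Basis"
  shows "pderivs vs \<phi> (- x) = - ((- 1) ^ length vs * pderivs vs \<phi> x)"
    and "pderivs vs \<phi> (scl 1 (- 1) x) = - prod_list (map (scl_coeff 1 (- 1)) vs) *\<^sub>R pderivs vs \<phi> x"
proof -
  note s = odd_testD(2)[OF assms(1)]
  have sg: "prod_list (map (scl_coeff 1 (- 1)) vs) * prod_list (map (scl_coeff 1 (- 1)) vs) = 1" for vs :: "'a space list"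
    by (induction vs) (auto simp: scl_coeff_def)
  have m: "prod_list (map (scl_coeff (- 1) (- 1)) vs) = (- 1) ^ length vs" for vs :: "'a space list"
    by (induction vs) (auto simp: scl_coeff_def)
  have neg: "pderivs vs (\<lambda>x. - \<phi> x) = (\<lambda>x. - pderivs vs \<phi> x)"
    using pderivs_cmult[OF s assms(2), of "-1"] by simp
  have "(\<lambda>x. \<phi> (scl (- 1) (- 1) x)) = (\<lambda>x. - \<phi> x)" using odd_testD(3)[OF assms(1)] by (simp add: scl_minus)
  from pderivs_scl[OF s assms(2), of "-1" "-1", unfolded this neg]
  have "- pderivs vs \<phi> x = (- 1) ^ length vs *\<^sub>R pderivs vs \<phi> (- x)" by (simp add: m scl_minus fun_eq_iff)
  then have "(- 1) ^ length vs *\<^sub>R (- pderivs vs \<phi> x) = ((- 1) ^ length vs * (- 1) ^ length vs) *\<^sub>R pderivs vs \<phi> (- x)" by simp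
  then show "pderivs vs \<phi> (- x) = - ((- 1) ^ length vs * pderivs vs \<phi> x)"
    by (simp add: power_mult_distrib[symmetric] scaleR_conv_of_real)
  have "(\<lambda>x. \<phi> (scl 1 (- 1) x)) = (\<lambda>x. - \<phi> x)" using odd_testD(4)[OF assms(1)] by simp
  from pderivs_scl[OF s assms(2), of 1 "-1", unfolded this neg]
  have "- pderivs vs \<phi> x = prod_list (map (scl_coeff 1 (- 1)) vs) *\<^sub>R pderivs vs \<phi> (scl 1 (- 1) x)" by (simp add: fun_eq_iff)
  then have "prod_list (map (scl_coeff 1 (- 1)) vs) *\<^sub>R (- pderivs vs \<phi> x) = 1 *\<^sub>R pderivs vs \<phi> (scl 1 (- 1) x)"
    by (simp add: sg)
  then show "pderivs vs \<phi> (scl 1 (- 1) x) = - prod_list (map (scl_coeff 1 (- 1)) vs) *\<^sub>R pderivs vs \<phi> x" by simp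
qed

lemma odd_test_vanish:
  assumes "\<phi> \<in> odd_test R" "set vs \<subseteq> Basis" "even (length vs)"
  shows "pderivs vs \<phi> 0 = 0"
  using odd_test_pderivs_parity(1)[OF assms(1,2), of 0] assms(3) by simp

text \<open>The delicate point is the support: the average uses values of \<open>f\<close> on a
  segment that may enter the ball. For x_n different from 0, \<open>Qop_eq\<close> expresses the
  value by \<open>f\<close> and its derivative at x alone; for x_n = 0 the segment is the single
  point x.\<close>

lemma Qop_odd_test:
  fixes \<phi> :: "'m::finite space cfun"
  assumes "\<phi> \<in> odd_test R" shows "Qop \<phi> \<in> odd_test R"
proof -
  note D = odd_testD[OF assms]
  have D2: "Dn (Dn \<phi>) (- x) = - Dn (Dn \<phi>) x" "Dn (Dn \<phi>) (scl 1 (- 1) x) = - Dn (Dn \<phi>) x" for x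
    using odd_test_pderivs_parity[OF assms, of "[e_n, e_n]"] by (auto simp: scl_coeff_def)
  have sm: "smooth (Qop \<phi>)"
    unfolding Qop_def by (intro smooth_av smooth_pderiv D(2) e_n_Basis continuous_intros)
  have "Qop \<phi> x = 0" if "R < norm x" for x
  proof (cases "snd x = 0")
    case True
    then have "scl 1 s x = x" for s by (simp add: scl_def prod_eq_iff)
    moreover have "Dn (Dn \<phi>) x = 0" using pderivs_vanish_outside[OF D(1) that, of "[e_n, e_n]"] by simp
    ultimately show ?thesis by (simp add: Qop_def av_def)
  next
    case False
    then show ?thesis using Qop_eq[OF D(2), of x] D(5) testR_zero[OF D(1) that]
      pderivs_vanish_outside[OF D(1) that, of "[e_n]"] by simp
  qed
  moreover have "Qop \<phi> (- x) = - Qop \<phi> x" for x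
  proof -
    have "scl 1 s (- x) = - scl 1 s x" for s by (simp add: scl_def)
    then show ?thesis by (simp add: Qop_def av_def D2)
  qed
  moreover have "Qop \<phi> (scl 1 (- 1) x) = - Qop \<phi> x" for x
  proof -
    have "scl 1 s (scl 1 (- 1) x) = scl 1 (- 1) (scl 1 s x)" for s by (simp add: scl_def)
    then show ?thesis by (simp add: Qop_def av_def D2)
  qed
  ultimately show ?thesis using sm by (auto simp: odd_test_def testR_def)
qed

text \<open>Derivatives of \<open>Qop\<close> are averages of derivatives of two orders more, with
  weights bounded by 1, so the same bound \<open>B\<close> survives.\<close>

lemma cbound_Qop:
  assumes "smooth \<phi>" "cbound (N + 2) B \<phi>" shows "cbound N B (Qop \<phi>)"
  unfolding cbound_def
proof (intro allI impI)
  fix vs :: "'a space list" and x assume vs: "set vs \<subseteq> Basis \<and> length vs \<le> N"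
  have le: "\<bar>s * prod_list (map (scl_coeff 1 s) vs)\<bar> \<le> 1" if s: "s \<in> {0..1}" for s
  proof -
    have "\<bar>prod_list (map (scl_coeff 1 s) vs)\<bar> \<le> 1"
      using s by (induction vs) (auto simp: abs_mult scl_coeff_def intro!: mult_le_one)
    then show ?thesis using s unfolding abs_mult by (intro mult_le_one) auto
  qed
  show "norm (pderivs vs (Qop \<phi>) x) \<le> B"
    unfolding Qop_def using vs
  proof (subst pderivs_av)
    show "norm (av (\<lambda>s. s * prod_list (map (scl_coeff 1 s) vs)) (pderivs vs (Dn (Dn \<phi>))) x) \<le> B"
    proof (rule norm_av_le[OF _ _ le])
      show "norm (pderivs vs (Dn (Dn \<phi>)) y) \<le> B" for y
        using vs cboundD[OF assms(2), of "vs @ [e_n, e_n]" y] by (simp add: pderivs_append)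
    qed (use vs assms(1) in \<open>auto intro!: smooth_pderivs smooth_pderiv continuous_intros continuous_on_scl_coeffs\<close>)
  qed (auto intro!: smooth_pderiv assms continuous_intros)
qed

lemma integral_power_01: "integral {0..1} (\<lambda>s::real. s ^ k) = 1 / (real k + 1)"
proof -
  have "((\<lambda>s. s ^ Suc k / (real k + 1)) has_real_derivative s ^ k) (at s within {0..1})" for s :: real
  proof -
    have "(1 + real k) * s ^ k / (real k + 1) = s ^ k" by (simp add: add.commute[of 1])
    then show ?thesis
      using DERIV_subset[OF DERIV_cdivide[OF DERIV_pow[of "Suc k" s], of "real k + 1"]] by auto
  qed
  then have "((\<lambda>s::real. s ^ k) has_integral (1 ^ Suc k / (real k + 1) - 0 ^ Suc k / (real k + 1))) {0..1}"
    by (intro fundamental_theorem_of_calculus) (auto simp: has_real_derivative_iff_has_vector_derivative)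
  then show ?thesis by (simp add: integral_unique)
qed

text \<open>On x_n = 0 the averaged function is constant in s, and the weight s^(q+1) integrates to
  1 / (q + 2).\<close>

lemma Dn_power_Qop:
  assumes "smooth \<phi>"
  shows "(Dn ^^ q) (Qop \<phi>) (y, 0) = (Dn ^^ (q + 2)) \<phi> (y, 0) / of_nat (q + 2)"
proof -
  have rep: "(Dn ^^ q) f = pderivs (replicate q e_n) f" for f :: "'a space cfun" and q
    by (induction q) auto
  have c: "prod_list (map (scl_coeff 1 s) (replicate q (e_n :: 'a space))) = s ^ q" for s
    by (induction q) (auto simp: scl_coeff_def)
  have "(Dn ^^ q) (Qop \<phi>) (y, 0) = integral {0..1} (\<lambda>s. (s * s ^ q) *\<^sub>R pderivs (replicate q e_n) (Dn (Dn \<phi>)) (y, 0))"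
    unfolding rep Qop_def using c
    by (subst pderivs_av) (auto intro!: smooth_pderiv assms continuous_intros simp: av_def scl_def)
  also have "... = integral {0..1} (\<lambda>s::real. s ^ (q + 1)) *\<^sub>R pderivs (replicate q e_n) (Dn (Dn \<phi>)) (y, 0)"
    by (rule integral_unique, simp only: power_add power_one_right mult.commute[of _ "_ ^ q"])
      (intro has_integral_scaleR_left integrable_integral integrable_continuous_real continuous_intros)
  also have "pderivs (replicate q e_n) (Dn (Dn \<phi>)) = (Dn ^^ (q + 2)) \<phi>"
    by (simp add: rep[symmetric] funpow_swap1)
  finally show ?thesis unfolding integral_power_01 by (simp add: scaleR_conv_of_real)
qed

section \<open>The operator E - c with the Euler operator E, and the removal of Taylor terms at the
  origin\<close>

definition EU :: "complex \<Rightarrow> ('a::euclidean_space cfun) \<Rightarrow> 'a \<Rightarrow> complex" where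
  "EU c f x = (\<Sum>b\<in>Basis. of_real (x \<bullet> b) * pderiv_along b f x) + (- c) * f x"

lemma smooth_EU: "smooth f \<Longrightarrow> smooth (EU c f)"
  unfolding EU_def by (intro smooth_add smooth_sum smooth_mult smooth_cmult smooth_coord smooth_pderiv) auto

lemma testR_EU: "f \<in> testR R \<Longrightarrow> EU c f \<in> testR R"
  unfolding EU_def by (intro testR_add testR_sum testR_mult testR_cmult smooth_coord testR_pderiv) auto

text \<open>The commutator of a partial derivative with the Euler operator is that partial
  derivative, so the constant drops by 1.\<close>

lemma pderiv_EU:
  assumes f: "smooth f" and b: "b \<in> Basis"
  shows "pderiv_along b (EU c f) = EU (c - 1) (pderiv_along b f)"
proof
  fix x
  have d: "(\<lambda>x. of_real (x \<bullet> a) * pderiv_along a f x) differentiable (at x)" if "a \<in> Basis" for a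
    by (intro smooth_differentiable smooth_mult smooth_coord smooth_pderiv f that)
  have "pderiv_along b (EU c f) x = pderiv_along b (\<lambda>x. \<Sum>a\<in>Basis. of_real (x \<bullet> a) * pderiv_along a f x) x
      + pderiv_along b (\<lambda>x. (- c) * f x) x"
    unfolding EU_def by (intro pderiv_along_add differentiable_sum smooth_differentiable smooth_sum
        smooth_mult smooth_coord smooth_pderiv smooth_cmult f) auto
  also have "... = (\<Sum>a\<in>Basis. pderiv_along b (\<lambda>x. of_real (x \<bullet> a) * pderiv_along a f x) x) + (- c) * pderiv_along b f x"
    by (subst pderiv_along_sum) (use d pderiv_along_cmult[OF smooth_differentiable[OF f], of b "- c"] in auto)
  also have "(\<Sum>a\<in>Basis. pderiv_along b (\<lambda>x. of_real (x \<bullet> a) * pderiv_along a f x) x)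
    = (\<Sum>a\<in>Basis. of_real (x \<bullet> a) * pderiv_along a (pderiv_along b f) x + of_real (b \<bullet> a) * pderiv_along a f x)"
    using f b by (intro sum.cong refl)
      (simp add: pderiv_along_mult differentiable_coord smooth_differentiable smooth_pderiv pderiv_along_coord pderiv_commute[of f b])
  also have "... = (\<Sum>a\<in>Basis. of_real (x \<bullet> a) * pderiv_along a (pderiv_along b f) x) + pderiv_along b f x"
    using b by (simp add: sum.distrib inner_Basis if_distrib[of of_real] if_distrib[of "\<lambda>r. r * _"] sum.delta' cong: if_cong)
  finally show "pderiv_along b (EU c f) x = EU (c - 1) (pderiv_along b f) x"
    by (simp add: EU_def[of "c - 1"] algebra_simps)
qed

lemma pderivs_EU:
  assumes "smooth f"
  shows "set vs \<subseteq> Basis \<Longrightarrow> pderivs vs (EU c f) = EU (c - of_nat (length vs)) (pderivs vs f)"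
proof (induction vs)
  case (Cons b vs)
  then show ?case by (simp add: pderiv_EU smooth_pderivs assms algebra_simps)
qed auto

lemma odd_test_EU:
  fixes f :: "'m::finite space cfun"
  assumes f: "f \<in> odd_test R" shows "EU c f \<in> odd_test R"
proof -
  note D = odd_testD[OF f]
  have p: "pderiv_along b f (- x) = pderiv_along b f x"
    "pderiv_along b f (scl 1 (- 1) x) = - scl_coeff 1 (- 1) b *\<^sub>R pderiv_along b f x" if "b \<in> Basis" for b x
    using odd_test_pderivs_parity[OF f, of "[b]" x] that by auto
  have i: "scl 1 (- 1) x \<bullet> b = scl_coeff 1 (- 1) b * (x \<bullet> b)" if "b \<in> Basis" for b and x :: "'m space"
    using that by (rule Basis_space_cases) (auto simp: scl_def scl_coeff_def inner_prod_def)
  have cc: "scl_coeff 1 (- 1) b * scl_coeff 1 (- 1) b = 1" for b :: "'m space" by (simp add: scl_coeff_def)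
  have "EU c f (- x) = - EU c f x" for x
    by (simp add: EU_def D p sum_negf cong: sum.cong)
  moreover have "EU c f (scl 1 (- 1) x) = - EU c f x" for x
  proof -
    have "(\<Sum>b\<in>Basis. of_real (scl 1 (- 1) x \<bullet> b) * pderiv_along b f (scl 1 (- 1) x)) =
      (\<Sum>b\<in>Basis. - (of_real (x \<bullet> b) * pderiv_along b f x))"
    proof (rule sum.cong[OF refl])
      fix b :: "'m space" assume b: "b \<in> Basis"
      show "of_real (scl 1 (- 1) x \<bullet> b) * pderiv_along b f (scl 1 (- 1) x) = - (of_real (x \<bullet> b) * pderiv_along b f x)"
        using cc[of b] unfolding i[OF b] p[OF b] scaleR_conv_of_real
        by (simp add: scl_coeff_def)
    qed
    then show ?thesis by (simp add: EU_def D sum_negf)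
  qed
  ultimately show ?thesis using testR_EU[OF D(1)] unfolding odd_test_def by blast
qed

lemma cbound_EU:
  fixes f :: "'a::euclidean_space cfun"
  assumes f: "f \<in> testR R" "0 \<le> R" "cbound (Suc N) B f"
  shows "cbound N ((real DIM('a) * (R + real N) + norm c) * B) (EU c f)"
proof -
  note s = testR_smooth[OF f(1)]
  have 1: "cbound N (\<Sum>b\<in>(Basis::'a set). (R + real N) * B) (\<lambda>x. \<Sum>b\<in>Basis. of_real (x \<bullet> b) * pderiv_along b f x)"
    using f s by (intro cbound_sum cbound_coord_mult cbound_pderiv testR_pderiv smooth_mult smooth_coord smooth_pderiv) auto
  have 2: "cbound N (norm (- c) * B) (\<lambda>x. (- c) * f x)"
    by (intro cbound_cmult cbound_mono[OF f(3)] s) auto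
  have "cbound N ((\<Sum>b\<in>(Basis::'a set). (R + real N) * B) + norm (- c) * B) (EU c f)"
    unfolding EU_def by (intro cbound_add 1 2 smooth_sum smooth_mult smooth_coord smooth_pderiv smooth_cmult s) auto
  then show ?thesis by (simp add: algebra_simps)
qed

text \<open>The product of E - 1, E - 3, ..., E - (2M - 1). Even Taylor degrees are absent on the
  parity class, so these M factors already give a zero of order 2M + 1 at the origin.\<close>

primrec hE :: "nat \<Rightarrow> ('a::euclidean_space cfun) \<Rightarrow> 'a \<Rightarrow> complex" where
  "hE 0 f = f"
| "hE (Suc M) f = EU (of_nat (2 * M + 1)) (hE M f)"

lemma odd_test_hE: "f \<in> odd_test R \<Longrightarrow> hE M f \<in> odd_test R"
  by (induction M) (auto intro: odd_test_EU)

lemma smooth_hE: "smooth f \<Longrightarrow> smooth (hE M f)"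
  by (induction M) (auto intro: smooth_EU)

text \<open>At 0 the Euler part of \<open>EU\<close> vanishes because of the coordinate factors, so
  every factor acts on a derivative of order d as the scalar d - (2i + 1).\<close>

lemma pderivs_hE_0:
  assumes "smooth f" "set vs \<subseteq> Basis"
  shows "pderivs vs (hE M f) 0 = (\<Prod>i<M. of_nat (length vs) - of_nat (2 * i + 1)) * pderivs vs f 0"
  using assms(2) by (induction M) (auto simp: pderivs_EU smooth_hE assms(1) EU_def algebra_simps)

lemma hE_vanish:
  assumes "f \<in> odd_test R" "set vs \<subseteq> Basis" "length vs \<le> 2 * M"
  shows "pderivs vs (hE M f) 0 = 0"
proof (cases "even (length vs)")
  case True then show ?thesis using odd_test_vanish[OF odd_test_hE[OF assms(1)] assms(2)] by blast
next
  case False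
  then obtain i where i: "length vs = 2 * i + 1" by (auto elim: oddE)
  then have "i < M" using assms(3) by simp
  then have "(\<Prod>i<M. of_nat (length vs) - of_nat (2 * i + 1) :: complex) = 0"
    by (intro prod_zero) (auto simp: i)
  then show ?thesis by (simp add: pderivs_hE_0[OF odd_testD(2)[OF assms(1)] assms(2)])
qed

lemma cbound_hE:
  assumes "0 \<le> R"
  shows "\<exists>C\<ge>0. \<forall>f\<in>(odd_test R :: 'm::finite space cfun set).
    \<forall>B. cbound (N + M) B f \<longrightarrow> cbound N (C * B) (hE M f)"
proof (induction M arbitrary: N)
  case 0 show ?case by (intro exI[of _ 1]) simp
next
  case (Suc M)
  from Suc[of "Suc N"] obtain C where C0: "C \<ge> 0"
    and C1: "\<forall>f\<in>odd_test R. \<forall>B. cbound (Suc N + M) B f \<longrightarrow> cbound (Suc N) (C * B) (hE M (f :: 'm space cfun))"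
    by (elim exE conjE) (rule that)
  note C = C0 C1[rule_format]
  let ?C = "(real DIM('m space) * (R + real N) + norm (of_nat (2 * M + 1) :: complex))"
  show ?case
  proof (intro exI[of _ "?C * C"] conjI ballI allI impI)
    show "0 \<le> ?C * C" using C assms by (intro mult_nonneg_nonneg add_nonneg_nonneg) auto
    fix f :: "'m space cfun" and B assume f: "f \<in> odd_test R" "cbound (N + Suc M) B f"
    then have "cbound (Suc N) (C * B) (hE M f)" by (intro C(2)) auto
    from cbound_EU[OF odd_testD(1)[OF odd_test_hE[OF f(1)]] assms this, of "of_nat (2 * M + 1)"]
    show "cbound N (?C * C * B) (hE (Suc M) f)" by (simp only: mult.assoc hE.simps)
  qed
qed

lemma hE_bound:
  assumes "0 \<le> R"
  shows "\<exists>C\<ge>0. \<exists>N. \<forall>f\<in>odd_test R. \<forall>B x. cbound N B f \<longrightarrow> norm (hE M f (x :: 'm::finite space)) \<le> C * B * norm x ^ (2 * M + 1)"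
proof -
  from cbound_hE[OF assms, of "Suc (2 * M)" M, where 'm = 'm] obtain C where C0: "C \<ge> 0"
    and C1: "\<forall>f\<in>odd_test R. \<forall>B. cbound (Suc (2 * M) + M) B f \<longrightarrow> cbound (Suc (2 * M)) (C * B) (hE M (f :: 'm space cfun))"
    by (elim exE conjE) (rule that)
  note C = C0 C1[rule_format]
  show ?thesis
  proof (intro exI[of _ "real DIM('m space) ^ Suc (2 * M) * C"] exI[of _ "Suc (2 * M) + M"] conjI ballI allI impI)
    fix f :: "'m space cfun" and B x assume f: "f \<in> odd_test R" "cbound (Suc (2 * M) + M) B f"
    show "norm (hE M f x) \<le> real DIM('m space) ^ Suc (2 * M) * C * B * norm x ^ (2 * M + 1)"
      using vanishing_order_bound[OF smooth_hE[OF odd_testD(2)[OF f(1)]] C(2)[OF f] hE_vanish[OF f(1)], of x]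
      by (simp add: mult.assoc)
  qed (use C in auto)
qed

text \<open>The projection onto the parity class; the kernel has these parities, so the pairing sees
  only this part (\<open>II_symm\<close>).\<close>

definition symm :: "'m::finite space cfun \<Rightarrow> 'm space cfun" where
  "symm f x = (1 / 4) * ((f x + (- 1) * f (scl 1 (- 1) x)) + (f (scl (- 1) 1 x) + (- 1) * f (scl (- 1) (- 1) x)))"

lemma testR_flip:
  assumes "f \<in> testR R" "\<bar>s\<bar> = 1" "\<bar>t\<bar> = 1" shows "(\<lambda>x. f (scl s t x)) \<in> testR R"
proof -
  have "norm (scl s t x) = norm x" for x :: "'a space"
    using assms power2_abs[of s] power2_abs[of t] by (simp add: scl_def norm_space power_mult_distrib)
  then show ?thesis using assms by (simp add: testR_def smooth_scl)
qed

lemma symm_odd_test: "f \<in> testR R \<Longrightarrow> symm f \<in> odd_test R"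
proof -
  assume f: "f \<in> testR R"
  have "symm f \<in> testR R" unfolding symm_def
    by (intro testR_cmult testR_add testR_flip f) auto
  moreover have "symm f (- x) = - symm f x" "symm f (scl 1 (- 1) x) = - symm f x" for x
    unfolding symm_def scl_minus[symmetric] by (simp_all add: scl_scl field_simps)
  ultimately show ?thesis by (simp add: odd_test_def)
qed

lemma cbound_symm:
  assumes "smooth f" "cbound N B f" shows "cbound N B (symm f)"
proof -
  have c: "cbound N B (\<lambda>x. f (scl s t x))" if "\<bar>s\<bar> = 1" "\<bar>t\<bar> = 1" for s t
    by (rule cbound_diag[OF assms(2,1) bounded_linear_scl scl_Basis]) (auto simp: scl_coeff_def that)
  have s: "smooth (\<lambda>x. f (scl s t x))" for s t by (rule smooth_scl[OF assms(1)])
  have "cbound N (norm (1 / 4 :: complex) * ((B + norm (- 1 :: complex) * B) + (B + norm (- 1 :: complex) * B))) (symm f)"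
    unfolding symm_def by (intro cbound_cmult cbound_add c s assms smooth_add smooth_cmult) auto
  then show ?thesis by simp
qed

lemma symm_id: "f \<in> odd_test R \<Longrightarrow> symm f = f"
proof
  fix x assume f: "f \<in> odd_test R"
  have "f (scl (- 1) 1 x) = f x"
    using odd_testD(3)[OF f, of "scl 1 (- 1) x"] odd_testD(4)[OF f, of x] by (simp add: scl_minus[symmetric] scl_scl)
  then show "symm f x = f x" using odd_testD(3,4)[OF f, of x] by (simp add: symm_def scl_minus)
qed

section \<open>Holomorphic functions of two variables\<close>

lemma holo2_onI:
  "(\<And>p. p \<in> U \<Longrightarrow> (f has_derivative (\<lambda>w. a p * fst w + b p * snd w)) (at p)) \<Longrightarrow> holo2_on f U"
  unfolding holo2_on_def using has_derivative_at_withinI by blast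

lemma holo2_on_subset:
  assumes "holo2_on f U" "V \<subseteq> U" shows "holo2_on f V"
  unfolding holo2_on_def
proof
  fix p assume "p \<in> V"
  then obtain a b where "(f has_derivative (\<lambda>w. a * fst w + b * snd w)) (at p within U)"
    using assms unfolding holo2_on_def by blast
  from has_derivative_subset[OF this assms(2)]
  show "\<exists>a b. (f has_derivative (\<lambda>w. a * fst w + b * snd w)) (at p within V)" by blast
qed

lemma holo2_on_open_iff:
  assumes "open U"
  shows "holo2_on f U \<longleftrightarrow> (\<forall>p\<in>U. \<exists>a b. (f has_derivative (\<lambda>w. a * fst w + b * snd w)) (at p))"
  unfolding holo2_on_def by (intro ball_cong refl) (simp only: at_within_open[OF _ assms])

lemma holo2_on_cong:
  assumes "\<And>p. p \<in> U \<Longrightarrow> f p = g p" "holo2_on f U" shows "holo2_on g U"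
  unfolding holo2_on_def
proof
  fix p assume p: "p \<in> U"
  then obtain a b where "(f has_derivative (\<lambda>w. a * fst w + b * snd w)) (at p within U)"
    using assms(2) unfolding holo2_on_def by blast
  then have "(g has_derivative (\<lambda>w. a * fst w + b * snd w)) (at p within U)"
    by (rule has_derivative_transform[OF p, rotated]) (simp add: assms(1))
  then show "\<exists>a b. (g has_derivative (\<lambda>w. a * fst w + b * snd w)) (at p within U)" by blast
qed

lemma holo2_on_local:
  assumes "open U" "\<And>p. p \<in> U \<Longrightarrow> \<exists>V. open V \<and> p \<in> V \<and> holo2_on f V"
  shows "holo2_on f U"
  unfolding holo2_on_open_iff[OF assms(1)] using assms(2) holo2_on_open_iff by meson

lemma holo2_on_const [simp]: "holo2_on (\<lambda>p. c) U"
  by (rule holo2_onI[of _ _ "\<lambda>_. 0" "\<lambda>_. 0"]) simp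

lemma holo2_on_add: 
  assumes "holo2_on f U" "holo2_on g U" shows "holo2_on (\<lambda>p. f p + g p) U"
  unfolding holo2_on_def
proof
  fix p assume "p \<in> U"
  then obtain a b c d where "(f has_derivative (\<lambda>w. a * fst w + b * snd w)) (at p within U)"
    "(g has_derivative (\<lambda>w. c * fst w + d * snd w)) (at p within U)"
    using assms unfolding holo2_on_def by blast
  from has_derivative_add[OF this]
  have "((\<lambda>p. f p + g p) has_derivative (\<lambda>w. (a + c) * fst w + (b + d) * snd w)) (at p within U)"
    by (simp add: algebra_simps)
  then show "\<exists>a b. ((\<lambda>p. f p + g p) has_derivative (\<lambda>w. a * fst w + b * snd w)) (at p within U)" by blast
qed

lemma holo2_on_mult: 
  assumes "holo2_on f U" "holo2_on g U" shows "holo2_on (\<lambda>p. f p * g p) U"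
  unfolding holo2_on_def
proof
  fix p assume "p \<in> U"
  then obtain a b c d where "(f has_derivative (\<lambda>w. a * fst w + b * snd w)) (at p within U)"
    "(g has_derivative (\<lambda>w. c * fst w + d * snd w)) (at p within U)"
    using assms unfolding holo2_on_def by blast
  from has_derivative_mult[OF this]
  have "((\<lambda>p. f p * g p) has_derivative (\<lambda>w. (f p * c + a * g p) * fst w + (f p * d + b * g p) * snd w)) (at p within U)"
    by (simp add: algebra_simps)
  then show "\<exists>a b. ((\<lambda>p. f p * g p) has_derivative (\<lambda>w. a * fst w + b * snd w)) (at p within U)" by blast
qed

lemma holo2_on_diff: 
  "holo2_on f U \<Longrightarrow> holo2_on g U \<Longrightarrow> holo2_on (\<lambda>p. f p - g p) U"
  using holo2_on_add[of f U "\<lambda>p. (- 1) * g p"] holo2_on_mult[of "\<lambda>_. - 1" U g] by simp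

lemma holo2_on_compose_field:
  assumes "\<And>z. (h has_field_derivative h' z) (at z)"
  shows "holo2_on (\<lambda>p. h (c * fst p + d * snd p + e)) U"
proof (rule holo2_onI)
  fix p :: "complex \<times> complex"
  have 1: "((\<lambda>p. c * fst p + d * snd p + e) has_derivative (\<lambda>w. c * fst w + d * snd w)) (at p)"
    by (auto intro!: derivative_eq_intros)
  have 2: "(h has_derivative (*) (h' (c * fst p + d * snd p + e))) (at (c * fst p + d * snd p + e))"
    using assms unfolding has_field_derivative_def .
  from has_derivative_compose[OF 1 2]
  show "((\<lambda>p. h (c * fst p + d * snd p + e)) has_derivative
     (\<lambda>w. (h' (c * fst p + d * snd p + e) * c) * fst w + (h' (c * fst p + d * snd p + e) * d) * snd w)) (at p)"
    by (simp add: algebra_simps)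
qed

lemma holo2_on_affine: "holo2_on (\<lambda>p. c * fst p + d * snd p + e) U"
  using holo2_on_compose_field[of "\<lambda>z. z" "\<lambda>_. 1" c d e U] by auto

lemma holo2_on_rGamma: "holo2_on (\<lambda>p. rGamma (c * fst p + d * snd p + e)) U"
  by (rule holo2_on_compose_field[of rGamma "deriv rGamma"])
    (metis UNIV_I field_differentiable_derivI holomorphic_on_imp_differentiable_at holomorphic_rGamma open_UNIV)

lemma holo2_on_compose_affine:
  assumes "holo2_on f V" "\<And>p. p \<in> U \<Longrightarrow> (a * fst p + b * snd p + c, a' * fst p + b' * snd p + c') \<in> V"
  shows "holo2_on (\<lambda>p. f (a * fst p + b * snd p + c, a' * fst p + b' * snd p + c')) U"
  unfolding holo2_on_def
proof
  fix p assume p: "p \<in> U"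
  let ?L = "\<lambda>p. (a * fst p + b * snd p + c, a' * fst p + b' * snd p + c')"
  obtain k l where D: "(f has_derivative (\<lambda>w. k * fst w + l * snd w)) (at (?L p) within V)"
    using assms p unfolding holo2_on_def by blast
  have 1: "(?L has_derivative (\<lambda>w. (a * fst w + b * snd w, a' * fst w + b' * snd w))) (at p within U)"
    by (auto intro!: derivative_eq_intros)
  have "((\<lambda>p. f (?L p)) has_derivative (\<lambda>w. k * fst (a * fst w + b * snd w, a' * fst w + b' * snd w)
     + l * snd (a * fst w + b * snd w, a' * fst w + b' * snd w))) (at p within U)"
    by (rule has_derivative_in_compose[OF 1 has_derivative_subset[OF D]]) (use assms(2) in auto)
  then have "((\<lambda>p. f (?L p)) has_derivative (\<lambda>w. (k * a + l * a') * fst w + (k * b + l * b') * snd w)) (at p within U)"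
    by (simp add: algebra_simps)
  then show "\<exists>a'' b''. ((\<lambda>p. f (?L p)) has_derivative (\<lambda>w. a'' * fst w + b'' * snd w)) (at p within U)" by blast
qed

lemma holo2_on_imp_continuous: "holo2_on f U \<Longrightarrow> continuous_on U f"
  unfolding holo2_on_def continuous_on_eq_continuous_within
  using has_derivative_continuous by blast

lemma holo2_on_line:
  assumes "holo2_on f U"
    and "\<And>z. z \<in> S \<Longrightarrow> (a * z + b, a' * z + b') \<in> U"
  shows "(\<lambda>z. f (a * z + b, a' * z + b')) holomorphic_on S"
  unfolding holomorphic_on_def field_differentiable_def
proof
  fix z assume z: "z \<in> S"
  let ?L = "\<lambda>z. (a * z + b, a' * z + b')"
  obtain k l where D: "(f has_derivative (\<lambda>w. k * fst w + l * snd w)) (at (?L z) within U)"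
    using assms z unfolding holo2_on_def by blast
  have 1: "(?L has_derivative (\<lambda>w. (a * w, a' * w))) (at z within S)"
    by (auto intro!: derivative_eq_intros)
  have "((\<lambda>z. f (?L z)) has_derivative (\<lambda>w. k * fst (a * w, a' * w) + l * snd (a * w, a' * w))) (at z within S)"
    by (rule has_derivative_in_compose[OF 1 has_derivative_subset[OF D]]) (use assms(2) in auto)
  then have "((\<lambda>z. f (?L z)) has_derivative (*) (k * a + l * a')) (at z within S)"
    by (rule has_derivative_eq_rhs) (simp add: fun_eq_iff algebra_simps)
  then show "\<exists>f'. ((\<lambda>z. f (?L z)) has_field_derivative f') (at z within S)"
    unfolding has_field_derivative_def by blast
qed

text \<open>Reduction to one variable on the complex line through p and a point q of T: the preimage
  of S is convex, hence connected, and the preimage of T is open and contains the parameter of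
  q.\<close>

lemma holo2_identity_convex:
  assumes f: "holo2_on f S" and S: "open S" "convex S" and T: "open T" "T \<noteq> {}" "T \<subseteq> S"
    and z: "\<And>p. p \<in> T \<Longrightarrow> f p = 0" and p: "p \<in> S"
  shows "f p = 0"
proof -
  obtain q where q: "q \<in> T" using T by blast
  define u where "u = p - q"
  define L where "L = (\<lambda>z. (fst u * z + fst q, snd u * z + snd q))"
  define Z where "Z = L -` S"
  have L: "L z = q + (z * fst u, z * snd u)" for z by (simp add: L_def prod_eq_iff)
  have cL: "continuous_on UNIV L" unfolding L_def by (intro continuous_intros)
  have Zo: "open Z" unfolding Z_def by (rule open_vimage[OF S(1) cL])
  have conv: "L ((1 - t) * x + t * y) = (1 - t) *\<^sub>R L x + t *\<^sub>R L y" for x y :: complex and t :: real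
    by (simp add: L_def prod_eq_iff scaleR_conv_of_real algebra_simps)
  have "convex Z" unfolding convex_alt Z_def
  proof (intro ballI allI impI)
    fix x y and t :: real assume xy: "x \<in> L -` S" "y \<in> L -` S" "0 \<le> t \<and> t \<le> 1"
    have "(1 - t) *\<^sub>R L x + t *\<^sub>R L y \<in> S"
      using S(2) xy unfolding convex_alt by blast
    then show "(1 - t) *\<^sub>R x + t *\<^sub>R y \<in> L -` S"
      using conv[of t x y] by (simp add: scaleR_conv_of_real)
  qed
  then have Zc: "connected Z" by (rule convex_connected)
  have "L 1 = p" by (simp add: L u_def prod_eq_iff)
  then have 1: "1 \<in> Z" using p by (simp only: Z_def vimage_eq)
  have hol: "(\<lambda>z. f (L z)) holomorphic_on Z"
    unfolding L_def by (rule holo2_on_line[OF f]) (simp only: Z_def L_def vimage_eq)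
  have "L 0 = q" by (simp add: L_def)
  then have ne: "L -` T \<noteq> {}" using q by (metis empty_iff vimage_eq)
  have sub: "L -` T \<subseteq> Z" unfolding Z_def by (rule vimage_mono[OF T(3)])
  have "f (L 1) = 0"
  proof (rule analytic_continuation_open[OF open_vimage[OF T(1) cL] Zo ne Zc sub hol holomorphic_on_const _ 1])
    fix x assume "x \<in> L -` T"
    then show "f (L x) = 0" by (intro z) (simp only: vimage_eq)
  qed
  then show ?thesis by (simp only: \<open>L 1 = p\<close>)
qed

lemma holo2_eq_convex:
  assumes "holo2_on f S" "holo2_on g S" and S: "open S" "convex S" and T: "open T" "T \<noteq> {}" "T \<subseteq> S"
    and z: "\<And>p. p \<in> T \<Longrightarrow> f p = g p" and p: "p \<in> S"
  shows "f p = g p"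
  using holo2_identity_convex[OF holo2_on_diff[OF assms(1,2)] S T _ p] z by simp

text \<open>Two-parameter Laplace integrals: since $|e^w - 1 - w| \le |w|^2 e^{|w|}$, a little room in the
  parameters dominates the remainder of the first order expansion.\<close>

lemma exp_remainder_le: "norm (exp w - 1 - w) \<le> (norm w)\<^sup>2 * exp (norm w)" for w :: complex
proof -
  have "norm (exp w - (\<Sum>i\<le>1. w ^ i / fact i)) \<le> exp \<bar>Re w\<bar> * (norm w ^ Suc 1) / fact 1"
    by (rule Taylor_exp)
  also have "... \<le> exp (norm w) * (norm w)\<^sup>2"
    using abs_Re_le_cmod[of w] by (auto simp: power2_eq_square intro!: mult_right_mono)
  finally show ?thesis by (simp add: algebra_simps)
qed

lemma square_le_exp: "(t::real)\<^sup>2 \<le> 4 / e\<^sup>2 * exp (e * t)" if "t \<ge> 0" "e > 0"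
proof -
  have "e * t / 2 \<le> exp (e * t / 2)" using exp_ge_add_one_self[of "e * t / 2"] by linarith
  then have "(e * t / 2)\<^sup>2 \<le> (exp (e * t / 2))\<^sup>2" using that by (intro power_mono) auto
  also have "... = exp (e * t)" by (simp add: power2_eq_square flip: exp_add)
  finally show ?thesis using that by (simp add: field_simps power2_eq_square)
qed

lemma laplace_integral_holo2:
  fixes g :: "'a cfun" and u v :: "'a \<Rightarrow> real"
  assumes [measurable]: "g \<in> borel_measurable M" "u \<in> borel_measurable M" "v \<in> borel_measurable M"
    and U: "open U"
    and int: "\<And>p. p \<in> U \<Longrightarrow> integrable M (\<lambda>x. g x * exp (fst p * of_real (u x) + snd p * of_real (v x)))"
  shows "holo2_on (\<lambda>p. \<integral>x. g x * exp (fst p * of_real (u x) + snd p * of_real (v x)) \<partial>M) U"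
proof -
  define k where "k = (\<lambda>p x. g x * exp (fst p * of_real (u x) + snd p * of_real (v x)))"
  have km [measurable]: "k p \<in> borel_measurable M" for p unfolding k_def by measurable
  have "\<exists>a b. ((\<lambda>p. \<integral>x. k p x \<partial>M) has_derivative (\<lambda>w. a * fst w + b * snd w)) (at p)" if p: "p \<in> U" for p
  proof -
    obtain d where d: "d > 0" "ball p d \<subseteq> U" using U p open_contains_ball by blast
    \<comment> \<open>The corners \<open>q s t\<close> then have distance at most 4e = d/2 from
      p.\<close>
    define e where "e = d / 8"
    have e: "e > 0" using d by (simp add: e_def)
    define q where "q = (\<lambda>s t :: real. p + (of_real (2 * e * s), of_real (2 * e * t)))"
    have qU: "q s t \<in> U" if "\<bar>s\<bar> \<le> 1" "\<bar>t\<bar> \<le> 1" for s t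
    proof -
      have "dist p (q s t) = norm (of_real (2 * e * s) :: complex, of_real (2 * e * t) :: complex)"
        unfolding q_def dist_norm norm_minus_commute[of p] by simp
      also have "... \<le> norm (of_real (2 * e * s) :: complex) + norm (of_real (2 * e * t) :: complex)"
        by (rule norm_Pair_le)
      also have "... \<le> 2 * e * 1 + 2 * e * 1"
        using that e by (intro add_mono) (auto simp: norm_mult abs_mult intro!: mult_left_mono)
      also have "... < d" using d by (simp add: e_def)
      finally show ?thesis using d by auto
    qed
    \<comment> \<open>With s and t the signs of u and v, the kernel at the corner
      \<open>q s t\<close> has norm |k p x| exp(2e(|u| + |v|)). The sum over the four corners is
      therefore an integrable majorant of this quantity.\<close>
    define D where "D = (\<lambda>x. norm (k (q 1 1) x) + norm (k (q 1 (-1)) x) + norm (k (q (-1) 1) x) + norm (k (q (-1) (-1)) x))"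
    have kint: "integrable M (k r)" if "r \<in> U" for r using int[OF that] unfolding k_def by simp
    have Dint: "integrable M D" unfolding D_def
      by (intro Bochner_Integration.integrable_add integrable_norm kint qU) auto
    have Dge: "norm (k p x) * exp (2 * e * (\<bar>u x\<bar> + \<bar>v x\<bar>)) \<le> D x" for x
    proof -
      have kq: "norm (k (q s t) x) = norm (k p x) * exp (2 * e * (s * u x + t * v x))" for s t
        by (simp add: k_def q_def norm_mult algebra_simps flip: exp_add)
      obtain s t where st: "s \<in> {1, -1}" "t \<in> {1, -1}" "\<bar>u x\<bar> = s * u x" "\<bar>v x\<bar> = t * v x"
        by (metis abs_if insertI1 insertI2 mult_1 mult_minus_left)
      then have "norm (k p x) * exp (2 * e * (\<bar>u x\<bar> + \<bar>v x\<bar>)) = norm (k (q s t) x)" by (simp only: kq)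
      then show ?thesis using st(1,2) unfolding D_def by (elim insertE emptyE) simp_all
    qed
    \<comment> \<open>The constant of \<open>square_le_exp\<close>: the square t^2 costs one factor
      exp(e t) and the exponential remainder with |w| <= e costs another. Together they are the
      exp(2 e t) dominated by \<open>D\<close>.\<close>
    define C where "C = 4 / e\<^sup>2"
    have C0: "C > 0" using e by (simp add: C_def)
    have rem: "norm (k (p + w) x - k p x - k p x * (fst w * of_real (u x) + snd w * of_real (v x))) \<le> (norm w)\<^sup>2 * (C * D x)"
      if w: "norm w \<le> e" for w x
    proof -
      define t where "t = \<bar>u x\<bar> + \<bar>v x\<bar>"
      define z where "z = fst w * of_real (u x) + snd w * of_real (v x)"
      have "norm z \<le> norm (fst w) * \<bar>u x\<bar> + norm (snd w) * \<bar>v x\<bar>"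
        unfolding z_def by (rule norm_triangle_le) (simp add: norm_mult)
      also have "... \<le> norm w * \<bar>u x\<bar> + norm w * \<bar>v x\<bar>"
        using norm_fst_le[of "fst w" "snd w"] norm_snd_le[of "snd w" "fst w"] by (intro add_mono mult_right_mono) auto
      finally have z: "norm z \<le> norm w * t" by (simp add: t_def algebra_simps)
      have t0: "t \<ge> 0" by (simp add: t_def)
      have "k (p + w) x = k p x * exp z"
        by (simp add: k_def z_def algebra_simps flip: exp_add)
      then have "norm (k (p + w) x - k p x - k p x * z) = norm (k p x) * norm (exp z - 1 - z)"
        by (simp add: norm_mult[symmetric] algebra_simps)
      also have "... \<le> norm (k p x) * ((norm w * t)\<^sup>2 * exp (e * t))"
      proof (intro mult_left_mono order_trans[OF exp_remainder_le] mult_mono power_mono z)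
        show "exp (norm z) \<le> exp (e * t)"
          using z mult_right_mono[OF w t0] by simp
      qed auto
      also have "... = (norm w)\<^sup>2 * (norm (k p x) * (t\<^sup>2 * exp (e * t)))"
        by (simp add: power_mult_distrib)
      also have "... \<le> (norm w)\<^sup>2 * (norm (k p x) * (C * exp (e * t) * exp (e * t)))"
        using square_le_exp[OF t0 e] by (intro mult_left_mono mult_right_mono) (auto simp: C_def)
      also have "... = (norm w)\<^sup>2 * (C * (norm (k p x) * exp (2 * e * t)))"
        by (simp flip: exp_add)
      also have "... \<le> (norm w)\<^sup>2 * (C * D x)"
        using Dge[of x] C0 by (intro mult_left_mono) (auto simp: t_def)
      finally show ?thesis by (simp add: z_def)
    qed
    have tle: "\<bar>u x\<bar> + \<bar>v x\<bar> \<le> exp (2 * e * (\<bar>u x\<bar> + \<bar>v x\<bar>)) / (2 * e)" for x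
    proof -
      have "2 * e * (\<bar>u x\<bar> + \<bar>v x\<bar>) \<le> exp (2 * e * (\<bar>u x\<bar> + \<bar>v x\<bar>))"
        using exp_ge_add_one_self[of "2 * e * (\<bar>u x\<bar> + \<bar>v x\<bar>)"] by linarith
      then show ?thesis using e by (simp add: pos_le_divide_eq mult.commute)
    qed
    have uvb: "norm (k p x) * (\<bar>u x\<bar> + \<bar>v x\<bar>) \<le> D x / (2 * e)" for x
    proof -
      have "norm (k p x) * (\<bar>u x\<bar> + \<bar>v x\<bar>) \<le> norm (k p x) * (exp (2 * e * (\<bar>u x\<bar> + \<bar>v x\<bar>)) / (2 * e))"
        by (intro mult_left_mono tle) auto
      also have "... \<le> D x / (2 * e)" using Dge[of x] e by (simp add: field_simps)
      finally show ?thesis .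
    qed
    have iu: "integrable M (\<lambda>x. k p x * of_real (u x))"
    proof (rule Bochner_Integration.integrable_bound[OF integrable_divide_zero[OF Dint, of "2 * e"]])
      show "AE x in M. norm (k p x * of_real (u x)) \<le> norm (D x / (2 * e))"
      proof (rule AE_I2)
        fix x
        have "norm (k p x) * \<bar>u x\<bar> \<le> norm (k p x) * (\<bar>u x\<bar> + \<bar>v x\<bar>)" by (intro mult_left_mono) auto
        also note uvb
        also have "D x / (2 * e) \<le> norm (D x / (2 * e))" by (simp only: real_norm_def abs_ge_self)
        finally show "norm (k p x * of_real (u x)) \<le> norm (D x / (2 * e))" by (simp only: norm_mult norm_of_real)
      qed
    qed measurable
    have iv: "integrable M (\<lambda>x. k p x * of_real (v x))"
    proof (rule Bochner_Integration.integrable_bound[OF integrable_divide_zero[OF Dint, of "2 * e"]])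
      show "AE x in M. norm (k p x * of_real (v x)) \<le> norm (D x / (2 * e))"
      proof (rule AE_I2)
        fix x
        have "norm (k p x) * \<bar>v x\<bar> \<le> norm (k p x) * (\<bar>u x\<bar> + \<bar>v x\<bar>)" by (intro mult_left_mono) auto
        also note uvb
        also have "D x / (2 * e) \<le> norm (D x / (2 * e))" by (simp only: real_norm_def abs_ge_self)
        finally show "norm (k p x * of_real (v x)) \<le> norm (D x / (2 * e))" by (simp only: norm_mult norm_of_real)
      qed
    qed measurable
    define a where "a = (\<integral>x. k p x * of_real (u x) \<partial>M)"
    define b where "b = (\<integral>x. k p x * of_real (v x) \<partial>M)"
    define B where "B = C * (\<integral>x. D x \<partial>M)"
    have est: "norm ((\<integral>x. k (p + w) x \<partial>M) - (\<integral>x. k p x \<partial>M) - (a * fst w + b * snd w)) \<le> (norm w)\<^sup>2 * B" if w: "norm w \<le> e" for w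
    proof -
      have pw: "p + w \<in> U" using w d e by (intro subsetD[OF d(2)]) (auto simp: dist_norm e_def)
        have i3: "integrable M (\<lambda>x. k p x * (fst w * of_real (u x) + snd w * of_real (v x)))"
          using Bochner_Integration.integrable_add[OF integrable_mult_right[OF iu, of "fst w"] integrable_mult_right[OF iv, of "snd w"]]
          by (simp add: algebra_simps)
      have eq: "(\<integral>x. k (p + w) x \<partial>M) - (\<integral>x. k p x \<partial>M) - (a * fst w + b * snd w)
        = (\<integral>x. k (p + w) x - k p x - k p x * (fst w * of_real (u x) + snd w * of_real (v x)) \<partial>M)"
      proof -
        have "a * fst w + b * snd w = (\<integral>x. k p x * of_real (u x) * fst w + k p x * of_real (v x) * snd w \<partial>M)"
          unfolding a_def b_def using iu iv by simp
        also have "... = (\<integral>x. k p x * (fst w * of_real (u x) + snd w * of_real (v x)) \<partial>M)"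
          by (simp add: algebra_simps)
        finally have ab: "a * fst w + b * snd w = (\<integral>x. k p x * (fst w * of_real (u x) + snd w * of_real (v x)) \<partial>M)" .
        show ?thesis unfolding ab using kint[OF pw] kint[OF p] i3 by simp
      qed
      have "norm (\<integral>x. k (p + w) x - k p x - k p x * (fst w * of_real (u x) + snd w * of_real (v x)) \<partial>M)
         \<le> (\<integral>x. (norm w)\<^sup>2 * (C * D x) \<partial>M)"
        using Dint kint[OF pw] kint[OF p] i3
        by (intro order_trans[OF integral_norm_bound integral_mono] rem w) auto
      also have "... = (norm w)\<^sup>2 * B" by (simp add: B_def)
      finally show ?thesis unfolding eq .
    qed
    have "((\<lambda>p. \<integral>x. k p x \<partial>M) has_derivative (\<lambda>w. a * fst w + b * snd w)) (at p)"
      unfolding has_derivative_at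
    proof
      show "bounded_linear (\<lambda>w. a * fst w + b * snd w)"
        by (intro bounded_linear_add bounded_linear_const_mult bounded_linear_fst bounded_linear_snd)
      show "(\<lambda>w. norm ((\<integral>x. k (p + w) x \<partial>M) - (\<integral>x. k p x \<partial>M) - (a * fst w + b * snd w)) / norm w) \<midarrow>0\<rightarrow> 0"
      proof (rule Lim_null_comparison[where g = "\<lambda>w. norm w * B"])
        have "eventually (\<lambda>w. norm w < e) (at (0 :: complex \<times> complex))"
          using e by (auto simp: eventually_at intro!: exI[of _ e])
        then show "\<forall>\<^sub>F w in at 0. norm (norm ((\<integral>x. k (p + w) x \<partial>M) - (\<integral>x. k p x \<partial>M) - (a * fst w + b * snd w)) / norm w) \<le> norm w * B"
        proof eventually_elim
          case (elim w)
          then show ?case using est[of w] by (cases "w = 0") (auto simp: divide_le_eq power2_eq_square algebra_simps)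
        qed
        show "((\<lambda>w. norm w * B) \<longlongrightarrow> 0) (at (0 :: complex \<times> complex))"
          by (auto intro!: tendsto_eq_intros)
      qed
    qed
    then show ?thesis by blast
  qed
  then show ?thesis unfolding holo2_on_open_iff[OF U] by (simp add: k_def)
qed

section \<open>Integrability of the kernel\<close>

lemma measurable_space [measurable]:
  "(fst :: 'm::finite space \<Rightarrow> _) \<in> borel_measurable borel"
  "(snd :: 'm::finite space \<Rightarrow> _) \<in> borel_measurable borel"
  by (auto intro!: borel_measurable_continuous_onI continuous_intros)

section \<open>Gamma, Beta and Gaussian integrals\<close>

lemma nn_Gamma_scaled:
  fixes c r :: real
  assumes c: "c > 0" and r: "r > 0"
  shows "(\<integral>\<^sup>+s. ennreal (indicator {0<..} s * (s powr (c - 1) * exp (- r * s))) \<partial>lborel) = ennreal (Gamma c * r powr (- c))"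
proof -
  have "ennreal (Gamma c) = (\<integral>\<^sup>+t. ennreal (indicator {0..} t * t powr (c - 1) / exp t) \<partial>lborel)"
    by (rule Gamma_conv_nn_integral_real[OF c])
  also have "... = ennreal \<bar>r\<bar> * (\<integral>\<^sup>+s. ennreal (indicator {0..} (0 + r * s) * (0 + r * s) powr (c - 1) / exp (0 + r * s)) \<partial>lborel)"
    using r by (intro nn_integral_real_affine) auto
  also have "... = (\<integral>\<^sup>+s. ennreal r * ennreal (indicator {0..} (0 + r * s) * (0 + r * s) powr (c - 1) / exp (0 + r * s)) \<partial>lborel)"
    using r by (subst nn_integral_cmult) auto
  also have "... = (\<integral>\<^sup>+s. ennreal (r powr c) * ennreal (indicator {0<..} s * (s powr (c - 1) * exp (- r * s))) \<partial>lborel)"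
  proof (rule nn_integral_cong)
    fix s :: real
    show "ennreal r * ennreal (indicator {0..} (0 + r * s) * (0 + r * s) powr (c - 1) / exp (0 + r * s)) =
        ennreal (r powr c) * ennreal (indicator {0<..} s * (s powr (c - 1) * exp (- r * s)))"
    proof (cases "s > 0")
      case True
      have "r * r powr (c - 1) = r powr c" using r by (simp add: powr_diff)
      then show ?thesis using r True
        by (simp add: ennreal_mult[symmetric] powr_mult exp_minus field_simps)
    next
      case False
      then have "indicator {0..} (r * s) * (r * s) powr (c - 1) = 0"
        using r by (cases "s = 0") (auto simp: indicator_def zero_le_mult_iff)
      then show ?thesis using False by simp
    qed
  qed
  also have "... = ennreal (r powr c) * (\<integral>\<^sup>+s. ennreal (indicator {0<..} s * (s powr (c - 1) * exp (- r * s))) \<partial>lborel)"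
    by (rule nn_integral_cmult) auto
  finally have *: "ennreal (Gamma c) = ennreal (r powr c) * (\<integral>\<^sup>+s. ennreal (indicator {0<..} s * (s powr (c - 1) * exp (- r * s))) \<partial>lborel)" .
  have "ennreal (r powr (- c)) * ennreal (Gamma c) = ennreal (r powr (- c) * r powr c) *
     (\<integral>\<^sup>+s. ennreal (indicator {0<..} s * (s powr (c - 1) * exp (- r * s))) \<partial>lborel)"
    unfolding * by (simp add: ennreal_mult mult.assoc)
  also have "r powr (- c) * r powr c = 1" using r by (simp add: powr_minus)
  finally show ?thesis using c by (simp add: ennreal_mult[symmetric] Gamma_real_pos mult.commute)
qed

text \<open>Gamma(c + e) (1 + s)^(-(c + e)) is a Gamma integral in a new variable r; after
  exchanging the two integrations the s-integral gives Gamma(c) and the r-integral Gamma(e).\<close>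

lemma nn_Beta_half_line:
  fixes c e :: real
  assumes c: "c > 0" and e: "e > 0"
  shows "(\<integral>\<^sup>+s. ennreal (indicator {0<..} s * (s powr (c - 1) * (1 + s) powr (- (c + e)))) \<partial>lborel)
     = ennreal (Gamma c * Gamma e / Gamma (c + e))"
proof -
  let ?I = "\<integral>\<^sup>+s. ennreal (indicator {0<..} s * (s powr (c - 1) * (1 + s) powr (- (c + e)))) \<partial>lborel"
  let ?f = "\<lambda>s r. ennreal (indicator {0<..} s * s powr (c - 1)) * ennreal (indicator {0<..} r * (r powr (c + e - 1) * exp (- (1 + s) * r)))"
  have "ennreal (Gamma (c + e)) * ?I = (\<integral>\<^sup>+s. ennreal (Gamma (c + e)) * ennreal (indicator {0<..} s * (s powr (c - 1) * (1 + s) powr (- (c + e)))) \<partial>lborel)"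
    by (rule nn_integral_cmult[symmetric]) auto
  also have "... = (\<integral>\<^sup>+s. \<integral>\<^sup>+r. ?f s r \<partial>lborel \<partial>lborel)"
  proof (rule nn_integral_cong)
    fix s :: real
    show "ennreal (Gamma (c + e)) * ennreal (indicator {0<..} s * (s powr (c - 1) * (1 + s) powr (- (c + e)))) = (\<integral>\<^sup>+r. ?f s r \<partial>lborel)"
    proof (cases "s > 0")
      case True
      have "(\<integral>\<^sup>+r. ?f s r \<partial>lborel) = ennreal (indicator {0<..} s * s powr (c - 1)) *
          (\<integral>\<^sup>+r. ennreal (indicator {0<..} r * (r powr (c + e - 1) * exp (- (1 + s) * r))) \<partial>lborel)"
        by (rule nn_integral_cmult) measurable
      also have "... = ennreal (indicator {0<..} s * s powr (c - 1)) * ennreal (Gamma (c + e) * (1 + s) powr (- (c + e)))"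
        using True c e by (subst nn_Gamma_scaled) auto
      finally show ?thesis using True c e
        by (simp add: ennreal_mult[symmetric] Gamma_real_pos less_imp_le algebra_simps)
    qed simp
  qed
  also have "... = (\<integral>\<^sup>+r. \<integral>\<^sup>+s. ?f s r \<partial>lborel \<partial>lborel)"
    by (rule lborel_pair.Fubini') measurable
  also have "... = (\<integral>\<^sup>+r. ennreal (Gamma c) * ennreal (indicator {0<..} r * (r powr (e - 1) * exp (- 1 * r))) \<partial>lborel)"
  proof (rule nn_integral_cong)
    fix r :: real
    show "(\<integral>\<^sup>+s. ?f s r \<partial>lborel) = ennreal (Gamma c) * ennreal (indicator {0<..} r * (r powr (e - 1) * exp (- 1 * r)))"
    proof (cases "r > 0")
      case True
      have "(\<integral>\<^sup>+s. ?f s r \<partial>lborel) = (\<integral>\<^sup>+s. ennreal (r powr (c + e - 1) * exp (- r)) * ennreal (indicator {0<..} s * (s powr (c - 1) * exp (- r * s))) \<partial>lborel)"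
        using True by (intro nn_integral_cong) (auto simp: ennreal_mult[symmetric] indicator_def algebra_simps exp_diff exp_minus field_simps simp flip: exp_add)
      also have "... = ennreal (r powr (c + e - 1) * exp (- r)) * ennreal (Gamma c * r powr (- c))"
        by (subst nn_integral_cmult) (simp_all only: nn_Gamma_scaled[OF c True], auto)
      also have "... = ennreal (Gamma c * (r powr (c + e - 1) * r powr (- c)) * exp (- r))"
        using c by (simp add: ennreal_mult[symmetric] Gamma_real_pos algebra_simps)
      also have "r powr (c + e - 1) * r powr (- c) = r powr (e - 1)" by (simp flip: powr_add)
      finally show ?thesis using c True by (simp add: ennreal_mult[symmetric] Gamma_real_pos less_imp_le algebra_simps)
    qed simp
  qed
  also have "... = ennreal (Gamma c) * ennreal (Gamma e * 1 powr (- e))"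
    by (subst nn_integral_cmult, simp, subst nn_Gamma_scaled[OF e]) auto
  finally have *: "ennreal (Gamma (c + e)) * ?I = ennreal (Gamma c * Gamma e)"
    using c e by (simp add: ennreal_mult Gamma_real_pos less_imp_le)
  have "ennreal (1 / Gamma (c + e)) * (ennreal (Gamma (c + e)) * ?I) = ennreal (1 / Gamma (c + e)) * ennreal (Gamma c * Gamma e)"
    by (simp only: *)
  moreover have "Gamma (c + e) > 0" using c e by (simp add: Gamma_real_pos)
  ultimately show ?thesis
    using c e by (simp add: ennreal_mult[symmetric] mult.assoc[symmetric] Gamma_real_pos less_imp_le)
qed

text \<open>The substitution y = t x^2 on the half-line leads to the Gamma integral with exponent (a
  + 1) / 2; the other half-line follows by reflection.\<close>

lemma nn_gauss_moment:
  fixes a t :: real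
  assumes a: "a > - 1" and t: "t > 0"
  shows "(\<integral>\<^sup>+x. ennreal (\<bar>x\<bar> powr a * exp (- t * x\<^sup>2)) \<partial>lborel) = ennreal (Gamma ((a + 1) / 2) * t powr (- (a + 1) / 2))"
proof -
  define c where "c = (a + 1) / 2"
  have c: "c > 0" using a by (simp add: c_def)
  define f where "f = (\<lambda>y. y powr (c - 1) * exp (- y))"
  have "(\<lambda>y. y powr (c - 1) / exp y) absolutely_integrable_on {0..}"
    using Gamma_integral_real[OF c] by (intro nonnegative_absolutely_integrable_1) auto
  then have fi: "f absolutely_integrable_on {0<..}"
    unfolding f_def by (rule set_integrable_subset[THEN set_integrable_cong[THEN iffD1, rotated -1], of _ _ _ "{0<..}"])
      (auto simp: exp_minus field_simps)
  have fI: "integral {0<..} f = Gamma c"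
  proof -
    have "((\<lambda>y. if y \<in> {0<..} then y powr (c - 1) / exp y else 0) has_integral Gamma c) {0..}"
      by (rule has_integral_spike[OF _ _ Gamma_integral_real[OF c], of "{0}"]) auto
    then have "((\<lambda>y. y powr (c - 1) / exp y) has_integral Gamma c) {0<..}"
      by (subst (asm) has_integral_restrict) auto
    then show ?thesis by (simp add: f_def exp_minus field_simps integral_unique)
  qed
  have im: "(\<lambda>x. t * x\<^sup>2) ` {0<..} = {0<..}"
  proof safe
    fix y :: real assume "0 < y"
    then show "y \<in> (\<lambda>x. t * x\<^sup>2) ` {0<..}" using t by (intro image_eqI[of _ _ "sqrt (y / t)"]) auto
  qed (use t in auto)
  have "(\<lambda>x. \<bar>2 * t * x\<bar> * f (t * x\<^sup>2)) absolutely_integrable_on {0<..} \<and> integral {0<..} (\<lambda>x. \<bar>2 * t * x\<bar> * f (t * x\<^sup>2)) = Gamma c"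
    using t fi fI im
    by (intro has_absolute_integral_change_of_variables_1'[where g = "\<lambda>x. t * x\<^sup>2" and g' = "\<lambda>x. 2 * t * x", THEN iffD2])
      (auto intro!: derivative_eq_intros inj_onI)
  then have hi: "((\<lambda>x. \<bar>2 * t * x\<bar> * f (t * x\<^sup>2)) has_integral Gamma c) {0<..}"
    using has_integral_iff set_lebesgue_integral_eq_integral(1) by blast
  have eq: "\<bar>2 * t * x\<bar> * f (t * x\<^sup>2) = 2 * t powr c * (\<bar>x\<bar> powr a * exp (- t * x\<^sup>2))" if "x > 0" for x
  proof -
    have "t * t powr (c - 1) = t powr c" using t by (simp add: powr_diff)
    moreover have "x * (x\<^sup>2) powr (c - 1) = x powr a"
      using that by (simp add: c_def powr_powr flip: powr_numeral) (simp add: powr_mult_base field_simps)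
    moreover have "2 * t * x * (t * x\<^sup>2) powr (c - 1) = 2 * (t * t powr (c - 1)) * (x * (x\<^sup>2) powr (c - 1))"
      using that t by (simp add: powr_mult)
    ultimately have "2 * t * x * (t * x\<^sup>2) powr (c - 1) = 2 * t powr c * x powr a" by (simp only: mult.assoc)
    then show ?thesis using that t by (simp add: f_def abs_mult flip: mult.assoc)
  qed
  have half: "(\<integral>\<^sup>+x. ennreal (indicator {0<..} x * (\<bar>x\<bar> powr a * exp (- t * x\<^sup>2))) \<partial>lborel) = ennreal (Gamma c * t powr (- c) / 2)"
  proof -
    have "((\<lambda>x. \<bar>x\<bar> powr a * exp (- t * x\<^sup>2)) has_integral Gamma c / (2 * t powr c)) {0<..}"
    proof -
      have "((\<lambda>x. 2 * t powr c * (\<bar>x\<bar> powr a * exp (- t * x\<^sup>2))) has_integral Gamma c) {0<..}"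
        by (rule has_integral_eq[OF _ hi]) (use eq in auto)
      from has_integral_mult_right[OF this, of "1 / (2 * t powr c)"] t show ?thesis by simp
    qed
    from nn_integral_has_integral_lebesgue[OF _ this]
    show ?thesis by (simp add: powr_minus field_simps)
  qed
  have half': "(\<integral>\<^sup>+x. ennreal (indicator {..<0} x * (\<bar>x\<bar> powr a * exp (- t * x\<^sup>2))) \<partial>lborel) = ennreal (Gamma c * t powr (- c) / 2)"
    using half by (subst nn_integral_real_affine[where c = "-1" and t = 0]) (auto simp: indicator_def cong: if_cong)
  have "(\<integral>\<^sup>+x. ennreal (\<bar>x\<bar> powr a * exp (- t * x\<^sup>2)) \<partial>lborel) =
     (\<integral>\<^sup>+x. ennreal (indicator {0<..} x * (\<bar>x\<bar> powr a * exp (- t * x\<^sup>2))) + ennreal (indicator {..<0} x * (\<bar>x\<bar> powr a * exp (- t * x\<^sup>2))) \<partial>lborel)"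
    by (intro nn_integral_cong) (auto simp: indicator_def)
  also have "... = ennreal (Gamma c * t powr (- c) / 2) + ennreal (Gamma c * t powr (- c) / 2)"
    by (subst nn_integral_add) (simp_all only: half half', auto)
  also have "... = ennreal (Gamma c * t powr (- c))"
    using c by (subst ennreal_plus[symmetric]) (auto simp: Gamma_real_pos less_imp_le)
  finally show ?thesis by (simp add: c_def minus_divide_left)
qed

lemma nn_gauss:
  assumes t: "t > 0"
  shows "(\<integral>\<^sup>+x. ennreal (exp (- t * x\<^sup>2)) \<partial>lborel) = ennreal ((pi / t) powr (1 / 2))"
proof -
  \<comment> \<open>\<open>0 powr 0\<close> is 0, so the integrands differ at the point 0 and agree
    only almost everywhere.\<close>
  have "(\<integral>\<^sup>+x. ennreal (exp (- t * x\<^sup>2)) \<partial>lborel) = (\<integral>\<^sup>+x. ennreal (\<bar>x\<bar> powr 0 * exp (- t * x\<^sup>2)) \<partial>lborel)"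
    using AE_lborel_singleton[of "0::real"] by (intro nn_integral_cong_AE) auto
  also have "... = ennreal ((pi / t) powr (1 / 2))"
    using t by (subst nn_gauss_moment) (auto simp: Gamma_one_half_real powr_divide powr_minus powr_half_sqrt field_simps)
  finally show ?thesis .
qed

lemma nn_gauss_euclidean:
  assumes t: "t > 0"
  shows "(\<integral>\<^sup>+x. ennreal (exp (- t * (norm x)\<^sup>2)) \<partial>(lborel :: 'a::euclidean_space measure)) = ennreal ((pi / t) powr (real DIM('a) / 2))"
proof -
  have "(\<integral>\<^sup>+x. ennreal (exp (- t * (norm x)\<^sup>2)) \<partial>(lborel :: 'a measure)) =
     (\<integral>\<^sup>+x. (\<Prod>b\<in>Basis. ennreal (exp (- t * (x \<bullet> b)\<^sup>2))) \<partial>(lborel :: 'a measure))"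
  proof (intro nn_integral_cong)
    fix x :: 'a
    have "exp (- t * (norm x)\<^sup>2) = (\<Prod>b\<in>Basis. exp (- t * (x \<bullet> b)\<^sup>2))"
      unfolding power2_norm_eq_inner euclidean_inner[of x x]
      by (simp add: exp_sum[symmetric] sum_distrib_left power2_eq_square sum_negf)
    then show "ennreal (exp (- t * (norm x)\<^sup>2)) = (\<Prod>b\<in>Basis. ennreal (exp (- t * (x \<bullet> b)\<^sup>2)))"
      by (simp add: prod_ennreal)
  qed
  also have "... = (\<Prod>b\<in>(Basis :: 'a set). ennreal ((pi / t) powr (1 / 2)))"
    by (subst nn_integral_lborel_prod) (simp_all only: nn_gauss[OF t], auto)
  also have "... = ennreal (((pi / t) powr (1 / 2)) ^ DIM('a))" by (simp add: ennreal_power)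
  also have "((pi / t) powr (1 / 2)) ^ DIM('a) = (pi / t) powr (real DIM('a) / 2)"
    using t by (simp add: powr_power)
  finally show ?thesis .
qed

lemma nn_integral_space:
  fixes f :: "'m::finite space \<Rightarrow> ennreal"
  assumes [measurable]: "f \<in> borel_measurable borel"
  shows "(\<integral>\<^sup>+x. f x \<partial>lborel) = (\<integral>\<^sup>+y. \<integral>\<^sup>+t. f (y, t) \<partial>lborel \<partial>lborel)"
proof -
  have "(\<integral>\<^sup>+x. f x \<partial>lborel) = (\<integral>\<^sup>+x. f x \<partial>(lborel \<Otimes>\<^sub>M lborel))" by (simp add: lborel_prod)
  also have "... = (\<integral>\<^sup>+y. \<integral>\<^sup>+t. f (y, t) \<partial>lborel \<partial>lborel)"
    by (subst lborel.nn_integral_fst[symmetric]) (auto simp: lborel_prod)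
  finally show ?thesis .
qed

lemma half_sum: "- (x + 1 + y) / 2 = - ((x + y + 1) / 2)" "- (x + 1) / 2 + - (y / 2) = - ((x + y + 1) / 2)" for x y :: real
  by (simp_all add: field_simps)

lemma nn_gauss_space:
  assumes a: "a > - 1" and t: "t > 0"
  shows "(\<integral>\<^sup>+x. ennreal (\<bar>snd x\<bar> powr a * exp (- t * (norm x)\<^sup>2)) \<partial>(lborel :: 'm::finite space measure)) =
     ennreal (Gamma ((a + 1) / 2) * pi powr (real CARD('m) / 2) * t powr (- (a + 1 + real CARD('m)) / 2))"
proof -
  have "(\<integral>\<^sup>+x. ennreal (\<bar>snd x\<bar> powr a * exp (- t * (norm x)\<^sup>2)) \<partial>(lborel :: 'm space measure)) =
    (\<integral>\<^sup>+y. \<integral>\<^sup>+s. ennreal (\<bar>s\<bar> powr a * exp (- t * ((norm (y :: real ^ 'm))\<^sup>2 + s\<^sup>2))) \<partial>lborel \<partial>lborel)"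
    by (subst nn_integral_space) (auto simp: norm_space)
  also have "... = (\<integral>\<^sup>+y. \<integral>\<^sup>+s. ennreal (exp (- t * (norm (y :: real ^ 'm))\<^sup>2)) * ennreal (\<bar>s\<bar> powr a * exp (- t * s\<^sup>2)) \<partial>lborel \<partial>lborel)"
    by (intro nn_integral_cong) (simp add: ennreal_mult[symmetric] algebra_simps flip: exp_add)
  also have "... = (\<integral>\<^sup>+y. ennreal (exp (- t * (norm (y :: real ^ 'm))\<^sup>2)) * ennreal (Gamma ((a + 1) / 2) * t powr (- (a + 1) / 2)) \<partial>lborel)"
    by (intro nn_integral_cong, subst nn_integral_cmult) (simp_all only: nn_gauss_moment[OF a t], auto)
  also have "... = ennreal ((pi / t) powr (real CARD('m) / 2)) * ennreal (Gamma ((a + 1) / 2) * t powr (- (a + 1) / 2))"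
    by (subst nn_integral_multc) (simp_all only: nn_gauss_euclidean[OF t], auto)
  also have "... = ennreal (Gamma ((a + 1) / 2) * pi powr (real CARD('m) / 2) * (t powr (- (a + 1) / 2) * t powr (- (real CARD('m) / 2))))"
    using t a by (simp add: ennreal_mult[symmetric] Gamma_real_pos less_imp_le powr_divide powr_minus field_simps)
  also have "t powr (- (a + 1) / 2) * t powr (- (real CARD('m) / 2)) = t powr (- (a + 1 + real CARD('m)) / 2)"
    by (simp only: powr_add[symmetric] half_sum)
  finally show ?thesis .
qed

lemma inverse_power_Gamma:
  fixes r b :: real
  assumes "r > 0" "b < 0"
  shows "ennreal (r powr b) = ennreal (1 / Gamma (- b / 2)) *
     (\<integral>\<^sup>+s. ennreal (indicator {0<..} s * (s powr (- b / 2 - 1) * exp (- r\<^sup>2 * s))) \<partial>lborel)"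
proof -
  have "(r\<^sup>2) powr (- (- b / 2)) = r powr b"
    using assms by (simp add: powr_powr flip: powr_numeral)
  moreover have "Gamma (- (b / 2)) \<noteq> 0" by (rule less_imp_neq[OF Gamma_real_pos, symmetric]) (use assms in simp)
  ultimately show ?thesis
    using assms by (subst nn_Gamma_scaled) (auto simp: ennreal_mult[symmetric] less_imp_le)
qed

text \<open>Writing $|x|^b$ as a superposition of Gaussians reduces the integral to a Beta integral.\<close>
lemma nn_kernel_gauss:
  assumes a: "a > - 1" and b: "b < 0" and ab: "a + b + real CARD('m) + 1 > 0"
  shows "(\<integral>\<^sup>+x. ennreal (\<bar>snd x\<bar> powr a * norm x powr b * exp (- (norm x)\<^sup>2)) \<partial>(lborel :: 'm::finite space measure)) =
     ennreal (Gamma ((a + 1) / 2) * pi powr (real CARD('m) / 2) * Gamma ((a + b + real CARD('m) + 1) / 2) / Gamma ((a + real CARD('m) + 1) / 2))"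
    (is "?L = _")
proof -
  \<comment> \<open>|x|^b = (|x|^2)^(-c) is the Gamma integral to be inserted, and the Beta integral
    then has the parameters c and e. Positivity of e is the integrability condition at the
    origin.\<close>
  define c where "c = - b / 2"
  define e where "e = (a + b + real CARD('m) + 1) / 2"
  have c: "c > 0" and e: "e > 0" using b ab by (auto simp: c_def e_def)
  have ce: "c + e = (a + real CARD('m) + 1) / 2" by (simp add: c_def e_def field_simps)
  let ?f = "\<lambda>(x :: 'm space) s. ennreal (\<bar>snd x\<bar> powr a * exp (- (1 + s) * (norm x)\<^sup>2)) * ennreal (indicator {0<..} s * s powr (c - 1))"
  have "?L = (\<integral>\<^sup>+x. ennreal (1 / Gamma c) * (\<integral>\<^sup>+s. ?f x s \<partial>lborel) \<partial>(lborel :: 'm space measure))"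
  proof (rule nn_integral_cong_AE, use AE_lborel_singleton[of "0 :: 'm space"] in eventually_elim)
    fix x :: "'m space" assume x: "x \<noteq> 0"
    have "ennreal (\<bar>snd x\<bar> powr a * norm x powr b * exp (- (norm x)\<^sup>2)) =
      ennreal (\<bar>snd x\<bar> powr a * exp (- (norm x)\<^sup>2)) * ennreal (norm x powr b)"
      by (simp add: ennreal_mult[symmetric] ac_simps)
    also have "... = ennreal (1 / Gamma c) * (ennreal (\<bar>snd x\<bar> powr a * exp (- (norm x)\<^sup>2)) * 
        (\<integral>\<^sup>+s. ennreal (indicator {0<..} s * (s powr (c - 1) * exp (- (norm x)\<^sup>2 * s))) \<partial>lborel))"
      using x b by (subst inverse_power_Gamma) (auto simp: c_def ac_simps)
    also have "ennreal (\<bar>snd x\<bar> powr a * exp (- (norm x)\<^sup>2)) * 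
        (\<integral>\<^sup>+s. ennreal (indicator {0<..} s * (s powr (c - 1) * exp (- (norm x)\<^sup>2 * s))) \<partial>lborel) = (\<integral>\<^sup>+s. ?f x s \<partial>lborel)"
      by (subst nn_integral_cmult[symmetric], simp, intro nn_integral_cong)
        (simp add: ennreal_mult[symmetric] algebra_simps flip: exp_add)
    finally show "ennreal (\<bar>snd x\<bar> powr a * norm x powr b * exp (- (norm x)\<^sup>2)) = ennreal (1 / Gamma c) * (\<integral>\<^sup>+s. ?f x s \<partial>lborel)" .
  qed
  also have "... = ennreal (1 / Gamma c) * (\<integral>\<^sup>+x. (\<integral>\<^sup>+s. ?f x s \<partial>lborel) \<partial>(lborel :: 'm space measure))"
    by (rule nn_integral_cmult) measurable
  also have "(\<integral>\<^sup>+x. (\<integral>\<^sup>+s. ?f x s \<partial>lborel) \<partial>(lborel :: 'm space measure)) = (\<integral>\<^sup>+s. (\<integral>\<^sup>+x. ?f x s \<partial>(lborel :: 'm space measure)) \<partial>lborel)"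
    by (rule lborel_pair.Fubini'[symmetric]) measurable
  also have "... = (\<integral>\<^sup>+s. ennreal (Gamma ((a + 1) / 2) * pi powr (real CARD('m) / 2)) * ennreal (indicator {0<..} s * (s powr (c - 1) * (1 + s) powr (- (c + e)))) \<partial>lborel)"
  proof (rule nn_integral_cong)
    fix s :: real
    show "(\<integral>\<^sup>+x. ?f x s \<partial>(lborel :: 'm space measure)) = ennreal (Gamma ((a + 1) / 2) * pi powr (real CARD('m) / 2)) * ennreal (indicator {0<..} s * (s powr (c - 1) * (1 + s) powr (- (c + e))))"
    proof (cases "s > 0")
      case True
      have ex: "- (a + 1 + real CARD('m)) / 2 = - (c + e)" by (simp only: ce half_sum)
      have "(\<integral>\<^sup>+x. ?f x s \<partial>(lborel :: 'm space measure)) = ennreal (Gamma ((a + 1) / 2) * pi powr (real CARD('m) / 2) * (1 + s) powr (- (c + e))) * ennreal (s powr (c - 1))"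
      proof -
        have "1 + s > 0" using True by simp
        from nn_gauss_space[OF a this, where 'm = 'm] show ?thesis
          using True by (subst nn_integral_multc) (simp_all only: ex, auto)
      qed
      then show ?thesis using True a by (simp add: ennreal_mult[symmetric] Gamma_real_pos less_imp_le ac_simps)
    qed simp
  qed
  also have "... = ennreal (Gamma ((a + 1) / 2) * pi powr (real CARD('m) / 2)) * ennreal (Gamma c * Gamma e / Gamma (c + e))"
    by (subst nn_integral_cmult) (simp_all only: nn_Beta_half_line[OF c e], auto)
  also have "ennreal (1 / Gamma c) * ... = ennreal (1 / Gamma c * (Gamma ((a + 1) / 2) * pi powr (real CARD('m) / 2) * (Gamma c * Gamma e / Gamma (c + e))))"
    using a c e by (simp add: ennreal_mult[symmetric] Gamma_real_pos less_imp_le)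
  also have "1 / Gamma c * (Gamma ((a + 1) / 2) * pi powr (real CARD('m) / 2) * (Gamma c * Gamma e / Gamma (c + e)))
     = Gamma ((a + 1) / 2) * pi powr (real CARD('m) / 2) * Gamma e / Gamma (c + e)"
    using Gamma_real_pos[OF c] by simp
  finally show ?thesis unfolding ce unfolding e_def .
qed

text \<open>The same superposition of Gaussians without the factor in x_n; it serves the boundary
  integrals over the hyperplane.\<close>

lemma nn_norm_gauss_finite:
  assumes b: "- real DIM('a) < b" "b < 0"
  shows "(\<integral>\<^sup>+x. ennreal (norm x powr b * exp (- (norm x)\<^sup>2)) \<partial>(lborel :: 'a::euclidean_space measure)) < \<infinity>"
    (is "?L < _")
proof -
  define c where "c = - b / 2"
  define e where "e = (b + real DIM('a)) / 2"
  have c: "c > 0" and e: "e > 0" using b by (auto simp: c_def e_def)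
  have ce: "c + e = real DIM('a) / 2" by (simp add: c_def e_def field_simps)
  let ?f = "\<lambda>(x :: 'a) s. ennreal (exp (- (1 + s) * (norm x)\<^sup>2)) * ennreal (indicator {0<..} s * s powr (c - 1))"
  have "?L = (\<integral>\<^sup>+x. ennreal (1 / Gamma c) * (\<integral>\<^sup>+s. ?f x s \<partial>lborel) \<partial>(lborel :: 'a measure))"
  proof (rule nn_integral_cong_AE, use AE_lborel_singleton[of "0 :: 'a"] in eventually_elim)
    fix x :: 'a assume x: "x \<noteq> 0"
    have "ennreal (norm x powr b * exp (- (norm x)\<^sup>2)) = ennreal (exp (- (norm x)\<^sup>2)) * ennreal (norm x powr b)"
      by (simp add: ennreal_mult[symmetric] ac_simps)
    also have "... = ennreal (1 / Gamma c) * (ennreal (exp (- (norm x)\<^sup>2)) * 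
        (\<integral>\<^sup>+s. ennreal (indicator {0<..} s * (s powr (c - 1) * exp (- (norm x)\<^sup>2 * s))) \<partial>lborel))"
      using x b by (subst inverse_power_Gamma) (auto simp: c_def ac_simps)
    also have "ennreal (exp (- (norm x)\<^sup>2)) * 
        (\<integral>\<^sup>+s. ennreal (indicator {0<..} s * (s powr (c - 1) * exp (- (norm x)\<^sup>2 * s))) \<partial>lborel) = (\<integral>\<^sup>+s. ?f x s \<partial>lborel)"
      by (subst nn_integral_cmult[symmetric], simp, intro nn_integral_cong)
        (simp add: ennreal_mult[symmetric] algebra_simps flip: exp_add)
    finally show "ennreal (norm x powr b * exp (- (norm x)\<^sup>2)) = ennreal (1 / Gamma c) * (\<integral>\<^sup>+s. ?f x s \<partial>lborel)" .
  qed
  also have "... = ennreal (1 / Gamma c) * (\<integral>\<^sup>+x. (\<integral>\<^sup>+s. ?f x s \<partial>lborel) \<partial>(lborel :: 'a measure))"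
    by (rule nn_integral_cmult) measurable
  also have "(\<integral>\<^sup>+x. (\<integral>\<^sup>+s. ?f x s \<partial>lborel) \<partial>(lborel :: 'a measure)) = (\<integral>\<^sup>+s. (\<integral>\<^sup>+x. ?f x s \<partial>(lborel :: 'a measure)) \<partial>lborel)"
    by (rule lborel_pair.Fubini'[symmetric]) measurable
  also have "... = (\<integral>\<^sup>+s. ennreal (pi powr (c + e)) * ennreal (indicator {0<..} s * (s powr (c - 1) * (1 + s) powr (- (c + e)))) \<partial>lborel)"
  proof (rule nn_integral_cong)
    fix s :: real
    show "(\<integral>\<^sup>+x. ?f x s \<partial>(lborel :: 'a measure)) = ennreal (pi powr (c + e)) * ennreal (indicator {0<..} s * (s powr (c - 1) * (1 + s) powr (- (c + e))))"
    proof (cases "s > 0")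
      case True
      have "(\<integral>\<^sup>+x. ?f x s \<partial>(lborel :: 'a measure)) = ennreal ((pi / (1 + s)) powr (c + e)) * ennreal (s powr (c - 1))"
      proof -
        have "1 + s > 0" using True by simp
        from nn_gauss_euclidean[OF this, where 'a = 'a] show ?thesis
          using True by (subst nn_integral_multc) (simp_all only: ce, auto)
      qed
      then show ?thesis using True unfolding powr_minus_divide by (simp add: ennreal_mult[symmetric] powr_divide)
    qed simp
  qed
  also have "... = ennreal (pi powr (c + e)) * ennreal (Gamma c * Gamma e / Gamma (c + e))"
    by (subst nn_integral_cmult) (simp_all only: nn_Beta_half_line[OF c e], auto)
  also have "ennreal (1 / Gamma c) * ... < \<infinity>" by (simp add: ennreal_mult_less_top)
  finally show ?thesis .
qed

section \<open>Local integrability of the kernel\<close>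

lemma integrable_power_cball:
  fixes a b R :: real
  assumes a: "a > - 1" and ab: "a + b + real CARD('m) + 1 > 0" and R: "R > 0"
  shows "integrable lborel (\<lambda>x :: 'm::finite space. indicator (cball 0 R) x * (\<bar>snd x\<bar> powr a * norm x powr b))"
proof -
  \<comment> \<open>The Gaussian formula requires a negative exponent. Lowering b to b' costs only
    the factor |x|^(b - b') <= R^(b - b') on the ball, and half of -(a + n) with n = CARD + 1 still
    keeps the integral finite.\<close>
  define b' where "b' = min b (- (a + real CARD('m) + 1) / 2)"
  have b': "b' \<le> b" "b' < 0" "a + b' + real CARD('m) + 1 > 0"
    using a ab by (auto simp: b'_def min_def field_simps)
  have fin: "integrable lborel (\<lambda>x :: 'm space. \<bar>snd x\<bar> powr a * norm x powr b' * exp (- (norm x)\<^sup>2))"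
    by (rule integrableI_nonneg) (auto simp: nn_kernel_gauss[OF a b'(2,3)])
  have [measurable]: "cball 0 R \<in> sets (borel :: 'm space measure)" by simp
  show ?thesis
  proof (rule Bochner_Integration.integrable_bound[OF integrable_mult_right[OF fin, of "R powr (b - b') * exp (R\<^sup>2)"]])
    show "AE x in lborel. norm (indicator (cball 0 R) x * (\<bar>snd x\<bar> powr a * norm x powr b))
       \<le> norm (R powr (b - b') * exp (R\<^sup>2) * (\<bar>snd (x :: 'm space)\<bar> powr a * norm x powr b' * exp (- (norm x)\<^sup>2)))"
    proof (rule AE_I2)
      fix x :: "'m space"
      show "norm (indicator (cball 0 R) x * (\<bar>snd x\<bar> powr a * norm x powr b))
       \<le> norm (R powr (b - b') * exp (R\<^sup>2) * (\<bar>snd x\<bar> powr a * norm x powr b' * exp (- (norm x)\<^sup>2)))"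
      proof (cases "x \<in> cball 0 R \<and> x \<noteq> 0")
        case True
        have "norm x powr b = norm x powr (b - b') * norm x powr b'" by (simp flip: powr_add)
        also have "... \<le> R powr (b - b') * norm x powr b'"
          using True b' by (intro mult_right_mono powr_mono2) auto
        finally have 1: "norm x powr b \<le> R powr (b - b') * norm x powr b'" .
        have "(norm x)\<^sup>2 \<le> R\<^sup>2" using True by (intro power_mono) auto
        then have "1 \<le> exp (R\<^sup>2) * exp (- (norm x)\<^sup>2)" by (simp flip: exp_add)
        then have "\<bar>snd x\<bar> powr a * norm x powr b * 1 \<le> \<bar>snd x\<bar> powr a * (R powr (b - b') * norm x powr b') * (exp (R\<^sup>2) * exp (- (norm x)\<^sup>2))"
          using 1 by (intro mult_mono mult_left_mono) auto
        then show ?thesis using True by (simp add: ac_simps)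
      next
        case False
        then have z: "indicator (cball 0 R) x * (\<bar>snd x\<bar> powr a * norm x powr b) = 0" by (auto simp: indicator_def)
        show ?thesis by (simp only: z norm_zero norm_ge_zero)
      qed
    qed
  qed (simp, measurable)
qed

lemma integrable_norm_power_cball:
  fixes b R :: real
  assumes b: "b > - real DIM('a)" and R: "R > 0"
  shows "integrable lborel (\<lambda>x :: 'a::euclidean_space. indicator (cball 0 R) x * norm x powr b)"
proof -
  define b' where "b' = min b (- real DIM('a) / 2)"
  have b': "b' \<le> b" "b' < 0" "b' > - real DIM('a)"
    using b by (auto simp: b'_def min_def field_simps)
  have fin: "integrable lborel (\<lambda>x :: 'a. norm x powr b' * exp (- (norm x)\<^sup>2))"
    by (rule integrableI_nonneg) (use nn_norm_gauss_finite[OF b'(3,2)] in auto)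
  have [measurable]: "cball 0 R \<in> sets (borel :: 'a measure)" by simp
  show ?thesis
  proof (rule Bochner_Integration.integrable_bound[OF integrable_mult_right[OF fin, of "R powr (b - b') * exp (R\<^sup>2)"]])
    show "AE x in lborel. norm (indicator (cball 0 R) x * norm x powr b)
       \<le> norm (R powr (b - b') * exp (R\<^sup>2) * (norm (x :: 'a) powr b' * exp (- (norm x)\<^sup>2)))"
    proof (rule AE_I2)
      fix x :: 'a
      show "norm (indicator (cball 0 R) x * norm x powr b)
       \<le> norm (R powr (b - b') * exp (R\<^sup>2) * (norm x powr b' * exp (- (norm x)\<^sup>2)))"
      proof (cases "x \<in> cball 0 R \<and> x \<noteq> 0")
        case True
        have "norm x powr b = norm x powr (b - b') * norm x powr b'" by (simp flip: powr_add)
        also have "... \<le> R powr (b - b') * norm x powr b'"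
          using True b' by (intro mult_right_mono powr_mono2) auto
        finally have 1: "norm x powr b \<le> R powr (b - b') * norm x powr b'" .
        have "(norm x)\<^sup>2 \<le> R\<^sup>2" using True by (intro power_mono) auto
        then have "1 \<le> exp (R\<^sup>2) * exp (- (norm x)\<^sup>2)" by (simp flip: exp_add)
        then have "norm x powr b * 1 \<le> (R powr (b - b') * norm x powr b') * (exp (R\<^sup>2) * exp (- (norm x)\<^sup>2))"
          using 1 by (intro mult_mono) auto
        then show ?thesis using True by (simp add: ac_simps)
      next
        case False
        then have z: "indicator (cball 0 R) x * norm x powr b = 0" by (auto simp: indicator_def)
        show ?thesis by (simp only: z norm_zero norm_ge_zero)
      qed
    qed
  qed (simp, measurable)
qed

text \<open>$\mathrm{sgn}(x_n)|x_n|^{2a-2}|x|^{-2\mu}$; the logarithms are harmless at $x_n = 0$, where the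
  sign vanishes.\<close>
definition ker :: "complex \<Rightarrow> complex \<Rightarrow> 'm::finite space cfun" where
  "ker a mu x = of_real (sgn (snd x)) *
     exp ((2 * a - 2) * of_real (ln \<bar>snd x\<bar>) - mu * of_real (ln ((norm x)\<^sup>2)))"

lemma ker_measurable [measurable]: "ker a mu \<in> borel_measurable borel"
  unfolding ker_def by measurable

lemma ker_eq_powr:
  "ker a mu x = of_real (sgn (snd x)) * of_real \<bar>snd x\<bar> powr (2 * a - 2) * of_real ((norm x)\<^sup>2) powr (- mu)"
proof (cases "snd x = 0")
  case False
  then have "x \<noteq> 0" by auto
  then have "of_real ((norm x)\<^sup>2) powr (- mu) = exp (- mu * of_real (ln ((norm x)\<^sup>2)))"
    by (simp add: powr_def Ln_of_real del: of_real_power)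
  moreover have "of_real \<bar>snd x\<bar> powr (2 * a - 2) = exp ((2 * a - 2) * of_real (ln \<bar>snd x\<bar>))"
    using False by (simp add: powr_def Ln_of_real)
  ultimately show ?thesis unfolding ker_def by (simp only: mult.assoc exp_add[symmetric]) simp
qed (simp add: ker_def)

lemma norm_space_power2: "(norm (x :: 'm::finite space))\<^sup>2 = (norm (fst x))\<^sup>2 + (snd x)\<^sup>2"
  by (simp add: norm_space)

lemma KA_fun_eq_ker:
  "KA_fun lam nu (x :: 'm::finite space) = ker ((lam + nu + 3/2) / 2) (nu + of_nat CARD('m) / 2) x"
proof -
  have "2 * ((lam + nu + 3/2) / 2) - 2 = lam + nu - 1/2" by (simp add: field_simps)
  moreover have "- (nu + of_nat CARD('m) / 2) = - nu - of_nat CARD('m) / 2" by simp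
  ultimately show ?thesis unfolding KA_fun_def ker_eq_powr norm_space_power2[symmetric] by (simp only:)
qed

lemma norm_ker:
  "norm (ker a mu x) = (if snd x = 0 then 0 else \<bar>snd x\<bar> powr (2 * Re a - 2) * norm x powr (- 2 * Re mu))"
proof (cases "snd x = 0")
  case False
  then have "x \<noteq> 0" by auto
  have "norm (ker a mu x) = exp ((2 * Re a - 2) * ln \<bar>snd x\<bar> - Re mu * ln ((norm x)\<^sup>2))"
    using False by (simp add: ker_def norm_mult)
  also have "... = \<bar>snd x\<bar> powr (2 * Re a - 2) * norm x powr (- 2 * Re mu)"
    using False \<open>x \<noteq> 0\<close> by (simp add: powr_def ln_realpow flip: exp_add)
  finally show ?thesis using False by simp
qed (simp add: ker_def)

lemma norm_ker_le: "norm (ker a mu x) \<le> \<bar>snd x\<bar> powr (2 * Re a - 2) * norm x powr (- 2 * Re mu)"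
  by (simp add: norm_ker)

text \<open>A zero of order q of \<open>f\<close> at the origin relaxes the integrability condition
  there by q. The bound is C times a number independent of \<open>f\<close>, as continuity of the
  distributions requires.\<close>

lemma ker_integral_bound:
  fixes R :: real
  assumes a: "Re a > 1/2" and ab: "2 * Re a - 2 * Re mu + real q + real CARD('m) > 1" and R: "R > 0"
  defines "M \<equiv> \<integral>x. indicator (cball 0 R) x * (\<bar>snd x\<bar> powr (2 * Re a - 2) * norm x powr (- 2 * Re mu + real q)) \<partial>(lborel :: 'm::finite space measure)"
  assumes [measurable]: "f \<in> borel_measurable borel"
    and f: "\<And>x. R < norm x \<Longrightarrow> f x = 0" "\<And>x. norm (f x) \<le> C * norm x ^ q"
  shows "integrable lborel (\<lambda>x :: 'm space. ker a mu x * f x)"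
    and "norm (\<integral>x. ker a mu x * f x \<partial>lborel) \<le> C * M"
proof -
  let ?g = "\<lambda>x :: 'm space. indicator (cball 0 R) x * (\<bar>snd x\<bar> powr (2 * Re a - 2) * norm x powr (- 2 * Re mu + real q))"
  have gi: "integrable lborel ?g"
    using a ab R by (intro integrable_power_cball) auto
  have C0: "0 \<le> C"
  proof -
    have "norm (e_n :: 'm space) = 1" by (rule norm_Basis[OF e_n_Basis])
    then have "norm (f e_n) \<le> C" using f(2)[of e_n] by (simp only: power_one mult_1_right)
    then show ?thesis using norm_ge_zero order_trans by blast
  qed
  have le: "norm (ker a mu x * f x) \<le> C * ?g x" for x
  proof (cases "norm x \<le> R \<and> x \<noteq> 0")
    case True
    have "norm (ker a mu x * f x) \<le> (\<bar>snd x\<bar> powr (2 * Re a - 2) * norm x powr (- 2 * Re mu)) * (C * norm x ^ q)"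
      unfolding norm_mult by (intro mult_mono norm_ker_le f(2)) auto
    also have "norm x ^ q = norm x powr real q" using True by (simp add: powr_realpow)
    finally have 1: "norm (ker a mu x * f x) \<le> (\<bar>snd x\<bar> powr (2 * Re a - 2) * norm x powr (- 2 * Re mu)) * (C * norm x powr real q)" .
    have "?g x = \<bar>snd x\<bar> powr (2 * Re a - 2) * (norm x powr (- 2 * Re mu) * norm x powr real q)"
      using True by (simp flip: powr_add)
    with 1 show ?thesis by (simp only: ac_simps)
  next
    case False
    then have z: "ker a mu x * f x = 0" using f(1)[of x] by (auto simp: ker_def not_le)
    have "0 \<le> C * ?g x" using C0 by (intro mult_nonneg_nonneg) auto
    then show ?thesis by (simp only: z norm_zero)
  qed
  show i: "integrable lborel (\<lambda>x :: 'm space. ker a mu x * f x)"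
  proof (rule Bochner_Integration.integrable_bound[OF integrable_mult_right[OF gi, of C]])
    show "AE x in lborel. norm (ker a mu x * f x) \<le> norm (C * ?g x)"
      by (intro AE_I2, simp only: real_norm_def, rule order_trans[OF le abs_ge_self])
  qed measurable
  have "norm (\<integral>x. ker a mu x * f x \<partial>lborel) \<le> (\<integral>x. norm (ker a mu x * f x) \<partial>lborel)"
    by (rule integral_norm_bound)
  also have "... \<le> (\<integral>x. C * ?g x \<partial>lborel)"
    using i gi by (intro integral_mono le) auto
  finally show "norm (\<integral>x. ker a mu x * f x \<partial>lborel) \<le> C * M" by (simp add: M_def)
qed

lemma smooth_measurable [measurable (raw)]: "smooth f \<Longrightarrow> f \<in> borel_measurable borel"
  by (intro borel_measurable_continuous_onI smooth_continuous)

lemma ker_testR_integrable: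
  assumes "Re a > 1/2" "2 * Re a - 2 * Re mu + real CARD('m) > 1" "f \<in> testR R"
  shows "integrable lborel (\<lambda>x :: 'm::finite space. ker a mu x * f x)"
proof -
  obtain B where B: "cbound 0 B f" using ex_cbound[OF assms(3)] by blast
  show ?thesis
  proof (rule ker_integral_bound(1)[of a mu 0 "max R 1" f B])
    show "norm (f x) \<le> B * norm x ^ 0" for x using cboundD[OF B, of "[]" x] by simp
    show "f \<in> borel_measurable borel" using smooth_measurable testR_smooth assms(3) by blast
  qed (use assms testR_zero in auto)
qed

text \<open>With mu = a - b + c the exponent of the kernel is linear in (a, b), so the kernel
  integral is a two-parameter Laplace integral with frequencies 2 ln |x_n| - ln |x|^2 and ln
  |x|^2.\<close>

lemma ker_laplace:
  "ker a (a - b + c) x = (of_real (sgn (snd x)) * exp (- 2 * of_real (ln \<bar>snd x\<bar>) - c * of_real (ln ((norm x)\<^sup>2)))) *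
     exp (a * of_real (2 * ln \<bar>snd x\<bar> - ln ((norm x)\<^sup>2)) + b * of_real (ln ((norm x)\<^sup>2)))"
  unfolding ker_def mult.assoc exp_add[symmetric] by (simp add: algebra_simps)

lemma ker_integral_holo2:
  fixes f :: "'m::finite space cfun"
  assumes [measurable]: "f \<in> borel_measurable borel" and U: "open U"
    and int: "\<And>p. p \<in> U \<Longrightarrow> integrable lborel (\<lambda>x. ker (fst p) (fst p - snd p + c) x * f x)"
  shows "holo2_on (\<lambda>p. \<integral>x. ker (fst p) (fst p - snd p + c) x * f x \<partial>lborel) U"
proof -
  let ?g = "\<lambda>x :: 'm space. (of_real (sgn (snd x)) * exp (- 2 * of_real (ln \<bar>snd x\<bar>) - c * of_real (ln ((norm x)\<^sup>2)))) * f x"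
  have eq: "ker (fst p) (fst p - snd p + c) x * f x = ?g x * exp (fst p * of_real (2 * ln \<bar>snd x\<bar> - ln ((norm x)\<^sup>2)) + snd p * of_real (ln ((norm x)\<^sup>2)))"
    for p and x :: "'m space" unfolding ker_laplace by (simp only: ac_simps)
  show ?thesis unfolding eq
    by (rule laplace_integral_holo2[OF _ _ _ U]) (use int in \<open>simp_all only: eq[symmetric]\<close>, measurable)
qed

section \<open>Identities from integration by parts\<close>

lemma continuous_compact_support_integrable:
  fixes f :: "'a::euclidean_space cfun"
  assumes "continuous_on UNIV f" "\<And>x. R < norm x \<Longrightarrow> f x = 0"
  shows "integrable lborel f"
proof -
  have "integrable lborel (\<lambda>x. indicator (cball 0 R) x *\<^sub>R f x)"
    by (intro borel_integrable_compact continuous_on_subset[OF assms(1)]) auto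
  moreover have "indicator (cball 0 R) x *\<^sub>R f x = f x" for x
    using assms(2)[of x] by (auto simp: indicator_def not_le)
  ultimately show ?thesis by simp
qed

lemma integral_translate:
  fixes f :: "'a::euclidean_space cfun"
  assumes "f \<in> borel_measurable borel"
  shows "(\<integral>x. f (c + x) \<partial>lborel) = (\<integral>x. f x \<partial>lborel)"
proof -
  have "(\<integral>x. f x \<partial>lborel) = (\<integral>x. f x \<partial>distr lborel borel ((+) c))" by (simp add: lborel_distr_plus)
  also have "... = (\<integral>x. f (c + x) \<partial>lborel)" using assms by (intro integral_distr) auto
  finally show ?thesis by simp
qed

text \<open>$\int_0^1\int \partial_b F(x + s b)\,dx\,ds = \int (F(x + b) - F(x))\,dx = 0$.\<close>
lemma integral_pderiv_zero:
  fixes F :: "'a::euclidean_space cfun"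
  assumes d: "\<And>x. F differentiable (at x)" and c: "continuous_on UNIV (pderiv_along b F)"
    and z: "\<And>x. R < norm x \<Longrightarrow> F x = 0"
  shows "(\<integral>x. pderiv_along b F x \<partial>lborel) = 0"
proof -
  let ?f = "pderiv_along b F"
  have Fc: "continuous_on UNIV F"
    by (meson continuous_at_imp_continuous_on d differentiable_imp_continuous_within)
  note Fm = borel_measurable_continuous_onI[OF Fc] and fm = borel_measurable_continuous_onI[OF c]
  have fz: "?f x = 0" if "R < norm x" for x
  proof -
    have "?f x = pderiv_along b (\<lambda>x. 0) x"
      using z that by (intro pderiv_along_cong[of "{x. R < norm x}"]) (auto intro!: open_Collect_less continuous_intros)
    then show ?thesis by simp
  qed
  let ?h = "\<lambda>s x. indicator {0..1} s *\<^sub>R ?f (x + s *\<^sub>R b)"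
  \<comment> \<open>For s in [0,1] the translated derivative vanishes outside the ball of radius R +
    |b|, so the double integral has a compactly supported integrand and Fubini applies.\<close>
  have hint: "integrable (lborel \<Otimes>\<^sub>M lborel) (case_prod ?h)"
  proof -
    have "integrable lborel (\<lambda>p. indicator ({0..1::real} \<times> cball 0 (R + norm b)) p *\<^sub>R ?f (snd p + fst p *\<^sub>R b))"
      by (intro borel_integrable_compact compact_Times continuous_on_compose2[OF c])
        (auto intro!: continuous_intros)
    moreover have "indicator ({0..1::real} \<times> cball 0 (R + norm b)) p *\<^sub>R ?f (snd p + fst p *\<^sub>R b) = case_prod ?h p" for p
    proof (cases "fst p \<in> {0..1} \<and> R + norm b < norm (snd p)")
      case True
      have "norm (fst p *\<^sub>R b) \<le> 1 * norm b" unfolding norm_scaleR using True by (intro mult_right_mono) auto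
      then have "R < norm (snd p + fst p *\<^sub>R b)"
        using True norm_diff_ineq[of "snd p" "fst p *\<^sub>R b"] by linarith
      then show ?thesis by (simp add: fz case_prod_beta)
    next
      case False then show ?thesis by (auto simp: case_prod_beta indicator_def mem_Times_iff)
    qed
    ultimately show ?thesis by (simp add: lborel_prod)
  qed
  have "(\<integral>x. ?f x \<partial>lborel) = (\<integral>s. indicator {0..1::real} s *\<^sub>R (\<integral>x. ?f x \<partial>lborel) \<partial>lborel)"
    by (simp add: Bochner_Integration.integral_scaleR_left)
  also have "... = (\<integral>s. (\<integral>x. ?h s x \<partial>lborel) \<partial>lborel)"
  proof (intro Bochner_Integration.integral_cong refl)
    fix s :: real
    have "(\<integral>x. ?f (x + s *\<^sub>R b) \<partial>lborel) = (\<integral>x. ?f x \<partial>lborel)"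
      using integral_translate[OF fm, of "s *\<^sub>R b"] by (simp add: add.commute)
    then show "indicator {0..1} s *\<^sub>R (\<integral>x. ?f x \<partial>lborel) = (\<integral>x. ?h s x \<partial>lborel)" by simp
  qed
  also have "... = (\<integral>x. (\<integral>s. ?h s x \<partial>lborel) \<partial>lborel)"
    by (rule lborel_pair.Fubini_integral[OF hint, symmetric])
  also have "... = (\<integral>x. F (x + b) - F x \<partial>lborel)"
  proof (intro Bochner_Integration.integral_cong refl)
    fix x
    have "(\<integral>s. indicator {0..1::real} s *\<^sub>R ?f (x + s *\<^sub>R b) \<partial>lborel) = F (x + 1 *\<^sub>R b) - F (x + 0 *\<^sub>R b)"
    proof (rule integral_FTC_atLeastAtMost)
      fix t :: real
      have 1: "((\<lambda>t. x + t *\<^sub>R b) has_derivative (\<lambda>s. s *\<^sub>R b)) (at t within {0..1})"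
        by (auto intro!: derivative_eq_intros)
      note D = pderiv_along_works[OF d, of "x + t *\<^sub>R b"]
      have lin: "linear (\<lambda>v. pderiv_along v F (x + t *\<^sub>R b))" using has_derivative_linear[OF D] .
      have "((\<lambda>t. F (x + t *\<^sub>R b)) has_derivative (\<lambda>s. pderiv_along (s *\<^sub>R b) F (x + t *\<^sub>R b))) (at t within {0..1})"
        using has_derivative_compose[OF 1 D] by simp
      then show "((\<lambda>t. F (x + t *\<^sub>R b)) has_vector_derivative ?f (x + t *\<^sub>R b)) (at t within {0..1})"
        unfolding has_vector_derivative_def by (simp only: linear_scale[OF lin])
    qed (auto intro!: continuous_on_compose2[OF c] continuous_intros)
    then show "(\<integral>s. ?h s x \<partial>lborel) = F (x + b) - F x" by simp
  qed
  also have "... = (\<integral>x. F (x + b) \<partial>lborel) - (\<integral>x. F x \<partial>lborel)"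
  proof (rule Bochner_Integration.integral_diff)
    show "integrable lborel F" using z by (rule continuous_compact_support_integrable[OF Fc])
    show "integrable lborel (\<lambda>x. F (x + b))"
    proof (rule continuous_compact_support_integrable[of _ "R + norm b"])
      show "continuous_on UNIV (\<lambda>x. F (x + b))" by (rule continuous_on_compose2[OF Fc]) (auto intro!: continuous_intros)
      show "F (x + b) = 0" if "R + norm b < norm x" for x
        using that norm_diff_ineq[of x b] by (intro z) linarith
    qed
  qed
  also have "(\<integral>x. F (x + b) \<partial>lborel) = (\<integral>x. F x \<partial>lborel)"
    using integral_translate[OF Fm, of b] by (simp add: add.commute)
  finally show ?thesis by simp
qed

section \<open>Complex powers on the real axis\<close>

definition cpw :: "complex \<Rightarrow> real \<Rightarrow> complex" where "cpw c t = of_real \<bar>t\<bar> powr c"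
text \<open>The even power |t|^c (\<open>cpw\<close>) and the odd power sgn(t) |t|^c are exchanged
  by differentiation, up to the factor c and with c lowered by 1. Both take the value 0 at t =
  0.\<close>

definition cps :: "complex \<Rightarrow> real \<Rightarrow> complex" where "cps c t = of_real (sgn t) * of_real \<bar>t\<bar> powr c"

lemma cpw_cps_0 [simp]: "cpw c 0 = 0" "cps c 0 = 0"
  by (simp_all add: cpw_def cps_def)

lemma cps_nonneg: "t \<ge> 0 \<Longrightarrow> cps c t = cpw c t"
  by (cases "t = 0") (simp_all add: cpw_def cps_def)

lemma powr_minus_one_mult: "z \<noteq> 0 \<Longrightarrow> z * z powr (c - 1) = z powr (c :: complex)"
  by (simp add: powr_diff)

lemma mult_cpw: "of_real t * cps (c - 1) t = cpw c t" "of_real t * cpw (c - 1) t = cps c t"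
proof -
  have ch: "(s * r) * (s * p) = r * p" "(s * r) * p = s * (r * p)" if "s * s = 1" for s r p :: complex
  proof -
    have "(s * r) * (s * p) = (s * s) * (r * p)" by (simp only: ac_simps)
    then show "(s * r) * (s * p) = r * p" by (simp add: that)
  qed (rule mult.assoc)
  have t: "of_real t = of_real (sgn t) * complex_of_real \<bar>t\<bar>" by (simp add: sgn_if abs_if)
  have "of_real t * cps (c - 1) t = cpw c t \<and> of_real t * cpw (c - 1) t = cps c t" if "t \<noteq> 0"
  proof -
    have "of_real (sgn t) * of_real (sgn t) = (1 :: complex)" using that by (simp add: sgn_if)
    note ch = ch[OF this]
    have p: "of_real \<bar>t\<bar> * of_real \<bar>t\<bar> powr (c - 1) = complex_of_real \<bar>t\<bar> powr c"
      using that by (intro powr_minus_one_mult) simp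
    have A: "of_real t * (of_real (sgn t) * q) = of_real \<bar>t\<bar> * q" for q :: complex by (subst t) (rule ch(1))
    have B: "of_real t * q = of_real (sgn t) * (of_real \<bar>t\<bar> * q)" for q :: complex by (subst t) (rule ch(2))
    show ?thesis unfolding cpw_def cps_def by (rule conjI, simp only: A p, simp only: B p)
  qed
  then show "of_real t * cps (c - 1) t = cpw c t" "of_real t * cpw (c - 1) t = cps c t"
    by (cases "t = 0"; simp)+
qed

lemma norm_cpw: "norm (cpw c t) = \<bar>t\<bar> powr Re c" "norm (cps c t) = \<bar>t\<bar> powr Re c"
proof -
  show 1: "norm (cpw c t) = \<bar>t\<bar> powr Re c" using norm_powr_real_powr[of "of_real \<bar>t\<bar>" c] by (simp add: cpw_def)
  show "norm (cps c t) = \<bar>t\<bar> powr Re c"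
  proof (cases "t = 0")
    case False
    then show ?thesis using 1 by (simp add: cps_def cpw_def norm_mult sgn_if)
  qed simp
qed

lemma cpw_deriv_nonzero:
  assumes "t \<noteq> 0"
  shows "(cpw c has_vector_derivative c * cps (c - 1) t) (at t)"
    and "(cps c has_vector_derivative c * cpw (c - 1) t) (at t)"
proof -
  have "(cpw c has_vector_derivative c * cps (c - 1) t) (at t) \<and> (cps c has_vector_derivative c * cpw (c - 1) t) (at t)"
  proof (cases "t > 0")
    case True
    have "((\<lambda>z. z powr c) has_field_derivative c * of_real t powr (c - 1)) (at (of_real t))"
      using True by (intro has_field_derivative_powr) (auto simp: complex_nonpos_Reals_iff)
    from has_vector_derivative_real_field[OF this]
    have "((\<lambda>x. of_real x powr c) has_vector_derivative c * of_real t powr (c - 1)) (at t within {0<..})" .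
    then have "((\<lambda>x. of_real x powr c) has_vector_derivative c * of_real t powr (c - 1)) (at t)"
      using True by (simp add: at_within_open[of _ "{0<..}"])
    then show ?thesis
      using True by (auto intro!: has_vector_derivative_transform_within_open[of "\<lambda>x. of_real x powr c" _ t "{0<..}"] simp: cpw_def cps_def)
  next
    case False
    then have t: "t < 0" using assms by simp
    have "((\<lambda>z. (- z) powr c) has_field_derivative - (c * of_real (- t) powr (c - 1))) (at (of_real t))"
      using t by (auto intro!: derivative_eq_intros simp: complex_nonpos_Reals_iff)
    from has_vector_derivative_real_field[OF this]
    have "((\<lambda>x. (- of_real x) powr c) has_vector_derivative - (c * of_real (- t) powr (c - 1))) (at t within {..<0})" .
    then have 1: "((\<lambda>x. (- of_real x) powr c) has_vector_derivative - (c * of_real (- t) powr (c - 1))) (at t)"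
      using t by (simp add: at_within_open[of _ "{..<0}"])
    have 2: "((\<lambda>x. - ((- of_real x) powr c)) has_vector_derivative c * of_real (- t) powr (c - 1)) (at t)"
      using has_vector_derivative_minus[OF 1] by simp
    show ?thesis
      using t has_vector_derivative_transform_within_open[OF 1, of "{..<0}" "cpw c"]
        has_vector_derivative_transform_within_open[OF 2, of "{..<0}" "cps c"] by (auto simp: cpw_def cps_def)
  qed
  then show "(cpw c has_vector_derivative c * cps (c - 1) t) (at t)"
    and "(cps c has_vector_derivative c * cpw (c - 1) t) (at t)" by auto
qed

lemma tendsto_abs_powr_0: "r > 0 \<Longrightarrow> ((\<lambda>t::real. \<bar>t\<bar> powr r) \<longlongrightarrow> 0) (at 0)"
  by (rule tendsto_eq_intros refl | simp)+ 

text \<open>At t = 0 the difference quotient has modulus |t|^(Re c - 1), which tends to 0 since Re c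
  > 1.\<close>

lemma cpw_has_vector_derivative:
  assumes "Re c > 1"
  shows "(cpw c has_vector_derivative c * cps (c - 1) t) (at t)"
    and "(cps c has_vector_derivative c * cpw (c - 1) t) (at t)"
proof -
  have 0: "(f has_vector_derivative 0) (at 0)" if "f 0 = 0" "\<And>t. norm (f t) = \<bar>t\<bar> powr Re c" for f :: "real \<Rightarrow> complex"
    unfolding has_vector_derivative_def has_derivative_at
  proof
    show "bounded_linear (\<lambda>x::real. x *\<^sub>R (0::complex))" by simp
    have "((\<lambda>h::real. \<bar>h\<bar> powr (Re c - 1)) \<longlongrightarrow> 0) (at 0)" using assms by (intro tendsto_abs_powr_0) simp
    moreover have "eventually (\<lambda>h. \<bar>h\<bar> powr (Re c - 1) = norm (f (0 + h) - f 0 - h *\<^sub>R 0) / norm h) (at 0)"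
      by (auto simp: that powr_diff eventually_at intro!: exI[of _ 1])
    ultimately show "(\<lambda>h. norm (f (0 + h) - f 0 - h *\<^sub>R 0) / norm h) \<midarrow>0\<rightarrow> 0"
      by (rule Lim_transform_eventually)
  qed
  show "(cpw c has_vector_derivative c * cps (c - 1) t) (at t)"
    using cpw_deriv_nonzero(1)[of t c] 0[of "cpw c"] by (cases "t = 0") (auto simp: norm_cpw)
  show "(cps c has_vector_derivative c * cpw (c - 1) t) (at t)"
    using cpw_deriv_nonzero(2)[of t c] 0[of "cps c"] by (cases "t = 0") (auto simp: norm_cpw)
qed

lemma continuous_cpw:
  assumes "Re c > 0"
  shows "continuous_on UNIV (cpw c)" "continuous_on UNIV (cps c)"
proof -
  have 0: "isCont f 0" if "f 0 = 0" "\<And>t. norm (f t) = \<bar>t\<bar> powr Re c" for f :: "real \<Rightarrow> complex"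
  proof -
    have "((\<lambda>t. norm (f t)) \<longlongrightarrow> 0) (at 0)" unfolding that(2) using assms by (rule tendsto_abs_powr_0)
    then show ?thesis unfolding isCont_def that(1) by (rule tendsto_norm_zero_cancel)
  qed
  have "isCont (cpw c) t" "isCont (cps c) t" for t
    using 0[of "cpw c"] 0[of "cps c"] cpw_deriv_nonzero[of t c]
    by (cases "t = 0"; auto simp: norm_cpw intro: has_vector_derivative_continuous)+
  then show "continuous_on UNIV (cpw c)" "continuous_on UNIV (cps c)"
    by (simp_all add: continuous_at_imp_continuous_on)
qed

lemma ker_cps: "ker a mu x = cps (2 * a - 2) (snd x) * cpw (- mu) ((norm x)\<^sup>2)"
  unfolding ker_eq_powr cps_def cpw_def by simp

lemma ker_continuous: "Re a > 1 \<Longrightarrow> Re mu < 0 \<Longrightarrow> continuous_on UNIV (ker a mu)"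
  unfolding ker_cps
  by (intro continuous_intros continuous_on_compose2[OF continuous_cpw(1)] continuous_on_compose2[OF continuous_cpw(2)]) auto

lemma ker_shift_xn: "of_real ((snd x)\<^sup>2) * ker (a - 1) mu x = ker a mu x"
proof -
  have "of_real ((snd x)\<^sup>2) * cps (2 * (a - 1) - 2) (snd x) = of_real (snd x) * (of_real (snd x) * cps ((2 * a - 2) - 1 - 1) (snd x))"
    by (simp add: power2_eq_square algebra_simps)
  also have "... = cps (2 * a - 2) (snd x)" by (simp only: mult_cpw)
  finally show ?thesis unfolding ker_cps by (simp only: mult.assoc[symmetric])
qed

lemma ker_shift_norm: "of_real ((norm x)\<^sup>2) * ker a (mu + 1) x = ker a mu x"
proof -
  have "of_real ((norm x)\<^sup>2) * cpw (- mu - 1) ((norm x)\<^sup>2) = cpw (- mu) ((norm x)\<^sup>2)"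
    unfolding mult_cpw by (simp add: cps_nonneg)
  then show ?thesis unfolding ker_cps by (simp add: mult.left_commute)
qed

text \<open>The bounds give both exponents, 2a - 2 for x_n and -mu for |x|^2, a real part above 1.
  The kernel is then differentiable across x_n = 0 and at the origin, which frees integration by
  parts from boundary terms.\<close>

lemma ker_has_derivative:
  assumes "Re a > 3/2" "Re mu < - 1"
  shows "(ker a mu has_derivative (\<lambda>h. (2 * a - 2) * of_real (snd h) * of_real (snd x) * ker (a - 1) mu x
     - 2 * mu * of_real (x \<bullet> h) * ker a (mu + 1) x)) (at x)"
proof -
  have 1: "((\<lambda>x. cps (2 * a - 2) (snd x)) has_derivative (\<lambda>h. snd h *\<^sub>R ((2 * a - 2) * cpw (2 * a - 3) (snd x)))) (at x)"
    using has_derivative_compose[OF has_derivative_snd[OF has_derivative_ident] cpw_has_vector_derivative(2)[of "2 * a - 2", unfolded has_vector_derivative_def, of "snd x"]]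
      assms by (simp add: algebra_simps)
  have n: "((\<lambda>x. (norm x)\<^sup>2) has_derivative (\<lambda>h. 2 * (x \<bullet> h))) (at x)"
    unfolding power2_norm_eq_inner by (auto intro!: derivative_eq_intros simp: inner_commute)
  have 2: "((\<lambda>x. cpw (- mu) ((norm x)\<^sup>2)) has_derivative (\<lambda>h. (2 * (x \<bullet> h)) *\<^sub>R (- mu * cpw (- mu - 1) ((norm x)\<^sup>2)))) (at x)"
    using has_derivative_compose[OF n cpw_has_vector_derivative(1)[of "- mu", unfolded has_vector_derivative_def]] assms
    by (simp add: cps_nonneg)
  have e: "cpw (2 * a - 3) (snd x) = of_real (snd x) * cps (2 * (a - 1) - 2) (snd x)"
    using mult_cpw(1)[of "snd x" "2 * a - 3"] by (simp add: algebra_simps)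
  have m: "- (mu + 1) = - mu - 1" by simp
  have k1: "of_real (snd x) * ker (a - 1) mu x = cpw (2 * a - 3) (snd x) * cpw (- mu) ((norm x)\<^sup>2)"
    unfolding ker_cps e by (simp only: mult.assoc)
  have k2: "ker a (mu + 1) x = cps (2 * a - 2) (snd x) * cpw (- mu - 1) ((norm x)\<^sup>2)"
    unfolding ker_cps m ..
  have eq: "ker a mu = (\<lambda>x. cps (2 * a - 2) (snd x) * cpw (- mu) ((norm x)\<^sup>2))"
    by (rule ext) (rule ker_cps)
  have "((\<lambda>x. cps (2 * a - 2) (snd x) * cpw (- mu) ((norm x)\<^sup>2)) has_derivative
     (\<lambda>h. (2 * a - 2) * of_real (snd h) * (of_real (snd x) * ker (a - 1) mu x) - 2 * mu * of_real (x \<bullet> h) * ker a (mu + 1) x)) (at x)"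
    unfolding k1 k2
    by (rule has_derivative_eq_rhs[OF has_derivative_mult[OF 1 2]])
      (simp add: fun_eq_iff scaleR_conv_of_real algebra_simps)
  then show ?thesis unfolding eq[symmetric] by (simp only: mult.assoc)
qed

section \<open>The kernel integral and its identities under differentiation\<close>

definition II :: "complex \<Rightarrow> complex \<Rightarrow> 'm::finite space cfun \<Rightarrow> complex" where
  "II a mu f = (\<integral>x. ker a mu x * f x \<partial>lborel)"

text \<open>Absolute convergence against every test function: the exponent 2 Re a - 2 of |x_n|
  exceeds -1, and the degree of homogeneity 2a - 2 - 2mu exceeds -n in real part. The type argument
  carries the dimension n - 1.\<close>

definition kcond :: "'m::finite itself \<Rightarrow> complex \<Rightarrow> complex \<Rightarrow> bool" where
  "kcond (_ :: 'm itself) a mu \<longleftrightarrow> Re a > 1/2 \<and> 2 * Re a - 2 * Re mu + real CARD('m) > 1"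

lemma kcond_nice: "Re a > 1/2 \<Longrightarrow> Re mu \<le> 0 \<Longrightarrow> kcond TYPE('m::finite) a mu"
proof -
  assume "Re a > 1/2" "Re mu \<le> 0"
  moreover have "real CARD('m) \<ge> 0" by simp
  ultimately show ?thesis unfolding kcond_def by linarith
qed

lemma II_integrable:
  "kcond TYPE('m::finite) a mu \<Longrightarrow> f \<in> testR R \<Longrightarrow> integrable lborel (\<lambda>x :: 'm space. ker a mu x * f x)"
  unfolding kcond_def by (intro ker_testR_integrable) auto

lemma II_add:
  fixes f :: "'m::finite space cfun"
  assumes "kcond TYPE('m) a mu" "f \<in> testR R" "g \<in> testR R"
  shows "II a mu (\<lambda>x. f x + g x) = II a mu f + II a mu g"
  unfolding II_def using II_integrable[OF assms(1,2)] II_integrable[OF assms(1,3)]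
  by (simp add: distrib_left)

lemma II_cmult: "II a mu (\<lambda>x. c * f x) = c * II a mu f"
  unfolding II_def by (simp add: mult.left_commute)

lemma II_sum:
  fixes f :: "'i \<Rightarrow> 'm::finite space cfun"
  assumes "kcond TYPE('m) a mu" "finite A" "\<And>i. i \<in> A \<Longrightarrow> f i \<in> testR R"
  shows "II a mu (\<lambda>x. \<Sum>i\<in>A. f i x) = (\<Sum>i\<in>A. II a mu (f i))"
  unfolding II_def using II_integrable[OF assms(1,3)]
  by (simp add: sum_distrib_left Bochner_Integration.integral_sum)

lemma II_by_parts:
  fixes f :: "'m::finite space cfun"
  assumes ab: "Re a > 2" "Re mu < - 1" and f: "f \<in> testR R" and b: "b \<in> Basis"
  shows "II a mu (pderiv_along b f) = - (2 * a - 2) * of_real (snd b) * II (a - 1) mu (\<lambda>x. of_real (snd x) * f x)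
     + 2 * mu * II a (mu + 1) (\<lambda>x. of_real (x \<bullet> b) * f x)"
proof -
  let ?F = "\<lambda>x. ker a mu x * f x"
  let ?A = "\<lambda>x. ker (a - 1) mu x * (of_real (snd x) * f x)" and ?B = "\<lambda>x. ker a (mu + 1) x * (of_real (x \<bullet> b) * f x)"
  let ?C = "\<lambda>x. ker a mu x * pderiv_along b f x"
  note D = has_derivative_mult[OF ker_has_derivative pderiv_along_works[OF smooth_differentiable[OF testR_smooth[OF f]]]]
  have eq: "pderiv_along b ?F x = ?C x + (((2 * a - 2) * of_real (snd b)) * ?A x + (- 2 * mu) * ?B x)" for x
    using pderiv_along_eqI[OF D, of a mu b x] ab by (simp add: algebra_simps)
  have sn: "smooth (\<lambda>x :: 'm space. complex_of_real (snd x))" using smooth_coord[of "e_n :: 'm space"] by simp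
  have t: "(\<lambda>x. of_real (snd x) * f x) \<in> testR R" "(\<lambda>x. of_real (x \<bullet> b) * f x) \<in> testR R"
    by (intro testR_mult sn smooth_coord f)+
  have fc: "continuous_on UNIV g" if "g \<in> testR R" for g :: "'m space cfun"
    using smooth_continuous[OF testR_smooth[OF that]] .
  have "(\<integral>x. pderiv_along b ?F x \<partial>lborel) = 0"
  proof (rule integral_pderiv_zero)
    have "3/2 < Re a" using ab by simp
    then show "?F differentiable at x" for x by (rule differentiableI[OF D[OF _ ab(2)]])
    have "continuous_on UNIV ?A" "continuous_on UNIV ?B" "continuous_on UNIV ?C"
      by (rule continuous_on_mult[OF ker_continuous fc[OF t(1)]] continuous_on_mult[OF ker_continuous fc[OF t(2)]]
          continuous_on_mult[OF ker_continuous fc[OF testR_pderiv[OF f b]]]; use ab in simp)+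
    then show "continuous_on UNIV (pderiv_along b ?F)" unfolding eq
      by (intro continuous_on_add continuous_on_mult_left)
    show "?F x = 0" if "R < norm x" for x using testR_zero[OF f that] by simp
  qed
  moreover have "(\<integral>x. pderiv_along b ?F x \<partial>lborel) = (\<integral>x. ?C x \<partial>lborel) + (((2 * a - 2) * of_real (snd b)) * (\<integral>x. ?A x \<partial>lborel) + (- 2 * mu) * (\<integral>x. ?B x \<partial>lborel))"
  proof -
    have "integrable lborel ?A" "integrable lborel ?B" "integrable lborel ?C"
      by (rule II_integrable[OF kcond_nice t(1)] II_integrable[OF kcond_nice t(2)]
          II_integrable[OF kcond_nice testR_pderiv[OF f b]]; use ab in simp)+
    then show ?thesis unfolding eq by simp
  qed
  ultimately show ?thesis unfolding II_def by (simp add: algebra_simps eq_neg_iff_add_eq_0)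
qed

lemma smooth_snd [simp]: "smooth (\<lambda>x :: 'm::finite space. complex_of_real (snd x))"
  using smooth_coord[of "e_n :: 'm space"] by simp

lemma II_ker_xn: "II (a - 1) mu (\<lambda>x. of_real ((snd x)\<^sup>2) * f x) = II a mu f"
  unfolding II_def ker_shift_xn[of _ a mu, symmetric] by (simp only: ac_simps)

lemma II_ker_norm: "II a (mu + 1) (\<lambda>x. of_real ((norm x)\<^sup>2) * f x) = II a mu f"
  unfolding II_def ker_shift_norm[of _ a mu, symmetric] by (simp only: ac_simps)

text \<open>Integration by parts for D_n(x_n f). The derivative of |x|^(-2mu) brings a factor x_n^2,
  which is absorbed by raising a to a + 1.\<close>

lemma II_theta:
  fixes f :: "'m::finite space cfun"
  assumes ab: "Re a > 2" "Re mu < - 1" and f: "f \<in> testR R"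
  shows "II a mu (\<lambda>x. of_real (snd x) * Dn f x - f x) = - 2 * a * II a mu f + 2 * mu * II (a + 1) (mu + 1) f"
proof -
  have t: "(\<lambda>x. of_real (snd x) * f x) \<in> testR R" "(\<lambda>x. of_real (snd x) * Dn f x) \<in> testR R"
    by (intro testR_mult smooth_snd f testR_pderiv e_n_Basis)+
  have d: "Dn (\<lambda>x. of_real (snd x) * f x) = (\<lambda>x. (of_real (snd x) * Dn f x - f x) + 2 * f x)"
  proof
    fix x
    show "Dn (\<lambda>x. of_real (snd x) * f x) x = (of_real (snd x) * Dn f x - f x) + 2 * f x"
      using pderiv_along_coord[of e_n "e_n :: 'm space"]
      by (subst pderiv_along_mult) (auto simp: smooth_differentiable testR_smooth[OF f])
  qed
  have "II a mu (Dn (\<lambda>x. of_real (snd x) * f x)) = II a mu (\<lambda>x. of_real (snd x) * Dn f x - f x) + 2 * II a mu f"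
    unfolding d using ab by (subst II_add[where R = R]) (auto intro!: kcond_nice testR_diff testR_cmult t f simp: II_cmult)
  moreover have "II a mu (Dn (\<lambda>x. of_real (snd x) * f x)) = - (2 * a - 2) * II a mu f + 2 * mu * II (a + 1) (mu + 1) f"
  proof -
    have "II a (mu + 1) (\<lambda>x. of_real (x \<bullet> e_n) * (of_real (snd x) * f x)) = II ((a + 1) - 1) (mu + 1) (\<lambda>x. of_real ((snd x)\<^sup>2) * f x)"
      by (simp add: power2_eq_square mult.assoc)
    then show ?thesis
      using II_by_parts[OF ab t(1) e_n_Basis] II_ker_xn[of a mu f] II_ker_xn[of "a + 1" "mu + 1" f]
      by (simp add: power2_eq_square mult.assoc)
  qed
  ultimately show ?thesis by (simp add: algebra_simps)
qed

text \<open>The kernel is homogeneous of degree d = 2a - 2 - 2mu, and the transpose of E is -E - n;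
  hence E - c acts as the scalar -(d + n + c).\<close>

lemma II_EU:
  fixes f :: "'m::finite space cfun"
  assumes ab: "Re a > 2" "Re mu < - 1" and f: "f \<in> testR R"
  shows "II a mu (EU c f) = - (2 * a - 2 * mu + of_nat CARD('m) - 1 + c) * II a mu f"
proof -
  let ?B = "Basis :: 'm space set"
  have t: "(\<lambda>x. of_real (x \<bullet> b) * f x) \<in> testR R" "(\<lambda>x. of_real (x \<bullet> b) * g x) \<in> testR R" if "g \<in> testR R" for b and g :: "'m space cfun"
    by (intro testR_mult smooth_coord f that)+
  have d: "pderiv_along b (\<lambda>x. of_real (x \<bullet> b) * f x) = (\<lambda>x. of_real (x \<bullet> b) * pderiv_along b f x + f x)" if "b \<in> ?B" for b
    using that by (intro ext, subst pderiv_along_mult)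
      (auto simp: smooth_differentiable testR_smooth[OF f] differentiable_coord pderiv_along_coord)
  have k: "kcond TYPE('m) a mu" "kcond TYPE('m) (a - 1) mu" "kcond TYPE('m) a (mu + 1)"
    using ab by (auto intro!: kcond_nice)
  have e1: "(\<Sum>b\<in>?B. II a mu (pderiv_along b (\<lambda>x. of_real (x \<bullet> b) * f x))) =
      II a mu (\<lambda>x. \<Sum>b\<in>?B. of_real (x \<bullet> b) * pderiv_along b f x) + of_nat DIM('m space) * II a mu f"
    by (simp add: d II_add[OF k(1) t(2)[OF testR_pderiv[OF f]] f] sum.distrib
        II_sum[OF k(1) _ t(2)[OF testR_pderiv[OF f]]] cong: sum.cong)
  have "(\<Sum>b\<in>?B. II a mu (pderiv_along b (\<lambda>x. of_real (x \<bullet> b) * f x))) =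
     (\<Sum>b\<in>?B. - (2 * a - 2) * II (a - 1) mu (\<lambda>x. of_real (snd b) * of_real (snd x) * (of_real (x \<bullet> b) * f x))
       + 2 * mu * II a (mu + 1) (\<lambda>x. of_real (x \<bullet> b) * (of_real (x \<bullet> b) * f x)))"
    by (intro sum.cong refl, subst II_by_parts[OF ab t(1)[OF f]])
      (simp_all add: II_cmult mult.assoc)
  also have "... = - (2 * a - 2) * II (a - 1) mu (\<lambda>x. of_real ((snd x)\<^sup>2) * f x) + 2 * mu * II a (mu + 1) (\<lambda>x. of_real ((norm x)\<^sup>2) * f x)"
  proof -
    have s1: "(\<Sum>b\<in>?B. of_real (snd b) * of_real (snd x) * (of_real (x \<bullet> b) * f x)) = of_real ((snd x)\<^sup>2) * f x" for x
    proof -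
      have "(\<Sum>b\<in>?B. snd b * (x \<bullet> b)) = snd x"
        using euclidean_inner[of x "e_n :: 'm space"] by (simp add: mult.commute inner_commute)
      then have "of_real (\<Sum>b\<in>?B. snd b * (x \<bullet> b)) = complex_of_real (snd x)" by simp
      moreover have "(\<Sum>b\<in>?B. of_real (snd b) * of_real (snd x) * (of_real (x \<bullet> b) * f x)) =
          of_real (\<Sum>b\<in>?B. snd b * (x \<bullet> b)) * (of_real (snd x) * f x)"
        unfolding of_real_sum sum_distrib_right by (intro sum.cong refl) simp
      ultimately show ?thesis by (simp add: power2_eq_square)
    qed
    have s2: "(\<Sum>b\<in>?B. of_real (x \<bullet> b) * (of_real (x \<bullet> b) * f x)) = of_real ((norm x)\<^sup>2) * f x" for x
      unfolding power2_norm_eq_inner euclidean_inner[of x x] by (simp add: sum_distrib_right mult.assoc)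
    have t1: "(\<lambda>x. of_real (snd b) * of_real (snd x) * (of_real (x \<bullet> b) * f x)) \<in> testR R" for b :: "'m space"
      unfolding mult.assoc by (intro testR_cmult testR_mult smooth_snd smooth_coord f)
    show ?thesis unfolding s1[symmetric] s2[symmetric]
      by (simp only: sum.distrib sum_distrib_left[symmetric] II_sum[OF k(2) finite_Basis t1] II_sum[OF k(3) finite_Basis t(2)[OF t(1)[OF f]]])
  qed
  finally have e2: "(\<Sum>b\<in>?B. II a mu (pderiv_along b (\<lambda>x. of_real (x \<bullet> b) * f x))) =
     - (2 * a - 2) * II a mu f + 2 * mu * II a mu f" unfolding II_ker_xn II_ker_norm .
  have E: "II a mu (\<lambda>x. \<Sum>b\<in>?B. of_real (x \<bullet> b) * pderiv_along b f x) = (2 * mu - (2 * a - 2) - of_nat DIM('m space)) * II a mu f"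
    using e1[unfolded e2] by (simp add: algebra_simps)
  have "II a mu (EU c f) = II a mu (\<lambda>x. \<Sum>b\<in>?B. of_real (x \<bullet> b) * pderiv_along b f x) + (- c) * II a mu f"
    unfolding EU_def II_cmult[symmetric]
    by (intro II_add[OF k(1), where R = R] testR_sum testR_mult smooth_coord testR_pderiv testR_cmult f) auto
  then show ?thesis unfolding E by (simp add: algebra_simps)
qed

text \<open>The Laplacian with a Bessel type term in x_n. The coefficient 2a - 3 is the one for
  which the terms where derivatives fall on |x_n|^(2a-2) cancel, so that the transpose only changes
  the power of |x|.\<close>

definition Lop :: "complex \<Rightarrow> 'm::finite space cfun \<Rightarrow> 'm space cfun" where
  "Lop a f x = (\<Sum>b\<in>Basis. pderiv_along b (pderiv_along b f) x) + (2 * a - 3) * Qop f x"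

lemma Lop_odd_test:
  fixes f :: "'m::finite space cfun"
  assumes f: "f \<in> odd_test R" shows "Lop a f \<in> odd_test R"
proof -
  note D = odd_testD[OF f] and Q = odd_testD[OF Qop_odd_test[OF f]]
  have "Lop a f \<in> testR R" unfolding Lop_def
    by (intro testR_add testR_sum testR_cmult testR_pderiv D(1) Q(1)) auto
  moreover have p: "pderiv_along b (pderiv_along b f) (- x) = - pderiv_along b (pderiv_along b f) x"
    "pderiv_along b (pderiv_along b f) (scl 1 (- 1) x) = - pderiv_along b (pderiv_along b f) x" if "b \<in> Basis" for b x
    using odd_test_pderivs_parity[OF f, of "[b, b]" x] that by (auto simp: scl_coeff_def)
  have "Lop a f (- x) = - Lop a f x" "Lop a f (scl 1 (- 1) x) = - Lop a f x" for x
    unfolding Lop_def by (simp_all add: p Q(3,4) sum_negf cong: sum.cong)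
  ultimately show ?thesis by (simp add: odd_test_def)
qed

text \<open>One integration by parts in each direction leaves the Euler operator, which homogeneity
  evaluates, and terms with \<open>II (a - 1) (mu - 1)\<close>; \<open>II_theta\<close> shows that
  the latter cancel.\<close>

lemma II_Lop:
  fixes f :: "'m::finite space cfun"
  assumes ab: "Re a > 3" "Re mu < - 1" and f: "f \<in> odd_test R"
  shows "II a (mu - 1) (Lop a f) = (2 - 2 * mu) * (2 * a - 2 * mu + of_nat CARD('m)) * II a mu f"
proof -
  let ?B = "Basis :: 'm space set"
  note D = odd_testD[OF f] and Q = odd_testD[OF Qop_odd_test[OF f]]
  have ab': "Re a > 2" "Re (mu - 1) < - 1" "Re (a - 1) > 2" using ab by auto
  have k: "kcond TYPE('m) a (mu - 1)" "kcond TYPE('m) (a - 1) (mu - 1)" "kcond TYPE('m) a mu"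
    using ab by (auto intro!: kcond_nice)
  have t1: "pderiv_along b f \<in> testR R" if "b \<in> ?B" for b by (rule testR_pderiv[OF D(1) that])
  have t2: "pderiv_along b (pderiv_along b f) \<in> testR R" if "b \<in> ?B" for b by (intro testR_pderiv D(1) that)
  have t3: "(\<lambda>x. of_real (x \<bullet> b) * pderiv_along b f x) \<in> testR R" if "b \<in> ?B" for b
    by (intro testR_mult smooth_coord t1 that)
  have t4: "(\<lambda>x. of_real (snd x) * Dn f x) \<in> testR R"
    by (intro testR_mult smooth_snd testR_pderiv D(1) e_n_Basis)
  have "II a (mu - 1) (Lop a f) = (\<Sum>b\<in>?B. II a (mu - 1) (pderiv_along b (pderiv_along b f))) + (2 * a - 3) * II a (mu - 1) (Qop f)"
  proof -
    have "II a (mu - 1) (Lop a f) = II a (mu - 1) (\<lambda>x. \<Sum>b\<in>?B. pderiv_along b (pderiv_along b f) x) + II a (mu - 1) (\<lambda>x. (2 * a - 3) * Qop f x)"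
      unfolding Lop_def by (intro II_add[OF k(1), where R = R] testR_sum testR_cmult t2 Q(1)) auto
    then show ?thesis by (simp add: II_cmult II_sum[OF k(1) finite_Basis t2])
  qed
  also have "(\<Sum>b\<in>?B. II a (mu - 1) (pderiv_along b (pderiv_along b f))) =
    (\<Sum>b\<in>?B. (if b = e_n then - (2 * a - 2) * II (a - 1) (mu - 1) (\<lambda>x. of_real (snd x) * Dn f x) else 0)
       + 2 * (mu - 1) * II a mu (\<lambda>x. of_real (x \<bullet> b) * pderiv_along b f x))"
  proof (intro sum.cong refl)
    fix b assume b: "b \<in> ?B"
    have "snd b = (if b = e_n then 1 else 0)" using b by (rule Basis_space_cases) auto
    then show "II a (mu - 1) (pderiv_along b (pderiv_along b f)) =
      (if b = e_n then - (2 * a - 2) * II (a - 1) (mu - 1) (\<lambda>x. of_real (snd x) * Dn f x) else 0)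
       + 2 * (mu - 1) * II a mu (\<lambda>x. of_real (x \<bullet> b) * pderiv_along b f x)"
      using II_by_parts[OF ab'(1,2) t1[OF b] b] by auto
  qed
  also have "... = - (2 * a - 2) * II (a - 1) (mu - 1) (\<lambda>x. of_real (snd x) * Dn f x)
      + 2 * (mu - 1) * II a mu (\<lambda>x. \<Sum>b\<in>?B. of_real (x \<bullet> b) * pderiv_along b f x)"
    by (simp add: sum.distrib sum_distrib_left[symmetric] II_sum[OF k(3) finite_Basis t3])
  also have "II a mu (\<lambda>x. \<Sum>b\<in>?B. of_real (x \<bullet> b) * pderiv_along b f x) = - (2 * a - 2 * mu + of_nat CARD('m) - 1) * II a mu f"
  proof -
    have "EU 0 f = (\<lambda>x. \<Sum>b\<in>?B. of_real (x \<bullet> b) * pderiv_along b f x)" by (simp add: EU_def fun_eq_iff)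
    then show ?thesis using II_EU[OF ab'(1) ab(2) D(1), of 0] by simp
  qed
  also have "II a (mu - 1) (Qop f) = II (a - 1) (mu - 1) (\<lambda>x. of_real (snd x) * Dn f x - f x)"
  proof -
    have "of_real ((snd x)\<^sup>2) * Qop f x = of_real (snd x) * Dn f x - f x" for x
      using Qop_eq[OF D(2), of x] D(5) by simp
    then show ?thesis using II_ker_xn[of a "mu - 1" "Qop f"] by simp
  qed
  also have "II (a - 1) (mu - 1) (\<lambda>x. of_real (snd x) * Dn f x) =
     II (a - 1) (mu - 1) (\<lambda>x. of_real (snd x) * Dn f x - f x) + II (a - 1) (mu - 1) f"
    using II_add[OF k(2) testR_diff[OF t4 D(1)] D(1)] by simp
  also have "II (a - 1) (mu - 1) (\<lambda>x. of_real (snd x) * Dn f x - f x) =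
     - 2 * (a - 1) * II (a - 1) (mu - 1) f + 2 * (mu - 1) * II a mu f"
    using II_theta[OF ab'(3,2) D(1)] by simp
  finally show ?thesis by (simp add: algebra_simps)
qed

section \<open>Analytic continuation\<close>

abbreviation hdim :: "'m::finite itself \<Rightarrow> complex" where
  "hdim (_ :: 'm itself) \<equiv> of_nat CARD('m) / 2"

text \<open>The coordinates are p = (alpha, beta). Since nu = alpha - beta, the exponent is mu =
  alpha - beta + (n - 1) / 2, and 2 alpha - 2 mu + n - 1 = 2 beta.\<close>

definition Ip :: "complex \<times> complex \<Rightarrow> 'm::finite space cfun \<Rightarrow> complex" where
  "Ip p f = II (fst p) (fst p - snd p + hdim TYPE('m)) f"

text \<open>By \<open>II_EU\<close> the factor E - (2M + 1) multiplies the integral by -2(beta + M).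
  The power of -1/2 and the shift in \<open>rGamma\<close> compensate this, so the value does not
  depend on M (\<open>Jf_Suc\<close>).\<close>

definition Jf :: "nat \<Rightarrow> complex \<times> complex \<Rightarrow> 'm::finite space cfun \<Rightarrow> complex" where
  "Jf M p f = (- 1 / 2) ^ M * rGamma (snd p + of_nat M) * rGamma (fst p) * Ip p (hE M f)"

definition Dom :: "nat \<Rightarrow> nat \<Rightarrow> (complex \<times> complex) set" where
  "Dom m M = {p. Re (fst p) > 1/2 - real m \<and> Re (snd p) > - real M}"

text \<open>The recursion in \<open>m\<close> lowers the bound on the first parameter and comes from integration by
  parts in $x_n$; \<open>M\<close> lowers the bound on the second one by means of the Euler operator.\<close>
primrec G :: "nat \<Rightarrow> nat \<Rightarrow> complex \<times> complex \<Rightarrow> 'm::finite space cfun \<Rightarrow> complex" where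
  "G 0 M p f = Jf M p f"
| "G (Suc m) M p f = (fst p - snd p + hdim TYPE('m)) * G m M (fst p + 1, snd p) f
     - snd p / 2 * G m M (fst p + 1, snd p + 1) (Qop f)"

lemma open_Dom: "open (Dom m M)"
  unfolding Dom_def by (intro open_Collect_conj open_Collect_less continuous_intros)

lemma convex_Dom: "convex (Dom m M)"
proof -
  have "Dom m M = {p. inner (1, 0) p > 1/2 - real m} \<inter> {p. inner (0, 1) p > - real M}"
    by (auto simp: Dom_def inner_prod_def)
  then show ?thesis by (simp add: convex_Int convex_halfspace_gt)
qed

lemma Dom_mono: "m \<le> m' \<Longrightarrow> M \<le> M' \<Longrightarrow> Dom m M \<subseteq> Dom m' M'"
  by (force simp: Dom_def)

text \<open>Here Re alpha is large and Re mu very negative for large c, so the kernel is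
  differentiable. The set is open and lies in every \<open>Dom m M\<close>, so identities proved on
  it propagate.\<close>

definition nice :: "real \<Rightarrow> (complex \<times> complex) set" where
  "nice c = {p. Re (fst p) > c \<and> Re (snd p) > Re (fst p) + c}"

lemma open_nice: "open (nice c)"
  unfolding nice_def by (intro open_Collect_conj open_Collect_less continuous_intros)

lemma nice_nonempty: "nice c \<noteq> {}"
proof -
  have "(of_real (c + 1), of_real (2 * c + 2)) \<in> nice c" by (simp add: nice_def)
  then show ?thesis by blast
qed

lemma nice_Dom: "c \<ge> 1/2 \<Longrightarrow> nice c \<subseteq> Dom m M"
  by (force simp: nice_def Dom_def)

text \<open>The zero of order 2M + 1 turns the condition at the origin into 2 Re beta + 2M + 1 > 1.
  Even for M = 0 the parity gains something: Re beta > 0 instead of Re beta > 1/2.\<close>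

lemma Ip_odd_test_integrable:
  fixes f :: "'m::finite space cfun"
  assumes "Re (fst p) > 1/2" "Re (snd p) > - real M" "f \<in> odd_test R" "R > 0"
  shows "integrable lborel (\<lambda>x. ker (fst p) (fst p - snd p + hdim TYPE('m)) x * hE M f x)"
proof -
  obtain C N where C: "C \<ge> 0" "\<And>f B x. f \<in> odd_test R \<Longrightarrow> cbound N B f \<Longrightarrow> norm (hE M f (x :: 'm space)) \<le> C * B * norm x ^ (2 * M + 1)"
    using hE_bound[of R M, where 'm = 'm] assms(4) by (meson less_imp_le)
  obtain B where B: "cbound N B f" using ex_cbound odd_testD(1)[OF assms(3)] by blast
  show ?thesis
  proof (rule ker_integral_bound(1)[where R = R and q = "2 * M + 1" and C = "C * B"])
    show "hE M f \<in> borel_measurable borel"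
      by (intro smooth_measurable odd_testD(2)[OF odd_test_hE[OF assms(3)]])
    show "hE M f x = 0" if "R < norm x" for x
      by (rule testR_zero[OF odd_testD(1)[OF odd_test_hE[OF assms(3)]] that])
    show "norm (hE M f x) \<le> C * B * norm x ^ (2 * M + 1)" for x by (rule C(2)[OF assms(3) B])
  qed (use assms in auto)
qed

lemma holo2_Jf:
  assumes "f \<in> odd_test R" "R > 0"
  shows "holo2_on (\<lambda>p. Jf M p (f :: 'm::finite space cfun)) (Dom 0 M)"
proof -
  have 1: "holo2_on (\<lambda>p. rGamma (snd p + of_nat M)) (Dom 0 M)" "holo2_on (\<lambda>p. rGamma (fst p)) (Dom 0 M)"
    using holo2_on_rGamma[of 0 1 "of_nat M" "Dom 0 M"] holo2_on_rGamma[of 1 0 0 "Dom 0 M"] by auto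
  have 2: "holo2_on (\<lambda>p. Ip p (hE M f)) (Dom 0 M)"
    unfolding Ip_def II_def
    by (rule ker_integral_holo2[OF _ open_Dom])
      (use Ip_odd_test_integrable[OF _ _ assms] odd_testD(2)[OF odd_test_hE[OF assms(1)]] in \<open>auto simp: Dom_def smooth_measurable\<close>)
  show ?thesis unfolding Jf_def by (intro holo2_on_mult holo2_on_const 1 2)
qed

lemma holo2_G:
  assumes "f \<in> odd_test R" "R > 0"
  shows "holo2_on (\<lambda>p. G m M p (f :: 'm::finite space cfun)) (Dom m M)"
  using assms(1)
proof (induction m arbitrary: f)
  case 0 then show ?case using holo2_Jf[OF 0 assms(2)] by simp
next
  case (Suc m)
  have 1: "holo2_on (\<lambda>p. G m M (1 * fst p + 0 * snd p + 1, 0 * fst p + 1 * snd p + 0) f) (Dom (Suc m) M)"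
    by (rule holo2_on_compose_affine[OF Suc.IH[OF Suc.prems]]) (auto simp: Dom_def)
  have 2: "holo2_on (\<lambda>p. G m M (1 * fst p + 0 * snd p + 1, 0 * fst p + 1 * snd p + 1) (Qop f)) (Dom (Suc m) M)"
    by (rule holo2_on_compose_affine[OF Suc.IH[OF Qop_odd_test[OF Suc.prems]]]) (auto simp: Dom_def)
  have 3: "holo2_on (\<lambda>p. fst p - snd p + hdim TYPE('m)) (Dom (Suc m) M)" "holo2_on (\<lambda>p. snd p / 2) (Dom (Suc m) M)"
    using holo2_on_affine[of 1 "- 1" "hdim TYPE('m)" "Dom (Suc m) M"] holo2_on_affine[of 0 "1/2" 0 "Dom (Suc m) M"] by auto
  have "holo2_on (\<lambda>p. G m M (fst p + 1, snd p) f) (Dom (Suc m) M)"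
    "holo2_on (\<lambda>p. G m M (fst p + 1, snd p + 1) (Qop f)) (Dom (Suc m) M)" using 1 2 by simp_all
  then show ?case unfolding G.simps using 3 by (intro holo2_on_diff holo2_on_mult)
qed

text \<open>The constants depend on p and R only. Each level of the recursion costs two derivatives
  through \<open>Qop\<close>, on top of those used by \<open>hE\<close>.\<close>

lemma G_bound:
  assumes R: "R > 0"
  shows "p \<in> Dom m M \<Longrightarrow> \<exists>C\<ge>0. \<exists>N. \<forall>f\<in>(odd_test R :: 'm::finite space cfun set). \<forall>B. cbound N B f \<longrightarrow> norm (G m M p f) \<le> C * B"
proof (induction m arbitrary: p)
  case 0
  obtain C N where C: "C \<ge> 0" "\<And>f B x. f \<in> odd_test R \<Longrightarrow> cbound N B f \<Longrightarrow> norm (hE M f (x :: 'm space)) \<le> C * B * norm x ^ (2 * M + 1)"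
    using hE_bound[of R M, where 'm = 'm] R by (meson less_imp_le)
  let ?c = "(- 1 / 2) ^ M * rGamma (snd p + of_nat M) * rGamma (fst p)"
  let ?mu = "fst p - snd p + hdim TYPE('m)"
  let ?K = "\<integral>x. indicator (cball 0 R) x * (\<bar>snd x\<bar> powr (2 * Re (fst p) - 2) * norm x powr (- 2 * Re ?mu + real (2 * M + 1))) \<partial>(lborel :: 'm space measure)"
  have K0: "0 \<le> ?K" by (intro Bochner_Integration.integral_nonneg) auto
  show ?case
  proof (intro exI[of _ "norm ?c * (C * ?K)"] exI[of _ N] conjI ballI allI impI)
    show "0 \<le> norm ?c * (C * ?K)" using C(1) K0 by (intro mult_nonneg_nonneg) auto
    fix f :: "'m space cfun" and B assume f: "f \<in> odd_test R" "cbound N B f"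
    have "norm (Ip p (hE M f)) \<le> (C * B) * ?K"
      unfolding Ip_def II_def
    proof (rule ker_integral_bound(2)[where R = R and q = "2 * M + 1"])
      show "hE M f \<in> borel_measurable borel"
        by (intro smooth_measurable odd_testD(2)[OF odd_test_hE[OF f(1)]])
      show "hE M f x = 0" if "R < norm x" for x
        by (rule testR_zero[OF odd_testD(1)[OF odd_test_hE[OF f(1)]] that])
      show "norm (hE M f x) \<le> C * B * norm x ^ (2 * M + 1)" for x by (rule C(2)[OF f])
    qed (use 0 R in \<open>auto simp: Dom_def\<close>)
    then have "norm ?c * norm (Ip p (hE M f)) \<le> norm ?c * ((C * B) * ?K)" by (intro mult_left_mono) auto
    then show "norm (G 0 M p f) \<le> norm ?c * (C * ?K) * B"
      unfolding G.simps Jf_def norm_mult[of ?c] by (simp only: ac_simps)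
  qed
next
  case (Suc m)
  let ?mu = "fst p - snd p + hdim TYPE('m)"
  have p1: "(fst p + 1, snd p) \<in> Dom m M" "(fst p + 1, snd p + 1) \<in> Dom m M" using Suc.prems by (auto simp: Dom_def)
  from Suc.IH[OF p1(1)] obtain C1 N1 where C1: "C1 \<ge> 0" "\<And>f B. f \<in> odd_test R \<Longrightarrow> cbound N1 B f \<Longrightarrow> norm (G m M (fst p + 1, snd p) (f :: 'm space cfun)) \<le> C1 * B" by metis
  from Suc.IH[OF p1(2)] obtain C2 N2 where C2: "C2 \<ge> 0" "\<And>f B. f \<in> odd_test R \<Longrightarrow> cbound N2 B f \<Longrightarrow> norm (G m M (fst p + 1, snd p + 1) (f :: 'm space cfun)) \<le> C2 * B" by metis
  show ?case
  proof (intro exI[of _ "norm ?mu * C1 + norm (snd p / 2) * C2"] exI[of _ "max N1 (N2 + 2)"] conjI ballI allI impI)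
    show "0 \<le> norm ?mu * C1 + norm (snd p / 2) * C2" using C1(1) C2(1) by (intro add_nonneg_nonneg mult_nonneg_nonneg) auto
    fix f :: "'m space cfun" and B assume f: "f \<in> odd_test R" "cbound (max N1 (N2 + 2)) B f"
    have "norm (G m M (fst p + 1, snd p) f) \<le> C1 * B" by (rule C1(2)[OF f(1) cbound_mono[OF f(2)]]) auto
    moreover have "norm (G m M (fst p + 1, snd p + 1) (Qop f)) \<le> C2 * B"
      by (rule C2(2)[OF Qop_odd_test[OF f(1)] cbound_Qop[OF odd_testD(2)[OF f(1)] cbound_mono[OF f(2)]]]) auto
    ultimately have "norm (?mu * G m M (fst p + 1, snd p) f) + norm (snd p / 2 * G m M (fst p + 1, snd p + 1) (Qop f)) \<le> norm ?mu * (C1 * B) + norm (snd p / 2) * (C2 * B)"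
      unfolding norm_mult by (intro add_mono mult_left_mono) auto
    then have "norm (G (Suc m) M p f) \<le> norm ?mu * (C1 * B) + norm (snd p / 2) * (C2 * B)"
      unfolding G.simps using norm_triangle_ineq4 order_trans by blast
    then show "norm (G (Suc m) M p f) \<le> (norm ?mu * C1 + norm (snd p / 2) * C2) * B"
      by (simp only: distrib_right mult.assoc)
  qed
qed

lemma nice_mu:
  assumes "p \<in> nice (3 + real CARD('m))"
  shows "Re (fst p) > 3" "Re (fst p - snd p + hdim TYPE('m::finite)) < - 1"
    "Re (fst p) > 2" "Re (fst p + 1) > 2"
proof -
  have "real CARD('m) \<ge> 0" by simp
  then show "Re (fst p) > 3" "Re (fst p) > 2" "Re (fst p + 1) > 2" using assms by (auto simp: nice_def)
  have "Re (fst p) - Re (snd p) < - 3 - real CARD('m)" using assms by (auto simp: nice_def)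
  moreover have "Re (hdim TYPE('m)) = real CARD('m) / 2" by simp
  ultimately show "Re (fst p - snd p + hdim TYPE('m)) < - 1" using \<open>real CARD('m) \<ge> 0\<close>
    unfolding plus_complex.sel minus_complex.sel by linarith
qed

lemma rGamma_shift: "rGamma z = z * rGamma (z + 1)" for z :: complex
  by (simp add: rGamma_plus1)

lemma Jf_Suc:
  fixes f :: "'m::finite space cfun"
  assumes p: "p \<in> nice (3 + real CARD('m))" and f: "f \<in> odd_test R"
  shows "Jf (Suc M) p f = Jf M p f"
proof -
  have i: "Ip p (hE (Suc M) f) = - 2 * (snd p + of_nat M) * Ip p (hE M f)"
    unfolding Ip_def hE.simps II_EU[OF nice_mu(3,2)[OF p] odd_testD(1)[OF odd_test_hE[OF f]]]
    by (simp add: algebra_simps)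
  have g: "rGamma (snd p + of_nat M) = (snd p + of_nat M) * rGamma (snd p + of_nat (Suc M))"
    using rGamma_shift[of "snd p + of_nat M"] by (simp add: ac_simps)
  show ?thesis unfolding Jf_def i g by (simp only: power_Suc) (simp add: field_simps)
qed

text \<open>This is \<open>II_theta\<close> divided by the Gamma factors: x_n^2 \<open>Qop f\<close>
  = (x_n D_n - 1) f moves its left side to a + 1, and \<open>rGamma_shift\<close> in a and in b
  absorbs the scalars.\<close>

lemma G_theta:
  fixes f :: "'m::finite space cfun"
  assumes p: "p \<in> nice (3 + real CARD('m))" and f: "f \<in> odd_test R"
  shows "G (Suc 0) 0 p f = G 0 0 p f"
proof -
  let ?a = "fst p" and ?b = "snd p"
  let ?mu = "?a - ?b + hdim TYPE('m)"
  have "of_real ((snd x)\<^sup>2) * Qop f x = of_real (snd x) * Dn f x - f x" for x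
    using Qop_eq[OF odd_testD(2)[OF f], of x] odd_testD(5)[OF f] by simp
  then have "II (?a + 1) ?mu (Qop f) = II ?a ?mu (\<lambda>x. of_real (snd x) * Dn f x - f x)"
    using II_ker_xn[of "?a + 1" ?mu "Qop f"] by simp
  then have key: "2 * ?a * II ?a ?mu f = 2 * ?mu * II (?a + 1) (?mu + 1) f - II (?a + 1) ?mu (Qop f)"
    using II_theta[OF nice_mu(3,2)[OF p] odd_testD(1)[OF f]] by simp
  have e: "(?a + 1) - ?b + hdim TYPE('m) = ?mu + 1" "(?a + 1) - (?b + 1) + hdim TYPE('m) = ?mu" by simp_all
  have "G (Suc 0) 0 p f = rGamma ?b * rGamma (?a + 1) * (?mu * II (?a + 1) (?mu + 1) f) - ?b * rGamma (?b + 1) * rGamma (?a + 1) * (II (?a + 1) ?mu (Qop f) / 2)"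
    by (simp add: Jf_def Ip_def e)
  also have "?b * rGamma (?b + 1) = rGamma ?b" by (simp only: rGamma_shift[symmetric])
  also have "rGamma ?b * rGamma (?a + 1) * (?mu * II (?a + 1) (?mu + 1) f) - rGamma ?b * rGamma (?a + 1) * (II (?a + 1) ?mu (Qop f) / 2)
     = rGamma ?b * rGamma (?a + 1) * ((2 * ?mu * II (?a + 1) (?mu + 1) f - II (?a + 1) ?mu (Qop f)) / 2)"
    by (simp add: algebra_simps diff_divide_distrib)
  also have "... = rGamma ?b * (?a * rGamma (?a + 1)) * II ?a ?mu f"
    unfolding key[symmetric] by simp
  also have "?a * rGamma (?a + 1) = rGamma ?a" by (simp only: rGamma_shift[symmetric])
  finally show ?thesis by (simp add: Jf_def Ip_def)
qed

lemma identity_nice: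
  assumes "holo2_on F S" "holo2_on H S" "open S" "convex S" "nice c \<subseteq> S"
    and "\<And>p. p \<in> nice c \<Longrightarrow> F p = H p" "p \<in> S"
  shows "F p = H p"
  by (rule holo2_eq_convex[OF assms(1-4) open_nice nice_nonempty assms(5-7)])

text \<open>Raising M or m by one leaves the value unchanged on \<open>nice\<close>, by
  \<open>Jf_Suc\<close> and \<open>G_theta\<close>; the identity theorem extends this to
  \<open>Dom 0 0\<close>.\<close>

lemma G_eq_G00:
  fixes f :: "'m::finite space cfun"
  assumes R: "R > 0"
  shows "f \<in> odd_test R \<Longrightarrow> p \<in> Dom 0 0 \<Longrightarrow> G m M p f = G 0 0 p f"
proof (induction m arbitrary: f p)
  case 0
  have "Jf M p f = Jf 0 p f" for M
  proof (rule identity_nice[of "\<lambda>p. Jf M p f" "Dom 0 0" "\<lambda>p. Jf 0 p f" "3 + real CARD('m)"])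
    show "Jf M q f = Jf 0 q f" if "q \<in> nice (3 + real CARD('m))" for q
      by (induction M) (simp_all add: Jf_Suc[OF that 0(1)])
    have h: "holo2_on (\<lambda>p. Jf M p f) (Dom 0 0)" for M
      by (rule holo2_on_subset[OF holo2_Jf[OF 0(1) R]]) (intro Dom_mono; simp)
    show "holo2_on (\<lambda>p. Jf M p f) (Dom 0 0)" "holo2_on (\<lambda>p. Jf 0 p f) (Dom 0 0)" by (rule h)+
    show "nice (3 + real CARD('m)) \<subseteq> Dom 0 0" by (rule nice_Dom) simp
  qed (use 0 open_Dom convex_Dom in blast)+
  then show ?case by simp
next
  case (Suc m)
  have p1: "(fst p + 1, snd p) \<in> Dom 0 0" "(fst p + 1, snd p + 1) \<in> Dom 0 0" using Suc.prems by (auto simp: Dom_def)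
  have "G (Suc m) M p f = G (Suc 0) 0 p f"
    using Suc.IH[OF Suc.prems(1) p1(1)] Suc.IH[OF Qop_odd_test[OF Suc.prems(1)] p1(2)] by simp
  also have "... = G 0 0 p f"
  proof (rule identity_nice[of "\<lambda>p. G (Suc 0) 0 p f" "Dom 0 0" "\<lambda>p. G 0 0 p f" "3 + real CARD('m)"])
    show "holo2_on (\<lambda>p. G (Suc 0) 0 p f) (Dom 0 0)"
      by (rule holo2_on_subset[OF holo2_G[OF Suc.prems(1) R]]) (intro Dom_mono; simp)
    show "holo2_on (\<lambda>p. G 0 0 p f) (Dom 0 0)" by (rule holo2_G[OF Suc.prems(1) R])
    show "nice (3 + real CARD('m)) \<subseteq> Dom 0 0" by (rule nice_Dom) simp
  qed (use Suc.prems G_theta[OF _ Suc.prems(1)] open_Dom convex_Dom in blast)+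
  finally show ?case .
qed

text \<open>The domains of two levels meet in a convex set that contains \<open>Dom 0 0\<close>,
  where both levels equal the classical integral.\<close>

lemma G_eq_G:
  fixes f :: "'m::finite space cfun"
  assumes R: "R > 0" and f: "f \<in> odd_test R" and p: "p \<in> Dom m M" "p \<in> Dom m' M'"
  shows "G m M p f = G m' M' p f"
proof -
  have i: "Dom m M \<inter> Dom m' M' = Dom (min m m') (min M M')" by (auto simp: Dom_def min_def)
  have s: "Dom 0 0 \<subseteq> Dom m M \<inter> Dom m' M'" using Dom_mono[of 0 _ 0] by blast
  have ne: "Dom 0 0 \<noteq> {}" using nice_nonempty[of 1] nice_Dom[of 1 0 0] by auto
  show ?thesis
  proof (rule holo2_eq_convex[of "\<lambda>p. G m M p f" "Dom m M \<inter> Dom m' M'" "\<lambda>p. G m' M' p f" "Dom 0 0"])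
    show "holo2_on (\<lambda>p. G m M p f) (Dom m M \<inter> Dom m' M')" "holo2_on (\<lambda>p. G m' M' p f) (Dom m M \<inter> Dom m' M')"
      by (rule holo2_on_subset[OF holo2_G[OF f R]]; blast)+
    show "G m M q f = G m' M' q f" if "q \<in> Dom 0 0" for q
      using G_eq_G00[OF R f that] by metis
  qed (use p s ne i open_Dom convex_Dom in auto)
qed

text \<open>The level chosen for p has p in its domain (\<open>in_Dom_ceiling\<close>), and by
  \<open>G_eq_G\<close> every other level with this property gives the same value.\<close>

definition J :: "complex \<times> complex \<Rightarrow> 'm::finite space cfun \<Rightarrow> complex" where
  "J p f = G (nat \<lceil>1 - Re (fst p)\<rceil>) (nat \<lceil>1 - Re (snd p)\<rceil>) p f"

lemma in_Dom_ceiling: "p \<in> Dom (nat \<lceil>1 - Re (fst p)\<rceil>) (nat \<lceil>1 - Re (snd p)\<rceil>)"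
proof -
  have "1 - Re (fst p) \<le> real (nat \<lceil>1 - Re (fst p)\<rceil>)" "1 - Re (snd p) \<le> real (nat \<lceil>1 - Re (snd p)\<rceil>)"
    by (rule of_nat_ceiling)+
  then show ?thesis unfolding Dom_def mem_Collect_eq by linarith
qed

lemma J_eq_G: "R > 0 \<Longrightarrow> f \<in> odd_test R \<Longrightarrow> p \<in> Dom m M \<Longrightarrow> J p f = G m M p f"
  unfolding J_def by (rule G_eq_G[OF _ _ in_Dom_ceiling])

lemma holo2_J:
  assumes "R > 0" "f \<in> odd_test R" shows "holo2_on (\<lambda>p. J p f) UNIV"
proof (rule holo2_on_local)
  fix p :: "complex \<times> complex"
  obtain m M where p: "p \<in> Dom m M" using in_Dom_ceiling by blast
  have "holo2_on (\<lambda>p. J p f) (Dom m M)"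
    by (rule holo2_on_cong[OF _ holo2_G[OF assms(2,1)]]) (simp add: J_eq_G[OF assms])
  then show "\<exists>V. open V \<and> p \<in> V \<and> holo2_on (\<lambda>p. J p f) V" using p open_Dom by blast
qed auto

lemma J_bound:
  assumes "R > 0"
  shows "\<exists>C\<ge>0. \<exists>N. \<forall>f\<in>(odd_test R :: 'm::finite space cfun set). \<forall>B. cbound N B f \<longrightarrow> norm (J p f) \<le> C * B"
  unfolding J_def by (rule G_bound[OF assms in_Dom_ceiling])

lemma J_base:
  fixes f :: "'m::finite space cfun"
  assumes "R > 0" "f \<in> odd_test R" "Re a > 1/2" "Re b > 0"
  shows "J (a, b) f = rGamma a * rGamma b * II a (a - b + hdim TYPE('m)) f"
  using J_eq_G[OF assms(1,2), of "(a, b)" 0 0] assms(3,4) by (simp add: Dom_def Jf_def Ip_def)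

lemma J_recursion:
  fixes f :: "'m::finite space cfun"
  assumes "R > 0" "f \<in> odd_test R"
  shows "J (a, b) f = (a - b + hdim TYPE('m)) * J (a + 1, b) f - b / 2 * J (a + 1, b + 1) (Qop f)"
proof -
  obtain m M where p: "(a, b) \<in> Dom m M" using in_Dom_ceiling by blast
  have "(a, b) \<in> Dom (Suc m) M" "(a + 1, b) \<in> Dom m M" "(a + 1, b + 1) \<in> Dom m M"
    using p by (auto simp: Dom_def)
  then show ?thesis
    using J_eq_G[OF assms] J_eq_G[OF assms(1) Qop_odd_test[OF assms(2)]] by simp
qed

lemma kcond_mu:
  "kcond TYPE('m::finite) a (a - b + hdim TYPE('m)) \<longleftrightarrow> Re a > 1/2 \<and> Re b > 1/2"
  unfolding kcond_def by auto

lemma nice_kcond: "p \<in> nice 1 \<Longrightarrow> kcond TYPE('m::finite) (fst p) (fst p - snd p + hdim TYPE('m)) \<and> Re (fst p) > 1/2 \<and> Re (snd p) > 0"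
  unfolding kcond_mu nice_def by auto

lemma J_nice:
  fixes f :: "'m::finite space cfun"
  assumes "R > 0" "f \<in> odd_test R" "p \<in> nice 1"
  shows "J p f = rGamma (fst p) * rGamma (snd p) * II (fst p) (fst p - snd p + hdim TYPE('m)) f"
  using J_base[OF assms(1,2), of "fst p" "snd p"] nice_kcond[OF assms(3), where 'm = 'm] by simp

lemma odd_test_add: "f \<in> odd_test R \<Longrightarrow> g \<in> odd_test R \<Longrightarrow> (\<lambda>x. f x + g x) \<in> odd_test R"
  and odd_test_cmult: "f \<in> odd_test R \<Longrightarrow> (\<lambda>x. c * f x) \<in> odd_test R"
  by (auto simp: odd_test_def testR_add testR_cmult)

lemma J_add:
  fixes f :: "'m::finite space cfun"
  assumes R: "R > 0" and f: "f \<in> odd_test R" and g: "g \<in> odd_test R"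
  shows "J p (\<lambda>x. f x + g x) = J p f + J p g"
proof (rule identity_nice[of "\<lambda>p. J p (\<lambda>x. f x + g x)" UNIV "\<lambda>p. J p f + J p g" 1])
  show "J q (\<lambda>x. f x + g x) = J q f + J q g" if "q \<in> nice 1" for q
    using II_add[OF conjunct1[OF nice_kcond[OF that]] odd_testD(1)[OF f] odd_testD(1)[OF g]]
    by (simp add: J_nice[OF R odd_test_add[OF f g] that] J_nice[OF R f that] J_nice[OF R g that] distrib_left)
qed (auto intro!: holo2_on_add holo2_J[OF R] f g odd_test_add)

lemma J_cmult:
  fixes f :: "'m::finite space cfun"
  assumes R: "R > 0" and f: "f \<in> odd_test R"
  shows "J p (\<lambda>x. c * f x) = c * J p f"
proof (rule identity_nice[of "\<lambda>p. J p (\<lambda>x. c * f x)" UNIV "\<lambda>p. c * J p f" 1])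
  show "J q (\<lambda>x. c * f x) = c * J q f" if "q \<in> nice 1" for q
    by (simp add: J_nice[OF R odd_test_cmult[OF f] that] J_nice[OF R f that] II_cmult)
qed (auto intro!: holo2_on_mult holo2_J[OF R] f odd_test_cmult)

lemma Lop_split: "Lop a f x = Lop (3/2) f x + (2 * a - 3) * Qop f x"
  by (simp add: Lop_def)

text \<open>The operator itself depends on the parameter, so the identity is continued after
  splitting \<open>Lop a\<close> into the pure Laplacian \<open>Lop (3/2)\<close> and (2a - 3)
  \<open>Qop\<close>. The factor 2 beta in \<open>II_Lop\<close> is absorbed by the step from
  1/Gamma(beta + 1) to 1/Gamma(beta).\<close>

lemma J_Lop:
  fixes f :: "'m::finite space cfun"
  assumes R: "R > 0" and f: "f \<in> odd_test R"
  shows "J (a, b + 1) (Lop a f) = 4 * (1 - (a - b + hdim TYPE('m))) * J (a, b) f"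
proof -
  note L = Lop_odd_test[OF f] and Q = Qop_odd_test[OF f]
  have split: "J p (Lop a f) = J p (Lop (3/2) f) + (2 * a - 3) * J p (Qop f)" for p a
  proof -
    have "Lop a f = (\<lambda>x. Lop (3/2) f x + (2 * a - 3) * Qop f x)" by (rule ext) (rule Lop_split)
    then show ?thesis by (simp add: J_add[OF R L odd_test_cmult[OF Q]] J_cmult[OF R Q])
  qed
  let ?F = "\<lambda>p. J (1 * fst p + 0 * snd p + 0, 0 * fst p + 1 * snd p + 1) (Lop (3/2) f) + (2 * fst p + 0 * snd p + (- 3)) * J (1 * fst p + 0 * snd p + 0, 0 * fst p + 1 * snd p + 1) (Qop f)"
  let ?H = "\<lambda>p. ((- 4) * fst p + 4 * snd p + 4 * (1 - hdim TYPE('m))) * J p f"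
  have "?F (a, b) = ?H (a, b)"
  proof (rule identity_nice[of ?F UNIV ?H "3 + real CARD('m)"])
    show "holo2_on ?F UNIV"
      by (intro holo2_on_add holo2_on_mult holo2_on_affine holo2_on_compose_affine[OF holo2_J[OF R L]] holo2_on_compose_affine[OF holo2_J[OF R Q]]) auto
    show "holo2_on ?H UNIV" by (intro holo2_on_mult holo2_on_affine holo2_J[OF R f])
    fix p assume p: "p \<in> nice (3 + real CARD('m))"
    let ?a = "fst p" and ?b = "snd p"
    let ?mu = "?a - ?b + hdim TYPE('m)"
    have p1: "p \<in> nice 1" "(?a, ?b + 1) \<in> nice 1" using p by (auto simp: nice_def)
    have e: "?a - (?b + 1) + hdim TYPE('m) = ?mu - 1" by simp
    have "?F p = J (?a, ?b + 1) (Lop ?a f)" by (simp add: split[of _ ?a])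
    also have "... = rGamma ?a * rGamma (?b + 1) * II ?a (?mu - 1) (Lop ?a f)"
      using J_nice[OF R L p1(2)] unfolding fst_conv snd_conv e .
    also have "II ?a (?mu - 1) (Lop ?a f) = (2 - 2 * ?mu) * (2 * ?a - 2 * ?mu + of_nat CARD('m)) * II ?a ?mu f"
      by (rule II_Lop[OF nice_mu(1,2)[OF p] f])
    also have "2 * ?a - 2 * ?mu + of_nat CARD('m) = 2 * ?b" by simp
    also have "rGamma ?a * rGamma (?b + 1) * ((2 - 2 * ?mu) * (2 * ?b) * II ?a ?mu f) = 4 * (1 - ?mu) * (rGamma ?a * (?b * rGamma (?b + 1)) * II ?a ?mu f)"
      by (simp add: algebra_simps)
    also have "?b * rGamma (?b + 1) = rGamma ?b" by (simp only: rGamma_shift[symmetric])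
    also have "rGamma ?a * rGamma ?b * II ?a ?mu f = J p f" by (simp only: J_nice[OF R f p1(1)])
    finally show "?F p = ?H p" by (simp add: algebra_simps)
  qed auto
  then show ?thesis by (simp add: split[of _ a] algebra_simps)
qed

section \<open>Residue formulas\<close>

lemma av_one_mult:
  fixes f :: "'m::finite space cfun"
  assumes f: "smooth f"
  shows "of_real (snd x) * av (\<lambda>_. 1) (Dn f) x = f x - f (fst x, 0)"
proof -
  define y where "y = (fst x, 0::real)"
  define xn where "xn = snd x"
  have scl: "scl 1 s x = y + (s * xn) *\<^sub>R e_n" for s by (simp add: scl_def y_def xn_def prod_eq_iff)
  have "((\<lambda>s. f (y + (s * xn) *\<^sub>R e_n)) has_vector_derivative xn *\<^sub>R Dn f (y + (s * xn) *\<^sub>R e_n)) (at s within {0..1})" for s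
  proof -
    have "((\<lambda>s. s * xn) has_real_derivative xn) (at s within {0..1})" by (auto intro!: derivative_eq_intros)
    from vector_diff_chain_within[OF this[unfolded has_real_derivative_iff_has_vector_derivative]
        smooth_line_derivative[OF f, of y "e_n" "s * xn"]]
    show ?thesis by (simp add: o_def)
  qed
  then have "((\<lambda>s. xn *\<^sub>R Dn f (y + (s * xn) *\<^sub>R e_n)) has_integral (f (y + (1 * xn) *\<^sub>R e_n) - f (y + (0 * xn) *\<^sub>R e_n))) {0..1}"
    by (intro fundamental_theorem_of_calculus) auto
  moreover have "y + xn *\<^sub>R e_n = x" by (simp add: y_def xn_def prod_eq_iff)
  ultimately have 1: "((\<lambda>s. xn *\<^sub>R (1 *\<^sub>R Dn f (scl 1 s x))) has_integral (f x - f y)) {0..1}"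
    by (simp add: scl zero_prod_def[symmetric])
  have "((\<lambda>s. 1 *\<^sub>R Dn f (scl 1 s x)) has_integral av (\<lambda>_. 1) (Dn f) x) {0..1}"
    unfolding av_def by (rule integrable_integral, rule av_integrable[OF smooth_pderiv[OF f e_n_Basis]]) simp
  from has_integral_unique[OF 1 has_integral_cmul[OF this]]
  show ?thesis by (simp add: xn_def y_def scaleR_conv_of_real)
qed

lemma integral_space:
  fixes f :: "'m::finite space cfun"
  assumes "integrable lborel f"
  shows "(\<integral>x. f x \<partial>lborel) = (\<integral>y. (\<integral>t. f (y, t) \<partial>lborel) \<partial>lborel)"
proof -
  have "integrable (lborel \<Otimes>\<^sub>M lborel) f" using assms by (simp add: lborel_prod)
  from lborel_pair.integral_fst'[OF this] show ?thesis by (simp add: lborel_prod)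
qed

text \<open>The pairing of |x'|^s delta(x_n) with \<open>g\<close>.\<close>

definition PI :: "complex \<Rightarrow> 'm::finite space cfun \<Rightarrow> complex" where
  "PI s g = (\<integral>y. of_real (norm y) powr s * g (y, 0) \<partial>lborel)"

lemma of_real_power2_powr: "r \<ge> 0 \<Longrightarrow> complex_of_real (r\<^sup>2) powr c = of_real r powr (2 * c)"
proof (cases "r = 0")
  case False
  assume "r \<ge> 0"
  then have r: "r > 0" using False by simp
  then have "Ln (of_real (r\<^sup>2)) = 2 * Ln (of_real r)"
    by (simp add: Ln_of_real ln_realpow del: of_real_power)
  then show ?thesis using r by (simp add: powr_def ac_simps del: of_real_power)
qed simp

lemma ker_1: "ker 1 mu x = of_real (sgn (snd x)) * cpw (- mu) ((norm x)\<^sup>2)"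
  unfolding ker_eq_powr cpw_def by (cases "snd x = 0") auto

text \<open>With $f = x_n\psi$ and $Q f = \partial_n\psi$ the integrand is
  $-\frac12\mathrm{sgn}(x_n)\partial_n(|x|^{-2\mu}\psi)$.\<close>
lemma integral_sgn_ker:
  fixes f :: "'m::finite space cfun"
  assumes f: "f \<in> odd_test R" and R: "R > 0" and b: "Re b > 0"
  defines "mu \<equiv> hdim TYPE('m) - b"
  shows "mu * II 1 (mu + 1) f - 1 / 2 * II 1 mu (Qop f) = PI (- 2 * mu) (Dn f)"
proof -
  note D = odd_testD[OF f] and Q = odd_testD[OF Qop_odd_test[OF f]]
  define psi where "psi = av (\<lambda>_. 1) (Dn f)"
  have s1: "smooth (Dn f)" by (rule smooth_pderiv[OF D(2) e_n_Basis])
  have psi: "smooth psi" unfolding psi_def by (rule smooth_av[OF s1]) simp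
  have fpsi: "f x = of_real (snd x) * psi x" for x
    using av_one_mult[OF D(2), of x] D(5) by (simp add: psi_def)
  have Dpsi: "Dn psi = Qop f"
    unfolding psi_def Qop_def
    by (rule ext, subst av_has_pderiv(2)[OF s1]) (simp_all add: scl_coeff_def)
  have psi0: "psi (y, 0) = Dn f (y, 0)" for y by (simp add: psi_def av_def scl_def)
  define h where "h = (\<lambda>x. mu * (ker 1 (mu + 1) x * f x) - 1 / 2 * (ker 1 mu x * Qop f x))"
  have i1: "integrable lborel (\<lambda>x. ker 1 (mu + 1) x * f x)"
    using Ip_odd_test_integrable[of "(1, b)" 0 f R] f R b by (simp add: mu_def algebra_simps)
  have i2: "integrable lborel (\<lambda>x. ker 1 mu x * Qop f x)"
    using Ip_odd_test_integrable[of "(1, b + 1)" 0 "Qop f" R] Qop_odd_test[OF f] R b by (simp add: mu_def algebra_simps)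
  have hint: "integrable lborel h" unfolding h_def using i1 i2 by simp
  have "mu * II 1 (mu + 1) f - 1 / 2 * II 1 mu (Qop f) = (\<integral>x. h x \<partial>lborel)"
    unfolding II_def h_def using i1 i2 by simp
  also have "... = (\<integral>y. (\<integral>t. h (y, t) \<partial>lborel) \<partial>lborel)" by (rule integral_space[OF hint])
  also have "... = PI (- 2 * mu) (Dn f)"
    unfolding PI_def
  proof (rule integral_cong_AE)
    show "AE y in lborel. (\<integral>t. h (y, t) \<partial>lborel) = of_real (norm y) powr (- 2 * mu) * Dn f (y, 0)"
      using AE_lborel_singleton[of "0 :: real ^ 'm"]
    proof eventually_elim
      case (elim y)
      \<comment> \<open>For y different from 0 the quantity |y|^2 + t^2 stays positive, so this is
        differentiable in t up to and across t = 0 for every mu.\<close>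
      define g where "g = (\<lambda>t. cpw (- mu) ((norm y)\<^sup>2 + t\<^sup>2) * psi (y, t))"
      define g' where "g' = (\<lambda>t. - 2 * mu * cps (- mu - 1) ((norm y)\<^sup>2 + t\<^sup>2) * of_real t * psi (y, t) + cpw (- mu) ((norm y)\<^sup>2 + t\<^sup>2) * Qop f (y, t))"
      have pos: "(norm y)\<^sup>2 + t\<^sup>2 > 0" for t using elim by (simp add: add_pos_nonneg)
      have yt: "(y, t) = (y, 0) + t *\<^sub>R e_n" for t by simp
      have gd: "(g has_vector_derivative g' t) (at t within S)" for t S
      proof -
        have 1: "((\<lambda>t. (norm y)\<^sup>2 + t\<^sup>2) has_vector_derivative 2 * t) (at t within S)"
          by (auto intro!: derivative_eq_intros simp: has_real_derivative_iff_has_vector_derivative[symmetric])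
        have nz: "(norm y)\<^sup>2 + t\<^sup>2 \<noteq> 0" using pos[of t] by linarith
        have "((\<lambda>t. cpw (- mu) ((norm y)\<^sup>2 + t\<^sup>2)) has_vector_derivative (2 * t) *\<^sub>R (- mu * cps (- mu - 1) ((norm y)\<^sup>2 + t\<^sup>2))) (at t within S)"
          using vector_diff_chain_within[OF 1 has_vector_derivative_at_within[OF cpw_deriv_nonzero(1)[OF nz, of "- mu"]]]
          by (simp add: o_def)
        from has_vector_derivative_mult[OF this smooth_line_derivative[OF psi, of "(y, 0)" e_n t]]
        show ?thesis unfolding g_def g'_def yt[symmetric] Dpsi
          by (simp add: scaleR_conv_of_real algebra_simps)
      qed
      have cc: "continuous_on S (\<lambda>t. F (y, t))" if "smooth F" for F :: "'m space cfun" and S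
        by (rule continuous_on_compose2[OF smooth_continuous[OF that, of UNIV]]) (auto intro!: continuous_intros)
      have cw: "continuous_on S (\<lambda>t. F ((norm y)\<^sup>2 + t\<^sup>2))" if "\<And>t. t \<noteq> 0 \<Longrightarrow> isCont F t" for F :: "real \<Rightarrow> complex" and S
      proof (rule continuous_at_imp_continuous_on, rule ballI)
        fix t
        have "isCont (\<lambda>t. (norm y)\<^sup>2 + t\<^sup>2) t" by (intro isCont_add continuous_const isCont_power continuous_ident)
        moreover have "isCont F ((norm y)\<^sup>2 + t\<^sup>2)" using pos[of t] by (intro that) linarith
        ultimately show "isCont (\<lambda>t. F ((norm y)\<^sup>2 + t\<^sup>2)) t" by (rule isCont_o2)
      qed
      have c1: "continuous_on S (\<lambda>t. cpw c ((norm y)\<^sup>2 + t\<^sup>2))" for S c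
        by (rule cw) (rule has_vector_derivative_continuous[OF cpw_deriv_nonzero(1)])
      have c2: "continuous_on S (\<lambda>t. cps c ((norm y)\<^sup>2 + t\<^sup>2))" for S c
        by (rule cw) (rule has_vector_derivative_continuous[OF cpw_deriv_nonzero(2)])
      have g'c: "continuous_on S g'" for S
        unfolding g'_def
        by (rule continuous_on_add[OF continuous_on_mult[OF continuous_on_mult[OF continuous_on_mult[OF continuous_on_const c2]] cc[OF psi]]
              continuous_on_mult[OF c1 cc[OF Q(2)]]]) (intro continuous_on_of_real continuous_on_id)
      define r where "r = R + 1"
      have out: "f (y, t) = 0 \<and> psi (y, t) = 0 \<and> Qop f (y, t) = 0" if "\<bar>t\<bar> \<ge> r" for t
      proof -
        have "\<bar>t\<bar> \<le> norm (y, t)" using norm_snd_le[of t y] by simp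
        then have "R < norm (y, t)" "t \<noteq> 0" using that R by (auto simp: r_def)
        then show ?thesis using testR_zero[OF D(1)] testR_zero[OF Q(1)] fpsi[of "(y, t)"] by simp
      qed
      have hyt: "h (y, t) = - 1 / 2 * of_real (sgn t) * g' t" for t
      proof -
        have e: "cpw (- (mu + 1)) ((norm (y, t))\<^sup>2) = cps (- mu - 1) ((norm y)\<^sup>2 + t\<^sup>2)"
          using pos[of t] by (simp add: norm_space_power2 cps_nonneg)
        show ?thesis unfolding h_def ker_1 e unfolding fpsi[of "(y, t)"] g'_def norm_space_power2
          by (simp add: algebra_simps)
      qed
      have r: "r > 0" using R by (simp add: r_def)
      \<comment> \<open>The sign is constant on each half-line and \<open>g\<close> vanishes at both
        far ends; the boundary terms at 0 are g(0)/2 from either side.\<close>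
      have "(\<integral>t. h (y, t) \<partial>lborel) = (\<integral>t. - 1 / 2 * (indicator {0..r} t *\<^sub>R g' t) + 1 / 2 * (indicator {- r..0} t *\<^sub>R g' t) \<partial>lborel)"
      proof (rule integral_cong_AE)
        show "AE t in lborel. h (y, t) = - 1 / 2 * (indicator {0..r} t *\<^sub>R g' t) + 1 / 2 * (indicator {- r..0} t *\<^sub>R g' t)"
          using AE_lborel_singleton[of "0 :: real"]
        proof eventually_elim
          case (elim t)
          have "g' t = 0" if "\<bar>t\<bar> \<ge> r" using out[OF that] by (simp add: g'_def)
          then show ?case unfolding hyt using elim by (cases "\<bar>t\<bar> \<ge> r") (auto simp: indicator_def sgn_if)
        qed
        have [measurable]: "g' \<in> borel_measurable borel" by (rule borel_measurable_continuous_onI[OF g'c])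
        show "(\<lambda>t. h (y, t)) \<in> borel_measurable lborel" unfolding hyt by measurable
        show "(\<lambda>t. - 1 / 2 * (indicator {0..r} t *\<^sub>R g' t) + 1 / 2 * (indicator {- r..0} t *\<^sub>R g' t)) \<in> borel_measurable lborel" by measurable
      qed
      also have "... = - 1 / 2 * (\<integral>t. indicator {0..r} t *\<^sub>R g' t \<partial>lborel) + 1 / 2 * (\<integral>t. indicator {- r..0} t *\<^sub>R g' t \<partial>lborel)"
      proof -
        have iI: "integrable lborel (\<lambda>t. indicator {a..b} t *\<^sub>R g' t)" for a b :: real
          by (rule borel_integrable_compact[OF compact_Icc g'c])
        show ?thesis
          by (subst Bochner_Integration.integral_add[OF integrable_mult_right[OF iI] integrable_mult_right[OF iI]])
            (simp only: integral_mult_right_zero)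
      qed
      also have "(\<integral>t. indicator {0..r} t *\<^sub>R g' t \<partial>lborel) = g r - g 0"
        using r by (intro integral_FTC_atLeastAtMost gd g'c) auto
      also have "(\<integral>t. indicator {- r..0} t *\<^sub>R g' t \<partial>lborel) = g 0 - g (- r)"
        using r by (intro integral_FTC_atLeastAtMost gd g'c) auto
      also have "g r = 0" using out[of r] r by (simp add: g_def)
      also have "g (- r) = 0" using out[of "- r"] r by (simp add: g_def)
      finally have "(\<integral>t. h (y, t) \<partial>lborel) = g 0" by simp
      also have "g 0 = of_real (norm y) powr (- 2 * mu) * Dn f (y, 0)"
        using of_real_power2_powr[of "norm y" "- mu"] by (simp add: g_def cpw_def psi0)
      finally show ?case .
    qed
    have [measurable]: "h \<in> borel_measurable borel" using borel_measurable_integrable[OF hint] by simp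
    show "(\<lambda>y. \<integral>t. h (y, t) \<partial>lborel) \<in> borel_measurable lborel" by measurable
    have "(\<lambda>y. Dn f (y, 0)) \<in> borel_measurable borel"
      by (intro borel_measurable_continuous_onI continuous_on_compose2[OF smooth_continuous[OF s1, of UNIV]]) (auto intro!: continuous_intros)
    moreover have "(\<lambda>y :: real ^ 'm. complex_of_real (norm y) powr (- 2 * mu)) \<in> borel_measurable borel"
    proof -
      have "(\<lambda>y :: real ^ 'm. if y = 0 then 0 else exp (- 2 * mu * of_real (ln (norm y)))) \<in> borel_measurable borel" by measurable
      also have "(\<lambda>y :: real ^ 'm. if y = 0 then 0 else exp (- 2 * mu * of_real (ln (norm y)))) = (\<lambda>y. complex_of_real (norm y) powr (- 2 * mu))"
        by (auto simp: powr_def Ln_of_real)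
      finally show ?thesis .
    qed
    ultimately show "(\<lambda>y. complex_of_real (norm y) powr (- 2 * mu) * Dn f (y, 0)) \<in> borel_measurable lborel" by simp
  qed
  finally show ?thesis .
qed

text \<open>The recursion expresses the value at alpha = 0 by values at alpha = 1, where the factor
  in x_n is a mere sign and the x_n-integral is explicit.\<close>

lemma J_0:
  fixes f :: "'m::finite space cfun"
  assumes R: "R > 0" and f: "f \<in> odd_test R" and b: "Re b > 0"
  shows "J (0, b) f = rGamma b * PI (2 * b - of_nat CARD('m)) (Dn f)"
proof -
  let ?mu = "hdim TYPE('m) - b"
  have "J (0, b) f = ?mu * J (1, b) f - b / 2 * J (1, b + 1) (Qop f)"
    using J_recursion[OF R f, of 0 b] by simp
  also have "J (1, b) f = rGamma b * II 1 (?mu + 1) f"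
    using J_base[OF R f, of 1 b] b by (simp add: algebra_simps)
  also have "J (1, b + 1) (Qop f) = rGamma (b + 1) * II 1 ?mu (Qop f)"
    using J_base[OF R Qop_odd_test[OF f], of 1 "b + 1"] b by (simp add: algebra_simps)
  also have "?mu * (rGamma b * II 1 (?mu + 1) f) - b / 2 * (rGamma (b + 1) * II 1 ?mu (Qop f)) =
    rGamma b * (?mu * II 1 (?mu + 1) f) - (b * rGamma (b + 1)) * (1 / 2 * II 1 ?mu (Qop f))" by simp
  also have "b * rGamma (b + 1) = rGamma b" by (simp only: rGamma_shift[symmetric])
  also have "rGamma b * (?mu * II 1 (?mu + 1) f) - rGamma b * (1 / 2 * II 1 ?mu (Qop f)) = rGamma b * PI (- 2 * ?mu) (Dn f)"
    using integral_sgn_ker[OF f R b] by (simp only: right_diff_distrib[symmetric])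
  finally show ?thesis by simp
qed

lemma PI_Dn_Qop:
  assumes "smooth f"
  shows "PI s ((Dn ^^ q) (Qop f)) = PI s ((Dn ^^ (q + 2)) f) / of_nat (q + 2)"
  unfolding PI_def Dn_power_Qop[OF assms] times_divide_eq_right by (rule integral_divide_zero)

text \<open>Induction along the recursion in alpha. With the coefficients of level k + 1, the first
  term yields the i-th summand i times and the second term yields it k + 1 - i times, so k! is
  multiplied by k + 1.\<close>

lemma J_X:
  fixes f :: "'m::finite space cfun"
  assumes R: "R > 0"
  shows "f \<in> odd_test R \<Longrightarrow> Re b > 0 \<Longrightarrow> J (- of_nat k, b) f = (- 1) ^ k * fact k * rGamma b *
    (\<Sum>i\<le>k. (- 1) ^ i * pochhammer (- of_nat k - b + hdim TYPE('m)) i / (fact i * fact (2 * k + 1 - 2 * i))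
       * PI (- 2 * (- of_nat k - b + hdim TYPE('m)) - 2 * of_nat i) ((Dn ^^ (2 * k + 1 - 2 * i)) f))"
proof (induction k arbitrary: f b)
  case 0
  then show ?case using J_0[OF R, of f b] by (simp add: algebra_simps)
next
  case (Suc k)
  define mu where "mu = - of_nat (Suc k) - b + hdim TYPE('m)"
  define T where "T = (\<lambda>i. PI (- 2 * mu - 2 * of_nat i) ((Dn ^^ (2 * k + 3 - 2 * i)) f))"
  define c where "c = (\<lambda>i. (- 1) ^ i * pochhammer mu i / (fact i * fact (2 * k + 3 - 2 * i)) :: complex)"
  have IH1: "J (- of_nat k, b) f = (- 1) ^ k * fact k * rGamma b *
    (\<Sum>i\<le>k. (- 1) ^ i * pochhammer (mu + 1) i / (fact i * fact (2 * k + 1 - 2 * i)) * PI (- 2 * (mu + 1) - 2 * of_nat i) ((Dn ^^ (2 * k + 1 - 2 * i)) f))"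
    using Suc.IH[OF Suc.prems] by (simp add: mu_def algebra_simps)
  have IH2: "J (- of_nat k, b + 1) (Qop f) = (- 1) ^ k * fact k * rGamma (b + 1) *
    (\<Sum>i\<le>k. (- 1) ^ i * pochhammer mu i / (fact i * fact (2 * k + 1 - 2 * i)) * PI (- 2 * mu - 2 * of_nat i) ((Dn ^^ (2 * k + 1 - 2 * i)) (Qop f)))"
    using Suc.IH[OF Qop_odd_test[OF Suc.prems(1)], of "b + 1"] Suc.prems(2) by (simp add: mu_def algebra_simps)
  have S1: "mu * (\<Sum>i\<le>k. (- 1) ^ i * pochhammer (mu + 1) i / (fact i * fact (2 * k + 1 - 2 * i)) * PI (- 2 * (mu + 1) - 2 * of_nat i) ((Dn ^^ (2 * k + 1 - 2 * i)) f))
     = - (\<Sum>i\<le>Suc k. of_nat i * c i * T i)"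
  proof -
    have t: "mu * ((- 1) ^ i * pochhammer (mu + 1) i / (fact i * fact (2 * k + 1 - 2 * i)) * PI (- 2 * (mu + 1) - 2 * of_nat i) ((Dn ^^ (2 * k + 1 - 2 * i)) f))
      = - (of_nat (Suc i) * c (Suc i) * T (Suc i))" for i
    proof -
      have "pochhammer mu (Suc i) = mu * pochhammer (mu + 1) i" by (rule pochhammer_rec)
      moreover have "2 * k + 3 - 2 * Suc i = 2 * k + 1 - 2 * i" by simp
      moreover have "- 2 * (mu + 1) - 2 * of_nat i = - 2 * mu - 2 * of_nat (Suc i)" by simp
      moreover have "fact (Suc i) = (of_nat (Suc i) * fact i :: complex)" by (rule fact_Suc)
      moreover have "mu * (s * P / (fi * F) * X) = - (n * ((- 1 * s) * (mu * P) / ((n * fi) * F)) * X)"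
        if "n \<noteq> 0" for n s P fi F X :: complex using that by (simp add: mult.assoc)
      then have "mu * ((- 1) ^ i * P / (fi * F) * X) = - (of_nat (Suc i) * (((- 1) ^ Suc i) * (mu * P) / ((of_nat (Suc i) * fi) * F)) * X)"
        for P fi F X by (simp del: of_nat_Suc)
      ultimately show ?thesis unfolding c_def T_def by (simp only:)
    qed
    show ?thesis unfolding sum_distrib_left t sum_negf by (subst sum.atMost_Suc_shift) simp
  qed
  have S2: "(\<Sum>i\<le>k. (- 1) ^ i * pochhammer mu i / (fact i * fact (2 * k + 1 - 2 * i)) * PI (- 2 * mu - 2 * of_nat i) ((Dn ^^ (2 * k + 1 - 2 * i)) (Qop f)))
     = (\<Sum>i\<le>Suc k. 2 * of_nat (Suc k - i) * c i * T i)"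
  proof -
    have t: "(- 1) ^ i * pochhammer mu i / (fact i * fact (2 * k + 1 - 2 * i)) * PI (- 2 * mu - 2 * of_nat i) ((Dn ^^ (2 * k + 1 - 2 * i)) (Qop f))
       = 2 * of_nat (Suc k - i) * c i * T i" if i: "i \<le> k" for i
    proof -
      define q where "q = 2 * k + 1 - 2 * i"
      have q2: "2 * k + 3 - 2 * i = q + 2" "2 * (Suc k - i) = q + 1" using i by (auto simp: q_def)
      have f: "fact (q + 2) = (of_nat (q + 2) * of_nat (q + 1) * fact q :: complex)"
        by (simp add: numeral_2_eq_2 algebra_simps)
      have "(2 * of_nat (Suc k - i) :: complex) = of_nat (q + 1)" unfolding q2(2)[symmetric] by simp
      then have "2 * of_nat (Suc k - i) * c i = (- 1) ^ i * pochhammer mu i / (fact i * (of_nat (q + 2) * fact q))"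
        unfolding c_def q2(1) f by (simp del: of_nat_Suc of_nat_add)
      then show ?thesis
        unfolding q_def[symmetric] PI_Dn_Qop[OF odd_testD(2)[OF Suc.prems(1)]] T_def q2(1) by simp
    qed
    have "(\<Sum>i\<le>k. (- 1) ^ i * pochhammer mu i / (fact i * fact (2 * k + 1 - 2 * i)) * PI (- 2 * mu - 2 * of_nat i) ((Dn ^^ (2 * k + 1 - 2 * i)) (Qop f)))
      = (\<Sum>i\<le>k. 2 * of_nat (Suc k - i) * c i * T i)"
      by (intro sum.cong refl) (rule t, simp)
    then show ?thesis
      by (simp only: sum.atMost_Suc diff_self_eq_0 of_nat_0 mult_zero_right mult_zero_left add_0_right)
  qed
  have "J (- of_nat (Suc k), b) f = mu * J (- of_nat k, b) f - b / 2 * J (- of_nat k, b + 1) (Qop f)"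
    using J_recursion[OF R Suc.prems(1), of "- of_nat (Suc k)" b] by (simp add: mu_def)
  also have "... = (- 1) ^ k * fact k * rGamma b * (mu * (\<Sum>i\<le>k. (- 1) ^ i * pochhammer (mu + 1) i / (fact i * fact (2 * k + 1 - 2 * i)) * PI (- 2 * (mu + 1) - 2 * of_nat i) ((Dn ^^ (2 * k + 1 - 2 * i)) f)))
     - (- 1) ^ k * fact k * (b * rGamma (b + 1)) * ((\<Sum>i\<le>k. (- 1) ^ i * pochhammer mu i / (fact i * fact (2 * k + 1 - 2 * i)) * PI (- 2 * mu - 2 * of_nat i) ((Dn ^^ (2 * k + 1 - 2 * i)) (Qop f))) / 2)"
    unfolding IH1 IH2 by (simp only: ac_simps times_divide_eq_left times_divide_eq_right)
  also have "b * rGamma (b + 1) = rGamma b" by (simp only: rGamma_shift[symmetric])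
  also have "(- 1) ^ k * fact k * rGamma b * (mu * (\<Sum>i\<le>k. (- 1) ^ i * pochhammer (mu + 1) i / (fact i * fact (2 * k + 1 - 2 * i)) * PI (- 2 * (mu + 1) - 2 * of_nat i) ((Dn ^^ (2 * k + 1 - 2 * i)) f)))
     - (- 1) ^ k * fact k * rGamma b * ((\<Sum>i\<le>k. (- 1) ^ i * pochhammer mu i / (fact i * fact (2 * k + 1 - 2 * i)) * PI (- 2 * mu - 2 * of_nat i) ((Dn ^^ (2 * k + 1 - 2 * i)) (Qop f))) / 2)
     = - ((- 1) ^ k * fact k * rGamma b * ((\<Sum>i\<le>Suc k. of_nat i * c i * T i) + (\<Sum>i\<le>Suc k. of_nat (Suc k - i) * c i * T i)))"
  proof -
    have "(\<Sum>i\<le>Suc k. 2 * of_nat (Suc k - i) * c i * T i) / 2 = (\<Sum>i\<le>Suc k. of_nat (Suc k - i) * c i * T i)"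
      unfolding sum_divide_distrib by (intro sum.cong refl) simp
    moreover have "x * (- A) - x * B = - (x * (A + B))" for x A B :: complex by (simp add: algebra_simps)
    ultimately show ?thesis unfolding S1 S2 by (simp only:)
  qed
  also have "(\<Sum>i\<le>Suc k. of_nat i * c i * T i) + (\<Sum>i\<le>Suc k. of_nat (Suc k - i) * c i * T i) = of_nat (Suc k) * (\<Sum>i\<le>Suc k. c i * T i)"
    unfolding sum.distrib[symmetric] sum_distrib_left
  proof (intro sum.cong refl)
    fix i assume "i \<in> {..Suc k}"
    then have "(of_nat i + of_nat (Suc k - i) :: complex) = of_nat (Suc k)" by (simp flip: of_nat_add)
    then show "of_nat i * c i * T i + of_nat (Suc k - i) * c i * T i = of_nat (Suc k) * (c i * T i)"
      by (metis distrib_right mult.assoc)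
  qed
  also have "- ((- 1) ^ k * fact k * rGamma b * (of_nat (Suc k) * (\<Sum>i\<le>Suc k. c i * T i))) =
    (- 1) ^ Suc k * fact (Suc k) * rGamma b * (\<Sum>i\<le>Suc k. c i * T i)" by simp
  finally have "J (- of_nat (Suc k), b) f = (- 1) ^ Suc k * fact (Suc k) * rGamma b * (\<Sum>i\<le>Suc k. c i * T i)" .
  moreover have "2 * Suc k + 1 = 2 * k + 3" by simp
  ultimately show ?case unfolding c_def T_def mu_def by (simp only:)
qed

lemma entire_eq_line:
  assumes "f holomorphic_on UNIV" "g holomorphic_on UNIV" "\<And>x::real. x > c \<Longrightarrow> f (of_real x) = g (of_real x)"
  shows "f z = g (z :: complex)"
proof -
  have hol: "(\<lambda>z. f z - g z) holomorphic_on UNIV" by (intro holomorphic_on_diff assms)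
  have lim: "complex_of_real (c + 1) islimpt (of_real ` {c<..})"
  proof (rule islimptI)
    fix T :: "complex set" assume "complex_of_real (c + 1) \<in> T" "open T"
    then obtain e where e: "e > 0" "ball (complex_of_real (c + 1)) e \<subseteq> T" using open_contains_ball by blast
    have "complex_of_real (c + 1 + e / 2) \<in> ball (of_real (c + 1)) e"
      using e by (simp add: dist_norm norm_minus_commute flip: of_real_diff of_real_add)
    moreover have "complex_of_real (c + 1 + e / 2) \<in> of_real ` {c<..}" using e by (intro imageI) auto
    moreover have "complex_of_real (c + 1 + e / 2) \<noteq> of_real (c + 1)" using e by (simp only: of_real_eq_iff)
    ultimately show "\<exists>y\<in>of_real ` {c<..}. y \<in> T \<and> y \<noteq> complex_of_real (c + 1)" using e by blast
  qed
  have "f z - g z = 0"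
  proof (rule analytic_continuation[OF hol _ _ _ _ lim])
    show "f w - g w = 0" if "w \<in> of_real ` {c<..}" for w using that assms(3) by auto
  qed auto
  then show ?thesis by simp
qed

lemma holo_J_line:
  assumes "R > 0" "f \<in> odd_test R"
  shows "(\<lambda>z. J (u * z + v, u' * z + v') f) holomorphic_on UNIV"
  by (rule holo2_on_line[OF holo2_J[OF assms]]) simp

section \<open>Residues at beta = -l: derivatives at the origin\<close>

lemma lipschitz_of_cbound:
  fixes f :: "'a::euclidean_space cfun"
  assumes "smooth f" "cbound 1 B f"
  shows "norm (f x - f y) \<le> real DIM('a) * B * norm (x - y)"
proof (rule differentiable_bound[of UNIV _ "\<lambda>y h. \<Sum>b\<in>Basis. (h \<bullet> b) *\<^sub>R pderiv_along b f y"])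
  fix y :: 'a
  show "(f has_derivative (\<lambda>h. \<Sum>b\<in>Basis. (h \<bullet> b) *\<^sub>R pderiv_along b f y)) (at y within UNIV)"
    using smooth_has_derivative[OF smooth_differentiable[OF assms(1)]] by simp
  show "onorm (\<lambda>h. \<Sum>b\<in>Basis. (h \<bullet> b) *\<^sub>R pderiv_along b f y) \<le> real DIM('a) * B"
  proof (rule onorm_le)
    fix h :: 'a
    have "norm (pderiv_along b f y) \<le> B" if "b \<in> Basis" for b using cboundD[OF assms(2), of "[b]" y] that by simp
    then have "norm (\<Sum>b\<in>Basis. (h \<bullet> b) *\<^sub>R pderiv_along b f y) \<le> (\<Sum>b\<in>(Basis::'a set). norm h * B)"
      by (intro sum_norm_le) (auto intro!: mult_mono Basis_le_norm simp: norm_scaleR)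
    then show "norm (\<Sum>b\<in>Basis. (h \<bullet> b) *\<^sub>R pderiv_along b f y) \<le> real DIM('a) * B * norm h" by (simp add: ac_simps)
  qed
qed auto

text \<open>The function x_n exp(-|x|^2) carries the linear Taylor term of \<open>f\<close>, and its
  kernel integral is known in closed form. The remainder is bounded by |x|^2 times a Gaussian on the
  whole space, so that its kernel integral can be estimated by the same formula.\<close>

lemma odd_test_minus_gauss_bound:
  fixes f :: "'m::finite space cfun"
  assumes R: "R > 0" and f: "f \<in> odd_test R"
  shows "\<exists>C\<ge>0. \<forall>x. norm (f x - Dn f 0 * of_real (snd x * exp (- (norm x)\<^sup>2))) \<le> C * ((norm x)\<^sup>2 * exp (- (norm x)\<^sup>2))"
proof -
  note D = odd_testD[OF f]
  define c where "c = Dn f 0"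
  obtain B where B: "cbound 2 B f" using ex_cbound[OF D(1)] by blast
  then have B1: "cbound 1 B (Dn f)" using cbound_pderiv[of 1 B f e_n] by (simp add: numeral_2_eq_2)
  define L where "L = real DIM('m space) * B"
  have L: "norm (Dn f y - c) \<le> L * norm y" for y
    using lipschitz_of_cbound[OF smooth_pderiv[OF D(2) e_n_Basis] B1, of y 0] by (simp add: c_def L_def)
  have L0: "L \<ge> 0" using cbound_nonneg[OF B] by (simp add: L_def)
  have psi: "norm (av (\<lambda>_. 1) (Dn f) x - c) \<le> L * norm x" for x
  proof -
    have i: "(\<lambda>s. 1 *\<^sub>R Dn f (scl 1 s x)) integrable_on {0..1}"
      by (rule av_integrable[OF smooth_pderiv[OF D(2) e_n_Basis]]) simp
    have "av (\<lambda>_. 1) (Dn f) x - c = integral {0..1} (\<lambda>s::real. 1 *\<^sub>R Dn f (scl 1 s x) - c)"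
      unfolding av_def using i by (subst integral_diff) auto
    also have "norm ... \<le> integral {0..1} (\<lambda>s::real. L * norm x)"
    proof (rule integral_norm_bound_integral)
      show "(\<lambda>s. 1 *\<^sub>R Dn f (scl 1 s x) - c) integrable_on {0..1}" using i by (intro integrable_diff) auto
      fix s :: real assume s: "s \<in> {0..1}"
      have "norm (scl 1 s x) \<le> norm x"
        unfolding norm_space using s by (intro real_sqrt_le_mono add_mono) (auto simp: scl_def power_mult_distrib intro!: mult_left_le_one_le power_le_one)
      then have "L * norm (scl 1 s x) \<le> L * norm x" using L0 by (intro mult_left_mono) auto
      then show "norm (1 *\<^sub>R Dn f (scl 1 s x) - c) \<le> L * norm x" using L[of "scl 1 s x"] by simp
    qed auto
    finally show ?thesis by simp
  qed
  have snd_le: "\<bar>snd x\<bar> \<le> norm x" for x :: "'m space" using norm_snd_le[of "snd x" "fst x"] by simp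
  \<comment> \<open>Inside the ball the first order remainder of \<open>f\<close> (constant L) and 1
    - exp(-|x|^2) <= |x|^2 enter, and exp(R^2) restores the Gaussian. Outside, \<open>f\<close>
    vanishes and |x_n| <= |x|^2 / R.\<close>
  define C where "C = (L + norm c * R) * exp (R\<^sup>2) + norm c / R"
  have "norm (f x - c * of_real (snd x * exp (- (norm x)\<^sup>2))) \<le> C * ((norm x)\<^sup>2 * exp (- (norm x)\<^sup>2))" for x
  proof (cases "norm x \<le> R")
    case True
    have "f x - c * of_real (snd x * exp (- (norm x)\<^sup>2)) =
       of_real (snd x) * (av (\<lambda>_. 1) (Dn f) x - c) + c * of_real (snd x * (1 - exp (- (norm x)\<^sup>2)))"
      using av_one_mult[OF D(2), of x] D(5) by (simp add: algebra_simps)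
    also have "norm ... \<le> norm x * (L * norm x) + norm c * (norm x * (norm x)\<^sup>2)"
    proof (rule norm_triangle_le[OF add_mono])
      show "norm (of_real (snd x) * (av (\<lambda>_. 1) (Dn f) x - c)) \<le> norm x * (L * norm x)"
        unfolding norm_mult norm_of_real by (intro mult_mono snd_le psi) auto
      have "1 - exp (- (norm x)\<^sup>2) \<le> (norm x)\<^sup>2" "exp (- (norm x)\<^sup>2) \<le> 1"
        using exp_ge_add_one_self[of "- (norm x)\<^sup>2"] by auto
      then have "\<bar>snd x * (1 - exp (- (norm x)\<^sup>2))\<bar> \<le> norm x * (norm x)\<^sup>2"
        unfolding abs_mult by (intro mult_mono snd_le) auto
      then show "norm (c * of_real (snd x * (1 - exp (- (norm x)\<^sup>2)))) \<le> norm c * (norm x * (norm x)\<^sup>2)"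
        unfolding norm_mult norm_of_real by (intro mult_left_mono) auto
    qed
    also have "... \<le> (L + norm c * R) * (norm x)\<^sup>2 * 1"
      using True mult_left_mono[OF True, of "norm c * (norm x)\<^sup>2"] by (simp add: power2_eq_square algebra_simps)
    also have "... \<le> (L + norm c * R) * (norm x)\<^sup>2 * (exp (R\<^sup>2) * exp (- (norm x)\<^sup>2))"
    proof (rule mult_left_mono)
      have "(norm x)\<^sup>2 \<le> R\<^sup>2" using True by (intro power_mono) auto
      then show "1 \<le> exp (R\<^sup>2) * exp (- (norm x)\<^sup>2)" by (simp flip: exp_add)
    qed (use L0 R in auto)
    also have "... \<le> C * ((norm x)\<^sup>2 * exp (- (norm x)\<^sup>2))"
      using R by (simp add: C_def algebra_simps)
    finally show ?thesis .
  next
    case False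
    then have "f x = 0" using testR_zero[OF D(1)] by simp
    then have "norm (f x - c * of_real (snd x * exp (- (norm x)\<^sup>2))) = norm c * (\<bar>snd x\<bar> * exp (- (norm x)\<^sup>2))"
      by (simp add: norm_mult)
    also have "... \<le> norm c * (norm x * (norm x / R) * exp (- (norm x)\<^sup>2))"
    proof (intro mult_left_mono mult_right_mono)
      have "norm x * 1 \<le> norm x * (norm x / R)" using False R by (intro mult_left_mono) auto
      then show "\<bar>snd x\<bar> \<le> norm x * (norm x / R)" using snd_le[of x] by simp
    qed auto
    also have "... = norm c / R * ((norm x)\<^sup>2 * exp (- (norm x)\<^sup>2))" by (simp add: power2_eq_square)
    also have "... \<le> C * ((norm x)\<^sup>2 * exp (- (norm x)\<^sup>2))"
      unfolding C_def using L0 R by (intro mult_right_mono) auto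
    finally show ?thesis .
  qed
  moreover have "C \<ge> 0" using L0 R by (simp add: C_def)
  ultimately show ?thesis unfolding c_def by blast
qed

lemma kernel_gauss_integral:
  assumes "a > - 1" "b < 0" "a + b + real CARD('m) + 1 > 0"
  shows "integrable lborel (\<lambda>x :: 'm::finite space. \<bar>snd x\<bar> powr a * norm x powr b * exp (- (norm x)\<^sup>2))"
    and "(\<integral>x. \<bar>snd x\<bar> powr a * norm x powr b * exp (- (norm x)\<^sup>2) \<partial>(lborel :: 'm space measure)) =
      Gamma ((a + 1) / 2) * pi powr (real CARD('m) / 2) * Gamma ((a + b + real CARD('m) + 1) / 2) / Gamma ((a + real CARD('m) + 1) / 2)"
proof -
  show "integrable lborel (\<lambda>x :: 'm::finite space. \<bar>snd x\<bar> powr a * norm x powr b * exp (- (norm x)\<^sup>2))"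
    by (rule integrableI_nonneg) (auto simp: nn_kernel_gauss[OF assms])
  have "Gamma ((a + 1) / 2) > 0" "Gamma ((a + b + real CARD('m) + 1) / 2) > 0" "Gamma ((a + real CARD('m) + 1) / 2) > 0"
    using assms by (intro Gamma_real_pos; simp)+
  then show "(\<integral>x. \<bar>snd x\<bar> powr a * norm x powr b * exp (- (norm x)\<^sup>2) \<partial>(lborel :: 'm space measure)) =
      Gamma ((a + 1) / 2) * pi powr (real CARD('m) / 2) * Gamma ((a + b + real CARD('m) + 1) / 2) / Gamma ((a + real CARD('m) + 1) / 2)"
    by (subst integral_eq_nn_integral) (simp_all add: nn_kernel_gauss[OF assms] less_imp_le)
qed

lemma ker_times_xn_real:
  "ker (of_real a) (of_real mu) x * of_real (snd x) = of_real (\<bar>snd x\<bar> powr (2 * a - 1) * norm x powr (- 2 * mu))"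
proof (cases "snd x = 0")
  case False
  then have x: "x \<noteq> 0" by auto
  have "ker (of_real a) (of_real mu) x * of_real (snd x) = of_real (sgn (snd x) * exp ((2 * a - 2) * ln \<bar>snd x\<bar> - mu * ln ((norm x)\<^sup>2)) * snd x)"
    unfolding ker_def by (simp add: exp_of_real[symmetric])
  also have "sgn (snd x) * exp ((2 * a - 2) * ln \<bar>snd x\<bar> - mu * ln ((norm x)\<^sup>2)) * snd x = \<bar>snd x\<bar> powr (2 * a - 1) * norm x powr (- 2 * mu)"
  proof -
    have "sgn (snd x) * snd x = \<bar>snd x\<bar>" by (simp add: sgn_if abs_if)
    then have "sgn (snd x) * exp ((2 * a - 2) * ln \<bar>snd x\<bar> - mu * ln ((norm x)\<^sup>2)) * snd x = exp (ln \<bar>snd x\<bar>) * exp ((2 * a - 2) * ln \<bar>snd x\<bar> - mu * ln ((norm x)\<^sup>2))"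
      using False by (simp add: mult.commute mult.left_commute)
    also have "... = \<bar>snd x\<bar> powr (2 * a - 1) * norm x powr (- 2 * mu)"
      using False x unfolding powr_def exp_add[symmetric] by (simp add: ln_realpow exp_add[symmetric] algebra_simps)
    finally show ?thesis .
  qed
  finally show ?thesis .
qed simp

text \<open>As beta tends to 0 from the right, the Gaussian part has Gamma(beta) as a factor, which
  cancels against 1/Gamma(beta). The remainder integral stays bounded, so 1/Gamma(beta) sends it to
  0.\<close>

lemma J_Y0_real:
  fixes f :: "'m::finite space cfun"
  assumes R: "R > 0" and f: "f \<in> odd_test R" and a: "a > 2"
  shows "J (of_real a, 0) f = of_real (pi powr (real CARD('m) / 2)) * rGamma (of_real a + hdim TYPE('m)) * Dn f 0"
proof -
  define d where "d = real CARD('m)"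
  have d: "d \<ge> 1" unfolding d_def using zero_less_card_finite[where 'a = 'm] by linarith
  have hd: "hdim TYPE('m) = of_real (d / 2)" by (simp add: d_def)
  define c where "c = Dn f 0"
  define gs where "gs = (\<lambda>x :: 'm space. snd x * exp (- (norm x)\<^sup>2))"
  obtain C where C: "C \<ge> 0" "\<And>x. norm (f x - c * of_real (gs x)) \<le> C * ((norm x)\<^sup>2 * exp (- (norm x)\<^sup>2))"
    using odd_test_minus_gauss_bound[OF R f] unfolding c_def gs_def by blast
  define K where "K = (\<lambda>b. Gamma ((2 * a - 2 + 1) / 2) * pi powr (d / 2) * Gamma ((2 * b + 1) / 2) / Gamma ((2 * a - 2 + d + 1) / 2))"
  define lim where "lim = of_real (pi powr (d / 2)) * rGamma (of_real (a + d / 2)) * c"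
  have est: "norm (J (of_real a, of_real b) f - lim) \<le> norm (rGamma (complex_of_real a)) * (C * (\<bar>rGamma b\<bar> * K b))" if b: "0 < b" "b < 1" for b
  proof -
    define mu where "mu = a - b + d / 2"
    \<comment> \<open>The Gaussian formula is used with the exponents -2 mu and 2 - 2 mu, and both
      have to be negative; the bound a > 2 ensures this.\<close>
    have mu: "mu > 1" using a b d by (simp add: mu_def)
    have cm: "complex_of_real a - of_real b + hdim TYPE('m) = of_real mu" by (simp add: mu_def hd)
    let ?k = "ker (of_real a) (of_real mu)"
    have e1: "2 * a - 1 + - 2 * mu + d + 1 = 2 * b" "2 * a - 2 + (2 - 2 * mu) + d + 1 = 2 * b + 1" by (simp_all add: mu_def)
    note g1 = kernel_gauss_integral[of "2 * a - 1" "- 2 * mu", where 'm = 'm, folded d_def, unfolded e1]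
    note g2 = kernel_gauss_integral[of "2 * a - 2" "2 - 2 * mu", where 'm = 'm, folded d_def, unfolded e1]
    have kg: "?k x * of_real (gs x) = of_real (\<bar>snd x\<bar> powr (2 * a - 1) * norm x powr (- 2 * mu) * exp (- (norm x)\<^sup>2))" for x
      using ker_times_xn_real[of a mu x] unfolding gs_def of_real_mult by (simp only: mult.assoc[symmetric])
    have ig: "integrable lborel (\<lambda>x. ?k x * of_real (gs x))"
      unfolding kg by (intro integrable_of_real g1) (use a b mu in auto)
    have Ig: "(\<integral>x. ?k x * of_real (gs x) \<partial>lborel) = of_real (Gamma a * pi powr (d / 2) * Gamma b / Gamma (a + d / 2))"
    proof -
      have "(\<integral>x. ?k x * of_real (gs x) \<partial>lborel) = complex_of_real (Gamma ((2 * a - 1 + 1) / 2) * pi powr (d / 2) * Gamma (2 * b / 2) / Gamma ((2 * a - 1 + d + 1) / 2))"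
        unfolding kg integral_complex_of_real by (subst g1(2)) (use a b mu in auto)
      moreover have "(2 * a - 1 + d + 1) / 2 = a + d / 2" by simp
      moreover have "(2 * a - 1 + 1) / 2 = a" "2 * b / 2 = b" by simp_all
      ultimately show ?thesis by (simp only:)
    qed
    have kf: "integrable lborel (\<lambda>x. ?k x * f x)"
      using Ip_odd_test_integrable[of "(of_real a, of_real b)" 0 f R] f R a b cm by simp
    let ?r = "\<lambda>x. ?k x * (f x - c * of_real (gs x))"
    have ir: "integrable lborel ?r"
      using Bochner_Integration.integrable_diff[OF kf integrable_mult_right[OF ig, of c]] by (simp add: algebra_simps)
    have Ir: "norm (\<integral>x. ?r x \<partial>lborel) \<le> C * K b"
    proof -
      have le: "norm (?r x) \<le> C * (\<bar>snd x\<bar> powr (2 * a - 2) * norm x powr (2 - 2 * mu) * exp (- (norm x)\<^sup>2))" for x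
      proof (cases "x = 0")
        case False
        have "(norm x)\<^sup>2 = norm x powr 2" using False by simp
        moreover have "norm x powr 2 * norm x powr (- 2 * mu) = norm x powr (2 - 2 * mu)"
          by (simp only: powr_add[symmetric]) simp
        ultimately have p: "norm x powr (- 2 * mu) * (norm x)\<^sup>2 = norm x powr (2 - 2 * mu)" by (simp only: mult.commute)
        have "norm (?r x) \<le> (\<bar>snd x\<bar> powr (2 * a - 2) * norm x powr (- 2 * mu)) * (C * ((norm x)\<^sup>2 * exp (- (norm x)\<^sup>2)))"
          unfolding norm_mult using norm_ker_le[of "of_real a" "of_real mu" x] by (intro mult_mono C(2)) auto
        then show ?thesis unfolding p[symmetric] by (simp only: ac_simps)
      qed (simp add: ker_def)
      have "norm (\<integral>x. ?r x \<partial>lborel) \<le> (\<integral>x. norm (?r x) \<partial>lborel)" by (rule integral_norm_bound)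
      also have "... \<le> (\<integral>x. C * (\<bar>snd x\<bar> powr (2 * a - 2) * norm x powr (2 - 2 * mu) * exp (- (norm x)\<^sup>2)) \<partial>(lborel :: 'm space measure))"
      proof (rule integral_mono[OF integrable_norm[OF ir] _ le])
        show "integrable lborel (\<lambda>x :: 'm space. C * (\<bar>snd x\<bar> powr (2 * a - 2) * norm x powr (2 - 2 * mu) * exp (- (norm x)\<^sup>2)))"
          by (rule integrable_mult_right, rule g2(1)) (use a b mu in auto)
      qed
      also have "... = C * K b" unfolding K_def by (subst integral_mult_right_zero, subst g2(2)) (use a b mu in auto)
      finally show ?thesis .
    qed
    have "II (of_real a) (of_real mu) f = c * (\<integral>x. ?k x * of_real (gs x) \<partial>lborel) + (\<integral>x. ?r x \<partial>lborel)"
    proof -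
      have "c * (\<integral>x. ?k x * of_real (gs x) \<partial>lborel) + (\<integral>x. ?r x \<partial>lborel) = (\<integral>x. c * (?k x * of_real (gs x)) + ?r x \<partial>lborel)"
        using ig ir by simp
      also have "... = II (of_real a) (of_real mu) f" unfolding II_def by (intro Bochner_Integration.integral_cong refl) (simp add: algebra_simps)
      finally show ?thesis by simp
    qed
    then have "J (of_real a, of_real b) f = rGamma (of_real a) * rGamma (of_real b) * (c * (\<integral>x. ?k x * of_real (gs x) \<partial>lborel)) + rGamma (of_real a) * rGamma (of_real b) * (\<integral>x. ?r x \<partial>lborel)"
      using J_base[OF R f, of "of_real a" "of_real b"] a b by (simp add: cm distrib_left)
    also have "rGamma (of_real a) * rGamma (of_real b) * (c * (\<integral>x. ?k x * of_real (gs x) \<partial>lborel)) = lim"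
    proof -
      have "Gamma a \<noteq> 0" "Gamma b \<noteq> 0"
        by (rule less_imp_neq[OF Gamma_real_pos, symmetric]; use a b in simp)+
      then show ?thesis unfolding Ig lim_def rGamma_complex_of_real by (simp add: rGamma_inverse_Gamma field_simps)
    qed
    finally have "J (of_real a, of_real b) f - lim = rGamma (of_real a) * rGamma (of_real b) * (\<integral>x. ?r x \<partial>lborel)" by simp
    then have "norm (J (of_real a, of_real b) f - lim) = norm (rGamma (complex_of_real a)) * (\<bar>rGamma b\<bar> * norm (\<integral>x. ?r x \<partial>lborel))"
      by (simp only: norm_mult rGamma_complex_of_real norm_of_real mult.assoc)
    also have "... \<le> norm (rGamma (complex_of_real a)) * (\<bar>rGamma b\<bar> * (C * K b))"
      by (intro mult_left_mono Ir) auto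
    finally show ?thesis by (simp only: ac_simps)
  qed
  have "((\<lambda>b. norm (rGamma (complex_of_real a)) * (C * (\<bar>rGamma b\<bar> * K b))) \<longlongrightarrow> norm (rGamma (complex_of_real a)) * (C * (\<bar>rGamma (0::real)\<bar> * K 0))) (at_right 0)"
  proof -
    have "isCont (rGamma :: real \<Rightarrow> real) 0" by (intro isCont_rGamma continuous_ident)
    then have 1: "(rGamma \<longlongrightarrow> rGamma (0::real)) (at_right 0)"
      by (rule isCont_tendsto_compose[OF _ tendsto_ident_at])
    have "isCont (\<lambda>b::real. Gamma ((2 * b + 1) / 2)) 0"
      by (intro isCont_Gamma continuous_intros) (auto dest: nonpos_Ints_nonpos)
    then have 2: "((\<lambda>b::real. Gamma ((2 * b + 1) / 2)) \<longlongrightarrow> Gamma ((2 * 0 + 1) / 2)) (at_right 0)"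
      by (rule isCont_tendsto_compose[OF _ tendsto_ident_at])
    have "Gamma ((2 * a - 2 + d + 1) / 2) \<noteq> 0"
      by (rule less_imp_neq[OF Gamma_real_pos, symmetric]) (use a d in simp)
    then show ?thesis unfolding K_def by (intro tendsto_intros 1 2)
  qed
  then have t0: "((\<lambda>b. norm (rGamma (complex_of_real a)) * (C * (\<bar>rGamma b\<bar> * K b))) \<longlongrightarrow> 0) (at_right 0)" by simp
  have l1: "((\<lambda>b. J (of_real a, of_real b) f) \<longlongrightarrow> lim) (at_right 0)"
  proof (rule LIM_zero_cancel, rule Lim_null_comparison[OF _ t0])
    show "\<forall>\<^sub>F b in at_right 0. norm (J (of_real a, of_real b) f - lim) \<le> norm (rGamma (complex_of_real a)) * (C * (\<bar>rGamma b\<bar> * K b))"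
      unfolding eventually_at_right_field by (intro exI[of _ 1] conjI allI impI est) auto
  qed
  have l2: "((\<lambda>b. J (of_real a, of_real b) f) \<longlongrightarrow> J (of_real a, of_real 0) f) (at_right 0)"
  proof -
    have "continuous_on UNIV (\<lambda>z. J (0 * z + of_real a, 1 * z + 0) f)"
      by (rule holomorphic_on_imp_continuous_on[OF holo_J_line[OF R f]])
    then have "isCont (\<lambda>z. J (of_real a, z) f) (of_real 0)" by (simp add: continuous_on_eq_continuous_at)
    moreover have "((\<lambda>b. complex_of_real b) \<longlongrightarrow> of_real 0) (at_right 0)" by (intro tendsto_intros)
    ultimately show ?thesis by (rule isCont_tendsto_compose)
  qed
  have "J (of_real a, of_real 0) f = lim"
    by (rule tendsto_unique[OF trivial_limit_at_right_real l2 l1])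
  moreover have e: "complex_of_real (a + d / 2) = of_real a + hdim TYPE('m)" unfolding hd by simp
  ultimately show ?thesis unfolding lim_def c_def e unfolding d_def by simp
qed

lemma J_Y0:
  fixes f :: "'m::finite space cfun"
  assumes R: "R > 0" and f: "f \<in> odd_test R"
  shows "J (a, 0) f = of_real (pi powr (real CARD('m) / 2)) * rGamma (a + hdim TYPE('m)) * Dn f 0"
proof -
  have "(\<lambda>z. J (1 * z + 0, 0 * z + 0) f) holomorphic_on UNIV" by (rule holo_J_line[OF R f])
  then have 1: "(\<lambda>z. J (z, 0) f) holomorphic_on UNIV" by simp
  show ?thesis
    by (rule entire_eq_line[of "\<lambda>z. J (z, 0) f" _ 2, OF 1]) (use J_Y0_real[OF R f] in \<open>auto intro!: holomorphic_intros\<close>)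
qed

section \<open>The Laplacian in x' and the functionals carried by the origin\<close>

definition Lp :: "'m::finite space cfun \<Rightarrow> 'm space cfun" where
  "Lp f x = (\<Sum>b\<in>(Basis :: (real ^ 'm) set). pderiv_along (b, 0) (pderiv_along (b, 0) f) x)"

lemma Basis_fst [simp]: "b \<in> Basis \<Longrightarrow> (b, 0) \<in> (Basis :: 'm::finite space set)"
  by (auto simp: Basis_prod_def)

lemma sum_Basis_space:
  "(\<Sum>b\<in>(Basis :: 'm::finite space set). g b) = (\<Sum>b\<in>Basis. g (b, 0)) + g e_n" for g :: "_ \<Rightarrow> complex"
proof -
  have B: "(Basis :: 'm space set) = (\<lambda>b. (b, 0)) ` Basis \<union> {e_n}" by (auto simp: Basis_prod_def)
  have "(0, 1) \<notin> (\<lambda>b :: real ^ 'm. (b, 0 :: real)) ` Basis" by auto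
  then show ?thesis unfolding B
    by (subst sum.union_disjoint) (auto simp: sum.reindex inj_on_def)
qed

lemma smooth_Lp: "smooth f \<Longrightarrow> smooth (Lp f)"
  unfolding Lp_def by (intro smooth_sum smooth_pderiv) auto

lemma smooth_Lp_power: "smooth f \<Longrightarrow> smooth ((Lp ^^ j) f)"
  by (induction j) (auto intro: smooth_Lp)

lemma smooth_Dn_power: "smooth f \<Longrightarrow> smooth ((Dn ^^ j) f)"
  by (induction j) (auto intro: smooth_pderiv)

lemma pderiv2_add:
  "smooth f \<Longrightarrow> smooth g \<Longrightarrow> b \<in> Basis \<Longrightarrow>
   pderiv_along b (pderiv_along b (\<lambda>x. f x + g x)) = (\<lambda>x. pderiv_along b (pderiv_along b f) x + pderiv_along b (pderiv_along b g) x)"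
  using pderivs_add[of f g "[b, b]"] by simp

lemma Lp_add: "smooth f \<Longrightarrow> smooth g \<Longrightarrow> Lp (\<lambda>x. f x + g x) = (\<lambda>x. Lp f x + Lp g x)"
  by (auto simp: Lp_def pderiv2_add sum.distrib intro!: ext)

lemma Lp_cmult: "smooth f \<Longrightarrow> Lp (\<lambda>x. c * f x) = (\<lambda>x. c * Lp f x)"
proof -
  assume f: "smooth f"
  have "pderiv_along b (pderiv_along b (\<lambda>x. c * f x)) = (\<lambda>x. c * pderiv_along b (pderiv_along b f) x)" if "b \<in> Basis" for b
    using pderivs_cmult[OF f, of "[b, b]" c] that by simp
  then show ?thesis by (auto simp: Lp_def sum_distrib_left intro!: ext)
qed

lemma Dn_power_add: "smooth f \<Longrightarrow> smooth g \<Longrightarrow> (Dn ^^ m) (\<lambda>x. f x + g x) = (\<lambda>x. (Dn ^^ m) f x + (Dn ^^ m) g x)"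
  by (induction m) (auto intro!: ext pderiv_along_add smooth_differentiable smooth_Dn_power)

lemma Dn_power_cmult: "smooth f \<Longrightarrow> (Dn ^^ m) (\<lambda>x. c * f x) = (\<lambda>x. c * (Dn ^^ m) f x)"
  by (induction m) (auto intro!: ext pderiv_along_cmult smooth_differentiable smooth_Dn_power)

lemma Lp_power_add: "smooth f \<Longrightarrow> smooth g \<Longrightarrow> (Lp ^^ m) (\<lambda>x. f x + g x) = (\<lambda>x. (Lp ^^ m) f x + (Lp ^^ m) g x)"
  by (induction m) (auto simp: Lp_add smooth_Lp_power)

lemma Lp_power_cmult: "smooth f \<Longrightarrow> (Lp ^^ m) (\<lambda>x. c * f x) = (\<lambda>x. c * (Lp ^^ m) f x)"
  by (induction m) (auto simp: Lp_cmult smooth_Lp_power)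

lemma Lp_pderiv:
  assumes "smooth f" "c \<in> Basis" shows "Lp (pderiv_along c f) = pderiv_along c (Lp f)"
proof
  fix x
  have "pderiv_along (b, 0) (pderiv_along (b, 0) (pderiv_along c f)) = pderiv_along c (pderiv_along (b, 0) (pderiv_along (b, 0) f))" if "b \<in> Basis" for b
    using that assms by (simp add: pderiv_commute[of _ "(b, 0)" c] smooth_pderiv)
  then show "Lp (pderiv_along c f) x = pderiv_along c (Lp f) x"
    unfolding Lp_def using assms
    by (subst pderiv_along_sum) (auto intro!: smooth_differentiable smooth_pderiv)
qed

lemma Lp_power_Dn: "smooth f \<Longrightarrow> (Lp ^^ j) (Dn f) = Dn ((Lp ^^ j) f)"
  by (induction j) (auto simp: Lp_pderiv smooth_Lp_power)

text \<open>The average in \<open>Qop\<close> runs in x_n only, so derivatives in x' pass through it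
  without changing the weight.\<close>

lemma Lp_Qop:
  fixes f :: "'m::finite space cfun"
  assumes f: "smooth f" shows "Lp (Qop f) = Qop (Lp f)"
proof
  fix x :: "'m space"
  note s = smooth_pderiv[OF f] smooth_pderiv[OF smooth_pderiv[OF f]]
  note s4 = smooth_pderiv[OF smooth_pderiv[OF s(2)]]
  have sc: "scl_coeff 1 s (b, 0) = 1" for s and b :: "real ^ 'm" by (simp add: scl_coeff_def)
  have p: "pderiv_along (b, 0) (av (\<lambda>s. s) g) = av (\<lambda>s. s) (pderiv_along (b, 0) g)" if "smooth g" "b \<in> Basis" for g and b :: "real ^ 'm"
    using that by (intro ext, subst av_has_pderiv(2)) (auto simp: sc intro!: continuous_intros)
  have c: "pderiv_along (b, 0) (pderiv_along (b, 0) (Dn (Dn f))) = Dn (Dn (pderiv_along (b, 0) (pderiv_along (b, 0) f)))"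
    if b: "b \<in> Basis" for b :: "real ^ 'm"
    using f b by (simp add: pderiv_commute[of _ "(b, 0)" e_n] smooth_pderiv)
  have "Lp (Qop f) x = (\<Sum>b\<in>Basis. av (\<lambda>s. s) (pderiv_along (b, 0) (pderiv_along (b, 0) (Dn (Dn f)))) x)"
    unfolding Lp_def Qop_def using f by (intro sum.cong refl) (simp add: p smooth_pderiv)
  also have "... = av (\<lambda>s. s) (\<lambda>x. \<Sum>b\<in>Basis. Dn (Dn (pderiv_along (b, 0) (pderiv_along (b, 0) f))) x) x"
    unfolding av_def scaleR_sum_right using f
    by (subst integral_sum) (auto simp: c intro!: av_integrable smooth_pderiv continuous_intros)
  also have "(\<lambda>x. \<Sum>b\<in>Basis. Dn (Dn (pderiv_along (b, 0) (pderiv_along (b, 0) f))) x) = Dn (Dn (Lp f))"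
  proof
    fix x
    have "Dn (Lp f) = (\<lambda>x. \<Sum>b\<in>Basis. Dn (pderiv_along (b, 0) (pderiv_along (b, 0) f)) x)"
      unfolding Lp_def[abs_def] using f by (intro ext pderiv_along_sum) (auto intro!: smooth_differentiable smooth_pderiv)
    then show "(\<Sum>b\<in>Basis. Dn (Dn (pderiv_along (b, 0) (pderiv_along (b, 0) f))) x) = Dn (Dn (Lp f)) x"
      using f by (subst pderiv_along_sum[symmetric]) (auto intro!: smooth_differentiable smooth_pderiv)
  qed
  finally show "Lp (Qop f) x = Qop (Lp f) x" by (simp add: Qop_def)
qed

lemma smooth_Qop: "smooth f \<Longrightarrow> smooth (Qop f)"
  unfolding Qop_def by (intro smooth_av smooth_pderiv e_n_Basis continuous_intros)

lemma Lp_power_Qop: "smooth f \<Longrightarrow> (Lp ^^ j) (Qop f) = Qop ((Lp ^^ j) f)"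
  by (induction j) (auto simp: Lp_Qop smooth_Lp_power)

lemma Lop_eq: "Lop a f = (\<lambda>x. Lp f x + (Dn (Dn f) x + (2 * a - 3) * Qop f x))"
  by (auto simp: Lop_def Lp_def sum_Basis_space add.assoc intro!: ext)

definition DD :: "nat \<Rightarrow> nat \<Rightarrow> 'm::finite space cfun \<Rightarrow> complex" where
  "DD j m f = (Dn ^^ m) ((Lp ^^ j) f) 0"

text \<open>By \<open>Dn_power_Qop\<close> the operator \<open>Qop\<close> acts at the origin as two
  normal derivatives divided by m + 2, and 1 + (2a - 3) / (m + 2) is the coefficient stated.\<close>

lemma DD_Lop:
  assumes f: "smooth f"
  shows "DD j m (Lop a f) = DD (Suc j) m f + (of_nat m + 2 * a - 1) / of_nat (m + 2) * DD j (m + 2) f"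
proof -
  note s = smooth_Lp[OF f] smooth_pderiv[OF smooth_pderiv[OF f e_n_Basis] e_n_Basis] smooth_Qop[OF f]
  let ?g = "(Lp ^^ j) f"
  have g: "smooth ?g" by (rule smooth_Lp_power[OF f])
  note sg = smooth_Lp[OF g] smooth_pderiv[OF smooth_pderiv[OF g e_n_Basis] e_n_Basis] smooth_Qop[OF g]
  have "(Lp ^^ j) (Lop a f) = (\<lambda>x. Lp ?g x + (Dn (Dn ?g) x + (2 * a - 3) * Qop ?g x))"
    unfolding Lop_eq using f s
    by (simp add: Lp_power_add smooth_add smooth_cmult Lp_power_cmult Lp_power_Dn Lp_power_Qop smooth_pderiv funpow_swap1)
  then have "(Dn ^^ m) ((Lp ^^ j) (Lop a f)) = (\<lambda>x. (Dn ^^ m) (Lp ?g) x + ((Dn ^^ m) (Dn (Dn ?g)) x + (2 * a - 3) * (Dn ^^ m) (Qop ?g) x))"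
    using sg by (simp add: Dn_power_add smooth_add smooth_cmult Dn_power_cmult)
  then have "DD j m (Lop a f) = DD (Suc j) m f + (DD j (m + 2) f + (2 * a - 3) * (DD j (m + 2) f / of_nat (m + 2)))"
    unfolding DD_def using Dn_power_Qop[OF g, of m 0] by (simp add: funpow_swap1 zero_prod_def)
  also have "DD j (m + 2) f + (2 * a - 3) * (DD j (m + 2) f / of_nat (m + 2)) = (of_nat m + 2 * a - 1) / of_nat (m + 2) * DD j (m + 2) f"
  proof -
    have "(of_nat (m + 2) :: complex) \<noteq> 0" by (simp only: of_nat_eq_0_iff)
    then show ?thesis by (simp add: field_simps)
  qed
  finally show ?thesis .
qed

text \<open>Up to the factor -4^l this is the pairing with \<open>KC_tilde l nu\<close> for nu = a +
  l, see \<open>KC_eq\<close>.\<close>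

definition YY :: "nat \<Rightarrow> complex \<Rightarrow> 'm::finite space cfun \<Rightarrow> complex" where
  "YY l a f = (\<Sum>j\<le>l. pochhammer a (l - j) / (4 ^ j * fact j * fact (2 * (l - j) + 1)) * DD j (2 * (l - j) + 1) f)"

text \<open>The two terms of \<open>DD_Lop\<close> contribute 4j and 4(l + 1 - j) times the j-th
  summand of \<open>YY (Suc l) a f\<close>.\<close>

lemma YY_Lop:
  assumes f: "smooth f"
  shows "YY l a (Lop a f) = 4 * of_nat (Suc l) * YY (Suc l) a f"
proof -
  define T where "T = (\<lambda>j. DD j (2 * (Suc l - j) + 1) f)"
  define e where "e = (\<lambda>j. pochhammer a (Suc l - j) / (4 ^ j * fact j * fact (2 * (Suc l - j) + 1)) :: complex)"
  have t: "pochhammer a (l - j) / (4 ^ j * fact j * fact (2 * (l - j) + 1)) * DD j (2 * (l - j) + 1) (Lop a f)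
     = 4 * of_nat (Suc j) * e (Suc j) * T (Suc j) + 4 * of_nat (Suc l - j) * e j * T j" if j: "j \<le> l" for j
  proof -
    define q where "q = l - j"
    have q: "Suc l - j = Suc q" "Suc l - Suc j = q" using j by (auto simp: q_def)
    have m3: "2 * q + 1 + 2 = 2 * Suc q + 1" by simp
    have A: "pochhammer a q / (4 ^ j * fact j * fact (2 * q + 1)) * DD (Suc j) (2 * q + 1) f = 4 * of_nat (Suc j) * e (Suc j) * T (Suc j)"
      unfolding e_def T_def q by (simp add: field_simps del: of_nat_Suc)
    have n1: "(of_nat (2 * q + 3) :: complex) \<noteq> 0" "(of_nat (2 * q + 2) :: complex) \<noteq> 0" by (simp_all only: of_nat_eq_0_iff)
    have fq: "fact (2 * Suc q + 1) = (of_nat (2 * q + 3) * (of_nat (2 * q + 2) * fact (2 * q + 1)) :: complex)"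
    proof -
      have "2 * Suc q + 1 = Suc (Suc (2 * q + 1))" by simp
      then show ?thesis by (simp only: fact_Suc) (simp add: algebra_simps)
    qed
    have p: "pochhammer a (Suc q) = pochhammer a q * (a + of_nat q)" by (rule pochhammer_Suc)
    have "pochhammer a q / (4 ^ j * fact j * fact (2 * q + 1)) * ((of_nat (2 * q + 1) + 2 * a - 1) / of_nat (2 * q + 1 + 2)) = 4 * of_nat (Suc q) * e j"
    proof -
      have u: "of_nat (2 * q + 1) + 2 * a - 1 = 2 * (a + of_nat q)" "2 * q + 1 + 2 = 2 * q + 3" by (simp_all add: algebra_simps)
      have v: "4 * of_nat (Suc q) = (2 * of_nat (2 * q + 2) :: complex)" by (simp add: algebra_simps)
      show ?thesis unfolding u v e_def q p fq using n1 by (simp add: field_simps del: of_nat_add of_nat_mult of_nat_Suc)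
    qed
    then have B: "pochhammer a q / (4 ^ j * fact j * fact (2 * q + 1)) * ((of_nat (2 * q + 1) + 2 * a - 1) / of_nat (2 * q + 1 + 2) * DD j (2 * q + 1 + 2) f) = 4 * of_nat (Suc l - j) * e j * T j"
      unfolding T_def q m3 by (simp only: mult.assoc[symmetric])
    show ?thesis unfolding q_def[symmetric] DD_Lop[OF f] distrib_left A B ..
  qed
  have "YY l a (Lop a f) = (\<Sum>j\<le>l. 4 * of_nat (Suc j) * e (Suc j) * T (Suc j) + 4 * of_nat (Suc l - j) * e j * T j)"
    unfolding YY_def by (intro sum.cong refl t) auto
  also have "... = (\<Sum>j\<le>l. 4 * of_nat (Suc j) * e (Suc j) * T (Suc j)) + (\<Sum>j\<le>l. 4 * of_nat (Suc l - j) * e j * T j)"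
    by (rule sum.distrib)
  also have "(\<Sum>j\<le>l. 4 * of_nat (Suc j) * e (Suc j) * T (Suc j)) = (\<Sum>j\<le>Suc l. 4 * of_nat j * e j * T j)"
    by (subst sum.atMost_Suc_shift) simp
  also have "(\<Sum>j\<le>l. 4 * of_nat (Suc l - j) * e j * T j) = (\<Sum>j\<le>Suc l. 4 * of_nat (Suc l - j) * e j * T j)"
    by (simp only: sum.atMost_Suc diff_self_eq_0 of_nat_0 mult_zero_right mult_zero_left add_0_right)
  also have "(\<Sum>j\<le>Suc l. 4 * of_nat j * e j * T j) + (\<Sum>j\<le>Suc l. 4 * of_nat (Suc l - j) * e j * T j) = (\<Sum>j\<le>Suc l. 4 * of_nat (Suc l) * (e j * T j))"
    unfolding sum.distrib[symmetric]
  proof (intro sum.cong refl)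
    fix j assume "j \<in> {..Suc l}"
    then have s: "(of_nat (Suc l) :: complex) = of_nat j + of_nat (Suc l - j)" by (simp flip: of_nat_add)
    show "4 * of_nat j * e j * T j + 4 * of_nat (Suc l - j) * e j * T j = 4 * of_nat (Suc l) * (e j * T j)"
      unfolding s by (simp only: distrib_left distrib_right mult.assoc)
  qed
  also have "... = 4 * of_nat (Suc l) * YY (Suc l) a f"
    unfolding sum_distrib_left[symmetric] YY_def e_def T_def ..
  finally show ?thesis .
qed

lemma holo_pochhammer: "(\<lambda>z. pochhammer (z + c) n) holomorphic_on (S :: complex set)"
  unfolding pochhammer_prod by (intro holomorphic_intros)

text \<open>Induction on l: \<open>J_Lop\<close> at beta = -(l + 1) leads back to beta = -l, and
  \<open>YY_Lop\<close> evaluates the functional found there on \<open>Lop a f\<close>.\<close>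

lemma J_Y:
  fixes f :: "'m::finite space cfun"
  assumes R: "R > 0"
  shows "f \<in> odd_test R \<Longrightarrow> J (a, - of_nat l) f =
    (- 1) ^ l * fact l * of_real (pi powr (real CARD('m) / 2)) * rGamma (a + of_nat l + hdim TYPE('m)) * YY l a f"
proof (induction l arbitrary: a f)
  case 0
  then show ?case using J_Y0[OF R 0, of a] by (simp add: YY_def DD_def)
next
  case (Suc l)
  let ?P = "complex_of_real (pi powr (real CARD('m) / 2))"
  let ?rhs = "\<lambda>a. (- 1) ^ Suc l * fact (Suc l) * ?P * rGamma (a + of_nat (Suc l) + hdim TYPE('m)) * YY (Suc l) a f"
  \<comment> \<open>In \<open>J_Lop\<close> the factor 1 - mu equals -(a + l + (n - 1)/2) and has to
    be divided out. The single excluded value of a is recovered at the end by analytic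
    continuation.\<close>
  have eq: "J (a, - of_nat (Suc l)) f = ?rhs a" if nz: "a + of_nat l + hdim TYPE('m) \<noteq> 0" for a
  proof -
    define w where "w = a + of_nat l + hdim TYPE('m)"
    have "J (a, - of_nat (Suc l) + 1) (Lop a f) = 4 * (1 - (a - (- of_nat (Suc l)) + hdim TYPE('m))) * J (a, - of_nat (Suc l)) f"
      by (rule J_Lop[OF R Suc.prems])
    moreover have "1 - (a - (- of_nat (Suc l)) + hdim TYPE('m)) = - w" by (simp add: w_def)
    moreover have "- of_nat (Suc l) + 1 = (- of_nat l :: complex)" by simp
    moreover have "J (a, - of_nat l) (Lop a f) = (- 1) ^ l * fact l * ?P * rGamma w * (4 * of_nat (Suc l) * YY (Suc l) a f)"
      unfolding w_def using Suc.IH[OF Lop_odd_test[OF Suc.prems]] YY_Lop[OF odd_testD(2)[OF Suc.prems]] by simp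
    moreover have "rGamma w = w * rGamma (w + 1)" by (rule rGamma_shift)
    ultimately have "4 * (- w) * J (a, - of_nat (Suc l)) f = (- 1) ^ l * fact l * ?P * (w * rGamma (w + 1)) * (4 * of_nat (Suc l) * YY (Suc l) a f)"
      by metis
    also have "... = 4 * (- w) * ((- 1) ^ Suc l * (of_nat (Suc l) * fact l) * ?P * rGamma (w + 1) * YY (Suc l) a f)"
      by (simp del: of_nat_Suc)
    finally have "J (a, - of_nat (Suc l)) f = (- 1) ^ Suc l * (of_nat (Suc l) * fact l) * ?P * rGamma (w + 1) * YY (Suc l) a f"
      using nz by (simp only: w_def[symmetric] mult_cancel_left) simp
    moreover have "w + 1 = a + of_nat (Suc l) + hdim TYPE('m)" by (simp add: w_def)
    ultimately show ?thesis by (simp only: fact_Suc)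
  qed
  have "(\<lambda>z. J (1 * z + 0, 0 * z + (- of_nat (Suc l))) f) holomorphic_on UNIV" by (rule holo_J_line[OF R Suc.prems])
  then have h1: "(\<lambda>z. J (z, - of_nat (Suc l)) f) holomorphic_on UNIV" by simp
  have "(\<lambda>z. YY (Suc l) z f) holomorphic_on UNIV"
    unfolding YY_def using holo_pochhammer[of 0] by (intro holomorphic_intros) auto
  then have h2: "?rhs holomorphic_on UNIV" by (intro holomorphic_intros) auto
  show ?case
  proof (rule analytic_continuation_open[OF _ _ _ _ _ h1 h2])
    show "open (- {- of_nat l - hdim TYPE('m)})" by (rule open_Compl[OF closed_singleton])
    show "- {- of_nat l - hdim TYPE('m)} \<noteq> {}"
      by (metis Compl_eq_Diff_UNIV infinite_UNIV_char_0 finite.emptyI finite_insert Diff_eq_empty_iff finite_subset)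
    show "J (z, - of_nat (Suc l)) f = ?rhs z" if "z \<in> - {- of_nat l - hdim TYPE('m)}" for z
    proof (rule eq, rule notI)
      assume "z + of_nat l + hdim TYPE('m) = 0"
      then have "z = - (of_nat l + hdim TYPE('m))" by (simp only: eq_neg_iff_add_eq_0 add.assoc)
      then show False using that by simp
    qed
  qed auto
qed

section \<open>The distribution family on all test functions\<close>

lemma Re_hdim_pos: "Re (hdim TYPE('m::finite)) > 0"
  using zero_less_card_finite[where 'a = 'm] by simp

lemma rGamma_nonzero: "Re z > 0 \<Longrightarrow> rGamma z \<noteq> (0 :: complex)"
  by (auto simp: rGamma_eq_zero_iff elim!: nonpos_Ints_cases)

lemma Qop_power_odd_test: "f \<in> odd_test R \<Longrightarrow> (Qop ^^ m) f \<in> odd_test R"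
  by (induction m) (auto intro: Qop_odd_test)

text \<open>The case $\mu = 0$, normalized by $\Gamma(a)$ only.\<close>
definition Wm :: "nat \<Rightarrow> complex \<Rightarrow> 'm::finite space cfun \<Rightarrow> complex" where
  "Wm m a f = (- 1 / 2) ^ m * J (a + of_nat m, a + of_nat m + hdim TYPE('m)) ((Qop ^^ m) f) / rGamma (a + of_nat m + hdim TYPE('m))"

text \<open>For mu = 0 the first term of the recursion drops out. The factor beta of the second one
  turns 1/Gamma(beta + 1) into 1/Gamma(beta), and division by the latter is safe because Re beta >
  0.\<close>

lemma Wm_Suc:
  fixes f :: "'m::finite space cfun"
  assumes R: "R > 0" and f: "f \<in> odd_test R" and a: "Re a + real m \<ge> 0"
  shows "Wm (Suc m) a f = Wm m a f"
proof -
  define a' where "a' = a + of_nat m"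
  define b where "b = a' + hdim TYPE('m)"
  let ?g = "(Qop ^^ m) f"
  have b: "Re b > 0"
  proof -
    have "Re b = (Re a + real m) + real CARD('m) / 2" by (simp add: b_def a'_def)
    then show ?thesis using a zero_less_card_finite[where 'a = 'm] by linarith
  qed
  have "J (a', b) ?g = - (b / 2) * J (a' + 1, b + 1) (Qop ?g)"
    using J_recursion[OF R Qop_power_odd_test[OF f], of a' b m] by (simp add: b_def)
  moreover have "rGamma b = b * rGamma (b + 1)" by (rule rGamma_shift)
  moreover have "b \<noteq> 0" "rGamma (b + 1) \<noteq> 0" using b rGamma_nonzero[of "b + 1"] by auto
  ultimately have "J (a', b) ?g / rGamma b = (- 1 / 2) * J (a' + 1, b + 1) (Qop ?g) / rGamma (b + 1)"
    by (simp add: field_simps)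
  moreover have "a + of_nat (Suc m) = a' + 1" "a + of_nat (Suc m) + hdim TYPE('m) = b + 1" by (simp_all add: a'_def b_def)
  ultimately have "Wm (Suc m) a f = (- 1 / 2) ^ m * ((- 1 / 2) * J (a' + 1, b + 1) (Qop ?g) / rGamma (b + 1))"
    and "(- 1 / 2) * J (a' + 1, b + 1) (Qop ?g) / rGamma (b + 1) = J (a', b) ?g / rGamma b"
    unfolding Wm_def by (simp_all only: power_Suc funpow.simps o_apply mult.assoc mult.left_commute times_divide_eq_right)
  moreover have "Wm m a f = (- 1 / 2) ^ m * (J (a', b) ?g / rGamma b)"
    unfolding Wm_def a'_def[symmetric] b_def[symmetric] by (rule times_divide_eq_right[symmetric])
  ultimately show ?thesis by (simp only:)
qed

definition WI :: "complex \<Rightarrow> 'm::finite space cfun \<Rightarrow> complex" where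
  "WI a f = Wm (nat \<lceil>- Re a\<rceil>) a f"

lemma WI_eq:
  fixes f :: "'m::finite space cfun"
  assumes R: "R > 0" and f: "f \<in> odd_test R" and a: "Re a + real m \<ge> 0"
  shows "WI a f = Wm m a f"
proof -
  define n where "n = nat \<lceil>- Re a\<rceil>"
  have n: "- Re a \<le> real n" unfolding n_def by (rule of_nat_ceiling)
  have "n \<le> m" unfolding n_def using a by (simp add: nat_le_iff ceiling_le_iff)
  then have "Wm m a f = Wm n a f"
  proof (induction m rule: dec_induct)
    case (step k)
    then have "Re a + real k \<ge> 0" using n by simp
    then show ?case using Wm_Suc[OF R f, of a k] step by simp
  qed simp
  then show ?thesis by (simp add: WI_def n_def)
qed

lemma WI_holomorphic:
  fixes f :: "'m::finite space cfun"
  assumes R: "R > 0" and f: "f \<in> odd_test R"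
  shows "(\<lambda>a. WI a f) holomorphic_on UNIV"
proof -
  have loc: "(\<lambda>a. WI a f) holomorphic_on {z. - real m < Re z}" for m
  proof -
    have "(\<lambda>z. J (1 * z + of_nat m, 1 * z + (of_nat m + hdim TYPE('m))) ((Qop ^^ m) f)) holomorphic_on UNIV"
      by (rule holo_J_line[OF R Qop_power_odd_test[OF f]])
    then have "(\<lambda>z. J (z + of_nat m, z + of_nat m + hdim TYPE('m)) ((Qop ^^ m) f)) holomorphic_on {z. - real m < Re z}"
      by (rule holomorphic_on_subset[OF _ subset_UNIV, THEN holomorphic_transform]) (simp add: add.assoc)
    moreover have "rGamma (z + of_nat m + hdim TYPE('m)) \<noteq> 0" if "- real m < Re z" for z
      using that Re_hdim_pos[where 'm = 'm] by (intro rGamma_nonzero) simp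
    ultimately have "(\<lambda>z. Wm m z f) holomorphic_on {z. - real m < Re z}"
      unfolding Wm_def by (intro holomorphic_intros) auto
    then show ?thesis
      by (rule holomorphic_transform) (use WI_eq[OF R f, of _ m] in auto)
  qed
  have "(\<lambda>a. WI a f) holomorphic_on (\<Union>m. {z. - real m < Re z})"
    by (rule holomorphic_on_UN_open[OF loc]) (auto intro: open_halfspace_Re_gt)
  moreover have "z \<in> (\<Union>m. {z. - real m < Re z})" for z
    using reals_Archimedean2[of "- Re z"] by (auto simp: minus_less_iff)
  ultimately show ?thesis by (metis UNIV_eq_I)
qed

lemma WI_base:
  fixes f :: "'m::finite space cfun"
  assumes R: "R > 0" and f: "f \<in> odd_test R" and a: "Re a > 1/2"
  shows "WI a f = rGamma a * II a 0 f"
proof -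
  have b: "Re (a + hdim TYPE('m)) > 0" using a Re_hdim_pos[where 'm = 'm] by simp
  have "WI a f = J (a, a + hdim TYPE('m)) f / rGamma (a + hdim TYPE('m))"
    using WI_eq[OF R f, of a 0] a by (simp add: Wm_def)
  also have "... = rGamma a * II a 0 f"
    using J_base[OF R f a b] rGamma_nonzero[OF b] by simp
  finally show ?thesis .
qed

lemma cbound_Qop_power:
  "f \<in> odd_test R \<Longrightarrow> cbound (N + 2 * m) B f \<Longrightarrow> cbound N B ((Qop ^^ m) f)"
proof (induction m arbitrary: N)
  case (Suc m)
  have "cbound (N + 2) B ((Qop ^^ m) f)" using Suc.prems by (intro Suc.IH) (auto simp: algebra_simps)
  then show ?case using cbound_Qop[OF odd_testD(2)[OF Qop_power_odd_test[OF Suc.prems(1)]]] by simp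
qed simp

lemma WI_bound:
  assumes R: "R > 0"
  shows "\<exists>C\<ge>0. \<exists>N. \<forall>f\<in>(odd_test R :: 'm::finite space cfun set). \<forall>B. cbound N B f \<longrightarrow> norm (WI a f) \<le> C * B"
proof -
  define m where "m = nat \<lceil>- Re a\<rceil>"
  define c where "c = (- 1 / 2) ^ m / rGamma (a + of_nat m + hdim TYPE('m))"
  obtain C N where C0: "C \<ge> 0" and C: "\<forall>f\<in>(odd_test R :: 'm space cfun set). \<forall>B. cbound N B f \<longrightarrow> norm (J (a + of_nat m, a + of_nat m + hdim TYPE('m)) f) \<le> C * B"
    using J_bound[OF R, of "(a + of_nat m, a + of_nat m + hdim TYPE('m))", where 'm = 'm] by blast
  show ?thesis
  proof (intro exI[of _ "norm c * C"] exI[of _ "N + 2 * m"] conjI ballI allI impI)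
    fix f :: "'m space cfun" and B assume f: "f \<in> odd_test R" "cbound (N + 2 * m) B f"
    have "WI a f = c * J (a + of_nat m, a + of_nat m + hdim TYPE('m)) ((Qop ^^ m) f)"
      by (simp add: WI_def Wm_def c_def m_def)
    moreover have "norm (J (a + of_nat m, a + of_nat m + hdim TYPE('m)) ((Qop ^^ m) f)) \<le> C * B"
      using C Qop_power_odd_test[OF f(1)] cbound_Qop_power[OF f] by blast
    ultimately show "norm (WI a f) \<le> norm c * C * B"
      by (simp add: norm_mult mult.assoc mult_left_mono)
  qed (use C0 in auto)
qed

text \<open>\<open>0 powr 0\<close> is 0, so |y|^0 equals 1 only off the origin; the origin is a
  null set.\<close>

lemma PI_0:
  fixes g :: "'m::finite space cfun"
  assumes g: "smooth g"
  shows "PI 0 g = (\<integral>y. g (y, 0) \<partial>lborel)"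
proof -
  have c: "continuous_on UNIV (\<lambda>y :: real ^ 'm. g (y, 0))"
    by (rule continuous_on_compose2[OF smooth_continuous[OF g, of UNIV]]) (auto intro!: continuous_intros)
  have m: "(\<lambda>y :: real ^ 'm. g (y, 0)) \<in> borel_measurable borel"
    by (rule borel_measurable_continuous_onI[OF c])
  have "(\<integral>y. (if y \<noteq> 0 then g (y, 0) else 0) \<partial>(lborel :: (real ^ 'm) measure)) = (\<integral>y. g (y, 0) \<partial>lborel)"
  proof (rule integral_cong_AE)
    show "AE y :: real ^ 'm in lborel. (if y \<noteq> 0 then g (y, 0) else 0) = g (y, 0)"
      using AE_lborel_singleton[of "0 :: real ^ 'm"] by eventually_elim simp
    show "(\<lambda>y :: real ^ 'm. g (y, 0)) \<in> borel_measurable lborel" using m by simp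
    have "(\<lambda>y :: real ^ 'm. if y \<noteq> 0 then g (y, 0) else 0) \<in> borel_measurable borel"
      by (rule measurable_If[OF m]) auto
    then show "(\<lambda>y :: real ^ 'm. if y \<noteq> 0 then g (y, 0) else 0) \<in> borel_measurable lborel" by simp
  qed
  moreover have "of_real (norm y) powr 0 * g (y, 0) = (if y \<noteq> 0 then g (y, 0) else 0)" for y :: "real ^ 'm"
    by (cases "y = 0") (simp_all add: powr_def)
  ultimately show ?thesis unfolding PI_def by (simp only:)
qed

text \<open>Every \<open>Qop\<close> divides by an odd number, so the constant is a quotient of
  double factorials, with (2p + 1)!! written as (2p + 1)! / (2^p p!). The cross-multiplied form
  suits the induction.\<close>

lemma PI_Qop_power:
  assumes "f \<in> odd_test R"
  shows "PI s ((Dn ^^ (2 * p + 1)) ((Qop ^^ k) f)) * (fact (2 * (p + k) + 1) / (2 ^ (p + k) * fact (p + k)))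
     = PI s ((Dn ^^ (2 * (p + k) + 1)) f) * (fact (2 * p + 1) / (2 ^ p * fact p))"
proof (induction k arbitrary: p)
  case (Suc k)
  define u where "u = (\<lambda>p. fact (2 * p + 1) / (2 ^ p * fact p) :: complex)"
  have u: "u (Suc p) = u p * of_nat (2 * p + 3)"
  proof -
    have "2 * Suc p + 1 = Suc (Suc (2 * p + 1))" by simp
    then have "fact (2 * Suc p + 1) = (of_nat (2 * p + 3) * (of_nat (2 * (p + 1)) * fact (2 * p + 1)) :: complex)"
      by (simp only: fact_Suc) (simp add: algebra_simps)
    moreover have "(of_nat (p + 1) :: complex) \<noteq> 0" by (simp only: of_nat_eq_0_iff)
    ultimately show ?thesis unfolding u_def by (simp add: field_simps del: of_nat_add of_nat_Suc) (simp add: algebra_simps)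
  qed
  have n0: "(of_nat (2 * p + 3) :: complex) \<noteq> 0" by (simp only: of_nat_eq_0_iff)
  have e: "p + Suc k = Suc p + k" "2 * Suc p + 1 = 2 * p + 1 + 2" "2 * p + 1 + 2 = 2 * p + 3" by simp_all
  have "PI s ((Dn ^^ (2 * p + 1)) ((Qop ^^ Suc k) f)) = PI s ((Dn ^^ (2 * p + 3)) ((Qop ^^ k) f)) / of_nat (2 * p + 3)"
    using PI_Dn_Qop[OF odd_testD(2)[OF Qop_power_odd_test[OF assms]], of s "2 * p + 1" k] unfolding e(3) by simp
  then have "PI s ((Dn ^^ (2 * p + 1)) ((Qop ^^ Suc k) f)) * u (Suc p + k) = PI s ((Dn ^^ (2 * Suc p + 1)) ((Qop ^^ k) f)) * u (Suc p + k) / of_nat (2 * p + 3)"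
    unfolding e(2,3) by simp
  also have "... = PI s ((Dn ^^ (2 * (Suc p + k) + 1)) f) * u (Suc p) / of_nat (2 * p + 3)"
    using Suc.IH[of "Suc p"] by (simp only: u_def)
  also have "... = PI s ((Dn ^^ (2 * (Suc p + k) + 1)) f) * u p"
    using n0 unfolding u by (simp del: of_nat_add of_nat_mult)
  finally show ?case unfolding e(1) u_def .
qed simp

text \<open>At level m = k the family is evaluated at alpha = 0 and beta = (n - 1)/2, where the
  power of |x'| in \<open>J_0\<close> is 0.\<close>

lemma WI_neg:
  fixes f :: "'m::finite space cfun"
  assumes R: "R > 0" and f: "f \<in> odd_test R"
  shows "WI (- of_nat k) f = (- 1) ^ k * fact k / fact (2 * k + 1) * PI 0 ((Dn ^^ (2 * k + 1)) f)"
proof -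
  have h: "Re (hdim TYPE('m)) > 0" by (rule Re_hdim_pos)
  have "WI (- of_nat k) f = (- 1 / 2) ^ k * J (0, hdim TYPE('m)) ((Qop ^^ k) f) / rGamma (hdim TYPE('m))"
    using WI_eq[OF R f, of "- of_nat k" k] by (simp add: Wm_def)
  also have "... = (- 1 / 2) ^ k * PI 0 (Dn ((Qop ^^ k) f))"
    using J_0[OF R Qop_power_odd_test[OF f] h, of k] rGamma_nonzero[OF h] by simp
  finally have 1: "WI (- of_nat k) f = (- 1 / 2) ^ k * PI 0 (Dn ((Qop ^^ k) f))" .
  have 2: "PI 0 (Dn ((Qop ^^ k) f)) * (fact (2 * k + 1) / (2 ^ k * fact k)) = PI 0 ((Dn ^^ (2 * k + 1)) f)"
    using PI_Qop_power[OF f, of 0 0 k] by simp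
  have 3: "(- 1 / 2 :: complex) ^ k = (- 1) ^ k / 2 ^ k" by (rule power_divide)
  have "fact (2 * k + 1) \<noteq> (0 :: complex)" "fact k \<noteq> (0 :: complex)" by (rule fact_nonzero)+
  then show ?thesis unfolding 1 2[symmetric] 3 by (simp add: field_simps del: fact_Suc)
qed

text \<open>Along a line of constant mu the factor 1/Gamma(beta) splits off when |x|^(-2mu) can be
  absorbed into the test function, which is hypothesis \<open>fg\<close>. Both sides are entire in
  a, and for large real a they are integrals.\<close>

lemma J_WI:
  fixes f :: "'m::finite space cfun"
  assumes R: "R > 0" and f: "f \<in> odd_test R" and g: "g \<in> odd_test R"
    and fg: "\<And>a x. ker a mu x * f x = ker a 0 x * g x"
  shows "J (a, a - mu + hdim TYPE('m)) f = rGamma (a - mu + hdim TYPE('m)) * WI a g"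
proof (rule entire_eq_line[of "\<lambda>a. J (a, a - mu + hdim TYPE('m)) f" _ "1 + \<bar>Re mu\<bar>"])
  show "(\<lambda>a. J (a, a - mu + hdim TYPE('m)) f) holomorphic_on UNIV"
    using holo_J_line[OF R f, of 1 0 1 "- mu + hdim TYPE('m)"] by (simp add: add_diff_eq diff_add_eq)
  show "(\<lambda>a. rGamma (a - mu + hdim TYPE('m)) * WI a g) holomorphic_on UNIV"
    by (intro holomorphic_intros WI_holomorphic[OF R g])
  fix x :: real assume x: "x > 1 + \<bar>Re mu\<bar>"
  have 1: "Re (of_real x) > 1/2" "Re (of_real x - mu + hdim TYPE('m)) > 0"
    using x Re_hdim_pos[where 'm = 'm] by auto
  have "II (of_real x) mu f = II (of_real x) 0 g" unfolding II_def fg ..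
  then show "J (of_real x, of_real x - mu + hdim TYPE('m)) f = rGamma (of_real x - mu + hdim TYPE('m)) * WI (of_real x) g"
    using J_base[OF R f 1] WI_base[OF R g 1(1)] by simp
qed

section \<open>Passage from the parity class to all test functions\<close>

lemma integral_flip:
  fixes F :: "'m::finite space cfun"
  assumes F: "F \<in> borel_measurable borel" and st: "\<bar>s\<bar> = 1" "\<bar>t\<bar> = 1"
  shows "(\<integral>x. F (scl s t x) \<partial>lborel) = (\<integral>x. F x \<partial>lborel)"
proof -
  have T: "0 + (\<Sum>j\<in>Basis. (scl_coeff s t j * (x \<bullet> j)) *\<^sub>R j) = scl s t x" for x :: "'m space"
  proof -
    have "scl s t (\<Sum>j\<in>Basis. (x \<bullet> j) *\<^sub>R j) = (\<Sum>j\<in>Basis. (x \<bullet> j) *\<^sub>R scl s t j)"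
      by (simp add: linear_sum[OF bounded_linear.linear[OF bounded_linear_scl]] linear_scale[OF bounded_linear.linear[OF bounded_linear_scl]])
    also have "... = (\<Sum>j\<in>Basis. (scl_coeff s t j * (x \<bullet> j)) *\<^sub>R j)"
      by (intro sum.cong refl) (simp add: scl_Basis mult.commute)
    finally show ?thesis by (simp add: euclidean_representation)
  qed
  have c: "\<bar>scl_coeff s t j\<bar> = 1" for j :: "'m space" using st by (simp add: scl_coeff_def)
  have c0: "scl_coeff s t j \<noteq> 0" for j :: "'m space" using c[of j] by auto
  have "lborel = density (distr lborel borel (\<lambda>x :: 'm space. 0 + (\<Sum>j\<in>Basis. (scl_coeff s t j * (x \<bullet> j)) *\<^sub>R j))) (\<lambda>_. ennreal (\<Prod>j\<in>(Basis :: 'm space set). \<bar>scl_coeff s t j\<bar>))"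
    using lborel_affine_euclidean[of "scl_coeff s t" "0 :: 'm space", OF c0] by (simp only:)
  then have "lborel = density (distr lborel borel (scl s t :: 'm space \<Rightarrow> 'm space)) (\<lambda>_. 1)"
    unfolding T c by simp
  then have "lborel = distr lborel borel (scl s t :: 'm space \<Rightarrow> 'm space)" by (simp only: density_1)
  then have "(\<integral>x. F x \<partial>lborel) = (\<integral>x. F x \<partial>distr lborel borel (scl s t))" by simp
  also have "... = (\<integral>x. F (scl s t x) \<partial>lborel)"
    using F by (intro integral_distr) (auto intro!: borel_measurable_continuous_onI linear_continuous_on)
  finally show ?thesis by simp
qed

lemma ker_flip: "ker a mu (scl 1 (- 1) x) = - ker a mu x" "ker a mu (scl (- 1) 1 x) = ker a mu x"
  "ker a mu (scl (- 1) (- 1) x) = - ker a mu x"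
  by (simp_all add: ker_def norm_scl_flip scl_minus) (simp_all add: scl_def)

text \<open>The kernel changes sign under x_n -> -x_n and is invariant under x' -> -x'. These are
  the signs in \<open>symm\<close>, so its four terms contribute equally.\<close>

lemma II_symm:
  fixes f :: "'m::finite space cfun"
  assumes k: "kcond TYPE('m) a mu" and f: "f \<in> testR R"
  shows "II a mu (symm f) = II a mu f"
proof -
  have fm [measurable]: "f \<in> borel_measurable borel" by (intro smooth_measurable testR_smooth[OF f])
  have e: "II a mu (\<lambda>x. f (scl s t x)) = c * II a mu f"
    if "\<bar>s\<bar> = 1" "\<bar>t\<bar> = 1" "s * s = 1" "t * t = 1" "\<And>x :: 'm space. ker a mu (scl s t x) = c * ker a mu x" for s t c
  proof -
    have inv: "scl s t (scl s t x) = x" for x :: "'m space" using that by (simp add: scl_scl)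
    have "II a mu (\<lambda>x. f (scl s t x)) = (\<integral>x. ker a mu (scl s t (scl s t x)) * f (scl s t x) \<partial>lborel)" unfolding II_def inv ..
    also have "... = (\<integral>x. ker a mu (scl s t x) * f x \<partial>lborel)"
      by (rule integral_flip[of "\<lambda>x. ker a mu (scl s t x) * f x" s t])
        (use that in \<open>simp_all only:\<close>, measurable)
    finally show ?thesis unfolding that(5) II_def by (simp add: mult.assoc)
  qed
  let ?g = "\<lambda>s t x. f (scl s t x)"
  have t: "?g s t \<in> testR R" if "\<bar>s\<bar> = 1" "\<bar>t\<bar> = 1" for s t by (rule testR_flip[OF f that])
  have t1: "?g 1 (- 1) \<in> testR R" "?g (- 1) 1 \<in> testR R" "?g (- 1) (- 1) \<in> testR R" by (rule t; simp)+
  have t2: "(\<lambda>x. f x + (- 1) * ?g 1 (- 1) x) \<in> testR R" "(\<lambda>x. ?g (- 1) 1 x + (- 1) * ?g (- 1) (- 1) x) \<in> testR R"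
    by (intro testR_add testR_cmult t1 f)+
  have "II a mu (symm f) = (1 / 4) * II a mu (\<lambda>x. (f x + (- 1) * ?g 1 (- 1) x) + (?g (- 1) 1 x + (- 1) * ?g (- 1) (- 1) x))"
    unfolding symm_def[abs_def] by (rule II_cmult)
  also have "... = (1 / 4) * (II a mu (\<lambda>x. f x + (- 1) * ?g 1 (- 1) x) + II a mu (\<lambda>x. ?g (- 1) 1 x + (- 1) * ?g (- 1) (- 1) x))"
    by (simp only: II_add[OF k t2])
  also have "... = (1 / 4) * ((II a mu f + (- 1) * II a mu (?g 1 (- 1))) + (II a mu (?g (- 1) 1) + (- 1) * II a mu (?g (- 1) (- 1))))"
    using II_add[OF k f testR_cmult[OF t1(1), of "- 1"]] II_add[OF k t1(2) testR_cmult[OF t1(3), of "- 1"]] by (simp only: II_cmult)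
  finally show ?thesis using e[of 1 "- 1" "- 1"] e[of "- 1" 1 1] e[of "- 1" "- 1" "- 1"] by (simp add: ker_flip)
qed

definition KT :: "complex \<times> complex \<Rightarrow> 'm::finite space functional" where
  "KT p \<phi> = J p (symm \<phi>)"

lemma symm_add: "symm (\<lambda>x. f x + g x) = (\<lambda>x. symm f x + symm g x)"
  and symm_cmult: "symm (\<lambda>x. c * f x) = (\<lambda>x. c * symm f x)"
  by (auto simp: symm_def algebra_simps add_divide_distrib diff_divide_distrib intro!: ext)

lemma test_symm:
  assumes "\<phi> \<in> test_functions" obtains R where "R > 0" "\<phi> \<in> testR R" "symm \<phi> \<in> odd_test R"
  using test_obtain_testR[OF assms] symm_odd_test by metis

lemma holo2_KT: "\<phi> \<in> test_functions \<Longrightarrow> holo2_on (\<lambda>p. KT p \<phi>) UNIV"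
  unfolding KT_def by (erule test_symm) (rule holo2_J)

lemma distributionI:
  fixes S :: "'a::euclidean_space functional"
  assumes add: "\<And>R f g. R > 0 \<Longrightarrow> f \<in> testR R \<Longrightarrow> g \<in> testR R \<Longrightarrow> S (\<lambda>x. f x + g x) = S f + S g"
    and cm: "\<And>R f c. R > 0 \<Longrightarrow> f \<in> testR R \<Longrightarrow> S (\<lambda>x. c * f x) = c * S f"
    and bd: "\<And>R. R > 0 \<Longrightarrow> \<exists>C N. \<forall>f\<in>testR R. \<forall>B. cbound N B f \<longrightarrow> norm (S f) \<le> C * B"
  shows "distribution S"
  unfolding distribution_def
proof (intro conjI ballI allI impI)
  fix f g :: "'a cfun" assume "f \<in> test_functions" "g \<in> test_functions"
  then obtain R R' where "R > 0" "f \<in> testR R" "g \<in> testR R'" using test_obtain_testR by metis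
  then have "f \<in> testR (max R R')" "g \<in> testR (max R R')" "max R R' > 0" by (auto intro: testR_mono)
  then show "S (\<lambda>x. f x + g x) = S f + S g" using add by blast
next
  fix c and f :: "'a cfun" assume "f \<in> test_functions"
  then show "S (\<lambda>x. c * f x) = c * S f" using test_obtain_testR cm by metis
next
  fix K :: "'a set" assume "compact K"
  then obtain R where R: "R > 0" "K \<subseteq> cball 0 R" using compact_subset_cball by blast
  from bd[OF R(1)] obtain C N where C: "\<forall>f\<in>testR R. \<forall>B. cbound N B f \<longrightarrow> norm (S f) \<le> C * B" by blast
  show "\<exists>C N. \<forall>\<phi>\<in>test_functions. fun_supp \<phi> \<subseteq> K \<longrightarrow>
        (\<forall>B. (\<forall>vs x. set vs \<subseteq> Basis \<and> length vs \<le> N \<longrightarrow> norm (pderivs vs \<phi> x) \<le> B) \<longrightarrow> norm (S \<phi>) \<le> C * B)"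
  proof (intro exI[of _ C] exI[of _ N] ballI impI allI)
    fix \<phi> :: "'a cfun" and B
    assume "\<phi> \<in> test_functions" "fun_supp \<phi> \<subseteq> K"
      and "\<forall>vs x. set vs \<subseteq> Basis \<and> length vs \<le> N \<longrightarrow> norm (pderivs vs \<phi> x) \<le> B"
    then show "norm (S \<phi>) \<le> C * B" using C test_imp_testR R(2) unfolding cbound_def by blast
  qed
qed

lemma distribution_symm:
  fixes A :: "'m::finite space functional"
  assumes add: "\<And>R f g. R > 0 \<Longrightarrow> f \<in> odd_test R \<Longrightarrow> g \<in> odd_test R \<Longrightarrow> A (\<lambda>x. f x + g x) = A f + A g"
    and cm: "\<And>R f c. R > 0 \<Longrightarrow> f \<in> odd_test R \<Longrightarrow> A (\<lambda>x. c * f x) = c * A f"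
    and bd: "\<And>R. R > 0 \<Longrightarrow> \<exists>C N. \<forall>f\<in>odd_test R. \<forall>B. cbound N B f \<longrightarrow> norm (A f) \<le> C * B"
  shows "distribution (\<lambda>\<phi>. A (symm \<phi>))"
proof (rule distributionI)
  fix R :: real assume R: "R > 0"
  from bd[OF R] obtain C N where C: "\<forall>f\<in>odd_test R. \<forall>B. cbound N B f \<longrightarrow> norm (A f) \<le> C * B" by blast
  show "\<exists>C N. \<forall>f\<in>testR R. \<forall>B. cbound N B f \<longrightarrow> norm (A (symm f)) \<le> C * B"
    using C symm_odd_test cbound_symm testR_smooth by metis
qed (simp_all add: symm_add symm_cmult add cm symm_odd_test)

lemma distribution_KT: "distribution (KT p :: 'm::finite space functional)"
  unfolding KT_def[abs_def]
proof (rule distribution_symm)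
  fix R :: real assume "R > 0"
  from J_bound[OF this, of p, where 'm = 'm]
  show "\<exists>C N. \<forall>f\<in>odd_test R. \<forall>B. cbound N B f \<longrightarrow> norm (J p (f :: 'm space cfun)) \<le> C * B" by blast
qed (rule J_add J_cmult; assumption)+

lemma KT_base:
  fixes \<phi> :: "'m::finite space cfun"
  assumes "\<phi> \<in> test_functions" "Re a > 1/2" "Re b > 1/2"
  shows "KT (a, b) \<phi> = rGamma a * rGamma b * II a (a - b + hdim TYPE('m)) \<phi>"
proof -
  obtain R where R: "R > 0" "\<phi> \<in> testR R" "symm \<phi> \<in> odd_test R" using test_symm[OF assms(1)] .
  have "kcond TYPE('m) a (a - b + hdim TYPE('m))" unfolding kcond_mu using assms by simp
  from II_symm[OF this R(2)] show ?thesis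
    unfolding KT_def using J_base[OF R(1,3), of a b] assms(2,3) by simp
qed

section \<open>Identification with the meromorphic extension\<close>

lemma holo2_on_inverse:
  assumes "holo2_on f U" "\<And>p. p \<in> U \<Longrightarrow> f p \<noteq> 0"
  shows "holo2_on (\<lambda>p. 1 / f p) U"
  unfolding holo2_on_def
proof
  fix p assume p: "p \<in> U"
  then obtain a b where "(f has_derivative (\<lambda>w. a * fst w + b * snd w)) (at p within U)"
    using assms(1) unfolding holo2_on_def by blast
  from Deriv.has_derivative_inverse[OF assms(2)[OF p] this]
  moreover have "(\<lambda>w. - (inverse (f p) * (a * fst w + b * snd w) * inverse (f p))) = (\<lambda>w. - (a / (f p)\<^sup>2) * fst w + - (b / (f p)\<^sup>2) * snd w)"
    by (simp add: fun_eq_iff divide_inverse power2_eq_square algebra_simps)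
  ultimately have "((\<lambda>p. 1 / f p) has_derivative (\<lambda>w. - (a / (f p)\<^sup>2) * fst w + - (b / (f p)\<^sup>2) * snd w)) (at p within U)"
    by (simp only: inverse_eq_divide)
  then show "\<exists>a b. ((\<lambda>p. 1 / f p) has_derivative (\<lambda>w. a * fst w + b * snd w)) (at p within U)" by blast
qed

text \<open>The interior of the zero set is relatively closed in V: at a boundary point the convex
  version applies on a ball. Connectedness then leaves only all of V.\<close>

lemma holo2_identity_connected:
  assumes f: "holo2_on f V" and V: "open V" "connected V" and W0: "open W0" "W0 \<noteq> {}" "W0 \<subseteq> V"
    and z: "\<And>p. p \<in> W0 \<Longrightarrow> f p = 0" and p: "p \<in> V"
  shows "f p = 0"
proof -
  define A where "A = interior {q \<in> V. f q = 0}"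
  have oA: "open A" and AV: "A \<subseteq> V" using interior_subset by (auto simp: A_def)
  have "W0 \<subseteq> A" unfolding A_def using W0 z by (intro interior_maximal) auto
  have loc: "q \<in> A" if q: "q \<in> V" "q \<in> closure A" for q
  proof -
    obtain e where e: "e > 0" "ball q e \<subseteq> V" using V(1) q(1) openE by blast
    have "ball q e \<inter> A \<noteq> {}"
      using q(2) e(1) by (metis centre_in_ball closure_iff_nhds_not_empty inf_commute open_ball order_refl)
    have "f r = 0" if "r \<in> ball q e" for r
    proof (rule holo2_identity_convex[OF holo2_on_subset[OF f e(2)]])
      show "open (ball q e \<inter> A)" using oA by blast
      show "f t = 0" if "t \<in> ball q e \<inter> A" for t
        using that interior_subset[of "{q \<in> V. f q = 0}"] unfolding A_def by blast
    qed (use \<open>ball q e \<inter> A \<noteq> {}\<close> that in auto)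
    then have "ball q e \<subseteq> {q \<in> V. f q = 0}" using e(2) by auto
    then have "ball q e \<subseteq> A" unfolding A_def by (rule interior_maximal) simp
    then show ?thesis using e(1) by auto
  qed
  have "V \<inter> (- closure A) = {}"
  proof (rule ccontr)
    assume "V \<inter> (- closure A) \<noteq> {}"
    moreover have "A \<inter> V \<noteq> {}" using \<open>W0 \<subseteq> A\<close> W0(2,3) by blast
    moreover have "A \<inter> (- closure A) \<inter> V = {}" using closure_subset[of A] by blast
    moreover have "V \<subseteq> A \<union> (- closure A)" using loc by blast
    ultimately show False
      using connectedD[OF V(2) oA, of "- closure A"] by (auto simp: inf_commute)
  qed
  then have "p \<in> A" using loc p by blast
  then show ?thesis using interior_subset[of "{q \<in> V. f q = 0}"] unfolding A_def by blast
qed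

lemma open_nonzero:
  assumes "continuous_on V f" "open V" shows "open {q \<in> V. f q \<noteq> (0 :: complex)}"
proof -
  have "open (- {0 :: complex})" by (rule open_Compl) simp
  from continuous_open_preimage[OF assms this] have "open (V \<inter> f -` (- {0}))" .
  also have "V \<inter> f -` (- {0}) = {q \<in> V. f q \<noteq> 0}" by auto
  finally show ?thesis .
qed

lemma deqD: "deq S T \<Longrightarrow> \<phi> \<in> test_functions \<Longrightarrow> S \<phi> = T \<phi>"
  by (simp add: deq_def)

lemma distributionD:
  assumes "distribution T"
  shows "f \<in> test_functions \<Longrightarrow> g \<in> test_functions \<Longrightarrow> T (\<lambda>x. f x + g x) = T f + T g"
    and "f \<in> test_functions \<Longrightarrow> T (\<lambda>x. c * f x) = c * T f"
    and "compact K \<Longrightarrow> \<exists>C N. \<forall>\<phi>\<in>test_functions. fun_supp \<phi> \<subseteq> K \<longrightarrow>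
        (\<forall>B. (\<forall>vs x. set vs \<subseteq> Basis \<and> length vs \<le> N \<longrightarrow> norm (pderivs vs \<phi> x) \<le> B) \<longrightarrow> norm (T \<phi>) \<le> C * B)"
  using assms unfolding distribution_def by simp_all

lemma distribution_bound:
  assumes "distribution T"
  shows "\<exists>C N. \<forall>f\<in>testR R. \<forall>B. cbound N B f \<longrightarrow> norm (T f) \<le> C * B"
proof -
  obtain C N where C: "\<forall>\<phi>\<in>test_functions. fun_supp \<phi> \<subseteq> cball 0 R \<longrightarrow> (\<forall>B. cbound N B \<phi> \<longrightarrow> norm (T \<phi>) \<le> C * B)"
    using distributionD(3)[OF assms compact_cball[of 0 R]] unfolding cbound_def by blast
  have "fun_supp f \<subseteq> cball 0 R" if "f \<in> testR R" for f :: "'a cfun"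
    by (rule fun_supp_minimal) (use testR_zero[OF that] in auto)
  then show ?thesis using C testR_imp_test by blast
qed

lemma distribution_deq:
  assumes "distribution T" "deq S T" shows "distribution S"
proof (rule distributionI)
  have e: "S f = T f" if "f \<in> testR R" for f R using assms(2) testR_imp_test[OF that] by (rule deqD)
  fix R :: real and f g :: "'a cfun" and c assume f: "f \<in> testR R"
  note t = testR_imp_test[OF f]
  show "S (\<lambda>x. c * f x) = c * S f"
    unfolding e[OF f] e[OF testR_cmult[OF f]] by (rule distributionD(2)[OF assms(1) t])
  assume g: "g \<in> testR R"
  show "S (\<lambda>x. f x + g x) = S f + S g"
    unfolding e[OF f] e[OF g] e[OF testR_add[OF f g]] by (rule distributionD(1)[OF assms(1) t testR_imp_test[OF g]])
next
  fix R :: real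
  show "\<exists>C N. \<forall>f\<in>testR R. \<forall>B. cbound N B f \<longrightarrow> norm (S f) \<le> C * B"
    using distribution_bound[OF assms(1), of R] deqD[OF assms(2) testR_imp_test] by (simp cong: ball_cong)
qed

lemma distribution_dscale:
  assumes "distribution T" shows "distribution (dscale c T)"
proof (rule distributionI)
  fix R :: real and f g :: "'a cfun" and d assume f: "f \<in> testR R"
  note t = testR_imp_test[OF f]
  show "dscale c T (\<lambda>x. d * f x) = d * dscale c T f"
    unfolding dscale_def distributionD(2)[OF assms t] by (rule mult.left_commute)
  assume g: "g \<in> testR R"
  show "dscale c T (\<lambda>x. f x + g x) = dscale c T f + dscale c T g"
    unfolding dscale_def distributionD(1)[OF assms t testR_imp_test[OF g]] by (rule distrib_left)
next
  fix R :: real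
  obtain C N where C: "\<forall>f\<in>testR R. \<forall>B. cbound N B f \<longrightarrow> norm (T f) \<le> C * B" using distribution_bound[OF assms] by blast
  have "norm (dscale c T f) \<le> (norm c * C) * B" if "f \<in> testR R" "cbound N B f" for f :: "'a cfun" and B
  proof -
    have "norm (T f) \<le> C * B" using C that by blast
    then show ?thesis by (simp add: dscale_def norm_mult mult.assoc mult_left_mono)
  qed
  then show "\<exists>C N. \<forall>f\<in>testR R. \<forall>B. cbound N B f \<longrightarrow> norm (dscale c T f) \<le> C * B" by blast
qed

lemma holo2_family_deq:
  assumes "holo2_family U F" "\<And>p. p \<in> U \<Longrightarrow> deq (Gf p) (F p)"
  shows "holo2_family U Gf"
  unfolding holo2_family_def
proof (intro conjI ballI)
  show "distribution (Gf p)" if "p \<in> U" for p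
    using assms that distribution_deq unfolding holo2_family_def by blast
  show "holo2_on (\<lambda>p. Gf p \<phi>) U" if \<phi>: "\<phi> \<in> test_functions" for \<phi>
  proof (rule holo2_on_cong[where f = "\<lambda>p. F p \<phi>"])
    show "F p \<phi> = Gf p \<phi>" if "p \<in> U" for p using deqD[OF assms(2)[OF that] \<phi>] by simp
  qed (use assms(1) \<phi> in \<open>auto simp: holo2_family_def\<close>)
qed

section \<open>The candidate for the renormalized family in the original parameters\<close>

definition al :: "complex \<times> complex \<Rightarrow> complex" where "al p = (fst p + snd p + 3/2) / 2"
definition be :: "complex \<times> complex \<Rightarrow> complex" where "be p = (fst p - snd p + 3/2) / 2"

definition hh :: "complex \<times> complex \<Rightarrow> complex" where
  "hh p = rGamma (al p) * rGamma (be p)"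

definition TT :: "complex \<times> complex \<Rightarrow> 'm::finite space functional" where
  "TT p = KT (al p, be p)"

lemma al_be_affine:
  "al p = (1/2) * fst p + (1/2) * snd p + 3/4" "be p = (1/2) * fst p + (- 1/2) * snd p + 3/4"
  by (simp_all add: al_def be_def field_simps)

lemma holo2_hh: "holo2_on hh U"
proof -
  have "holo2_on (\<lambda>p. rGamma ((1/2) * fst p + (1/2) * snd p + 3/4) * rGamma ((1/2) * fst p + (- 1/2) * snd p + 3/4)) U"
    by (intro holo2_on_mult holo2_on_rGamma)
  then show ?thesis unfolding hh_def[abs_def] al_be_affine .
qed

lemma holo2_family_TT: "holo2_family UNIV (TT :: complex \<times> complex \<Rightarrow> 'm::finite space functional)"
  unfolding holo2_family_def
proof (intro conjI ballI)
  fix \<phi> :: "'m space cfun" assume "\<phi> \<in> test_functions"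
  then show "holo2_on (\<lambda>p. TT p \<phi>) UNIV" unfolding TT_def al_be_affine
    by (intro holo2_on_compose_affine[where V = UNIV] holo2_KT) auto
qed (simp add: TT_def distribution_KT)

lemma KA_dom_iff: "p \<in> KA_dom \<longleftrightarrow> Re (al p) > 1/2 \<and> Re (be p) > 1/2"
  by (cases p) (auto simp: KA_dom_def al_def be_def)

lemma hh_dom: "p \<in> KA_dom \<Longrightarrow> hh p \<noteq> 0"
  unfolding KA_dom_iff hh_def using rGamma_nonzero[of "al p"] rGamma_nonzero[of "be p"] by simp

lemma TT_dom:
  fixes \<phi> :: "'m::finite space cfun"
  assumes "(lam, nu) \<in> KA_dom" "\<phi> \<in> test_functions"
  shows "TT (lam, nu) \<phi> = hh (lam, nu) * KA_int lam nu \<phi>"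
proof -
  have "al (lam, nu) - be (lam, nu) + hdim TYPE('m) = nu + of_nat CARD('m) / 2" by (simp add: al_def be_def field_simps)
  then show ?thesis
    using KT_base[OF assms(2), of "al (lam, nu)" "be (lam, nu)"] assms(1)
    unfolding TT_def hh_def KA_int_def KA_fun_eq_ker KA_dom_iff II_def by (simp add: al_def)
qed

lemma open_KA_dom: "open KA_dom"
proof -
  have "KA_dom = {p. Re (fst p + snd p) > - 1/2} \<inter> {p. Re (fst p - snd p) > - 1/2}"
    by (auto simp: KA_dom_def)
  also have "open ..." by (intro open_Int open_Collect_less continuous_intros)
  finally show ?thesis .
qed

lemma KA_dom_nonempty: "(0, 0) \<in> KA_dom"
  by (simp add: KA_dom_def)

text \<open>\<open>KA\<close> is a choice, so a witness is needed: \<open>TT\<close> divided by the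
  entire function \<open>hh\<close>. Nothing but the two properties proved here is known about the
  chosen family.\<close>

lemma KA_props:
  "mero2_family (KA :: complex \<times> complex \<Rightarrow> 'm::finite space functional)"
  "(lam, nu) \<in> KA_dom \<Longrightarrow> deq (KA (lam, nu) :: 'm space functional) (KA_int lam nu)"
proof -
  let ?P = "\<lambda>F :: complex \<times> complex \<Rightarrow> 'm space functional. mero2_family F \<and> (\<forall>lam nu. (lam, nu) \<in> KA_dom \<longrightarrow> deq (F (lam, nu)) (KA_int lam nu))"
  have "?P (\<lambda>p. dscale (1 / hh p) (TT p))"
  proof (intro conjI allI impI)
    show "mero2_family (\<lambda>p. dscale (1 / hh p) (TT p) :: 'm space functional)"
      unfolding mero2_family_def
    proof (rule allI, rule exI[of _ UNIV], rule exI[of _ TT], rule exI[of _ hh], intro conjI)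
      show "\<exists>q\<in>UNIV. hh q \<noteq> 0" using hh_dom[OF KA_dom_nonempty] by (rule bexI[of "\<lambda>q. hh q \<noteq> 0"]) (rule UNIV_I)
      show "holo2_family UNIV (TT :: complex \<times> complex \<Rightarrow> 'm space functional)" by (rule holo2_family_TT)
      show "holo2_on hh UNIV" by (rule holo2_hh)
      show "\<forall>q\<in>UNIV. hh q \<noteq> 0 \<longrightarrow> deq (dscale (1 / hh q) (TT q)) (dscale (1 / hh q) (TT q :: 'm space functional))"
        unfolding deq_def by (intro ballI impI refl)
      show "connected (UNIV :: (complex \<times> complex) set)" by (rule connected_UNIV)
    qed (rule open_UNIV UNIV_I)+
    show "deq (dscale (1 / hh (lam, nu)) (TT (lam, nu) :: 'm space functional)) (KA_int lam nu)" if "(lam, nu) \<in> KA_dom" for lam nu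
      unfolding deq_def
    proof
      fix \<phi> :: "'m space cfun" assume "\<phi> \<in> test_functions"
      then show "dscale (1 / hh (lam, nu)) (TT (lam, nu)) \<phi> = KA_int lam nu \<phi>"
        unfolding dscale_def TT_dom[OF that \<open>\<phi> \<in> test_functions\<close>] using hh_dom[OF that] by simp
    qed
  qed
  then have "?P (SOME F. ?P F)" by (rule someI[of ?P])
  then have "?P KA" unfolding KA_def .
  note K = conjunct1[OF this] conjunct2[OF this]
  show "mero2_family (KA :: complex \<times> complex \<Rightarrow> 'm::finite space functional)" by (rule K(1))
  show "deq (KA (lam, nu) :: 'm space functional) (KA_int lam nu)" if "(lam, nu) \<in> KA_dom"
    using K(2)[rule_format, OF that] .
qed

text \<open>The parameters where the chosen extension has the expected value. On its polar set the
  choice is arbitrary, so density is the best that can be expected.\<close>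

definition KS :: "(complex \<times> complex \<Rightarrow> 'm::finite space functional) \<Rightarrow> (complex \<times> complex) set" where
  "KS F = {q. \<forall>\<phi>\<in>test_functions. F q \<phi> * hh q = TT q \<phi>}"

lemma nonzero_dense:
  assumes h: "holo2_on h V" and V: "open V" "connected V" "q \<in> V" "h q \<noteq> 0" and U: "open U" "U \<inter> V \<noteq> {}"
  shows "\<exists>r \<in> U \<inter> V. h r \<noteq> 0"
proof (rule ccontr)
  assume n: "\<not> (\<exists>r \<in> U \<inter> V. h r \<noteq> 0)"
  have "h q = 0"
  proof (rule holo2_identity_connected[OF h V(1,2) _ U(2) _ _ V(3)])
    show "h r = 0" if "r \<in> U \<inter> V" for r using n that by blast
  qed (use U(1) V(1) in blast)+
  then show False using V(4) by simp
qed

text \<open>Locally the chosen family is a quotient G/h. Clearing denominators gives a holomorphic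
  function that vanishes on an open subset of V, hence on V; so all points of V with h nonzero
  belong to \<open>KS F\<close>, and these are dense in V.\<close>

lemma mero2_KS_local:
  fixes F :: "complex \<times> complex \<Rightarrow> 'm::finite space functional"
  assumes V: "open V" "connected V" and Gf: "holo2_family V Gf" and h: "holo2_on h V" and q0: "q0 \<in> V" "h q0 \<noteq> 0"
    and FG: "\<forall>q\<in>V. h q \<noteq> 0 \<longrightarrow> deq (F q) (dscale (1 / h q) (Gf q))"
    and p: "p \<in> V" "p \<in> closure (interior (KS F))"
  shows "V \<subseteq> closure (interior (KS F))"
proof -
  define W0 where "W0 = V \<inter> interior (KS F)"
  have W0: "open W0" "W0 \<subseteq> V" using V(1) by (auto simp: W0_def)
  have Wne: "W0 \<noteq> {}"
    using p V(1) unfolding W0_def by (metis closure_iff_nhds_not_empty inf_commute order_refl)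
  have main: "h q * TT q \<phi> = hh q * Gf q \<phi>" if q: "q \<in> V" "h q \<noteq> 0" and \<phi>: "\<phi> \<in> test_functions" for q \<phi>
  proof -
    have hT: "holo2_on (\<lambda>p. TT p \<phi>) V"
      using holo2_family_TT \<phi> holo2_on_subset[OF _ subset_UNIV] unfolding holo2_family_def by blast
    have hG: "holo2_on (\<lambda>p. Gf p \<phi>) V" using Gf \<phi> unfolding holo2_family_def by blast
    \<comment> \<open>The extra factor h makes the expression vanish also at the zeros of h, where
      the quotient says nothing about \<open>F\<close>.\<close>
    have "h q * (h q * TT q \<phi> - hh q * Gf q \<phi>) = 0"
    proof (rule holo2_identity_connected[OF _ V W0(1) Wne W0(2)])
      show "holo2_on (\<lambda>q. h q * (h q * TT q \<phi> - hh q * Gf q \<phi>)) V"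
        by (intro holo2_on_mult holo2_on_diff h hT hG holo2_hh)
      show "h r * (h r * TT r \<phi> - hh r * Gf r \<phi>) = 0" if r: "r \<in> W0" for r
      proof (cases "h r = 0")
        case False
        have "F r \<phi> = 1 / h r * Gf r \<phi>"
          using FG False r W0(2) deqD[OF _ \<phi>] unfolding dscale_def by blast
        moreover have "F r \<phi> * hh r = TT r \<phi>"
          using r interior_subset[of "KS F"] \<phi> unfolding W0_def KS_def by blast
        ultimately have "TT r \<phi> = (1 / h r * Gf r \<phi>) * hh r" by simp
        then show ?thesis using False by simp
      qed simp
    qed (rule q(1))
    then show ?thesis using q(2) by simp
  qed
  have sub: "{q \<in> V. h q \<noteq> 0} \<subseteq> interior (KS F)"
  proof (rule interior_maximal)
    show "{q \<in> V. h q \<noteq> 0} \<subseteq> KS F"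
    proof
      fix q assume q: "q \<in> {q \<in> V. h q \<noteq> 0}"
      show "q \<in> KS F" unfolding KS_def
      proof (intro CollectI ballI)
        fix \<phi> :: "'m space cfun" assume \<phi>: "\<phi> \<in> test_functions"
        have "F q \<phi> = 1 / h q * Gf q \<phi>" using FG q deqD[OF _ \<phi>] unfolding dscale_def by blast
        moreover have "TT q \<phi> = hh q * Gf q \<phi> / h q" using main[of q \<phi>] q \<phi> by (simp add: field_simps)
        ultimately show "F q \<phi> * hh q = TT q \<phi>" by simp
      qed
    qed
    show "open {q \<in> V. h q \<noteq> 0}"
      by (rule open_nonzero[OF holo2_on_imp_continuous[OF h] V(1)])
  qed
  show ?thesis
  proof
    fix q assume q: "q \<in> V"
    show "q \<in> closure (interior (KS F))"
      unfolding closure_iff_nhds_not_empty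
    proof (intro allI impI)
      fix A U assume U: "U \<subseteq> A" "q \<in> U" "open U"
      then obtain r where "r \<in> U \<inter> V" "h r \<noteq> 0" using nonzero_dense[OF h V q0, of U] q by blast
      then show "interior (KS F) \<inter> A \<noteq> {}" using sub U(1) by blast
    qed
  qed
qed

text \<open>The closure is nonempty, since it contains the domain of convergence, and open by
  \<open>mero2_KS_local\<close>; a clopen nonempty set is everything.\<close>

lemma KS_dense: "closure (interior (KS (KA :: complex \<times> complex \<Rightarrow> 'm::finite space functional))) = UNIV"
proof -
  let ?F = "KA :: complex \<times> complex \<Rightarrow> 'm space functional"
  let ?C = "closure (interior (KS ?F))"
  have "KA_dom \<subseteq> KS ?F"
  proof
    fix p assume p: "p \<in> KA_dom"
    obtain lam nu where e: "p = (lam, nu)" by (cases p)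
    show "p \<in> KS ?F" unfolding KS_def
    proof (intro CollectI ballI)
      fix \<phi> :: "'m space cfun" assume \<phi>: "\<phi> \<in> test_functions"
      show "KA p \<phi> * hh p = TT p \<phi>"
        unfolding e deqD[OF KA_props(2)[OF p[unfolded e]] \<phi>] TT_dom[OF p[unfolded e] \<phi>] by (rule mult.commute)
    qed
  qed
  then have "(0, 0) \<in> interior (KS ?F)" by (rule subsetD[OF interior_maximal[OF _ open_KA_dom] KA_dom_nonempty])
  then have "(0, 0) \<in> ?C" by (rule subsetD[OF closure_subset])
  then have ne: "?C \<noteq> {}" by (rule ex_in_conv[THEN iffD1, OF exI])
  have "open ?C"
  proof (subst open_subopen, intro ballI)
    fix p assume p: "p \<in> ?C"
    obtain V Gf h where V: "open V" "connected V" "p \<in> V" and Gf: "holo2_family V Gf" "holo2_on h V"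
      and q: "\<exists>q\<in>V. h q \<noteq> 0" and FG: "\<forall>q\<in>V. h q \<noteq> 0 \<longrightarrow> deq (?F q) (dscale (1 / h q) (Gf q))"
      using KA_props(1)[where 'm = 'm, unfolded mero2_family_def, rule_format, of p] by blast
    obtain q0 where q0: "q0 \<in> V" "h q0 \<noteq> 0" using q by blast
    have "V \<subseteq> ?C" by (rule mero2_KS_local[OF V(1,2) Gf q0 FG V(3) p])
    then show "\<exists>T. open T \<and> p \<in> T \<and> T \<subseteq> ?C" using V by blast
  qed
  moreover have "closed ?C" by simp
  ultimately show ?thesis using clopen[of ?C] ne by (simp only: simp_thms)
qed

text \<open>Near a regular point both sides are continuous, so a difference there would persist on
  an open set, against the density of \<open>KS\<close>.\<close>

lemma regular_eq:
  fixes \<phi> :: "'m::finite space cfun"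
  assumes p: "p \<in> regular_points (KA :: complex \<times> complex \<Rightarrow> 'm space functional)" and \<phi>: "\<phi> \<in> test_functions"
  shows "KA p \<phi> * hh p = TT p \<phi>"
proof (rule ccontr)
  let ?F = "KA :: complex \<times> complex \<Rightarrow> 'm space functional"
  assume ne: "KA p \<phi> * hh p \<noteq> TT p \<phi>"
  obtain V where V: "open V" "p \<in> V" "holo2_family V ?F" using p unfolding regular_points_def by blast
  have h1: "holo2_on (\<lambda>q. ?F q \<phi>) V" using V(3) \<phi> unfolding holo2_family_def by blast
  have h2: "holo2_on (\<lambda>q. TT q \<phi>) V"
    using holo2_family_TT \<phi> holo2_on_subset[OF _ subset_UNIV] unfolding holo2_family_def by blast
  have "holo2_on (\<lambda>q. ?F q \<phi> * hh q - TT q \<phi>) V" by (intro holo2_on_diff holo2_on_mult h1 h2 holo2_hh)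
  from open_nonzero[OF holo2_on_imp_continuous[OF this] V(1)]
  have "open {q \<in> V. ?F q \<phi> * hh q - TT q \<phi> \<noteq> 0}" .
  moreover have "p \<in> {q \<in> V. ?F q \<phi> * hh q - TT q \<phi> \<noteq> 0}" using ne V(2) by simp
  ultimately have "interior (KS ?F) \<inter> {q \<in> V. ?F q \<phi> * hh q - TT q \<phi> \<noteq> 0} \<noteq> {}"
    using KS_dense[where 'm = 'm] closure_iff_nhds_not_empty[of p "interior (KS ?F)"] by blast
  then obtain q where "q \<in> KS ?F" "?F q \<phi> * hh q - TT q \<phi> \<noteq> 0" using interior_subset[of "KS ?F"] by blast
  then show False using \<phi> by (simp add: KS_def)
qed

text \<open>Without this the limit in \<open>KA_tilde\<close> would be taken along a trivial filter.
  Near any p the points where the local denominator is nonzero are regular, and they accumulate at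
  p.\<close>

lemma regular_islimpt:
  "p islimpt regular_points (KA :: complex \<times> complex \<Rightarrow> 'm::finite space functional)"
proof (rule islimptI)
  let ?F = "KA :: complex \<times> complex \<Rightarrow> 'm space functional"
  fix U assume U: "p \<in> U" "open U"
  obtain V Gf h where V: "open V" "connected V" "p \<in> V" and Gf: "holo2_family V Gf" "holo2_on h V"
    and q: "\<exists>q\<in>V. h q \<noteq> 0" and FG: "\<forall>q\<in>V. h q \<noteq> 0 \<longrightarrow> deq (?F q) (dscale (1 / h q) (Gf q))"
    using KA_props(1)[where 'm = 'm, unfolded mero2_family_def, rule_format, of p] by blast
  obtain q0 where q0: "q0 \<in> V" "h q0 \<noteq> 0" using q by blast
  have "p islimpt (UNIV :: (complex \<times> complex) set)" by (rule islimpt_UNIV)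
  then obtain y where "y \<in> U \<inter> V" "y \<noteq> p"
    using U V unfolding islimpt_def by (metis IntI UNIV_I open_Int)
  then have "(U - {p}) \<inter> V \<noteq> {}" by blast
  moreover have "open (U - {p})" using U(2) by (simp add: open_delete)
  ultimately obtain r where r: "r \<in> (U - {p}) \<inter> V" "h r \<noteq> 0" using nonzero_dense[OF Gf(2) V(1,2) q0, of "U - {p}"] by blast
  define V' where "V' = {q \<in> V. h q \<noteq> 0}"
  have oV': "open V'" unfolding V'_def
    by (rule open_nonzero[OF holo2_on_imp_continuous[OF Gf(2)] V(1)])
  have sub: "V' \<subseteq> V" by (auto simp: V'_def)
  have "holo2_family V' (\<lambda>q. dscale (1 / h q) (Gf q))"
    unfolding holo2_family_def
  proof (intro conjI ballI)
    show "distribution (dscale (1 / h q) (Gf q))" if "q \<in> V'" for q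
      using Gf(1) that sub distribution_dscale unfolding holo2_family_def by blast
    show "holo2_on (\<lambda>q. dscale (1 / h q) (Gf q) \<phi>) V'" if "\<phi> \<in> test_functions" for \<phi>
      unfolding dscale_def
    proof (rule holo2_on_mult[OF holo2_on_inverse])
      show "holo2_on h V'" by (rule holo2_on_subset[OF Gf(2) sub])
      show "holo2_on (\<lambda>q. Gf q \<phi>) V'" using Gf(1) that holo2_on_subset[OF _ sub] unfolding holo2_family_def by blast
    qed (simp add: V'_def)
  qed
  then have "holo2_family V' ?F" by (rule holo2_family_deq) (use FG in \<open>auto simp: V'_def\<close>)
  then have "r \<in> regular_points ?F" unfolding regular_points_def using oV' r by (auto simp: V'_def)
  then show "\<exists>y\<in>regular_points ?F. y \<in> U \<and> y \<noteq> p" using r(1) by blast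
qed

lemma KA_tilde_eq:
  fixes \<phi> :: "'m::finite space cfun"
  assumes \<phi>: "\<phi> \<in> test_functions"
  shows "KA_tilde p \<phi> = TT p \<phi>"
proof -
  let ?R = "regular_points (KA :: complex \<times> complex \<Rightarrow> 'm space functional)"
  have "continuous_on UNIV (\<lambda>p. TT p \<phi>)"
    using holo2_family_TT \<phi> holo2_on_imp_continuous unfolding holo2_family_def by blast
  then have "isCont (\<lambda>p. TT p \<phi>) p" by (simp add: continuous_on_eq_continuous_at)
  then have "((\<lambda>p. TT p \<phi>) \<longlongrightarrow> TT p \<phi>) (at p within ?R)"
    unfolding isCont_def by (rule tendsto_within_subset) simp
  then have "((\<lambda>(lam, nu). KA (lam, nu) \<phi> * rGamma ((lam + nu + 3/2) / 2) * rGamma ((lam - nu + 3/2) / 2)) \<longlongrightarrow> TT p \<phi>) (at p within ?R)"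
  proof (rule Lim_transform_eventually)
    have "KA q \<phi> * hh q = TT q \<phi>" if "q \<in> ?R" for q by (rule regular_eq[OF that \<phi>])
    then have "TT q \<phi> = (case q of (lam, nu) \<Rightarrow> KA (lam, nu) \<phi> * rGamma ((lam + nu + 3/2) / 2) * rGamma ((lam - nu + 3/2) / 2))" if "q \<in> ?R" for q
      using that by (cases q) (auto simp: hh_def al_def be_def mult.assoc)
    then show "\<forall>\<^sub>F q in at p within ?R. TT q \<phi> = (case q of (lam, nu) \<Rightarrow> KA (lam, nu) \<phi> * rGamma ((lam + nu + 3/2) / 2) * rGamma ((lam - nu + 3/2) / 2))"
      unfolding eventually_at_filter by simp
  qed
  moreover have "at p within ?R \<noteq> bot" using regular_islimpt trivial_limit_within by blast
  ultimately show ?thesis unfolding KA_tilde_def by (intro tendsto_Lim)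
qed

lemma KA_tilde_TT: "deq (KA_tilde p) (TT p)"
  by (simp add: deq_def KA_tilde_eq)

section \<open>Supports\<close>

lemma power_times_exp_bound:
  fixes y :: real
  assumes "y > 0" "k > 0" shows "y ^ k * exp (- y) \<le> real k ^ k"
proof -
  have "y / real k \<le> exp (y / real k)" using exp_ge_add_one_self[of "y / real k"] by linarith
  then have "(y / real k) ^ k \<le> exp (y / real k) ^ k" using assms by (intro power_mono) auto
  also have "... = exp y" using assms by (simp add: exp_of_nat_mult[symmetric])
  finally have "y ^ k \<le> real k ^ k * exp y" using assms by (simp add: power_divide divide_le_eq mult.commute)
  then show ?thesis by (simp add: exp_minus divide_inverse[symmetric] divide_le_eq)
qed

text \<open>The polynomial factor in 1/t makes the family closed under differentiation, as
  \<open>smooth_upto_compose_family\<close> demands; the bump itself is the case p = 1.\<close>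

definition bump0 :: "real poly \<Rightarrow> real \<Rightarrow> complex" where
  "bump0 p t = (if t > 0 then of_real (poly p (1 / t) * exp (- 1 / t)) else 0)"

text \<open>Each y^(i+2) exp(-y) with y = 1/t is bounded, and the two spare powers of y give t^2.
  This order of vanishing forces derivative 0 at t = 0.\<close>

lemma bump0_bound: "\<exists>C. \<forall>t. norm (bump0 p t) \<le> C * t\<^sup>2"
proof (intro exI allI)
  fix t :: real
  let ?C = "\<Sum>i\<le>degree p. \<bar>coeff p i\<bar> * real (i + 2) ^ (i + 2)"
  have C: "?C \<ge> 0" by (intro sum_nonneg) auto
  show "norm (bump0 p t) \<le> ?C * t\<^sup>2"
  proof (cases "t > 0")
    case True
    have "norm (bump0 p t) = \<bar>poly p (1 / t)\<bar> * exp (- 1 / t)"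
      using True unfolding bump0_def by (simp only: if_True norm_of_real abs_mult abs_exp_cancel)
    also have "... \<le> (\<Sum>i\<le>degree p. \<bar>coeff p i\<bar> * (1 / t) ^ i) * exp (- 1 / t)"
      unfolding poly_altdef using True
      by (intro mult_right_mono order_trans[OF sum_abs] sum_mono) (auto simp: abs_mult power_abs)
    also have "... = (\<Sum>i\<le>degree p. \<bar>coeff p i\<bar> * ((1 / t) ^ (i + 2) * exp (- (1 / t)))) * t\<^sup>2"
      using True by (simp add: sum_distrib_right sum_distrib_left field_simps power2_eq_square)
    also have "... \<le> ?C * t\<^sup>2"
      using True by (intro mult_right_mono sum_mono mult_left_mono power_times_exp_bound) auto
    finally show ?thesis .
  qed (use C in \<open>simp add: bump0_def\<close>)
qed

text \<open>With y = 1/t one has d/dt = -y^2 d/dy, and the y-derivative of p(y) exp(-y) is (p' -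
  p)(y) exp(-y).\<close>

lemma bump0_deriv: "(bump0 p has_vector_derivative bump0 ([:0, 0, 1:] * (p - pderiv p)) t) (at t)"
proof -
  let ?p' = "[:0, 0, 1:] * (p - pderiv p)"
  consider "t > 0" | "t < 0" | "t = 0" by linarith
  then show ?thesis
  proof cases
    case 1
    have "((\<lambda>t. poly p (1 / t) * exp (- 1 / t)) has_real_derivative poly ?p' (1 / t) * exp (- 1 / t)) (at t)"
      using 1 by (auto intro!: derivative_eq_intros poly_DERIV[THEN DERIV_chain2] simp: field_simps power2_eq_square)
    then have "((\<lambda>t. poly p (1 / t) * exp (- 1 / t)) has_vector_derivative poly ?p' (1 / t) * exp (- 1 / t)) (at t)"
      by (simp only: has_real_derivative_iff_has_vector_derivative)
    from bounded_linear.has_vector_derivative[OF bounded_linear_of_real this]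
    have "((\<lambda>t. complex_of_real (poly p (1 / t) * exp (- 1 / t))) has_vector_derivative bump0 ?p' t) (at t)"
      using 1 unfolding bump0_def by (simp only: if_True)
    then show ?thesis
      by (rule has_vector_derivative_transform_within_open[of _ _ _ "{0<..}"]) (use 1 in \<open>auto simp: bump0_def\<close>)
  next
    case 2
    have "((\<lambda>t. 0) has_vector_derivative bump0 ?p' t) (at t)" using 2 by (simp add: bump0_def)
    then show ?thesis
      by (rule has_vector_derivative_transform_within_open[of _ _ _ "{..<0}"]) (use 2 in \<open>auto simp: bump0_def\<close>)
  next
    case 3
    obtain C where C: "norm (bump0 p t) \<le> C * t\<^sup>2" for t using bump0_bound[of p] by blast
    have "(bump0 p has_derivative (\<lambda>h. 0)) (at 0)"
    proof (rule has_derivativeI_sandwich[where H = "\<lambda>t. C * \<bar>t\<bar>" and e = 1])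
      show "norm (bump0 p y - bump0 p 0 - 0) / norm (y - 0) \<le> C * \<bar>y\<bar>" if "y \<noteq> 0" for y
      proof -
        have "norm (bump0 p y) / \<bar>y\<bar> \<le> C * y\<^sup>2 / \<bar>y\<bar>" by (intro divide_right_mono C) simp
        also have "... = C * \<bar>y\<bar>" using that by (simp add: power2_eq_square field_simps abs_if)
        finally show ?thesis by (simp add: bump0_def)
      qed
      have "((\<lambda>t. C * \<bar>t\<bar>) \<longlongrightarrow> C * \<bar>0\<bar>) (at 0)" by (intro tendsto_intros)
      then show "((\<lambda>t. C * \<bar>t\<bar>) \<longlongrightarrow> 0) (at 0)" by simp
    qed auto
    then show ?thesis using 3 by (simp add: has_vector_derivative_def bump0_def)
  qed
qed

lemma bump_exists:
  fixes x0 :: "'a::euclidean_space"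
  assumes r: "r > 0"
  obtains g :: "'a \<Rightarrow> real" where "smooth (\<lambda>x. complex_of_real (g x))" "\<And>x. g x \<ge> 0" "g x0 > 0"
    "\<And>x. r \<le> dist x x0 \<Longrightarrow> g x = 0" "continuous_on UNIV g"
proof -
  define q where "q = (\<lambda>x :: 'a. r\<^sup>2 - (norm (x - x0))\<^sup>2)"
  define g where "g = (\<lambda>x. if q x > 0 then exp (- 1 / q x) else 0)"
  have g: "complex_of_real (g x) = bump0 1 (q x)" for x by (simp add: g_def bump0_def)
  have qe: "complex_of_real (q x) = of_real (r\<^sup>2) - (\<Sum>b\<in>Basis. (of_real (x \<bullet> b) - of_real (x0 \<bullet> b)) * (of_real (x \<bullet> b) - of_real (x0 \<bullet> b)))" for x
  proof -
    have "(norm (x - x0))\<^sup>2 = (\<Sum>b\<in>Basis. (x \<bullet> b - x0 \<bullet> b) * (x \<bullet> b - x0 \<bullet> b))"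
      unfolding power2_norm_eq_inner by (subst euclidean_inner) (simp add: inner_diff_left)
    then show ?thesis by (simp only: q_def of_real_diff of_real_sum of_real_mult)
  qed
  have "smooth (\<lambda>x. complex_of_real (q x))"
    unfolding qe by (intro smooth_diff smooth_sum smooth_mult smooth_const smooth_coord) auto
  then have sq: "smooth_upto k UNIV (\<lambda>x. complex_of_real (q x))" for k by (rule smooth_upto_smooth)
  have sg: "smooth (\<lambda>x. complex_of_real (g x))"
    unfolding g
  proof (rule smoothI_upto, rule smooth_upto_compose_family[where F = "range bump0" and T = UNIV])
    show "\<exists>f'\<in>range bump0. \<forall>t\<in>UNIV. (f has_vector_derivative f' t) (at t)" if "f \<in> range bump0" for f
    proof -
      obtain p where "f = bump0 p" using \<open>f \<in> range bump0\<close> by blast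
      then show ?thesis using bump0_deriv by blast
    qed
  qed (use sq in auto)
  have "continuous_on UNIV (\<lambda>x. Re (complex_of_real (g x)))"
    by (intro continuous_intros smooth_continuous[OF sg])
  then have cg: "continuous_on UNIV g" by simp
  show ?thesis
  proof (rule that[OF sg _ _ _ cg])
    show "g x \<ge> 0" for x by (simp add: g_def)
    show "g x0 > 0" using r by (simp add: g_def q_def)
    show "g x = 0" if "r \<le> dist x x0" for x
    proof -
      have "r\<^sup>2 \<le> (norm (x - x0))\<^sup>2" using that r by (intro power_mono) (auto simp: dist_norm)
      then show ?thesis by (simp add: g_def q_def)
    qed
  qed
qed

lemma bump_test:
  fixes x0 :: "'a::euclidean_space" and g :: "'a \<Rightarrow> real"
  assumes g: "smooth (\<lambda>x. complex_of_real (g x))" "\<And>x. r \<le> dist x x0 \<Longrightarrow> g x = 0" and f: "smooth f"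
  shows "(\<lambda>x. f x * complex_of_real (g x)) \<in> test_functions"
    and "fun_supp (\<lambda>x. f x * complex_of_real (g x)) \<subseteq> cball x0 r"
proof -
  have "(\<lambda>x. complex_of_real (g x)) \<in> testR (norm x0 + r)"
    unfolding testR_def
  proof (intro CollectI conjI allI impI g(1))
    fix x :: 'a assume "norm x0 + r < norm x"
    then have "r \<le> dist x x0" using norm_triangle_ineq2[of x x0] by (simp add: dist_norm)
    then show "complex_of_real (g x) = 0" using g(2) by simp
  qed
  then show "(\<lambda>x. f x * complex_of_real (g x)) \<in> test_functions" by (intro testR_imp_test testR_mult f)
  show "fun_supp (\<lambda>x. f x * complex_of_real (g x)) \<subseteq> cball x0 r"
  proof (rule fun_supp_minimal)
    fix x assume "x \<notin> cball x0 r"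
    then have "r \<le> dist x x0" by (simp add: dist_commute)
    then show "f x * complex_of_real (g x) = 0" using g(2) by simp
  qed simp
qed

text \<open>After multiplication by the conjugate of h(x0), the real part of the integrand is at
  least |h(x0)|^2 / 2 times \<open>g\<close>, and \<open>g\<close> has positive integral.\<close>

lemma integral_bump_nonzero:
  fixes g :: "'a::euclidean_space \<Rightarrow> real" and h :: "'a cfun"
  assumes gc: "continuous_on UNIV g" and g0: "\<And>x. g x \<ge> 0" "g x0 > 0" and gz: "\<And>x. r \<le> dist x x0 \<Longrightarrow> g x = 0"
    and U: "open U" "cball x0 r \<subseteq> U" "continuous_on U h"
    and h: "h x0 \<noteq> 0" "\<And>x. dist x x0 < r \<Longrightarrow> norm (h x - h x0) \<le> norm (h x0) / 2"
  shows "(\<integral>x. h x * complex_of_real (g x) \<partial>lborel) \<noteq> 0"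
proof
  assume z: "(\<integral>x. h x * complex_of_real (g x) \<partial>lborel) = 0"
  have far: "g x = 0" if "norm x0 + r < norm x" for x
    using that norm_triangle_ineq2[of x x0] by (intro gz) (simp add: dist_norm)
  have "continuous_on (U \<union> - cball x0 r) (\<lambda>x. h x * complex_of_real (g x))"
  proof (rule continuous_on_open_Un)
    show "continuous_on U (\<lambda>x. h x * complex_of_real (g x))"
      by (intro continuous_intros U(3) continuous_on_subset[OF gc]) auto
    have "continuous_on (- cball x0 r) (\<lambda>x. 0 :: complex)" by simp
    then show "continuous_on (- cball x0 r) (\<lambda>x. h x * complex_of_real (g x))"
    proof (rule continuous_on_eq)
      fix x assume "x \<in> - cball x0 r"
      then have "r \<le> dist x x0" by (simp add: dist_commute)
      then show "0 = h x * complex_of_real (g x)" using gz by simp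
    qed
  qed (use U(1) in auto)
  then have hc: "continuous_on UNIV (\<lambda>x. h x * complex_of_real (g x))"
    using U(2) by (metis Compl_partition Un_mono order_refl top.extremum_uniqueI)
  have i1: "integrable lborel (\<lambda>x. h x * complex_of_real (g x))"
    by (rule continuous_compact_support_integrable[OF hc, of "norm x0 + r"]) (use far in auto)
  have "integrable lborel (\<lambda>x. complex_of_real (g x))"
    by (rule continuous_compact_support_integrable[of _ "norm x0 + r"]) (use far in \<open>auto intro!: continuous_intros gc\<close>)
  then have "integrable lborel (\<lambda>x. Re (complex_of_real (g x)))" by (rule integrable_Re)
  then have i2: "integrable lborel g" by simp
  have i3: "integrable lborel (\<lambda>x. Re (cnj (h x0) * (h x * complex_of_real (g x))))"
    by (intro integrable_Re integrable_mult_right i1)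
  have "(\<integral>x. (norm (h x0))\<^sup>2 / 2 * g x \<partial>lborel) \<le> (\<integral>x. Re (cnj (h x0) * (h x * complex_of_real (g x))) \<partial>lborel)"
  proof (rule integral_mono[OF _ i3])
    show "integrable lborel (\<lambda>x. (norm (h x0))\<^sup>2 / 2 * g x)" using i2 by simp
    fix x
    show "(norm (h x0))\<^sup>2 / 2 * g x \<le> Re (cnj (h x0) * (h x * complex_of_real (g x)))"
    proof (cases "dist x x0 < r")
      case True
      have "\<bar>Re (cnj (h x0) * (h x - h x0))\<bar> \<le> norm (cnj (h x0) * (h x - h x0))" by (rule abs_Re_le_cmod)
      also have "... \<le> norm (h x0) * (norm (h x0) / 2)" unfolding norm_mult complex_mod_cnj by (intro mult_left_mono h(2) True) simp
      finally have "\<bar>Re (cnj (h x0) * (h x - h x0))\<bar> \<le> (norm (h x0))\<^sup>2 / 2" by (simp add: power2_eq_square)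
      moreover have "Re (cnj (h x0) * h x0) = (norm (h x0))\<^sup>2" by (simp add: cmod_power2) (simp add: power2_eq_square)
      moreover have "Re (cnj (h x0) * h x) = Re (cnj (h x0) * h x0) + Re (cnj (h x0) * (h x - h x0))" by (simp add: algebra_simps)
      ultimately have "(norm (h x0))\<^sup>2 / 2 \<le> Re (cnj (h x0) * h x)" by linarith
      then have "(norm (h x0))\<^sup>2 / 2 * g x \<le> Re (cnj (h x0) * h x) * g x" using g0(1) by (intro mult_right_mono) auto
      also have "... = Re (cnj (h x0) * h x * complex_of_real (g x))" by simp
      finally show ?thesis by (simp only: mult.assoc)
    qed (simp add: gz)
  qed
  also have "... = Re (cnj (h x0) * (\<integral>x. h x * complex_of_real (g x) \<partial>lborel))"
    using i1 by (simp only: integral_Re[OF integrable_mult_right[OF i1]] integral_mult_right_zero)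
  finally have "(norm (h x0))\<^sup>2 / 2 * integral\<^sup>L lborel g \<le> 0" unfolding z by simp
  then have le: "integral\<^sup>L lborel g \<le> 0" using h(1) by (simp add: mult_le_0_iff)
  have "isCont g x0" using gc by (simp add: continuous_on_eq_continuous_at)
  then obtain d where d: "d > 0" "\<And>x. dist x x0 < d \<Longrightarrow> dist (g x) (g x0) < g x0 / 2"
    unfolding continuous_at_eps_delta using g0(2) by (meson half_gt_zero)
  have "measure lborel (ball x0 d) * (g x0 / 2) = (\<integral>x. indicator (ball x0 d) x * (g x0 / 2) \<partial>lborel)"
    by simp
  also have "... \<le> integral\<^sup>L lborel g"
  proof (rule integral_mono[OF _ i2])
    show "integrable lborel (\<lambda>x. indicator (ball x0 d) x * (g x0 / 2))"
      using emeasure_lborel_ball_finite[of x0 d] by (intro integrable_mult_left) (simp add: less_top)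
    show "indicator (ball x0 d) x * (g x0 / 2) \<le> g x" for x
    proof (cases "x \<in> ball x0 d")
      case True
      then have "dist x x0 < d" by (simp add: dist_commute)
      from d(2)[OF this] have "dist (g x) (g x0) < g x0 / 2" .
      then have "g x0 / 2 \<le> g x" unfolding dist_real_def by linarith
      then show ?thesis using True by simp
    qed (simp add: g0(1))
  qed
  finally have "measure lborel (ball x0 d) * (g x0 / 2) \<le> 0" using le by linarith
  moreover have "measure lborel (ball x0 d) > 0" using content_ball_pos[OF d(1), of x0] by (simp add: measure_completion)
  ultimately show False using g0(2) by (simp add: mult_le_0_iff)
qed

lemma mem_dsupp_iff:
  "x \<in> dsupp S \<longleftrightarrow> (\<forall>U. open U \<and> x \<in> U \<longrightarrow> (\<exists>\<phi>\<in>test_functions. fun_supp \<phi> \<subseteq> U \<and> S \<phi> \<noteq> 0))"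
  unfolding dsupp_def by auto

lemma closed_dsupp: "closed (dsupp S)"
  unfolding dsupp_def by (intro closed_Compl open_Union) auto

lemma dsupp_subset:
  assumes "closed C" "\<And>\<phi>. \<phi> \<in> test_functions \<Longrightarrow> fun_supp \<phi> \<subseteq> - C \<Longrightarrow> S \<phi> = 0"
  shows "dsupp S \<subseteq> C"
proof
  fix x assume "x \<in> dsupp S"
  then show "x \<in> C" using assms unfolding mem_dsupp_iff by (metis ComplI open_Compl)
qed

lemma dsupp_superset:
  assumes A: "\<And>x. x \<in> A \<Longrightarrow> x \<in> dsupp S" and C: "C \<subseteq> closure A"
  shows "C \<subseteq> dsupp S"
  using closure_minimal[OF _ closed_dsupp, of A S] A C by blast

lemma continuous_small_ball:
  fixes h :: "'a::euclidean_space cfun"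
  assumes "open U" "x0 \<in> U" "continuous_on U h" "h x0 \<noteq> 0"
  obtains r where "r > 0" "cball x0 r \<subseteq> U" "\<And>x. dist x x0 < r \<Longrightarrow> norm (h x - h x0) \<le> norm (h x0) / 2"
proof -
  obtain e where e: "e > 0" "cball x0 e \<subseteq> U" using assms(1,2) open_contains_cball by blast
  have "isCont h x0" using assms continuous_on_eq_continuous_at by blast
  then obtain d where d: "d > 0" "\<And>x. dist x x0 < d \<Longrightarrow> dist (h x) (h x0) < norm (h x0) / 2"
    unfolding continuous_at_eps_delta using assms(4) by (meson half_gt_zero zero_less_norm_iff)
  show ?thesis
  proof (rule that[of "min d e"])
    show "norm (h x - h x0) \<le> norm (h x0) / 2" if "dist x x0 < min d e" for x
      using d(2)[of x] that by (simp add: dist_norm)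
  qed (use d(1) e in auto)
qed

section \<open>Derivatives, boundary integrals and the symmetrization\<close>

lemma Dn_power_pderivs: "(Dn ^^ m) f = pderivs (replicate m e_n) f"
  by (induction m) auto

lemma Dn_scl: "smooth f \<Longrightarrow> Dn (\<lambda>x. f (scl s t x)) = (\<lambda>x. of_real t * Dn f (scl s t x))"
  using pderivs_scl[of f "[e_n]" s t] by (simp add: e_n_Basis scl_coeff_def scaleR_conv_of_real)

lemma Lp_scl:
  fixes f :: "'m::finite space cfun"
  assumes "smooth f" "s * s = 1" shows "Lp (\<lambda>x. f (scl s t x)) = (\<lambda>x. Lp f (scl s t x))"
proof
  fix x
  have "pderiv_along (b, 0) (pderiv_along (b, 0) (\<lambda>x. f (scl s t x))) x = pderiv_along (b, 0) (pderiv_along (b, 0) f) (scl s t x)"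
    if "b \<in> Basis" for b :: "real ^ 'm"
    using pderivs_scl[OF assms(1), of "[(b, 0), (b, 0)]" s t] that assms(2) by (simp add: scl_coeff_def)
  then show "Lp (\<lambda>x. f (scl s t x)) x = Lp f (scl s t x)" by (simp add: Lp_def)
qed

lemma Dn_Lp_scl:
  assumes f: "smooth f" "s * s = 1"
  shows "(Dn ^^ m) ((Lp ^^ j) (\<lambda>x. f (scl s t x))) = (\<lambda>x. of_real (t ^ m) * (Dn ^^ m) ((Lp ^^ j) f) (scl s t x))"
proof -
  have 1: "(Lp ^^ j) (\<lambda>x. f (scl s t x)) = (\<lambda>x. (Lp ^^ j) f (scl s t x))"
    by (induction j) (simp_all add: Lp_scl[OF smooth_Lp_power[OF f(1)] f(2)])
  show ?thesis unfolding 1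
  proof (induction m)
    case (Suc m)
    have s: "smooth ((Dn ^^ m) ((Lp ^^ j) f))" by (intro smooth_Dn_power smooth_Lp_power f)
    have "Dn (\<lambda>x. of_real (t ^ m) * (Dn ^^ m) ((Lp ^^ j) f) (scl s t x)) = (\<lambda>x. of_real (t ^ m) * (of_real t * Dn ((Dn ^^ m) ((Lp ^^ j) f)) (scl s t x)))"
      using Dn_power_cmult[OF smooth_scl[OF s], of 1 "of_real (t ^ m)" s t] Dn_scl[OF s, of s t] by simp
    then show ?case using Suc by (simp add: mult_ac)
  qed simp
qed

text \<open>An odd number of normal derivatives produces a sign under x_n -> -x_n, which cancels the
  minus signs in \<open>symm\<close>. The Laplacian in x' is even and produces none.\<close>

lemma Dn_Lp_symm:
  fixes f :: "'m::finite space cfun"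
  assumes f: "smooth f" and m: "odd m"
  shows "(Dn ^^ m) ((Lp ^^ j) (symm f)) x = ((Dn ^^ m) ((Lp ^^ j) f) x + (Dn ^^ m) ((Lp ^^ j) f) (scl 1 (- 1) x)
     + ((Dn ^^ m) ((Lp ^^ j) f) (scl (- 1) 1 x) + (Dn ^^ m) ((Lp ^^ j) f) (- x))) / 4"
proof -
  define D where "D f = (Dn ^^ m) ((Lp ^^ j) f)" for f :: "'m space cfun"
  have add: "D (\<lambda>x. g x + h x) = (\<lambda>x. D g x + D h x)" if "smooth g" "smooth h" for g h
    unfolding D_def using that by (simp add: Lp_power_add Dn_power_add smooth_Lp_power)
  have cm: "D (\<lambda>x. c * g x) = (\<lambda>x. c * D g x)" if "smooth g" for g c
    unfolding D_def using that by (simp add: Lp_power_cmult Dn_power_cmult smooth_Lp_power)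
  have sc: "D (\<lambda>x. f (scl s t x)) = (\<lambda>x. of_real (t ^ m) * D f (scl s t x))" if "s * s = 1" for s t
    unfolding D_def by (rule Dn_Lp_scl[OF f that])
  have m1: "(- 1 :: real) ^ m = - 1" using m by simp
  have "D (symm f) = (\<lambda>x. (1 / 4) * ((D f x + (- 1) * D (\<lambda>x. f (scl 1 (- 1) x)) x) + (D (\<lambda>x. f (scl (- 1) 1 x)) x + (- 1) * D (\<lambda>x. f (scl (- 1) (- 1) x)) x)))"
    unfolding symm_def[abs_def] by (simp only: add cm f smooth_add smooth_cmult smooth_scl)
  also have "D (\<lambda>x. f (scl 1 (- 1) x)) = (\<lambda>x. - D f (scl 1 (- 1) x))" using sc[of 1 "- 1"] m1 by simp
  also have "D (\<lambda>x. f (scl (- 1) 1 x)) = (\<lambda>x. D f (scl (- 1) 1 x))" using sc[of "- 1" 1] by simp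
  also have "D (\<lambda>x. f (scl (- 1) (- 1) x)) = (\<lambda>x. - D f (- x))" using sc[of "- 1" "- 1"] m1 by (simp add: scl_minus)
  finally show ?thesis unfolding D_def by simp
qed

lemma DD_symm:
  fixes f :: "'m::finite space cfun"
  shows "smooth f \<Longrightarrow> odd m \<Longrightarrow> DD j m (symm f) = DD j m f"
proof -
  assume a: "smooth f" "odd m"
  have "scl s t (0 :: 'm space) = 0" for s t by (simp add: scl_def zero_prod_def)
  then show ?thesis unfolding DD_def Dn_Lp_symm[OF a] by simp
qed

lemma integral_uminus:
  fixes f :: "'a::euclidean_space cfun"
  assumes "f \<in> borel_measurable borel"
  shows "(\<integral>x. f (- x) \<partial>lborel) = (\<integral>x. f x \<partial>lborel)"
proof -
  have "lborel = density (distr lborel borel (\<lambda>x :: 'a. 0 + (- 1) *\<^sub>R x)) (\<lambda>_. ennreal (\<bar>- 1\<bar> ^ DIM('a)))"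
    by (rule lborel_affine) simp
  then have e: "lborel = distr lborel borel (uminus :: 'a \<Rightarrow> 'a)" by (simp add: density_1)
  have "(\<integral>x. f x \<partial>lborel) = (\<integral>x. f x \<partial>distr lborel borel uminus)" using e by simp
  also have "... = (\<integral>x. f (- x) \<partial>lborel)" using assms by (intro integral_distr) auto
  finally show ?thesis by simp
qed

lemma section_measurable:
  assumes "smooth F" shows "(\<lambda>y :: real ^ 'm::finite. F (y, 0)) \<in> borel_measurable borel"
proof -
  have "continuous_on UNIV (\<lambda>y :: real ^ 'm. F (y, 0))"
    by (rule continuous_on_compose2[OF smooth_continuous[OF assms, of UNIV]]) (auto intro!: continuous_intros)
  then show ?thesis by (rule borel_measurable_continuous_onI)
qed

lemma norm_powr_measurable: "(\<lambda>y :: 'a::euclidean_space. complex_of_real (norm y) powr s) \<in> borel_measurable borel"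
proof -
  have "complex_of_real (norm y) powr s = (if y = 0 then 0 else exp (s * of_real (ln (norm y))))" for y :: 'a
    by (simp add: powr_def Ln_of_real)
  then show ?thesis by simp
qed

lemma PI_integrable:
  fixes F :: "'m::finite space cfun"
  assumes F: "F \<in> testR R" "R > 0" and s: "Re s > - real CARD('m)"
  shows "integrable lborel (\<lambda>y. of_real (norm y) powr s * F (y, 0))"
proof -
  obtain B where "cbound 0 B F" using ex_cbound[OF F(1)] by blast
  then have B: "norm (F x) \<le> B" for x unfolding cbound_def by (drule_tac spec[of _ "[]"]) simp
  have i: "integrable lborel (\<lambda>y :: real ^ 'm. B * (indicator (cball 0 R) y * norm y powr Re s))"
    using s by (intro integrable_mult_right integrable_norm_power_cball F(2)) simp
  show ?thesis
  proof (rule Bochner_Integration.integrable_bound[OF i])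
    have "(\<lambda>y :: real ^ 'm. of_real (norm y) powr s * F (y, 0)) \<in> borel_measurable borel"
      by (intro borel_measurable_times norm_powr_measurable section_measurable testR_smooth[OF F(1)])
    then show "(\<lambda>y :: real ^ 'm. of_real (norm y) powr s * F (y, 0)) \<in> borel_measurable lborel" by simp
    show "AE y in lborel. norm (of_real (norm y) powr s * F (y, 0)) \<le> norm (B * (indicator (cball 0 R) y * norm y powr Re s))"
    proof (rule AE_I2)
      fix y :: "real ^ 'm"
      show "norm (of_real (norm y) powr s * F (y, 0)) \<le> norm (B * (indicator (cball 0 R) y * norm y powr Re s))"
      proof (cases "R < norm y")
        case True
        then have "F (y, 0) = 0" by (intro testR_zero[OF F(1)]) (simp add: norm_Pair)
        then show ?thesis by simp
      next
        case False
        have "B \<ge> 0" using order_trans[OF norm_ge_zero B[of 0]] .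
        have "norm (complex_of_real (norm y) powr s) = norm y powr Re s" by (simp add: norm_powr_real_powr)
        then show ?thesis using False B[of "(y, 0)"] \<open>B \<ge> 0\<close> by (simp add: norm_mult abs_mult mult.commute mult_right_mono)
      qed
    qed
  qed
qed

lemma testR_Dn_power: "f \<in> testR R \<Longrightarrow> (Dn ^^ m) f \<in> testR R"
  by (induction m) (auto intro: testR_pderiv e_n_Basis)

text \<open>On the hyperplane the symmetrization of an odd normal derivative is the mean over y and
  -y, and |y|^s is even.\<close>

lemma PI_symm:
  fixes f :: "'m::finite space cfun"
  assumes f: "f \<in> testR R" "R > 0" and s: "Re s > - real CARD('m)" and m: "odd m"
  shows "PI s ((Dn ^^ m) (symm f)) = PI s ((Dn ^^ m) f)"
proof -
  let ?h = "\<lambda>y :: real ^ 'm. of_real (norm y) powr s * (Dn ^^ m) f (y, 0)"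
  note i = PI_integrable[OF testR_Dn_power[OF f(1), of m] f(2) s]
  have hm: "?h \<in> borel_measurable borel" using borel_measurable_integrable[OF i] by simp
  have e: "of_real (norm y) powr s * (Dn ^^ m) (symm f) (y, 0) = (?h y + ?h (- y)) / 2" for y :: "real ^ 'm"
  proof -
    have "(Dn ^^ m) (symm f) (y, 0) = (((Dn ^^ m) f (y, 0) + (Dn ^^ m) f (y, 0)) + ((Dn ^^ m) f (- y, 0) + (Dn ^^ m) f (- y, 0))) / 4"
      using Dn_Lp_symm[OF testR_smooth[OF f(1)] m, of 0 "(y, 0)"] by (simp add: scl_def)
    then show ?thesis by (simp only: norm_minus_cancel) (simp add: field_simps)
  qed
  have "(\<lambda>x. (Dn ^^ m) f (scl (- 1) 1 x)) \<in> testR R" by (rule testR_flip[OF testR_Dn_power[OF f(1)]]) simp_all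
  from PI_integrable[OF this f(2) s] have i': "integrable lborel (\<lambda>y. ?h (- y))" by (simp add: scl_def)
  have "PI s ((Dn ^^ m) (symm f)) = (\<integral>y. (?h y + ?h (- y)) / 2 \<partial>lborel)" unfolding PI_def e ..
  also have "... = ((\<integral>y. ?h y \<partial>lborel) + (\<integral>y. ?h (- y) \<partial>lborel)) / 2"
    by (simp only: integral_divide_zero Bochner_Integration.integral_add[OF i i'])
  also have "(\<integral>y. ?h (- y) \<partial>lborel) = (\<integral>y. ?h y \<partial>lborel)" by (rule integral_uminus[OF hm])
  finally show ?thesis by (simp add: PI_def)
qed

text \<open>Since \<open>F\<close> vanishes near 0, the power |y|^s is harmless for every s. The
  integral is a Laplace integral with frequency ln |y| and a dummy second parameter of frequency
  0.\<close>

lemma PI_holomorphic: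
  fixes F :: "'m::finite space cfun"
  assumes F: "F \<in> testR R" and r: "r > 0" "\<And>x. norm x < r \<Longrightarrow> F x = 0"
  shows "(\<lambda>s. PI s F) holomorphic_on UNIV"
proof -
  let ?g = "\<lambda>y :: real ^ 'm. F (y, 0)"
  have gc: "continuous_on A ?g" for A
    by (rule continuous_on_compose2[OF smooth_continuous[OF testR_smooth[OF F], of UNIV]]) (auto intro!: continuous_intros)
  have g0: "?g y = 0" if "norm y < r" for y using that by (intro r(2)) (simp add: norm_Pair)
  have e: "of_real (norm y) powr s * ?g y = ?g y * exp (s * of_real (ln (norm y)) + 0 * of_real 0)" for s y
    using g0[of 0] r(1) by (cases "y = 0") (simp_all add: powr_def Ln_of_real mult.commute)
  have "integrable lborel (\<lambda>y. ?g y * exp (fst p * of_real (ln (norm y)) + snd p * of_real 0))" for p :: "complex \<times> complex"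
  proof (rule continuous_compact_support_integrable)
    have "continuous_on ((- {0}) \<union> ball 0 r) (\<lambda>y. ?g y * exp (fst p * of_real (ln (norm y)) + snd p * of_real 0))"
    proof (rule continuous_on_open_Un)
      show "continuous_on (- {0}) (\<lambda>y. ?g y * exp (fst p * of_real (ln (norm y)) + snd p * of_real 0))"
        by (intro continuous_intros gc) auto
      have "continuous_on (ball 0 r) (\<lambda>y :: real ^ 'm. 0 :: complex)" by simp
      then show "continuous_on (ball 0 r) (\<lambda>y. ?g y * exp (fst p * of_real (ln (norm y)) + snd p * of_real 0))"
        by (rule continuous_on_eq) (use g0 in simp)
    qed auto
    moreover have "(- {0}) \<union> ball (0 :: real ^ 'm) r = UNIV" using r(1) by auto
    ultimately show "continuous_on UNIV (\<lambda>y. ?g y * exp (fst p * of_real (ln (norm y)) + snd p * of_real 0))" by simp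
    show "?g y * exp (fst p * of_real (ln (norm y)) + snd p * of_real 0) = 0" if "R < norm y" for y
      using testR_zero[OF F, of "(y, 0)"] that by (simp add: norm_Pair)
  qed
  from laplace_integral_holo2[OF _ _ _ open_UNIV this]
  have "holo2_on (\<lambda>p. \<integral>y. ?g y * exp (fst p * of_real (ln (norm y)) + snd p * of_real 0) \<partial>lborel) UNIV"
    using borel_measurable_continuous_onI[OF gc] by simp
  from holo2_on_line[OF this, of UNIV 1 0 0 0]
  show ?thesis unfolding PI_def e by simp
qed

section \<open>The residue formulas for general test functions\<close>

definition X_sum :: "nat \<Rightarrow> complex \<Rightarrow> 'm::finite space cfun \<Rightarrow> complex" where
  "X_sum k b \<phi> = (\<Sum>i\<le>k. (- 1) ^ i * pochhammer (- of_nat k - b + hdim TYPE('m)) i / (fact i * fact (2 * k + 1 - 2 * i))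
       * PI (- 2 * (- of_nat k - b + hdim TYPE('m)) - 2 * of_nat i) ((Dn ^^ (2 * k + 1 - 2 * i)) \<phi>))"

lemma KT_X:
  fixes \<phi> :: "'m::finite space cfun"
  assumes \<phi>: "\<phi> \<in> test_functions" and b: "Re b > 0"
  shows "KT (- of_nat k, b) \<phi> = (- 1) ^ k * fact k * rGamma b * X_sum k b \<phi>"
proof -
  obtain R where R: "R > 0" "\<phi> \<in> testR R" "symm \<phi> \<in> odd_test R" using test_symm[OF \<phi>] .
  show ?thesis unfolding KT_def J_X[OF R(1,3) b] X_sum_def
  proof (intro arg_cong2[where f = "(*)"] sum.cong refl PI_symm[OF R(2,1)])
    fix i assume i: "i \<in> {..k}"
    then show "odd (2 * k + 1 - 2 * i)" by auto
    have "real i \<le> real k" using i by simp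
    then show "- real CARD('m) < Re (- 2 * (- of_nat k - b + hdim TYPE('m)) - 2 * of_nat i)" using b by simp
  qed
qed

lemma Dn_power_zero:
  assumes "open U" "\<And>x. x \<in> U \<Longrightarrow> f x = 0" "x \<in> U" shows "(Dn ^^ m) f x = 0"
  using pderivs_cong[OF assms(1) _ assms(3), of f "\<lambda>_. 0"] assms(2) by (simp add: Dn_power_pderivs pderivs_zero)

text \<open>For test functions that vanish near the origin both sides of \<open>KT_X\<close> are
  entire in b. Such functions are enough to determine supports, and the formula then holds also
  where |x'|^s is not locally integrable.\<close>

lemma KT_X_off:
  fixes \<phi> :: "'m::finite space cfun"
  assumes \<phi>: "\<phi> \<in> test_functions" and r: "r > 0" "\<And>x. norm x < r \<Longrightarrow> \<phi> x = 0"
  shows "KT (- of_nat k, b) \<phi> = (- 1) ^ k * fact k * rGamma b * X_sum k b \<phi>"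
proof (rule entire_eq_line[of "\<lambda>b. KT (- of_nat k, b) \<phi>" "\<lambda>b. (- 1) ^ k * fact k * rGamma b * X_sum k b \<phi>" 0 b])
  obtain R where R: "R > 0" "\<phi> \<in> testR R" "symm \<phi> \<in> odd_test R" using test_symm[OF \<phi>] .
  show "(\<lambda>b. KT (- of_nat k, b) \<phi>) holomorphic_on UNIV"
    unfolding KT_def using holo_J_line[OF R(1,3), of 0 "- of_nat k" 1 0] by simp
  have P: "(\<lambda>b. PI (- 2 * (- of_nat k - b + hdim TYPE('m)) - 2 * of_nat i) ((Dn ^^ m) \<phi>)) holomorphic_on UNIV" for i m
  proof (rule holomorphic_on_compose_gen[of _ _ "\<lambda>s. PI s ((Dn ^^ m) \<phi>)" UNIV, unfolded o_def])
    show "(\<lambda>s. PI s ((Dn ^^ m) \<phi>)) holomorphic_on UNIV"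
    proof (rule PI_holomorphic[OF testR_Dn_power[OF R(2)] r(1)])
      show "(Dn ^^ m) \<phi> x = 0" if "norm x < r" for x
        by (rule Dn_power_zero[of "ball 0 r"]) (use that r(2) in auto)
    qed
  qed (auto intro!: holomorphic_intros)
  have H: "(\<lambda>b. pochhammer (- of_nat k - b + hdim TYPE('m)) i) holomorphic_on UNIV" for i
    unfolding pochhammer_prod by (intro holomorphic_intros)
  show "(\<lambda>b. (- 1) ^ k * fact k * rGamma b * X_sum k b \<phi>) holomorphic_on UNIV"
    unfolding X_sum_def by (intro holomorphic_intros P H) simp_all
qed (use KT_X[OF \<phi>] in simp)

lemma KT_Y:
  fixes \<phi> :: "'m::finite space cfun"
  assumes \<phi>: "\<phi> \<in> test_functions"
  shows "KT (a, - of_nat l) \<phi> =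
    (- 1) ^ l * fact l * of_real (pi powr (real CARD('m) / 2)) * rGamma (a + of_nat l + hdim TYPE('m)) * YY l a \<phi>"
proof -
  obtain R where R: "R > 0" "\<phi> \<in> testR R" "symm \<phi> \<in> odd_test R" using test_symm[OF \<phi>] .
  have "YY l a (symm \<phi>) = YY l a \<phi>"
    unfolding YY_def by (intro sum.cong refl arg_cong2[where f = "(*)"] DD_symm testR_smooth[OF R(2)]) simp
  then show ?thesis unfolding KT_def J_Y[OF R(1,3)] by simp
qed

section \<open>The family away from the hyperplane x_n = 0\<close>

lemma ker_continuous_off: "continuous_on {x. snd x \<noteq> 0} (ker a mu)"
  unfolding ker_def[abs_def] by (intro continuous_intros) auto

lemma ker_off_integrable:
  fixes \<phi> :: "'m::finite space cfun"
  assumes \<phi>: "\<phi> \<in> test_functions" and off: "fun_supp \<phi> \<subseteq> {x. snd x \<noteq> 0}"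
  shows "integrable lborel (\<lambda>x. ker a mu x * \<phi> x)"
proof -
  obtain R where R: "R > 0" "\<phi> \<in> testR R" using test_obtain_testR[OF \<phi>] .
  have cl: "closed (fun_supp \<phi>)" by (simp add: fun_supp_def)
  have "continuous_on ({x. snd x \<noteq> 0} \<union> - fun_supp \<phi>) (\<lambda>x. ker a mu x * \<phi> x)"
  proof (rule continuous_on_open_Un)
    show "continuous_on {x. snd x \<noteq> 0} (\<lambda>x. ker a mu x * \<phi> x)"
      by (intro continuous_intros ker_continuous_off smooth_continuous testR_smooth[OF R(2)])
    have "continuous_on (- fun_supp \<phi>) (\<lambda>x. 0 :: complex)" by simp
    then show "continuous_on (- fun_supp \<phi>) (\<lambda>x. ker a mu x * \<phi> x)"
      by (rule continuous_on_eq) (simp add: fun_supp_imp_zero)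
    show "open {x :: 'm space. snd x \<noteq> 0}" by (intro open_Collect_neq continuous_intros)
  qed (use cl in auto)
  moreover have "{x. snd x \<noteq> 0} \<union> - fun_supp \<phi> = UNIV" using off by auto
  ultimately have "continuous_on UNIV (\<lambda>x. ker a mu x * \<phi> x)" by simp
  then show ?thesis
    by (rule continuous_compact_support_integrable[where R = R]) (simp add: testR_zero[OF R(2)])
qed

lemma II_off_holo2:
  fixes \<phi> :: "'m::finite space cfun"
  assumes \<phi>: "\<phi> \<in> test_functions" and off: "fun_supp \<phi> \<subseteq> {x. snd x \<noteq> 0}"
  shows "holo2_on (\<lambda>p. II (fst p) (fst p - snd p + hdim TYPE('m)) \<phi>) UNIV"
proof -
  obtain R where R: "R > 0" "\<phi> \<in> testR R" using test_obtain_testR[OF \<phi>] .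
  show ?thesis unfolding II_def
    by (rule ker_integral_holo2[OF smooth_measurable[OF testR_smooth[OF R(2)]] open_UNIV ker_off_integrable[OF \<phi> off]])
qed

text \<open>Away from the hyperplane the kernel is continuous for all parameters, so the integral is
  entire and the identity of the convergent range continues.\<close>

lemma KT_off:
  fixes \<phi> :: "'m::finite space cfun"
  assumes \<phi>: "\<phi> \<in> test_functions" and off: "fun_supp \<phi> \<subseteq> {x. snd x \<noteq> 0}"
  shows "KT (a, b) \<phi> = rGamma a * rGamma b * II a (a - b + hdim TYPE('m)) \<phi>"
proof -
  let ?H = "\<lambda>p. rGamma (1 * fst p + 0 * snd p + 0) * rGamma (0 * fst p + 1 * snd p + 0) * II (fst p) (fst p - snd p + hdim TYPE('m)) \<phi>"
  let ?T = "{p :: complex \<times> complex. Re (fst p) > 1/2} \<inter> {p. Re (snd p) > 1/2}"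
  have "KT (a, b) \<phi> = ?H (a, b)"
  proof (rule holo2_eq_convex[OF holo2_KT[OF \<phi>], of ?H ?T])
    show "holo2_on ?H UNIV" by (intro holo2_on_mult holo2_on_rGamma II_off_holo2[OF \<phi> off])
    show "open ?T" by (intro open_Int open_Collect_less continuous_intros)
    have "(1, 1) \<in> ?T" by simp
    then show "?T \<noteq> {}" by blast
    show "KT p \<phi> = ?H p" if "p \<in> ?T" for p
      using KT_base[OF \<phi>, of "fst p" "snd p"] that by simp
  qed auto
  then show ?thesis by simp
qed

lemma WI_off:
  fixes \<phi> :: "'m::finite space cfun"
  assumes \<phi>: "\<phi> \<in> test_functions" and off: "fun_supp \<phi> \<subseteq> {x. snd x \<noteq> 0}"
  shows "WI a (symm \<phi>) = rGamma a * II a 0 \<phi>"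
proof (rule entire_eq_line[of "\<lambda>a. WI a (symm \<phi>)" "\<lambda>a. rGamma a * II a 0 \<phi>" 1 a])
  obtain R where R: "R > 0" "\<phi> \<in> testR R" "symm \<phi> \<in> odd_test R" using test_symm[OF \<phi>] .
  show "(\<lambda>a. WI a (symm \<phi>)) holomorphic_on UNIV" by (rule WI_holomorphic[OF R(1,3)])
  have "(\<lambda>a. II a 0 \<phi>) holomorphic_on UNIV"
    using holo2_on_line[OF II_off_holo2[OF \<phi> off], of UNIV 1 0 1 "hdim TYPE('m)"] by simp
  then show "(\<lambda>a. rGamma a * II a 0 \<phi>) holomorphic_on UNIV" by (intro holomorphic_intros)
  fix x :: real assume x: "x > 1"
  then have "kcond TYPE('m) (of_real x) 0" by (intro kcond_nice) auto
  from WI_base[OF R(1,3), of "of_real x"] II_symm[OF this R(2)] x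
  show "WI (of_real x) (symm \<phi>) = rGamma (of_real x) * II (of_real x) 0 \<phi>" by simp
qed

lemma ker_nonzero: "snd x \<noteq> 0 \<Longrightarrow> ker a mu x \<noteq> 0"
  by (simp add: ker_def sgn_if)

lemma open_off: "open {x :: 'm::finite space. snd x \<noteq> 0}"
  by (intro open_Collect_neq continuous_intros)

text \<open>The weight is 1 for \<open>KA_tilde\<close> and |x|^(2j) for
  \<open>KAA_tilde\<close>.\<close>

lemma II_off_nonzero:
  fixes x0 :: "'m::finite space"
  assumes U: "open U" "x0 \<in> U" and x0: "snd x0 \<noteq> 0" and w: "smooth w" "w x0 \<noteq> 0"
  obtains \<phi> where "\<phi> \<in> test_functions" "fun_supp \<phi> \<subseteq> U" "fun_supp \<phi> \<subseteq> {x. snd x \<noteq> 0}"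
    "II a mu (\<lambda>x. w x * \<phi> x) \<noteq> 0"
proof -
  define V where "V = U \<inter> {x. snd x \<noteq> 0}"
  define h where "h = (\<lambda>x. ker a mu x * w x)"
  have V: "open V" "x0 \<in> V" using U x0 open_off by (auto simp: V_def)
  have hc: "continuous_on V h" unfolding h_def V_def
    by (intro continuous_intros smooth_continuous w continuous_on_subset[OF ker_continuous_off]) auto
  have h0: "h x0 \<noteq> 0" using ker_nonzero[OF x0] w by (simp add: h_def)
  obtain r where r: "r > 0" "cball x0 r \<subseteq> V" "\<And>x. dist x x0 < r \<Longrightarrow> norm (h x - h x0) \<le> norm (h x0) / 2"
    using continuous_small_ball[OF V hc h0] by blast
  obtain g :: "'m space \<Rightarrow> real" where g: "smooth (\<lambda>x. complex_of_real (g x))" "\<And>x. g x \<ge> 0" "g x0 > 0"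
    "\<And>x. r \<le> dist x x0 \<Longrightarrow> g x = 0" "continuous_on UNIV g"
    using bump_exists[OF r(1), of x0] by blast
  define \<phi> where "\<phi> = (\<lambda>x. 1 * complex_of_real (g x))"
  have t: "\<phi> \<in> test_functions" "fun_supp \<phi> \<subseteq> cball x0 r"
    unfolding \<phi>_def by (rule bump_test[OF g(1,4) smooth_const]; assumption)+
  have "(\<integral>x. h x * complex_of_real (g x) \<partial>lborel) \<noteq> 0"
    by (rule integral_bump_nonzero[OF g(5,2,3,4) V(1) r(2) hc h0 r(3)])
  then have "II a mu (\<lambda>x. w x * \<phi> x) \<noteq> 0" by (simp add: II_def h_def \<phi>_def mult.assoc)
  then show ?thesis using that[OF t(1)] t(2) r(2) unfolding V_def by blast
qed

section \<open>Test functions that detect boundary densities and derivatives at the origin\<close>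

lemma Dn_snd_mult:
  assumes g: "smooth g"
  shows "(Dn ^^ q) (\<lambda>x. of_real (snd x) * g x) = (\<lambda>x. of_real (snd x) * (Dn ^^ q) g x + of_nat q * (Dn ^^ (q - 1)) g x)"
proof (induction q)
  case (Suc q)
  have D: "Dn (\<lambda>x. of_real (snd x) * h x) = (\<lambda>x. of_real (snd x) * Dn h x + h x)" if "smooth h" for h :: "'a space cfun"
    using pderiv_along_mult[OF smooth_differentiable[OF smooth_snd] smooth_differentiable[OF that]]
      pderiv_along_coord[of "e_n :: 'a space" "e_n :: 'a space"] by (intro ext) simp
  have s: "smooth ((Dn ^^ i) g)" for i by (rule smooth_Dn_power[OF g])
  have "(Dn ^^ Suc q) (\<lambda>x. of_real (snd x) * g x) = Dn (\<lambda>x. of_real (snd x) * (Dn ^^ q) g x + of_nat q * (Dn ^^ (q - 1)) g x)"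
    by (simp only: funpow.simps o_apply Suc.IH)
  also have "... = (\<lambda>x. Dn (\<lambda>x. of_real (snd x) * (Dn ^^ q) g x) x + of_nat q * Dn ((Dn ^^ (q - 1)) g) x)"
    using Dn_power_add[of "\<lambda>x. of_real (snd x) * (Dn ^^ q) g x" "\<lambda>x. of_nat q * (Dn ^^ (q - 1)) g x" 1]
      Dn_power_cmult[OF s, of 1 "of_nat q" "q - 1"] by (simp add: smooth_mult smooth_cmult s)
  also have "... = (\<lambda>x. of_real (snd x) * (Dn ^^ Suc q) g x + of_nat (Suc q) * (Dn ^^ q) g x)"
    unfolding D[OF s] by (cases q) (auto simp: algebra_simps)
  finally show ?case by simp
qed simp

lemma Dn_snd_power:
  assumes "smooth g" "q \<le> m"
  shows "(Dn ^^ q) (\<lambda>x. of_real (snd x) ^ m * g x) (y, 0) = (if q = m then fact m * g (y, 0) else 0)"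
  using assms
proof (induction m arbitrary: q g)
  case (Suc m)
  have s: "smooth (\<lambda>x. of_real (snd x) ^ m * g x)"
  proof -
    have "smooth (\<lambda>x :: 'a space. complex_of_real (snd x) ^ m)"
      by (induction m) (auto intro: smooth_mult)
    then show ?thesis using Suc.prems by (intro smooth_mult)
  qed
  have e: "(\<lambda>x. of_real (snd x) ^ Suc m * g x) = (\<lambda>x. of_real (snd x) * (of_real (snd x) ^ m * g x))"
    by (simp add: mult.assoc)
  show ?case
  proof (cases q)
    case 0
    then show ?thesis by simp
  next
    case (Suc r)
    then have "r \<le> m" using Suc.prems by simp
    from Suc.IH[OF Suc.prems(1) this] show ?thesis
      unfolding e Dn_snd_mult[OF s] using \<open>q = Suc r\<close> by (simp add: algebra_simps)
  qed
qed simp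

lemma smooth_snd_power: "smooth (\<lambda>x :: 'm::finite space. complex_of_real (snd x) ^ m)"
  by (induction m) (auto intro: smooth_mult)

text \<open>The test function is x_n^m times a bump around (y0, 0). On the hyperplane all normal
  derivatives below order m vanish, so only the leading term of a residue formula survives, with
  density m! times the bump.\<close>

lemma PI_nonzero:
  fixes y0 :: "real ^ 'm::finite"
  assumes U: "open U" "(y0, 0) \<in> U" and y0: "y0 \<noteq> 0" and w: "smooth w" "w (y0, 0) \<noteq> 0"
  obtains \<phi> r where "\<phi> \<in> test_functions" "fun_supp \<phi> \<subseteq> U" "r > 0" "\<And>x. norm x < r \<Longrightarrow> \<phi> x = 0"
    "\<And>q y. q < m \<Longrightarrow> (Dn ^^ q) (\<lambda>x. w x * \<phi> x) (y, 0) = 0" "PI s ((Dn ^^ m) (\<lambda>x. w x * \<phi> x)) \<noteq> 0"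
proof -
  define h where "h = (\<lambda>y :: real ^ 'm. of_real (norm y) powr s * (fact m * w (y, 0)))"
  have eh: "h y = exp (s * of_real (ln (norm y))) * (fact m * w (y, 0))" if "y \<noteq> 0" for y
    using that by (simp add: h_def powr_def Ln_of_real)
  have oV: "open (- {0 :: real ^ 'm})" by (rule open_Compl) simp
  have wc: "continuous_on A (\<lambda>y :: real ^ 'm. w (y, 0))" for A
    by (rule continuous_on_compose2[OF smooth_continuous[OF w(1), of UNIV]]) (auto intro!: continuous_intros)
  have "continuous_on (- {0}) (\<lambda>y :: real ^ 'm. exp (s * of_real (ln (norm y))) * (fact m * w (y, 0)))"
    by (intro continuous_intros wc) auto
  then have hc: "continuous_on (- {0}) h" by (rule continuous_on_eq) (simp add: eh)
  have h0: "h y0 \<noteq> 0" using eh[OF y0] w(2) by simp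
  obtain r1 where r1: "r1 > 0" "cball y0 r1 \<subseteq> - {0}" "\<And>y. dist y y0 < r1 \<Longrightarrow> norm (h y - h y0) \<le> norm (h y0) / 2"
    using continuous_small_ball[OF oV _ hc h0] y0 by blast
  obtain r2 where r2: "r2 > 0" "cball (y0, 0) r2 \<subseteq> U" using U open_contains_cball by blast
  \<comment> \<open>The bound by half the norm of y0 keeps the support away from the origin, where
    the density |y|^s may be singular.\<close>
  define r where "r = min (min r1 r2) (norm y0 / 2)"
  have r: "r > 0" "r \<le> r1" "r \<le> r2" "r \<le> norm y0 / 2" using r1(1) r2(1) y0 by (auto simp: r_def)
  obtain g :: "'m space \<Rightarrow> real" where g: "smooth (\<lambda>x. complex_of_real (g x))" "\<And>x. g x \<ge> 0" "g (y0, 0) > 0"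
    "\<And>x. r \<le> dist x (y0, 0) \<Longrightarrow> g x = 0" "continuous_on UNIV g"
    using bump_exists[OF r(1), of "(y0, 0)"] by blast
  define \<phi> where "\<phi> = (\<lambda>x. of_real (snd x) ^ m * complex_of_real (g x))"
  have t: "\<phi> \<in> test_functions" "fun_supp \<phi> \<subseteq> cball (y0, 0) r"
    unfolding \<phi>_def by (rule bump_test[OF g(1,4) smooth_snd_power]; assumption)+
  have e: "(\<lambda>x. w x * \<phi> x) = (\<lambda>x. of_real (snd x) ^ m * (w x * complex_of_real (g x)))"
    by (simp add: \<phi>_def mult_ac)
  note D = Dn_snd_power[OF smooth_mult[OF w(1) g(1)]]
  have d: "dist (y, 0) (y0, 0 :: real) = dist y y0" for y :: "real ^ 'm" by (simp add: dist_Pair_Pair)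
  have "(\<integral>y. h y * complex_of_real (g (y, 0)) \<partial>lborel) \<noteq> 0"
  proof (rule integral_bump_nonzero[where r = r and ?x0.0 = y0, OF _ _ _ _ oV _ hc h0])
    show "continuous_on UNIV (\<lambda>y. g (y, 0))"
      by (rule continuous_on_compose2[OF g(5)]) (auto intro!: continuous_intros)
    show "cball y0 r \<subseteq> - {0}" using r1(2) r(2) subset_cball[of r r1 y0] by blast
    show "g (y, 0) = 0" if "r \<le> dist y y0" for y using g(4)[of "(y, 0)"] that d by simp
    show "norm (h y - h y0) \<le> norm (h y0) / 2" if "dist y y0 < r" for y using r1(3) that r(2) by simp
  qed (use g in auto)
  also have "(\<integral>y. h y * complex_of_real (g (y, 0)) \<partial>lborel) = PI s ((Dn ^^ m) (\<lambda>x. w x * \<phi> x))"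
    unfolding PI_def e D[OF order_refl] h_def by (simp add: mult_ac)
  finally have "PI s ((Dn ^^ m) (\<lambda>x. w x * \<phi> x)) \<noteq> 0" .
  moreover have "\<phi> x = 0" if "norm x < norm y0 / 2" for x
  proof -
    have "norm (y0, 0 :: real) = norm y0" by (simp add: norm_Pair)
    then have "r \<le> dist x (y0, 0)" using norm_triangle_ineq2[of "(y0, 0)" x] that r(4) by (simp add: dist_norm norm_minus_commute)
    then show ?thesis using g(4) by (simp add: \<phi>_def)
  qed
  moreover have "(Dn ^^ q) (\<lambda>x. w x * \<phi> x) (y, 0) = 0" if "q < m" for q y unfolding e using D[of q m y] that by simp
  moreover have "fun_supp \<phi> \<subseteq> U" using t(2) r2(2) r(3) subset_cball[of r r2 "(y0, 0 :: real)"] by blast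
  moreover have "norm y0 / 2 > 0" using y0 by simp
  ultimately show ?thesis using that[OF t(1)] by blast
qed

lemma Lp_coord_mult:
  fixes b :: "real ^ 'm::finite"
  assumes Gf: "smooth Gf" and b: "b \<in> Basis"
  shows "Lp (\<lambda>x. of_real (x \<bullet> (b, 0)) * Gf x) = (\<lambda>x. of_real (x \<bullet> (b, 0)) * Lp Gf x + 2 * pderiv_along (b, 0) Gf x)"
    and "Lp (\<lambda>x :: 'm space. of_real (snd x) * Gf x) = (\<lambda>x. of_real (snd x) * Lp Gf x)"
proof -
  have gen: "pderiv_along v (pderiv_along v (\<lambda>x. of_real (x \<bullet> u) * Gf x)) x
      = of_real (x \<bullet> u) * pderiv_along v (pderiv_along v Gf) x + 2 * of_real (v \<bullet> u) * pderiv_along v Gf x"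
    if v: "v \<in> Basis" for v u x :: "'m space"
  proof -
    have 1: "pderiv_along v (\<lambda>x. of_real (x \<bullet> u) * h x) = (\<lambda>x. of_real (x \<bullet> u) * pderiv_along v h x + of_real (v \<bullet> u) * h x)" if "smooth h" for h
      using pderiv_along_mult[OF differentiable_coord smooth_differentiable[OF that]] by (intro ext) (simp add: pderiv_along_coord)
    have s: "smooth (pderiv_along v Gf)" by (rule smooth_pderiv[OF Gf v])
    have "pderiv_along v (\<lambda>x. of_real (x \<bullet> u) * pderiv_along v Gf x + of_real (v \<bullet> u) * Gf x) x
      = pderiv_along v (\<lambda>x. of_real (x \<bullet> u) * pderiv_along v Gf x) x + pderiv_along v (\<lambda>x. of_real (v \<bullet> u) * Gf x) x"
      by (intro pderiv_along_add smooth_differentiable smooth_mult smooth_cmult smooth_coord s Gf)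
    also have "pderiv_along v (\<lambda>x. of_real (v \<bullet> u) * Gf x) x = of_real (v \<bullet> u) * pderiv_along v Gf x"
      by (intro pderiv_along_cmult smooth_differentiable Gf)
    finally show ?thesis unfolding 1[OF Gf] 1[OF s] by simp
  qed
  have ip: "(c, 0 :: real) \<bullet> (b, 0) = (if c = b then 1 else 0)" if "c \<in> Basis" for c
    using that b by (simp add: inner_prod_def inner_Basis)
  show "Lp (\<lambda>x. of_real (x \<bullet> (b, 0)) * Gf x) = (\<lambda>x. of_real (x \<bullet> (b, 0)) * Lp Gf x + 2 * pderiv_along (b, 0) Gf x)"
  proof
    fix x
    have "Lp (\<lambda>x. of_real (x \<bullet> (b, 0)) * Gf x) x = (\<Sum>c\<in>Basis. of_real (x \<bullet> (b, 0)) * pderiv_along (c, 0) (pderiv_along (c, 0) Gf) x + (if c = b then 2 * pderiv_along (c, 0) Gf x else 0))"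
      unfolding Lp_def by (intro sum.cong refl) (simp only: gen[OF Basis_fst] ip, simp)
    also have "... = of_real (x \<bullet> (b, 0)) * Lp Gf x + 2 * pderiv_along (b, 0) Gf x"
      using b by (simp add: sum.distrib Lp_def sum_distrib_left sum.delta)
    finally show "Lp (\<lambda>x. of_real (x \<bullet> (b, 0)) * Gf x) x = of_real (x \<bullet> (b, 0)) * Lp Gf x + 2 * pderiv_along (b, 0) Gf x" .
  qed
  show "Lp (\<lambda>x :: 'm space. of_real (snd x) * Gf x) = (\<lambda>x. of_real (snd x) * Lp Gf x)"
  proof
    fix x :: "'m space"
    have "of_real (x \<bullet> e_n) = complex_of_real (snd x)" for x :: "'m space" by (simp add: inner_prod_def)
    then have 1: "(\<lambda>x :: 'm space. of_real (snd x) * Gf x) = (\<lambda>x. of_real (x \<bullet> e_n) * Gf x)" by simp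
    have 2: "((c, 0) :: 'm space) \<bullet> e_n = 0" for c by (simp add: inner_prod_def)
    show "Lp (\<lambda>x :: 'm space. of_real (snd x) * Gf x) x = of_real (snd x) * Lp Gf x"
      unfolding 1 Lp_def sum_distrib_left by (intro sum.cong refl) (simp only: gen[OF Basis_fst] 2, simp add: inner_prod_def)
  qed
qed

lemma Lp_power_coord_mult:
  fixes b :: "real ^ 'm::finite"
  assumes Gf: "smooth Gf" and b: "b \<in> Basis"
  shows "(Lp ^^ j) (\<lambda>x. of_real (x \<bullet> (b, 0)) * Gf x) = (\<lambda>x. of_real (x \<bullet> (b, 0)) * (Lp ^^ j) Gf x + 2 * of_nat j * (Lp ^^ (j - 1)) (pderiv_along (b, 0) Gf) x)"
    and "(Lp ^^ j) (\<lambda>x :: 'm space. of_real (snd x) * Gf x) = (\<lambda>x. of_real (snd x) * (Lp ^^ j) Gf x)"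
proof -
  have s: "smooth ((Lp ^^ i) Gf)" "smooth ((Lp ^^ i) (pderiv_along (b, 0) Gf))" for i
    using b by (auto intro!: smooth_Lp_power smooth_pderiv Gf)
  have c: "pderiv_along (b, 0) ((Lp ^^ i) Gf) = (Lp ^^ i) (pderiv_along (b, 0) Gf)" for i
    by (induction i) (simp_all add: Lp_pderiv[symmetric] s b)
  show "(Lp ^^ j) (\<lambda>x. of_real (x \<bullet> (b, 0)) * Gf x) = (\<lambda>x. of_real (x \<bullet> (b, 0)) * (Lp ^^ j) Gf x + 2 * of_nat j * (Lp ^^ (j - 1)) (pderiv_along (b, 0) Gf) x)"
  proof (induction j)
    case (Suc j)
    have "(Lp ^^ Suc j) (\<lambda>x. of_real (x \<bullet> (b, 0)) * Gf x) = Lp (\<lambda>x. of_real (x \<bullet> (b, 0)) * (Lp ^^ j) Gf x + 2 * of_nat j * (Lp ^^ (j - 1)) (pderiv_along (b, 0) Gf) x)"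
      by (simp only: funpow.simps o_apply Suc.IH)
    also have "... = (\<lambda>x. Lp (\<lambda>x. of_real (x \<bullet> (b, 0)) * (Lp ^^ j) Gf x) x + 2 * of_nat j * Lp ((Lp ^^ (j - 1)) (pderiv_along (b, 0) Gf)) x)"
      by (simp only: Lp_add Lp_cmult s smooth_mult smooth_cmult smooth_coord)
    also have "... = (\<lambda>x. of_real (x \<bullet> (b, 0)) * (Lp ^^ Suc j) Gf x + 2 * of_nat (Suc j) * (Lp ^^ j) (pderiv_along (b, 0) Gf) x)"
      unfolding Lp_coord_mult(1)[OF s(1) b] c by (cases j) (auto simp: algebra_simps)
    finally show ?case by simp
  qed simp
  show "(Lp ^^ j) (\<lambda>x :: 'm space. of_real (snd x) * Gf x) = (\<lambda>x. of_real (snd x) * (Lp ^^ j) Gf x)"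
    by (induction j) (simp_all add: Lp_coord_mult(2)[OF s(1) b])
qed

text \<open>At the origin the product formula leaves only the commutator term, which lowers the
  power of the coordinate by two and the power of the Laplacian by one. The factors 2(j + 1) and k -
  1 collected on the way build up k!.\<close>

lemma Lp_power_coord_power:
  fixes b :: "real ^ 'm::finite"
  assumes b: "b \<in> Basis"
  shows "smooth g \<Longrightarrow> 2 * j \<le> k \<Longrightarrow> (Lp ^^ j) (\<lambda>x. of_real (x \<bullet> (b, 0)) ^ k * g x) 0 = (if 2 * j = k then fact k * g 0 else 0)"
proof (induction j arbitrary: k g)
  case 0
  then show ?case by simp
next
  case (Suc j)
  obtain i where i: "k = Suc (Suc i)" "2 * j \<le> i" using Suc.prems(2) by (cases k; cases "k - 1") auto
  let ?c = "\<lambda>x :: 'm space. complex_of_real (x \<bullet> (b, 0))"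
  have sc: "smooth (\<lambda>x. ?c x ^ q)" for q by (induction q) (auto intro: smooth_mult)
  define Gf where "Gf = (\<lambda>x. ?c x ^ Suc i * g x)"
  have sG: "smooth Gf" unfolding Gf_def by (intro smooth_mult sc Suc.prems)
  have sd: "smooth (pderiv_along (b, 0) g)" using b by (intro smooth_pderiv Suc.prems) auto
  have bb: "(b, 0 :: real) \<bullet> (b, 0) = 1" using b by (simp add: inner_prod_def)
  have pc: "pderiv_along (b, 0) (\<lambda>x. ?c x ^ q) x = of_nat q * ?c x ^ (q - 1)" for q x
  proof (induction q)
    case (Suc q)
    have "pderiv_along (b, 0) (\<lambda>x. ?c x * ?c x ^ q) x = ?c x * pderiv_along (b, 0) (\<lambda>x. ?c x ^ q) x + pderiv_along (b, 0) ?c x * ?c x ^ q"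
      by (intro pderiv_along_mult differentiable_coord smooth_differentiable[OF sc])
    then show ?case unfolding Suc.IH pderiv_along_coord bb by (cases q) (simp_all add: algebra_simps)
  qed (simp add: pderiv_along_const)
  have dG: "pderiv_along (b, 0) Gf = (\<lambda>x. of_nat (Suc i) * (?c x ^ i * g x) + ?c x ^ Suc i * pderiv_along (b, 0) g x)"
  proof
    fix x
    have "pderiv_along (b, 0) Gf x = ?c x ^ Suc i * pderiv_along (b, 0) g x + pderiv_along (b, 0) (\<lambda>x. ?c x ^ Suc i) x * g x"
      unfolding Gf_def by (intro pderiv_along_mult smooth_differentiable sc Suc.prems)
    then show "pderiv_along (b, 0) Gf x = of_nat (Suc i) * (?c x ^ i * g x) + ?c x ^ Suc i * pderiv_along (b, 0) g x"
      unfolding pc by (simp add: algebra_simps)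
  qed
  have "(Lp ^^ j) (pderiv_along (b, 0) Gf) 0 = of_nat (Suc i) * (Lp ^^ j) (\<lambda>x. ?c x ^ i * g x) 0 + (Lp ^^ j) (\<lambda>x. ?c x ^ Suc i * pderiv_along (b, 0) g x) 0"
    unfolding dG by (simp only: Lp_power_add Lp_power_cmult smooth_mult smooth_cmult sc sd Suc.prems)
  also have "... = of_nat (Suc i) * (if 2 * j = i then fact i * g 0 else 0)"
    using Suc.IH[OF Suc.prems(1) i(2)] Suc.IH[OF sd, of "Suc i"] i(2) by (simp del: of_nat_Suc)
  finally have 1: "(Lp ^^ j) (pderiv_along (b, 0) Gf) 0 = of_nat (Suc i) * (if 2 * j = i then fact i * g 0 else 0)" .
  have e: "(\<lambda>x. ?c x ^ k * g x) = (\<lambda>x. ?c x * Gf x)" by (simp add: Gf_def i(1) mult_ac)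
  have "(Lp ^^ Suc j) (\<lambda>x. ?c x ^ k * g x) 0 = 2 * of_nat (Suc j) * (Lp ^^ j) (pderiv_along (b, 0) Gf) 0"
    unfolding e Lp_power_coord_mult(1)[OF sG b] by simp
  also have "... = of_nat (2 * Suc j) * of_nat (Suc i) * (if 2 * j = i then fact i * g 0 else 0)"
    unfolding 1 by (simp only: of_nat_mult of_nat_numeral mult.assoc)
  also have "... = (if 2 * Suc j = k then fact k * g 0 else 0)"
  proof (cases "2 * j = i")
    case True
    then have k: "k = 2 * Suc j" using i(1) by simp
    have "fact k = (of_nat k * (of_nat (Suc i) * fact i) :: complex)" unfolding i(1) by (simp only: fact_Suc)
    then show ?thesis using True k by (simp only: if_True mult.assoc refl)
  qed (use i(1) in simp)
  finally show ?case .
qed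

text \<open>The test function x_n x_b^(2l) times a bump isolates the summand j = l. Its coefficient
  contains \<open>pochhammer a 0\<close> = 1, so it is nonzero for every a, including the
  exceptional parameters.\<close>

lemma YY_nonzero:
  fixes U :: "'m::finite space set"
  assumes U: "open U" "0 \<in> U"
  obtains \<phi> :: "'m space cfun" where "\<phi> \<in> test_functions" "fun_supp \<phi> \<subseteq> U" "YY l a \<phi> \<noteq> 0"
proof -
  obtain b :: "real ^ 'm" where b: "b \<in> Basis" using nonempty_Basis by blast
  obtain r where r: "r > 0" "cball 0 r \<subseteq> U" using U open_contains_cball by blast
  obtain g :: "'m space \<Rightarrow> real" where g: "smooth (\<lambda>x. complex_of_real (g x))" "\<And>x. g x \<ge> 0" "g 0 > 0"
    "\<And>x. r \<le> dist x 0 \<Longrightarrow> g x = 0" "continuous_on UNIV g"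
    using bump_exists[OF r(1), of 0] by blast
  let ?c = "\<lambda>x :: 'm space. complex_of_real (x \<bullet> (b, 0))"
  have sc: "smooth (\<lambda>x. ?c x ^ q)" for q by (induction q) (auto intro: smooth_mult)
  define h where "h = (\<lambda>x. complex_of_real (g x))"
  define \<phi> where "\<phi> = (\<lambda>x. (of_real (snd x) * ?c x ^ (2 * l)) * h x)"
  have t: "\<phi> \<in> test_functions" "fun_supp \<phi> \<subseteq> cball 0 r"
    unfolding \<phi>_def h_def by (rule bump_test[OF g(1,4) smooth_mult[OF smooth_snd sc]]; assumption)+
  have sh: "smooth h" using g(1) by (simp add: h_def)
  let ?Gf = "\<lambda>x. ?c x ^ (2 * l) * h x"
  have sG: "smooth ?Gf" by (intro smooth_mult sc sh)
  have e: "\<phi> = (\<lambda>x. of_real (snd x) * ?Gf x)" by (simp add: \<phi>_def mult.assoc)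
  have DG: "(Dn ^^ q) ?Gf = (\<lambda>x. ?c x ^ (2 * l) * (Dn ^^ q) h x)" for q
  proof (induction q)
    case (Suc q)
    have s: "smooth ((Dn ^^ q) h)" by (rule smooth_Dn_power[OF sh])
    have z: "Dn (\<lambda>x. ?c x ^ n) x = 0" for n x
    proof (induction n)
      case (Suc n)
      have "Dn (\<lambda>x. ?c x * ?c x ^ n) x = ?c x * Dn (\<lambda>x. ?c x ^ n) x + Dn ?c x * ?c x ^ n"
        by (intro pderiv_along_mult differentiable_coord smooth_differentiable[OF sc])
      then show ?case unfolding Suc.IH pderiv_along_coord by (simp add: inner_prod_def)
    qed (simp add: pderiv_along_const)
    have "Dn (\<lambda>x. ?c x ^ (2 * l) * (Dn ^^ q) h x) = (\<lambda>x. ?c x ^ (2 * l) * Dn ((Dn ^^ q) h) x)"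
    proof
      fix x
      have "Dn (\<lambda>x. ?c x ^ (2 * l) * (Dn ^^ q) h x) x = ?c x ^ (2 * l) * Dn ((Dn ^^ q) h) x + Dn (\<lambda>x. ?c x ^ (2 * l)) x * (Dn ^^ q) h x"
        by (intro pderiv_along_mult smooth_differentiable sc s)
      then show "Dn (\<lambda>x. ?c x ^ (2 * l) * (Dn ^^ q) h x) x = ?c x ^ (2 * l) * Dn ((Dn ^^ q) h) x" unfolding z by simp
    qed
    then show ?case using Suc.IH by (simp only: funpow.simps o_apply)
  qed simp
  have LD: "(Dn ^^ q) ((Lp ^^ j) ?Gf) = (Lp ^^ j) ((Dn ^^ q) ?Gf)" for q j
    by (induction q) (simp_all add: Lp_power_Dn[symmetric] smooth_Dn_power[OF sG])
  have DD: "DD j (Suc q) \<phi> = of_nat (Suc q) * (Lp ^^ j) (\<lambda>x. ?c x ^ (2 * l) * (Dn ^^ q) h x) 0" for j q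
    unfolding DD_def e Lp_power_coord_mult(2)[OF sG b] Dn_snd_mult[OF smooth_Lp_power[OF sG]] by (simp add: LD[unfolded DG])
  have "DD j (2 * (l - j) + 1) \<phi> = (if j = l then fact (2 * l) * h 0 else 0)" if "j \<le> l" for j
    using DD[of j "2 * (l - j)"] Lp_power_coord_power[OF b smooth_Dn_power[OF sh], of j "2 * l" "2 * (l - j)"] that
    by auto
  then have "YY l a \<phi> = (\<Sum>j\<le>l. if j = l then fact (2 * l) * h 0 / (4 ^ l * fact l) else 0)"
    unfolding YY_def by (intro sum.cong refl) auto
  also have "... = fact (2 * l) * h 0 / (4 ^ l * fact l)" by simp
  also have "... \<noteq> 0" using g(3) by (simp add: h_def)
  finally show ?thesis using that t r(2) by blast
qed

section \<open>The kernels of the statement in terms of \<open>PI\<close> and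
  \<open>YY\<close>\<close>

lemma dderiv_power: "(dderiv e_n ^^ m) S \<phi> = (- 1) ^ m * S ((Dn ^^ m) \<phi>)"
proof (induction m arbitrary: \<phi>)
  case (Suc m)
  have "(dderiv e_n ^^ Suc m) S \<phi> = - (dderiv e_n ^^ m) S (Dn \<phi>)" by (simp add: dderiv_def)
  also have "... = (- 1) ^ Suc m * S ((Dn ^^ Suc m) \<phi>)" unfolding Suc.IH by (simp add: funpow_swap1)
  finally show ?case .
qed simp

lemma pow_delta_xn_eq: "pow_delta_xn s m \<phi> = (- 1) ^ m * PI s ((Dn ^^ m) \<phi>)"
  unfolding pow_delta_xn_def dderiv_power PI_def ..

lemma delta_xn_eq: "smooth \<phi> \<Longrightarrow> delta_xn m \<phi> = (- 1) ^ m * PI 0 ((Dn ^^ m) \<phi>)"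
  unfolding delta_xn_def dderiv_power by (subst PI_0) (auto intro: smooth_Dn_power)

lemma Dn_power_sum:
  assumes "finite I" "\<And>i. i \<in> I \<Longrightarrow> smooth (f i)"
  shows "(Dn ^^ m) (\<lambda>x. \<Sum>i\<in>I. f i x) = (\<lambda>x. \<Sum>i\<in>I. (Dn ^^ m) (f i) x)"
  using assms
proof (induction I rule: finite_induct)
  case empty
  then show ?case by (simp add: Dn_power_pderivs pderivs_zero)
next
  case (insert i I)
  then show ?case by (simp add: Dn_power_add smooth_sum)
qed

lemma dlaplace_power:
  fixes \<phi> :: "'m::finite space cfun"
  assumes "smooth \<phi>"
  shows "(dlaplace' ^^ j) ((dderiv e_n ^^ m) dirac) \<phi> = (- 1) ^ m * DD j m \<phi>"
  using assms
proof (induction j arbitrary: \<phi>)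
  case 0
  then show ?case by (simp add: dderiv_power dirac_def DD_def)
next
  case (Suc j)
  let ?S = "(dlaplace' ^^ j) ((dderiv e_n ^^ m) (dirac :: 'm space functional))"
  let ?P = "\<lambda>b \<psi>. pderiv_along (b, 0) (pderiv_along (b, 0) \<psi>)"
  have s: "smooth (?P b \<psi>)" if "smooth \<psi>" "b \<in> Basis" for b :: "real ^ 'm" and \<psi> :: "'m space cfun"
    using that by (intro smooth_pderiv) auto
  have c: "(Lp ^^ i) (?P b \<phi>) = ?P b ((Lp ^^ i) \<phi>)" if b: "b \<in> Basis" for b i
    by (induction i) (simp_all add: Lp_pderiv smooth_Lp_power Suc.prems b smooth_pderiv)
  have "(dlaplace' ^^ Suc j) ((dderiv e_n ^^ m) dirac) \<phi> = (\<Sum>b\<in>Basis. ?S (?P b \<phi>))"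
    by (simp add: dlaplace'_def dderiv_def)
  also have "... = (\<Sum>b\<in>Basis. (- 1) ^ m * (Dn ^^ m) (?P b ((Lp ^^ j) \<phi>)) 0)"
    by (intro sum.cong refl) (simp add: Suc.IH s Suc.prems DD_def c)
  also have "... = (- 1) ^ m * (Dn ^^ m) (\<lambda>x. \<Sum>b\<in>Basis. ?P b ((Lp ^^ j) \<phi>) x) 0"
    by (subst Dn_power_sum) (auto simp: sum_distrib_left intro!: s smooth_Lp_power Suc.prems)
  also have "(\<lambda>x. \<Sum>b\<in>Basis. ?P b ((Lp ^^ j) \<phi>) x) = Lp ((Lp ^^ j) \<phi>)" by (simp add: Lp_def[abs_def])
  finally show ?case by (simp add: DD_def)
qed

text \<open>The number of transposed normal derivatives is odd, which gives the sign, and 2^(2l -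
  2j) = 4^l / 4^j gives the factor.\<close>

lemma KC_eq:
  fixes \<phi> :: "'m::finite space cfun"
  assumes \<phi>: "smooth \<phi>"
  shows "KC_tilde l nu \<phi> = - (4 ^ l) * YY l (nu - of_nat l) \<phi>"
  unfolding KC_tilde_def YY_def sum_distrib_left
proof (rule sum.cong[OF refl])
  fix j assume "j \<in> {..l}"
  then have j: "j \<le> l" by simp
  have e: "2 * l - 2 * j = 2 * (l - j)" by simp
  have p: "(2 :: complex) ^ (2 * (l - j)) = 4 ^ l / 4 ^ j"
    using j by (simp add: power_mult power_diff)
  show "2 ^ (2 * l - 2 * j) * pochhammer (nu - of_nat l) (l - j) / (fact j * fact (2 * l - 2 * j + 1)) * (dlaplace' ^^ j) ((dderiv e_n ^^ (2 * l - 2 * j + 1)) dirac) \<phi>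
    = - (4 ^ l) * (pochhammer (nu - of_nat l) (l - j) / (4 ^ j * fact j * fact (2 * (l - j) + 1)) * DD j (2 * (l - j) + 1) \<phi>)"
    unfolding dlaplace_power[OF \<phi>] e p by (simp add: field_simps del: fact_Suc)
qed

lemma cbound_Lp_power:
  fixes \<phi> :: "'m::finite space cfun"
  assumes \<phi>: "smooth \<phi>" "cbound (N + 2 * j) B \<phi>"
  shows "cbound N (real CARD('m) ^ j * B) ((Lp ^^ j) \<phi>)"
  using \<phi>(2)
proof (induction j arbitrary: N)
  case (Suc j)
  have 1: "cbound (Suc (Suc N)) (real CARD('m) ^ j * B) ((Lp ^^ j) \<phi>)" by (rule Suc.IH) (use Suc.prems in simp)
  have "cbound N (\<Sum>b\<in>(Basis :: (real ^ 'm) set). real CARD('m) ^ j * B) (\<lambda>x. \<Sum>b\<in>Basis. pderiv_along (b, 0) (pderiv_along (b, 0) ((Lp ^^ j) \<phi>)) x)"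
    by (rule cbound_sum) (auto intro!: cbound_pderiv 1 smooth_pderiv smooth_Lp_power \<phi>(1))
  then show ?case by (simp add: Lp_def[abs_def] mult.assoc)
qed simp

lemma DD_cmult: "smooth f \<Longrightarrow> DD j m (\<lambda>x. c * f x) = c * DD j m f"
  and DD_add: "smooth f \<Longrightarrow> smooth g \<Longrightarrow> DD j m (\<lambda>x. f x + g x) = DD j m f + DD j m g"
  unfolding DD_def by (simp_all only: Lp_power_cmult Dn_power_cmult Lp_power_add Dn_power_add smooth_Lp_power)

lemma distribution_YY: "distribution (YY l a :: 'm::finite space functional)"
proof (rule distributionI)
  fix R :: real and f g :: "'m space cfun" and c assume R: "R > 0" "f \<in> testR R"
  note s = testR_smooth[OF R(2)]
  show "YY l a (\<lambda>x. c * f x) = c * YY l a f"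
    unfolding YY_def by (simp only: DD_cmult[OF s] sum_distrib_left mult.left_commute)
  assume "g \<in> testR R"
  note s2 = testR_smooth[OF this]
  show "YY l a (\<lambda>x. f x + g x) = YY l a f + YY l a g"
    unfolding YY_def by (simp only: DD_add[OF s s2] sum.distrib distrib_left)
next
  fix R :: real assume R: "R > 0"
  let ?c = "\<lambda>j. pochhammer a (l - j) / (4 ^ j * fact j * fact (2 * (l - j) + 1))"
  have "norm (YY l a f) \<le> (\<Sum>j\<le>l. norm (?c j) * real CARD('m) ^ j) * B" if f: "f \<in> testR R" "cbound (4 * l + 1) B f" for f :: "'m space cfun" and B
    unfolding YY_def sum_distrib_right
  proof (rule sum_norm_le)
    fix j assume "j \<in> {..l}"
    then have j: "(2 * (l - j) + 1) + 2 * j \<le> 4 * l + 1" by auto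
    have "cbound ((2 * (l - j) + 1) + 2 * j) B f" by (rule cbound_mono[OF f(2) j order_refl])
    from cboundD[OF cbound_Lp_power[OF testR_smooth[OF f(1)] this], of "replicate (2 * (l - j) + 1) e_n" 0]
    have "norm (DD j (2 * (l - j) + 1) f) \<le> real CARD('m) ^ j * B"
      unfolding DD_def Dn_power_pderivs using e_n_Basis[where 'm = 'm] by (simp add: set_replicate_conv_if)
    then show "norm (?c j * DD j (2 * (l - j) + 1) f) \<le> norm (?c j) * real CARD('m) ^ j * B"
      unfolding norm_mult by (simp only: mult.assoc) (rule mult_left_mono, simp_all)
  qed
  then show "\<exists>C N. \<forall>f\<in>testR R. \<forall>B. cbound N B f \<longrightarrow> norm (YY l a (f :: 'm space cfun)) \<le> C * B" by blast
qed

lemma test_smooth: "\<phi> \<in> test_functions \<Longrightarrow> smooth \<phi>"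
  by (simp add: test_functions_def)

lemma holo_family_KC: "holo_family UNIV (KC_tilde l :: complex \<Rightarrow> 'm::finite space functional)"
  unfolding holo_family_def
proof (intro conjI ballI)
  fix nu
  have "deq (KC_tilde l nu :: 'm space functional) (dscale (- (4 ^ l)) (YY l (nu - of_nat l)))"
    unfolding deq_def dscale_def using KC_eq test_smooth by blast
  then show "distribution (KC_tilde l nu :: 'm space functional)"
    by (rule distribution_deq[OF distribution_dscale[OF distribution_YY]])
next
  fix \<phi> :: "'m space cfun" assume "\<phi> \<in> test_functions"
  show "(\<lambda>nu. KC_tilde l nu \<phi>) holomorphic_on UNIV"
    unfolding KC_tilde_def pochhammer_prod by (intro holomorphic_intros) simp_all
qed

lemma dsupp_0_iff:
  fixes S :: "'m::finite space functional"
  assumes "c \<noteq> 0" "\<And>\<phi>. \<phi> \<in> test_functions \<Longrightarrow> S \<phi> = c * YY l a \<phi>"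
  shows "dsupp S = {0}"
proof
  show "dsupp S \<subseteq> {0}"
  proof (rule dsupp_subset)
    fix \<phi> :: "'m space cfun" assume \<phi>: "\<phi> \<in> test_functions" "fun_supp \<phi> \<subseteq> - {0}"
    have o: "open (- fun_supp \<phi>)" unfolding fun_supp_def by (rule open_Compl[OF closed_closure])
    have z: "0 \<in> - fun_supp \<phi>" using \<phi>(2) by blast
    have "\<phi> x = 0" if "x \<in> - fun_supp \<phi>" for x using that fun_supp_imp_zero by blast
    then have "Lp \<psi> x = 0" if "x \<in> - fun_supp \<phi>" "\<And>x. x \<in> - fun_supp \<phi> \<Longrightarrow> \<psi> x = 0" for x \<psi>
      using pderivs_cong[OF o _ that(1), of \<psi> "\<lambda>_. 0"] that(2) unfolding Lp_def
      by (intro sum.neutral ballI) (metis pderivs.simps pderivs_zero)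
    then have L: "(Lp ^^ j) \<phi> x = 0" if "x \<in> - fun_supp \<phi>" for j x using that
      by (induction j arbitrary: x) (auto simp: fun_supp_imp_zero)
    have "DD j m \<phi> = 0" for j m unfolding DD_def by (rule Dn_power_zero[OF o L z])
    then show "S \<phi> = 0" unfolding assms(2)[OF \<phi>(1)] YY_def by simp
  qed simp
  show "{0} \<subseteq> dsupp S"
  proof
    fix x :: "'m space" assume "x \<in> {0}"
    then show "x \<in> dsupp S" unfolding mem_dsupp_iff
      using YY_nonzero[where l = l and a = a] assms by (metis mult_eq_0_iff singletonD)
  qed
qed

text \<open>On this line alpha = -k and beta = -nu - k, so Re nu < -k is the range Re beta > 0 of
  \<open>KT_X\<close>. The rescaled \<open>KT\<close> is itself the entire function described in
  \<open>KB_tilde\<close>; uniqueness is the identity theorem after z -> -z.\<close>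

lemma KT_X_KB:
  fixes \<phi> :: "'m::finite space cfun"
  assumes \<phi>: "\<phi> \<in> test_functions"
  shows "KT (- of_nat k, - nu - of_nat k) \<phi> = (- 1) ^ (k + 1) * fact k / fact (2 * k + 1) * KB_tilde k nu \<phi>"
proof -
  define c :: complex where "c = (- 1) ^ (k + 1) * fact k / fact (2 * k + 1)"
  have c0: "c \<noteq> 0" by (simp add: c_def del: fact_Suc)
  define g where "g = (\<lambda>z. KT (- of_nat k, - z - of_nat k) \<phi> / c)"
  obtain R where R: "R > 0" "\<phi> \<in> testR R" "symm \<phi> \<in> odd_test R" using test_symm[OF \<phi>] .
  have gh: "g holomorphic_on UNIV"
    unfolding g_def KT_def using holo_J_line[OF R(1,3), of 0 "- of_nat k" "- 1" "- of_nat k"] c0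
    by (intro holomorphic_intros) simp_all
  have gk: "g z = KB_sum k z \<phi>" if z: "Re z < - real k" for z
  proof -
    have b: "Re (- z - of_nat k) > 0" using z by simp
    have e: "- of_nat k - (- z - of_nat k) + hdim TYPE('m) = z + of_nat CARD('m) / 2"
      "((- 3/2 - 2 * of_nat k - z) - z + 3/2) / 2 = - z - of_nat k" by (simp_all add: field_simps)
    have e2: "- 2 * (z + of_nat CARD('m) / 2) - 2 * of_nat i = - of_nat CARD('m) - 2 * z - 2 * of_nat i" for i
      by (simp add: algebra_simps)
    have "KB_sum k z \<phi> = (\<Sum>i\<le>k. - fact (2 * k + 1) * rGamma (- z - of_nat k) * ((- 1) ^ i * pochhammer (z + of_nat CARD('m) / 2) i / (fact i * fact (2 * k + 1 - 2 * i))
       * PI (- of_nat CARD('m) - 2 * z - 2 * of_nat i) ((Dn ^^ (2 * k + 1 - 2 * i)) \<phi>)))"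
      unfolding KB_sum_def Let_def e
    proof (rule sum.cong[OF refl])
      fix i assume "i \<in> {..k}"
      then have i: "2 * k - 2 * i + 1 = 2 * k + 1 - 2 * i" by auto
      have o: "(- 1 :: complex) ^ (2 * k + 1 - 2 * i) = - 1" using i[symmetric] by simp
      show "(- 1) ^ i * fact (2 * k + 1) * pochhammer (z + of_nat CARD('m) / 2) i / (fact i * fact (2 * k - 2 * i + 1)) * rGamma (- z - of_nat k) * pow_delta_xn (- of_nat CARD('m) - 2 * z - 2 * of_nat i) (2 * k - 2 * i + 1) \<phi>
        = - fact (2 * k + 1) * rGamma (- z - of_nat k) * ((- 1) ^ i * pochhammer (z + of_nat CARD('m) / 2) i / (fact i * fact (2 * k + 1 - 2 * i)) * PI (- of_nat CARD('m) - 2 * z - 2 * of_nat i) ((Dn ^^ (2 * k + 1 - 2 * i)) \<phi>))"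
        unfolding pow_delta_xn_eq i o by (simp add: mult_ac del: fact_Suc)
    qed
    then have "c * KB_sum k z \<phi> = KT (- of_nat k, - z - of_nat k) \<phi>"
      unfolding KT_X[OF \<phi> b] X_sum_def e e2 sum_distrib_left[symmetric] c_def by (simp add: field_simps del: fact_Suc)
    then show ?thesis using c0 by (simp add: g_def field_simps)
  qed
  have "(THE g. g holomorphic_on UNIV \<and> (\<forall>z. Re z < - real k \<longrightarrow> g z = KB_sum k z \<phi>)) = g"
  proof (rule the_equality)
    show "g holomorphic_on UNIV \<and> (\<forall>z. Re z < - real k \<longrightarrow> g z = KB_sum k z \<phi>)" using gh gk by blast
    fix h assume h: "h holomorphic_on UNIV \<and> (\<forall>z. Re z < - real k \<longrightarrow> h z = KB_sum k z \<phi>)"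
    have m: "(\<lambda>z. f (- z)) holomorphic_on UNIV" if "f holomorphic_on UNIV" for f :: "complex \<Rightarrow> complex"
      using holomorphic_on_compose_gen[OF _ that, of uminus UNIV] by (simp add: o_def holomorphic_intros)
    have "h (- z) = g (- z)" for z
      by (rule entire_eq_line[of "\<lambda>z. h (- z)" "\<lambda>z. g (- z)" "real k"]) (use h gk m[OF gh] m[of h] in auto)
    from this[of "- z" for z] show "h = g" by (intro ext) (metis minus_minus)
  qed
  then have "KB_tilde k nu \<phi> = g nu" unfolding KB_tilde_def by simp
  then show ?thesis unfolding c_def[symmetric] using c0 by (simp add: g_def)
qed

section \<open>The second renormalization on the lines nu = -rho_H - j\<close>

definition wj :: "nat \<Rightarrow> 'm::finite space cfun" where
  "wj j x = of_real (((norm (fst x))\<^sup>2 + (snd x)\<^sup>2) ^ j)"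

lemma wj_norm: "wj j x = of_real ((norm x)\<^sup>2) ^ j"
  by (simp add: wj_def norm_space_power2)

text \<open>Writing |x|^2 as a sum of squares of coordinates reduces smoothness and C^N bounds for
  the weight |x|^(2j) to multiplication by coordinates.\<close>

lemma wj_Suc: "wj (Suc j) x = (\<Sum>b\<in>Basis. of_real (x \<bullet> b) * (of_real (x \<bullet> b) * wj j x))"
proof -
  have "complex_of_real ((norm x)\<^sup>2) = (\<Sum>b\<in>Basis. of_real (x \<bullet> b) * of_real (x \<bullet> b))"
    unfolding power2_norm_eq_inner by (subst euclidean_inner) (simp only: of_real_sum of_real_mult)
  then show ?thesis unfolding wj_norm by (simp only: power_Suc sum_distrib_right mult.assoc)
qed

lemma smooth_wj: "smooth (wj j)"
proof (induction j)
  case 0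
  have "wj 0 = (\<lambda>x :: 'a space. 1)" by (simp add: wj_def fun_eq_iff)
  then show ?case by (simp only: smooth_const)
next
  case (Suc j)
  have "wj (Suc j) = (\<lambda>x :: 'a space. \<Sum>b\<in>Basis. of_real (x \<bullet> b) * (of_real (x \<bullet> b) * wj j x))" by (rule ext) (rule wj_Suc)
  then show ?case by (simp only:) (intro smooth_sum smooth_mult smooth_coord Suc finite_Basis)
qed

lemma symm_wj: "symm (\<lambda>x. wj j x * \<phi> x) = (\<lambda>x. wj j x * symm \<phi> x)"
proof -
  have "wj j (scl 1 (- 1) x) = wj j x" "wj j (scl (- 1) 1 x) = wj j x" "wj j (scl (- 1) (- 1) x) = wj j x" for x :: "'a space"
    unfolding wj_norm norm_scl_flip scl_minus norm_minus_cancel by (rule refl)+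
  then show ?thesis by (intro ext) (simp add: symm_def algebra_simps)
qed

lemma test_wj: "\<phi> \<in> test_functions \<Longrightarrow> (\<lambda>x. wj j x * \<phi> x) \<in> test_functions"
  using test_obtain_testR testR_mult[OF smooth_wj] testR_imp_test by metis

lemma fun_supp_mult: "fun_supp (\<lambda>x. w x * \<phi> x) \<subseteq> fun_supp \<phi>"
  by (rule fun_supp_minimal) (auto simp: fun_supp_imp_zero, simp add: fun_supp_def)

lemma cbound_wj:
  fixes f :: "'m::finite space cfun"
  assumes R: "R > 0" and f: "f \<in> testR R"
  shows "cbound N B f \<Longrightarrow> cbound N ((real DIM('m space) * (R + real N)\<^sup>2) ^ j * B) (\<lambda>x. wj j x * f x)"
proof (induction j)
  case 0
  then show ?case by (simp add: wj_def)
next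
  case (Suc j)
  let ?B = "(real DIM('m space) * (R + real N)\<^sup>2) ^ j * B"
  have t: "(\<lambda>x. wj j x * f x) \<in> testR R" by (rule testR_mult[OF smooth_wj f])
  have c: "cbound N ((R + real N) * ((R + real N) * ?B)) (\<lambda>x. of_real (x \<bullet> b) * (of_real (x \<bullet> b) * (wj j x * f x)))"
    if b: "b \<in> Basis" for b :: "'m space"
    using R by (intro cbound_coord_mult[OF b, where R = R] testR_mult[OF smooth_coord t] t Suc) simp_all
  have "cbound N (\<Sum>b\<in>(Basis :: 'm space set). (R + real N) * ((R + real N) * ?B)) (\<lambda>x. \<Sum>b\<in>Basis. of_real (x \<bullet> b) * (of_real (x \<bullet> b) * (wj j x * f x)))"
    by (rule cbound_sum[OF finite_Basis]) (erule c, intro smooth_mult smooth_coord testR_smooth[OF t])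
  also have "(\<lambda>x. \<Sum>b\<in>Basis. of_real (x \<bullet> b) * (of_real (x \<bullet> b) * (wj j x * f x))) = (\<lambda>x. wj (Suc j) x * f x)"
    unfolding wj_Suc by (simp only: sum_distrib_right mult.assoc)
  also have "(\<Sum>b\<in>(Basis :: 'm space set). (R + real N) * ((R + real N) * ?B)) = (real DIM('m space) * (R + real N)\<^sup>2) ^ Suc j * B"
    by (simp only: sum_constant power_Suc power2_eq_square mult_ac)
  finally show ?case .
qed

lemma WI_add:
  fixes f :: "'m::finite space cfun"
  assumes R: "R > 0" and f: "f \<in> odd_test R" and g: "g \<in> odd_test R"
  shows "WI a (\<lambda>x. f x + g x) = WI a f + WI a g"
proof (rule entire_eq_line[of "\<lambda>a. WI a (\<lambda>x. f x + g x)" "\<lambda>a. WI a f + WI a g" 1])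
  show "(\<lambda>a. WI a (\<lambda>x. f x + g x)) holomorphic_on UNIV" by (rule WI_holomorphic[OF R odd_test_add[OF f g]])
  show "(\<lambda>a. WI a f + WI a g) holomorphic_on UNIV" by (intro holomorphic_intros WI_holomorphic[OF R f] WI_holomorphic[OF R g])
  fix x :: real assume x: "x > 1"
  then have "kcond TYPE('m) (of_real x) 0" by (intro kcond_nice) auto
  from II_add[OF this odd_testD(1)[OF f] odd_testD(1)[OF g]]
  show "WI (of_real x) (\<lambda>x. f x + g x) = WI (of_real x) f + WI (of_real x) g"
    using WI_base[OF R odd_test_add[OF f g], of "of_real x"] WI_base[OF R f, of "of_real x"] WI_base[OF R g, of "of_real x"] x
    by (simp add: distrib_left)
qed

lemma WI_cmult:
  fixes f :: "'m::finite space cfun"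
  assumes R: "R > 0" and f: "f \<in> odd_test R"
  shows "WI a (\<lambda>x. c * f x) = c * WI a f"
proof (rule entire_eq_line[of "\<lambda>a. WI a (\<lambda>x. c * f x)" "\<lambda>a. c * WI a f" 1])
  show "(\<lambda>a. WI a (\<lambda>x. c * f x)) holomorphic_on UNIV" by (rule WI_holomorphic[OF R odd_test_cmult[OF f]])
  show "(\<lambda>a. c * WI a f) holomorphic_on UNIV" by (intro holomorphic_intros WI_holomorphic[OF R f])
  fix x :: real assume x: "x > 1"
  show "WI (of_real x) (\<lambda>x. c * f x) = c * WI (of_real x) f"
    using WI_base[OF R odd_test_cmult[OF f], of "of_real x"] WI_base[OF R f, of "of_real x"] x by (simp add: II_cmult)
qed

lemma odd_test_wj:
  assumes f: "f \<in> odd_test R" shows "(\<lambda>x. wj j x * f x) \<in> odd_test R"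
  using symm_odd_test[OF testR_mult[OF smooth_wj odd_testD(1)[OF f]]] unfolding symm_wj symm_id[OF f] .

lemma distribution_WI: "distribution (\<lambda>\<phi>. WI a (symm (\<lambda>x. wj j x * \<phi> x)) :: complex)"
  unfolding symm_wj
proof (rule distribution_symm[where A = "\<lambda>f. WI a (\<lambda>x. wj j x * f x)"])
  fix R :: real and f g :: "'a space cfun" and c assume R: "R > 0" and f: "f \<in> odd_test R"
  show "WI a (\<lambda>x. wj j x * (c * f x)) = c * WI a (\<lambda>x. wj j x * f x)"
    using WI_cmult[OF R odd_test_wj[OF f]] by (simp add: mult.left_commute)
  assume g: "g \<in> odd_test R"
  show "WI a (\<lambda>x. wj j x * (f x + g x)) = WI a (\<lambda>x. wj j x * f x) + WI a (\<lambda>x. wj j x * g x)"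
    using WI_add[OF R odd_test_wj[OF f] odd_test_wj[OF g]] by (simp add: distrib_left)
next
  fix R :: real assume R: "R > 0"
  obtain C N where C: "\<forall>f\<in>(odd_test R :: 'a space cfun set). \<forall>B. cbound N B f \<longrightarrow> norm (WI a f) \<le> C * B"
    using WI_bound[OF R, of a] by blast
  let ?D = "(real DIM('a space) * (R + real N)\<^sup>2) ^ j"
  have "norm (WI a (\<lambda>x. wj j x * f x)) \<le> (C * ?D) * B" if f: "f \<in> odd_test R" "cbound N B f" for f :: "'a space cfun" and B
    using C odd_test_wj[OF f(1)] cbound_wj[OF R odd_testD(1)[OF f(1)] f(2)] by (simp only: mult.assoc)
  then show "\<exists>C N. \<forall>f\<in>odd_test R. \<forall>B. cbound N B f \<longrightarrow> norm (WI a (\<lambda>x. wj j x * (f :: 'a space cfun) x)) \<le> C * B" by blast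
qed

text \<open>On this line mu = -j, so the kernel is |x|^(2j) times the kernel at mu = 0. By
  \<open>J_WI\<close> the factor 1/Gamma(beta) separates from a family that is entire in
  alpha.\<close>

lemma TT_WI:
  fixes \<phi> :: "'m::finite space cfun"
  assumes \<phi>: "\<phi> \<in> test_functions" and nu: "nu = - hdim TYPE('m) - of_nat j"
  shows "TT (z, nu) \<phi> = rGamma (be (z, nu)) * WI (al (z, nu)) (symm (\<lambda>x. wj j x * \<phi> x))"
proof -
  obtain R where R: "R > 0" "\<phi> \<in> testR R" "symm \<phi> \<in> odd_test R" using test_symm[OF \<phi>] .
  have b: "be (z, nu) = al (z, nu) - (- of_nat j) + hdim TYPE('m)" by (simp add: al_def be_def nu field_simps)
  have k: "ker a (- of_nat j) x * symm \<phi> x = ker a 0 x * (wj j x * symm \<phi> x)" for a and x :: "'m space"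
  proof (cases "snd x = 0")
    case False
    then have "norm x \<noteq> 0" by auto
    then show ?thesis unfolding ker_eq_powr wj_norm by (simp add: powr_nat')
  qed (simp add: ker_def)
  show ?thesis unfolding TT_def KT_def b J_WI[OF R(1,3) odd_test_wj[OF R(3)] k] symm_wj ..
qed

lemma Gamma_rGamma: "rGamma z \<noteq> 0 \<Longrightarrow> Gamma z * rGamma z = (1 :: complex)"
  by (simp add: rGamma_inverse_Gamma)

text \<open>Off the poles, Gamma(beta) cancels the factor 1/Gamma(beta) of \<open>TT_WI\<close>. The
  function that remains is entire, so it gives the limit at the poles as well.\<close>

lemma KAA_eq:
  fixes \<phi> :: "'m::finite space cfun"
  assumes \<phi>: "\<phi> \<in> test_functions"
  shows "KAA_tilde j lam \<phi> = WI (al (lam, - hdim TYPE('m) - of_nat j)) (symm (\<lambda>x. wj j x * \<phi> x))"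
proof -
  define nu where "nu = - hdim TYPE('m) - of_nat j"
  define F where "F = (\<lambda>z. WI (al (z, nu)) (symm (\<lambda>x. wj j x * \<phi> x)))"
  obtain R where R: "R > 0" "(\<lambda>x. wj j x * \<phi> x) \<in> testR R" "symm (\<lambda>x. wj j x * \<phi> x) \<in> odd_test R"
    using test_symm[OF test_wj[OF \<phi>]] .
  have "F holomorphic_on UNIV" unfolding F_def al_def
    by (rule holomorphic_on_compose_gen[OF _ WI_holomorphic[OF R(1,3)], unfolded o_def]) (auto intro!: holomorphic_intros)
  then have "isCont F lam" using holomorphic_on_imp_continuous_on continuous_on_eq_continuous_at by blast
  then have "(F \<longlongrightarrow> F lam) (at lam)" by (simp add: isCont_def)
  moreover have "\<forall>\<^sub>F z in at lam. F z = Gamma ((z - nu + 3/2) / 2) * KA_tilde (z, nu) \<phi>"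
  proof -
    let ?b = "\<lambda>z. be (z, nu)"
    \<comment> \<open>The poles other than the value of \<open>be\<close> at \<open>lam\<close> form
      a closed set, so near \<open>lam\<close> they are avoided. That value itself is avoided for z
      different from \<open>lam\<close>, since \<open>be\<close> is injective on the line.\<close>
    have "closed (\<int>\<^sub>\<le>\<^sub>0 - {?b lam})" by (rule closed_subset_Ints) (auto simp: nonpos_Ints_def)
    then have o: "open (- (\<int>\<^sub>\<le>\<^sub>0 - {?b lam}))" by (rule open_Compl)
    have "continuous_on UNIV ?b" unfolding be_def by (intro continuous_intros) auto
    with o have "open (?b -` (- (\<int>\<^sub>\<le>\<^sub>0 - {?b lam})))" by (rule open_vimage)
    then have "\<forall>\<^sub>F z in at lam. z \<in> ?b -` (- (\<int>\<^sub>\<le>\<^sub>0 - {?b lam})) \<and> z \<noteq> lam"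
      unfolding eventually_at_topological by (intro exI[of _ "?b -` (- (\<int>\<^sub>\<le>\<^sub>0 - {?b lam}))"]) auto
    then show ?thesis
    proof eventually_elim
      case (elim z)
      then have "?b z \<noteq> ?b lam" by (simp add: be_def)
      then have "?b z \<notin> \<int>\<^sub>\<le>\<^sub>0" using elim by auto
      then have "Gamma (?b z) * rGamma (?b z) = 1" by (intro Gamma_rGamma) (simp add: rGamma_eq_zero_iff)
      then have "Gamma (?b z) * KA_tilde (z, nu) \<phi> = F z"
        unfolding KA_tilde_eq[OF \<phi>] TT_WI[OF \<phi> nu_def] F_def by (simp only: mult.assoc[symmetric] mult_1)
      then show ?case by (simp add: be_def)
    qed
  qed
  ultimately have "((\<lambda>z. Gamma ((z - nu + 3/2) / 2) * KA_tilde (z, nu) \<phi>) \<longlongrightarrow> F lam) (at lam)"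
    by (rule Lim_transform_eventually)
  then have "Lim (at lam) (\<lambda>z. Gamma ((z - nu + 3/2) / 2) * KA_tilde (z, nu) \<phi>) = F lam"
    by (intro tendsto_Lim) simp_all
  then show ?thesis unfolding KAA_tilde_def Let_def F_def nu_def by simp
qed

lemma holo_family_KAA: "holo_family UNIV (KAA_tilde j :: complex \<Rightarrow> 'm::finite space functional)"
  unfolding holo_family_def
proof (intro conjI ballI)
  fix lam
  have "deq (KAA_tilde j lam :: 'm space functional) (\<lambda>\<phi>. WI (al (lam, - hdim TYPE('m) - of_nat j)) (symm (\<lambda>x. wj j x * \<phi> x)))"
    unfolding deq_def using KAA_eq by blast
  then show "distribution (KAA_tilde j lam :: 'm space functional)" by (rule distribution_deq[OF distribution_WI])
next
  fix \<phi> :: "'m space cfun" assume \<phi>: "\<phi> \<in> test_functions"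
  obtain R where R: "R > 0" "(\<lambda>x. wj j x * \<phi> x) \<in> testR R" "symm (\<lambda>x. wj j x * \<phi> x) \<in> odd_test R"
    using test_symm[OF test_wj[OF \<phi>]] .
  show "(\<lambda>lam. KAA_tilde j lam \<phi>) holomorphic_on UNIV" unfolding KAA_eq[OF \<phi>] al_def
    by (rule holomorphic_on_compose_gen[OF _ WI_holomorphic[OF R(1,3)], unfolded o_def]) (auto intro!: holomorphic_intros)
qed

section \<open>Determination of the supports\<close>

lemma closure_off: "closure {x :: 'm::finite space. snd x \<noteq> 0} = UNIV"
proof -
  have "(y, t) \<in> closure {x :: 'm space. snd x \<noteq> 0}" for y t
    unfolding closure_approachable
  proof (intro allI impI)
    fix e :: real assume e: "e > 0"
    define t' where "t' = (if t = 0 then e / 2 else t)"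
    have "(y, t') \<in> {x :: 'm space. snd x \<noteq> 0}" "dist (y, t') (y, t) < e" using e by (auto simp: t'_def dist_Pair_Pair)
    then show "\<exists>z\<in>{x :: 'm space. snd x \<noteq> 0}. dist z (y, t) < e" by blast
  qed
  then show ?thesis by auto
qed

text \<open>The hyperplane has dimension at least 1, so its origin is a limit of its other points.
  Supports can therefore be tested away from the origin.\<close>

lemma closure_punctured: "{x :: 'm::finite space. snd x = 0} \<subseteq> closure {x. snd x = 0 \<and> fst x \<noteq> 0}"
proof
  fix x :: "'m space" assume x: "x \<in> {x. snd x = 0}"
  obtain b :: "real ^ 'm" where b: "b \<in> Basis" using nonempty_Basis by blast
  show "x \<in> closure {x. snd x = 0 \<and> fst x \<noteq> 0}"
    unfolding closure_approachable
  proof (intro allI impI)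
    fix e :: real assume e: "e > 0"
    define y where "y = (if fst x = 0 then (e / 2) *\<^sub>R b else fst x)"
    have "y \<noteq> 0" using e b by (auto simp: y_def)
    moreover have "dist y (fst x) < e" using e b by (auto simp: y_def)
    then have "dist (y, 0) x < e" using x by (cases x) (simp add: dist_Pair_Pair)
    ultimately show "\<exists>z\<in>{x. snd x = 0 \<and> fst x \<noteq> 0}. dist z x < e" by (intro bexI[of _ "(y, 0)"]) auto
  qed
qed

lemma dsupp_UNIV:
  fixes S :: "'m::finite space functional"
  assumes w: "smooth w" "\<And>x. snd x \<noteq> 0 \<Longrightarrow> w x \<noteq> 0" and c: "c \<noteq> 0"
    and S: "\<And>\<phi>. \<phi> \<in> test_functions \<Longrightarrow> fun_supp \<phi> \<subseteq> {x. snd x \<noteq> 0} \<Longrightarrow> S \<phi> = c * II a mu (\<lambda>x. w x * \<phi> x)"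
  shows "dsupp S = UNIV"
proof -
  have "x \<in> dsupp S" if "x \<in> {x. snd x \<noteq> 0}" for x
    unfolding mem_dsupp_iff
  proof (intro allI impI)
    fix U assume U: "open U \<and> x \<in> U"
    have sx: "snd x \<noteq> 0" using that by simp
    show "\<exists>\<phi>\<in>test_functions. fun_supp \<phi> \<subseteq> U \<and> S \<phi> \<noteq> 0"
    proof (rule II_off_nonzero[OF conjunct1[OF U] conjunct2[OF U] sx w(1) w(2)[OF sx], of a mu])
      fix \<phi> assume p: "\<phi> \<in> test_functions" "fun_supp \<phi> \<subseteq> U" "fun_supp \<phi> \<subseteq> {x. snd x \<noteq> 0}" "II a mu (\<lambda>x. w x * \<phi> x) \<noteq> 0"
      have "S \<phi> \<noteq> 0" using S[OF p(1,3)] p(4) c by simp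
      with p(2) show ?thesis by (intro bexI[OF _ p(1)] conjI)
    qed
  qed
  then show ?thesis using dsupp_superset[of "{x. snd x \<noteq> 0}" S UNIV] closure_off[where 'm = 'm] by (simp add: top.extremum_unique)
qed

text \<open>The functional need only be known on the functions supplied by
  \<open>PI_nonzero\<close>: zero near the origin and vanishing to order m on the hyperplane. The
  origin is added because supports are closed.\<close>

lemma dsupp_hyperplane:
  fixes S :: "'m::finite space functional"
  assumes off: "\<And>\<phi>. \<phi> \<in> test_functions \<Longrightarrow> fun_supp \<phi> \<subseteq> {x. snd x \<noteq> 0} \<Longrightarrow> S \<phi> = 0"
    and w: "smooth w" "\<And>y. y \<noteq> 0 \<Longrightarrow> w (y, 0) \<noteq> 0" and c: "c \<noteq> 0"
    and S: "\<And>\<phi> r. \<phi> \<in> test_functions \<Longrightarrow> r > 0 \<Longrightarrow> (\<And>x. norm x < r \<Longrightarrow> \<phi> x = 0) \<Longrightarrow>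
      (\<And>q y. q < m \<Longrightarrow> (Dn ^^ q) (\<lambda>x. w x * \<phi> x) (y, 0) = 0) \<Longrightarrow> S \<phi> = c * PI s ((Dn ^^ m) (\<lambda>x. w x * \<phi> x))"
  shows "dsupp S = {x. snd x = 0}"
proof
  have "- {x :: 'm space. snd x = 0} = {x. snd x \<noteq> 0}" by auto
  then show "dsupp S \<subseteq> {x. snd x = 0}"
    using open_off[where 'm = 'm] off by (intro dsupp_subset) (auto simp: closed_def)
  have "x \<in> dsupp S" if x: "x \<in> {x. snd x = 0 \<and> fst x \<noteq> 0}" for x
    unfolding mem_dsupp_iff
  proof (intro allI impI)
    fix U assume U: "open U \<and> x \<in> U"
    have e: "x = (fst x, 0)" using x by (simp add: prod_eq_iff)
    have y: "fst x \<noteq> 0" using x by simp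
    have U2: "open U" "(fst x, 0) \<in> U" using U e by simp_all
    obtain \<phi> r where p: "\<phi> \<in> test_functions" "fun_supp \<phi> \<subseteq> U" "r > 0" "\<And>x. norm x < r \<Longrightarrow> \<phi> x = 0"
      "\<And>q y. q < m \<Longrightarrow> (Dn ^^ q) (\<lambda>x. w x * \<phi> x) (y, 0) = 0" "PI s ((Dn ^^ m) (\<lambda>x. w x * \<phi> x)) \<noteq> 0"
      using PI_nonzero[OF U2 y w(1) w(2)[OF y], of m s] by blast
    have "S \<phi> \<noteq> 0" using S[OF p(1,3,4,5)] p(6) c by simp
    then show "\<exists>\<phi>\<in>test_functions. fun_supp \<phi> \<subseteq> U \<and> S \<phi> \<noteq> 0" using p(1,2) by blast
  qed
  then show "{x. snd x = 0} \<subseteq> dsupp S" by (rule dsupp_superset[OF _ closure_punctured])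
qed

lemma dsupp_TT_UNIV:
  assumes "rGamma (al p) \<noteq> 0" "rGamma (be p) \<noteq> 0"
    and S: "deq (S :: 'm::finite space functional) (TT p)"
  shows "dsupp S = UNIV"
proof (rule dsupp_UNIV[where w = "\<lambda>_. 1" and c = "rGamma (al p) * rGamma (be p)" and a = "al p" and mu = "al p - be p + hdim TYPE('m)"])
  fix \<phi> :: "'m space cfun" assume \<phi>: "\<phi> \<in> test_functions" "fun_supp \<phi> \<subseteq> {x. snd x \<noteq> 0}"
  show "S \<phi> = rGamma (al p) * rGamma (be p) * II (al p) (al p - be p + hdim TYPE('m)) (\<lambda>x. 1 * \<phi> x)"
    unfolding deqD[OF S \<phi>(1)] TT_def KT_off[OF \<phi>] by simp
qed (use assms in auto)

lemma dsupp_TT_X: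
  assumes a: "al p = - of_nat k" and b: "rGamma (be p) \<noteq> 0"
    and S: "deq (S :: 'm::finite space functional) (TT p)"
  shows "dsupp S = {x. snd x = 0}"
proof (rule dsupp_hyperplane[where w = "\<lambda>_. 1" and m = "2 * k + 1" and s = "- 2 * (- of_nat k - be p + hdim TYPE('m))"
      and c = "(- 1) ^ k * fact k * rGamma (be p) / fact (2 * k + 1)"])
  fix \<phi> :: "'m space cfun" assume \<phi>: "\<phi> \<in> test_functions"
  show "S \<phi> = 0" if "fun_supp \<phi> \<subseteq> {x. snd x \<noteq> 0}"
  proof -
    have "rGamma (- of_nat k) = (0 :: complex)" by (simp add: rGamma_eq_zero_iff)
    then show ?thesis unfolding deqD[OF S \<phi>] TT_def KT_off[OF \<phi> that] a by simp
  qed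
  fix r :: real assume r: "r > 0" "\<And>x. norm x < r \<Longrightarrow> \<phi> x = 0"
    and z: "\<And>q y. q < 2 * k + 1 \<Longrightarrow> (Dn ^^ q) (\<lambda>x. 1 * \<phi> x) (y, 0) = 0"
  let ?mu = "- of_nat k - be p + hdim TYPE('m)"
  have 0: "PI s ((Dn ^^ q) \<phi>) = 0" if "q < 2 * k + 1" for q s using z[OF that] by (simp add: PI_def)
  \<comment> \<open>Normal derivatives below order 2k + 1 vanish on the hyperplane, so only the
    summand i = 0 remains, and its coefficient is never 0.\<close>
  have "X_sum k (be p) \<phi>
    = (\<Sum>i\<le>k. if i = 0 then 1 / fact (2 * k + 1) * PI (- 2 * ?mu) ((Dn ^^ (2 * k + 1)) \<phi>) else 0)"
    unfolding X_sum_def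
  proof (rule sum.cong[OF refl])
    fix i assume "i \<in> {..k}"
    show "(- 1) ^ i * pochhammer ?mu i / (fact i * fact (2 * k + 1 - 2 * i)) * PI (- 2 * ?mu - 2 * of_nat i) ((Dn ^^ (2 * k + 1 - 2 * i)) \<phi>)
      = (if i = 0 then 1 / fact (2 * k + 1) * PI (- 2 * ?mu) ((Dn ^^ (2 * k + 1)) \<phi>) else 0)"
    proof (cases "i = 0")
      case False
      then have "2 * k + 1 - 2 * i < 2 * k + 1" by simp
      from 0[OF this] show ?thesis using False by (simp only: mult_zero_right if_False)
    qed (simp del: fact_Suc)
  qed
  also have "... = 1 / fact (2 * k + 1) * PI (- 2 * ?mu) ((Dn ^^ (2 * k + 1)) \<phi>)" by simp
  finally have sum: "X_sum k (be p) \<phi> = 1 / fact (2 * k + 1) * PI (- 2 * ?mu) ((Dn ^^ (2 * k + 1)) \<phi>)" .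
  have "S \<phi> = KT (- of_nat k, be p) \<phi>" using deqD[OF S \<phi>] by (simp only: TT_def a)
  also have "... = (- 1) ^ k * fact k * rGamma (be p) * (1 / fact (2 * k + 1) * PI (- 2 * ?mu) ((Dn ^^ (2 * k + 1)) \<phi>))"
    using KT_X_off[OF \<phi> r, of k "be p"] by (simp only: sum)
  finally show "S \<phi> = (- 1) ^ k * fact k * rGamma (be p) / fact (2 * k + 1) * PI (- 2 * ?mu) ((Dn ^^ (2 * k + 1)) (\<lambda>x. 1 * \<phi> x))"
    by (simp only: mult_1 times_divide_eq_left times_divide_eq_right mult_1_right)
next
  show "(- 1) ^ k * fact k * rGamma (be p) / fact (2 * k + 1) \<noteq> 0" using b by (simp del: fact_Suc)
qed auto

lemma KAA_neg:
  fixes \<phi> :: "'m::finite space cfun"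
  assumes \<phi>: "\<phi> \<in> test_functions" and a: "al (lam, - hdim TYPE('m) - of_nat j) = - of_nat k"
  shows "KAA_tilde j lam \<phi> = (- 1) ^ k * fact k / fact (2 * k + 1) * PI 0 ((Dn ^^ (2 * k + 1)) (\<lambda>x. wj j x * \<phi> x))"
proof -
  obtain R where R: "R > 0" "(\<lambda>x. wj j x * \<phi> x) \<in> testR R" "symm (\<lambda>x. wj j x * \<phi> x) \<in> odd_test R"
    using test_symm[OF test_wj[OF \<phi>]] .
  have "PI 0 ((Dn ^^ (2 * k + 1)) (symm (\<lambda>x. wj j x * \<phi> x))) = PI 0 ((Dn ^^ (2 * k + 1)) (\<lambda>x. wj j x * \<phi> x))"
    using zero_less_card_finite[where 'a = 'm] by (intro PI_symm[OF R(2,1)]) simp_all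
  then show ?thesis unfolding KAA_eq[OF \<phi>] a WI_neg[OF R(1,3)] by (simp only:)
qed

lemma KAA_off:
  fixes \<phi> :: "'m::finite space cfun"
  assumes \<phi>: "\<phi> \<in> test_functions" "fun_supp \<phi> \<subseteq> {x. snd x \<noteq> 0}"
  shows "KAA_tilde j lam \<phi> = rGamma (al (lam, - hdim TYPE('m) - of_nat j)) * II (al (lam, - hdim TYPE('m) - of_nat j)) 0 (\<lambda>x. wj j x * \<phi> x)"
  unfolding KAA_eq[OF \<phi>(1)]
  by (rule WI_off[OF test_wj[OF \<phi>(1)] order_trans[OF fun_supp_mult \<phi>(2)]])

lemma wj_nonzero: "x \<noteq> 0 \<Longrightarrow> wj j x \<noteq> 0"
  by (simp add: wj_norm)

lemma dsupp_KAA_UNIV: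
  assumes "rGamma (al (lam, - hdim TYPE('m::finite) - of_nat j)) \<noteq> 0"
  shows "dsupp (KAA_tilde j lam :: 'm space functional) = UNIV"
  by (rule dsupp_UNIV[OF smooth_wj _ assms KAA_off]) (auto intro!: wj_nonzero)

lemma dsupp_KAA_hyperplane:
  assumes a: "al (lam, - hdim TYPE('m::finite) - of_nat j) = - of_nat k"
  shows "dsupp (KAA_tilde j lam :: 'm space functional) = {x. snd x = 0}"
proof (rule dsupp_hyperplane[OF _ smooth_wj[of j] _ _ KAA_neg[OF _ a]])
  show "KAA_tilde j lam \<phi> = 0" if "\<phi> \<in> test_functions" "fun_supp \<phi> \<subseteq> {x. snd x \<noteq> 0}" for \<phi> :: "'m space cfun"
  proof -
    have "rGamma (- of_nat k) = (0 :: complex)" by (simp add: rGamma_eq_zero_iff)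
    then show ?thesis using KAA_off[OF that, where j = j and lam = lam] unfolding a by simp
  qed
  show "wj j (y, 0) \<noteq> 0" if "y \<noteq> 0" for y :: "real ^ 'm" using that by (intro wj_nonzero) (simp add: prod_eq_iff)
qed (auto simp del: fact_Suc)

text \<open>The condition i - j = 2m + 1 says lambda - nu = -3/2 - 2m, and j in N says that nu +
  rho_H is a pole of Gamma. So the set consists of the points of \<open>Y_minus\<close> where the
  constant in front of the kernel at the origin vanishes.\<close>

lemma L_odd_iff:
  "(lam, nu) \<in> L_odd n \<longleftrightarrow> (\<exists>l::nat. lam - nu = - 3/2 - 2 * of_nat l) \<and> rGamma (nu + (of_nat n - 1) / 2) = 0"
proof
  assume "(lam, nu) \<in> L_odd n"
  then obtain i j m :: nat where e: "lam = - of_nat n / 2 - of_nat i" "nu = - (of_nat n - 1) / 2 - of_nat j" "int i - int j = 2 * int m + 1"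
    unfolding L_odd_def by auto
  then have i: "i = j + 2 * m + 1" by linarith
  have "lam - nu = - 3/2 - 2 * of_nat m" unfolding e(1,2) i by (simp add: field_simps)
  moreover have "nu + (of_nat n - 1) / 2 = - of_nat j" unfolding e(2) by (simp add: field_simps)
  then have "rGamma (nu + (of_nat n - 1) / 2) = 0" by (simp add: rGamma_eq_zero_iff)
  ultimately show "(\<exists>l::nat. lam - nu = - 3/2 - 2 * of_nat l) \<and> rGamma (nu + (of_nat n - 1) / 2) = 0" by blast
next
  assume "(\<exists>l::nat. lam - nu = - 3/2 - 2 * of_nat l) \<and> rGamma (nu + (of_nat n - 1) / 2) = 0"
  then obtain l where l: "lam - nu = - 3/2 - 2 * of_nat l" and r: "nu + (of_nat n - 1) / 2 \<in> \<int>\<^sub>\<le>\<^sub>0"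
    by (auto simp: rGamma_eq_zero_iff)
  from r obtain j :: nat where j: "nu + (of_nat n - 1) / 2 = - of_nat j" by (auto elim: nonpos_Ints_cases')
  have "nu = - (of_nat n - 1) / 2 - of_nat j" using j by (simp add: field_simps eq_diff_eq)
  moreover have "lam = - of_nat n / 2 - of_nat (j + 2 * l + 1)"
  proof -
    have "lam = (lam - nu) + (nu + (of_nat n - 1) / 2) - (of_nat n - 1) / 2" by simp
    also have "... = (- 3/2 - 2 * of_nat l) + (- of_nat j) - (of_nat n - 1) / 2" by (simp only: l j)
    also have "... = - of_nat n / 2 - of_nat (j + 2 * l + 1)" by (simp add: field_simps)
    finally show ?thesis .
  qed
  moreover have "int (j + 2 * l + 1) - int j = 2 * int l + 1" by simp
  ultimately show "(lam, nu) \<in> L_odd n" unfolding L_odd_def by blast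
qed

lemma rGamma_half_zero_iff: "rGamma ((z + 3/2) / 2) = 0 \<longleftrightarrow> (\<exists>k::nat. z = - 3/2 - 2 * of_nat k)" for z :: complex
proof
  assume "rGamma ((z + 3/2) / 2) = 0"
  then obtain k :: nat where k: "(z + 3/2) / 2 = - of_nat k" by (auto simp: rGamma_eq_zero_iff elim: nonpos_Ints_cases')
  have "z = 2 * ((z + 3/2) / 2) - 3/2" by (simp add: field_simps)
  also have "... = - 3/2 - 2 * of_nat k" by (simp only: k) simp
  finally show "\<exists>k::nat. z = - 3/2 - 2 * of_nat k" by blast
next
  assume "\<exists>k::nat. z = - 3/2 - 2 * of_nat k"
  then obtain k :: nat where "z = - 3/2 - 2 * of_nat k" by blast
  then have "(z + 3/2) / 2 = - of_nat k" by simp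
  then show "rGamma ((z + 3/2) / 2) = 0" by (simp only: rGamma_eq_zero_iff) simp
qed

lemma X_minus_iff: "p \<in> X_minus \<longleftrightarrow> rGamma (al p) = 0"
  and Y_minus_iff: "p \<in> Y_minus \<longleftrightarrow> rGamma (be p) = 0"
  by (cases p; simp add: X_minus_def Y_minus_def al_def be_def rGamma_half_zero_iff)+

lemma KA_tilde_Y:
  fixes \<phi> :: "'m::finite space cfun"
  assumes \<phi>: "\<phi> \<in> test_functions" and l: "lam - nu = - 3/2 - 2 * of_nat l"
  shows "KA_tilde (lam, nu) \<phi> =
    (- 1) ^ l * fact l * of_real (pi powr (real CARD('m) / 2)) * rGamma (nu + hdim TYPE('m)) * YY l (nu - of_nat l) \<phi>"
proof -
  have lam: "lam = nu - 3/2 - 2 * of_nat l" using l by (simp add: algebra_simps)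
  have "be (lam, nu) = - of_nat l" "al (lam, nu) = nu - of_nat l" unfolding lam al_def be_def by (simp_all add: field_simps)
  then show ?thesis unfolding KA_tilde_eq[OF \<phi>] TT_def using KT_Y[OF \<phi>, of "nu - of_nat l" l] by simp
qed

lemma KA_tilde_KC:
  fixes \<phi> :: "'m::finite space cfun"
  assumes \<phi>: "\<phi> \<in> test_functions" and l: "lam - nu = - 3/2 - 2 * of_nat l"
  shows "KA_tilde (lam, nu) \<phi> =
    (- 1) ^ (l + 1) * fact l * of_real (pi powr (real CARD('m) / 2)) / 2 ^ (2 * l) * rGamma (nu + hdim TYPE('m)) * KC_tilde l nu \<phi>"
proof -
  have "(2 :: complex) ^ (2 * l) = 4 ^ l" by (simp add: power_mult)
  then show ?thesis unfolding KA_tilde_Y[OF \<phi> l] KC_eq[OF test_smooth[OF \<phi>]] by simp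
qed

lemma dsupp_deq_0: "deq S (\<lambda>_. 0) \<Longrightarrow> dsupp S = {}"
  unfolding dsupp_def deq_def by blast

lemma dsupp_KA_tilde_Y:
  assumes l: "lam - nu = - 3/2 - 2 * of_nat l" and r: "rGamma (nu + hdim TYPE('m::finite)) \<noteq> 0"
  shows "dsupp (KA_tilde (lam, nu) :: 'm space functional) = {0}"
proof (rule dsupp_0_iff[OF _ KA_tilde_Y[OF _ l]])
  show "(- 1) ^ l * fact l * of_real (pi powr (real CARD('m) / 2)) * rGamma (nu + hdim TYPE('m)) \<noteq> 0"
    using r by simp
qed

text \<open>Outside \<open>L_odd n\<close> the distribution is nonzero because its support, found in
  each of the three remaining cases, is nonempty.\<close>

lemma KA_tilde_deq_0_iff:
  assumes hd: "hdim TYPE('m::finite) = (of_nat n - 1) / 2"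
  shows "deq (KA_tilde p :: 'm space functional) (\<lambda>_. 0) \<longleftrightarrow> p \<in> L_odd n"
proof -
  obtain lam nu where p: "p = (lam, nu)" by (cases p)
  show ?thesis
  proof (cases "p \<in> Y_minus")
    case True
    then obtain l :: nat where l: "lam - nu = - 3/2 - 2 * of_nat l" by (auto simp: p Y_minus_def)
    have L: "p \<in> L_odd n \<longleftrightarrow> rGamma (nu + hdim TYPE('m)) = 0" unfolding p L_odd_iff hd using l by blast
    show ?thesis
    proof (cases "rGamma (nu + hdim TYPE('m)) = 0")
      case True
      have "deq (KA_tilde p :: 'm space functional) (\<lambda>_. 0)"
        unfolding deq_def p by (intro ballI) (simp only: KA_tilde_Y[OF _ l] True mult_zero_right mult_zero_left)
      then show ?thesis using L True by simp
    next
      case False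
      then show ?thesis using L dsupp_deq_0 dsupp_KA_tilde_Y[OF l False] unfolding p by (metis empty_not_insert)
    qed
  next
    case Y: False
    then have b: "rGamma (be p) \<noteq> 0" by (simp add: Y_minus_iff)
    have L: "p \<notin> L_odd n" using Y by (auto simp: p L_odd_iff Y_minus_def)
    have "dsupp (KA_tilde p :: 'm space functional) \<noteq> {}"
    proof (cases "rGamma (al p) = 0")
      case True
      then obtain k :: nat where "al p = - of_nat k" by (auto simp: rGamma_eq_zero_iff elim: nonpos_Ints_cases')
      then have "dsupp (KA_tilde p :: 'm space functional) = {x. snd x = 0}" by (rule dsupp_TT_X[OF _ b KA_tilde_TT])
      moreover have "(0 :: 'm space) \<in> {x. snd x = 0}" by simp
      ultimately show ?thesis by blast
    next
      case False
      have "dsupp (KA_tilde p :: 'm space functional) = UNIV" by (rule dsupp_TT_UNIV[OF False b KA_tilde_TT])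
      then show ?thesis by simp
    qed
    then show ?thesis using L dsupp_deq_0 by blast
  qed
qed

text \<open>In the product formulas of item 4 the points of \<open>L_odd n\<close> are left out,
  because Gamma sits at a pole there and has the value 0 by convention. The two families are defined
  and holomorphic at these points all the same.\<close>

theorem theorem4p7:
  fixes n :: nat and rho rhoH :: complex
  assumes n: "n \<ge> 2" and card: "CARD('m::finite) = n - 1"
    and rho: "rho = of_nat n / 2" and rhoH: "rhoH = (of_nat n - 1) / 2"
  shows
    "holo2_family UNIV (KA_tilde :: complex \<times> complex \<Rightarrow> 'm space functional)
     \<and> (\<forall>lam nu. (lam, nu) \<in> KA_dom \<longrightarrow>
          deq (KA_tilde (lam, nu) :: 'm space functional)
              (dscale (1 / (Gamma ((lam + nu + 3/2) / 2) * Gamma ((lam - nu + 3/2) / 2)))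
                 (KA_int lam nu)))
     \<and> (\<forall>p. deq (KA_tilde p :: 'm space functional) (\<lambda>_. 0) \<longleftrightarrow> p \<in> L_odd n)
     \<and> (\<forall>p. p \<notin> X_minus \<union> Y_minus \<longrightarrow> dsupp (KA_tilde p :: 'm space functional) = UNIV)
     \<and> (\<forall>lam nu. \<forall>k::nat. (lam, nu) \<in> X_minus - Y_minus \<and> lam + nu = - 3/2 - 2 * of_nat k \<longrightarrow>
          deq (KA_tilde (lam, nu) :: 'm space functional)
              (dscale ((-1) ^ (k + 1) * fact k / fact (2*k + 1)) (KB_tilde k nu))
          \<and> dsupp (KA_tilde (lam, nu) :: 'm space functional) = {x. snd x = 0})
     \<and> (\<forall>lam nu. \<forall>l::nat. (lam, nu) \<in> Y_minus - L_odd n \<and> lam - nu = - 3/2 - 2 * of_nat l \<longrightarrow>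
          deq (KA_tilde (lam, nu) :: 'm space functional)
              (dscale ((-1) ^ (l + 1) * fact l * of_real (pi powr ((real n - 1) / 2))
                         / 2 ^ (2*l) * rGamma (nu + (of_nat n - 1) / 2))
                 (KC_tilde l nu))
          \<and> dsupp (KA_tilde (lam, nu) :: 'm space functional) = {0})
     \<and> (\<forall>i j l :: nat. (- rho - of_nat i, - rhoH - of_nat j) \<in> L_odd n
                       \<and> 2 * int l = int i - int j - 1 \<longrightarrow>
          (- rho - of_nat i) - (- rhoH - of_nat j) = - 3/2 - 2 * of_nat l
          \<and> holo_family UNIV (KC_tilde l :: complex \<Rightarrow> 'm space functional)
          \<and> (\<forall>lam nu. lam - nu = - 3/2 - 2 * of_nat l \<and> (lam, nu) \<notin> L_odd n \<longrightarrow>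
               deq (KC_tilde l nu :: 'm space functional)
                   (dscale ((-1) ^ (l + 1) * 2 ^ (2*l)
                              / (fact l * of_real (pi powr ((real n - 1) / 2))) * Gamma (nu + rhoH))
                      (KA_tilde (lam, nu))))
          \<and> holo_family UNIV (KAA_tilde j :: complex \<Rightarrow> 'm space functional)
          \<and> (\<forall>lam nu. nu = - rhoH - of_nat j \<and> (lam, nu) \<notin> L_odd n \<longrightarrow>
               deq (KAA_tilde j lam :: 'm space functional)
                   (dscale (Gamma ((lam - nu + 3/2) / 2)) (KA_tilde (lam, nu))))
          \<and> dsupp (KC_tilde l (- rhoH - of_nat j) :: 'm space functional) = {0}
          \<and> dsupp (KAA_tilde j (- rho - of_nat i) :: 'm space functional)
              = (if even n then UNIV else {x. snd x = 0})
          \<and> (odd n \<longrightarrow> (\<forall>k::nat. 2 * int k = int n + int i + int j - 2 \<longrightarrow>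
               deq (KAA_tilde j (- rho - of_nat i) :: 'm space functional)
                   (dscale ((-1) ^ (k + 1) * fact k / fact (2*k + 1))
                      (dmult (\<lambda>x. of_real (((norm (fst x))\<^sup>2 + (snd x)\<^sup>2) ^ j))
                         (delta_xn (2*k + 1)))))))"
proof (intro conjI allI impI)
  have hd: "hdim TYPE('m) = (of_nat n - 1) / 2" using n card by (simp add: of_nat_diff)
  have hdr: "hdim TYPE('m) = rhoH" unfolding rhoH by (rule hd)
  have hr: "real CARD('m) / 2 = (real n - 1) / 2" using n card by (simp add: of_nat_diff)
  show "holo2_family UNIV (KA_tilde :: complex \<times> complex \<Rightarrow> 'm space functional)"
    by (rule holo2_family_deq[OF holo2_family_TT KA_tilde_TT])
  show "deq (KA_tilde (lam, nu) :: 'm space functional)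
              (dscale (1 / (Gamma ((lam + nu + 3/2) / 2) * Gamma ((lam - nu + 3/2) / 2))) (KA_int lam nu))"
    if "(lam, nu) \<in> KA_dom" for lam nu
    unfolding deq_def dscale_def
  proof
    fix \<phi> :: "'m space cfun" assume \<phi>: "\<phi> \<in> test_functions"
    have "hh (lam, nu) = 1 / (Gamma ((lam + nu + 3/2) / 2) * Gamma ((lam - nu + 3/2) / 2))"
      by (simp only: hh_def al_def be_def fst_conv snd_conv rGamma_inverse_Gamma inverse_eq_divide times_divide_times_eq mult_1)
    then show "KA_tilde (lam, nu) \<phi> = 1 / (Gamma ((lam + nu + 3/2) / 2) * Gamma ((lam - nu + 3/2) / 2)) * KA_int lam nu \<phi>"
      unfolding KA_tilde_eq[OF \<phi>] TT_dom[OF that \<phi>] by (simp only:)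
  qed
  show "deq (KA_tilde p :: 'm space functional) (\<lambda>_. 0) \<longleftrightarrow> p \<in> L_odd n" for p
    by (rule KA_tilde_deq_0_iff[OF hd])
  show "dsupp (KA_tilde p :: 'm space functional) = UNIV" if "p \<notin> X_minus \<union> Y_minus" for p
    by (rule dsupp_TT_UNIV[OF _ _ KA_tilde_TT]) (use that in \<open>auto simp: X_minus_iff Y_minus_iff\<close>)
  show "deq (KA_tilde (lam, nu) :: 'm space functional) (dscale ((-1) ^ (k + 1) * fact k / fact (2*k + 1)) (KB_tilde k nu))"
    if "(lam, nu) \<in> X_minus - Y_minus \<and> lam + nu = - 3/2 - 2 * of_nat k" for lam nu and k :: nat
  proof -
    have lam: "lam = - 3/2 - 2 * of_nat k - nu" using conjunct2[OF that] by (simp add: algebra_simps)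
    have "al (lam, nu) = - of_nat k" "be (lam, nu) = - nu - of_nat k" unfolding lam al_def be_def by (simp_all add: field_simps)
    then show ?thesis unfolding deq_def dscale_def
      by (intro ballI) (simp only: KA_tilde_eq TT_def KT_X_KB)
  qed
  show "dsupp (KA_tilde (lam, nu) :: 'm space functional) = {x. snd x = 0}"
    if "(lam, nu) \<in> X_minus - Y_minus \<and> lam + nu = - 3/2 - 2 * of_nat k" for lam nu and k :: nat
  proof (rule dsupp_TT_X[OF _ _ KA_tilde_TT])
    show "al (lam, nu) = - of_nat k" using that by (simp add: al_def)
    show "rGamma (be (lam, nu)) \<noteq> 0" using that by (simp add: Y_minus_iff)
  qed
  show "deq (KA_tilde (lam, nu) :: 'm space functional)
              (dscale ((-1) ^ (l + 1) * fact l * of_real (pi powr ((real n - 1) / 2)) / 2 ^ (2*l) * rGamma (nu + (of_nat n - 1) / 2)) (KC_tilde l nu))"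
    if "(lam, nu) \<in> Y_minus - L_odd n \<and> lam - nu = - 3/2 - 2 * of_nat l" for lam nu and l :: nat
    unfolding deq_def dscale_def by (intro ballI) (simp only: KA_tilde_KC[OF _ conjunct2[OF that]] hd hr)
  show "dsupp (KA_tilde (lam, nu) :: 'm space functional) = {0}"
    if "(lam, nu) \<in> Y_minus - L_odd n \<and> lam - nu = - 3/2 - 2 * of_nat l" for lam nu and l :: nat
  proof (rule dsupp_KA_tilde_Y[OF conjunct2[OF that]])
    have "(lam, nu) \<notin> L_odd n" using that by blast
    then show "rGamma (nu + hdim TYPE('m)) \<noteq> 0" using conjunct2[OF that] unfolding hd L_odd_iff by blast
  qed
  fix i j l :: nat
  assume A: "(- rho - of_nat i, - rhoH - of_nat j) \<in> L_odd n \<and> 2 * int l = int i - int j - 1"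
  then have i: "i = j + 2 * l + 1" by linarith
  have nu: "- rhoH - of_nat j = - hdim TYPE('m) - of_nat j" by (simp only: hdr)
  show "(- rho - of_nat i) - (- rhoH - of_nat j) = - 3/2 - 2 * of_nat l"
    unfolding rho rhoH i by (simp add: field_simps)
  show "holo_family UNIV (KC_tilde l :: complex \<Rightarrow> 'm space functional)" by (rule holo_family_KC)
  show "holo_family UNIV (KAA_tilde j :: complex \<Rightarrow> 'm space functional)" by (rule holo_family_KAA)
  show "deq (KC_tilde l nu :: 'm space functional)
     (dscale ((-1) ^ (l + 1) * 2 ^ (2*l) / (fact l * of_real (pi powr ((real n - 1) / 2))) * Gamma (nu + rhoH)) (KA_tilde (lam, nu)))"
    if h: "lam - nu = - 3/2 - 2 * of_nat l \<and> (lam, nu) \<notin> L_odd n" for lam nu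
    unfolding deq_def dscale_def
  proof
    fix \<phi> :: "'m space cfun" assume \<phi>: "\<phi> \<in> test_functions"
    define P where "P = complex_of_real (pi powr ((real n - 1) / 2))"
    define K where "K = KC_tilde l nu \<phi>"
    have P: "P \<noteq> 0" by (simp add: P_def)
    have r: "Gamma (nu + rhoH) * rGamma (nu + rhoH) = 1"
      by (rule Gamma_rGamma) (use h in \<open>auto simp: L_odd_iff rhoH\<close>)
    have "(-1) ^ (l + 1) * 2 ^ (2*l) / (fact l * P) * Gamma (nu + rhoH) * KA_tilde (lam, nu) \<phi>
      = ((-1) ^ (l + 1) * (-1) ^ (l + 1)) * (2 ^ (2*l) / 2 ^ (2*l)) * ((fact l * P) / (fact l * P)) * (Gamma (nu + rhoH) * rGamma (nu + rhoH)) * K"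
      unfolding KA_tilde_KC[OF \<phi> conjunct1[OF h]] hdr hr P_def[symmetric] K_def[symmetric] by (simp add: mult_ac)
    also have "... = K" using P unfolding r by (simp add: power_mult_distrib[symmetric])
    finally show "KC_tilde l nu \<phi> = (-1) ^ (l + 1) * 2 ^ (2*l) / (fact l * of_real (pi powr ((real n - 1) / 2))) * Gamma (nu + rhoH) * KA_tilde (lam, nu) \<phi>"
      by (simp only: P_def K_def)
  qed
  show "deq (KAA_tilde j lam :: 'm space functional) (dscale (Gamma ((lam - nu + 3/2) / 2)) (KA_tilde (lam, nu)))"
    if h: "nu = - rhoH - of_nat j \<and> (lam, nu) \<notin> L_odd n" for lam nu
    unfolding deq_def dscale_def
  proof
    fix \<phi> :: "'m space cfun" assume \<phi>: "\<phi> \<in> test_functions"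
    have nu': "nu = - hdim TYPE('m) - of_nat j" using h by (simp only: hdr)
    have "nu + (of_nat n - 1) / 2 = - of_nat j" unfolding nu' hd by simp
    then have z: "rGamma (nu + (of_nat n - 1) / 2) = 0" by (simp only: rGamma_eq_zero_iff) simp
    \<comment> \<open>On this line nu + rho_H = -j is a pole of Gamma, so a zero of this factor
      would put the point into \<open>L_odd n\<close>.\<close>
    have "rGamma ((lam - nu + 3/2) / 2) \<noteq> 0"
      using conjunct2[OF h] z unfolding L_odd_iff rGamma_half_zero_iff by blast
    from Gamma_rGamma[OF this] have r: "Gamma ((lam - nu + 3/2) / 2) * rGamma (be (lam, nu)) = 1" by (simp add: be_def)
    show "KAA_tilde j lam \<phi> = Gamma ((lam - nu + 3/2) / 2) * KA_tilde (lam, nu) \<phi>"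
      unfolding KA_tilde_eq[OF \<phi>] TT_WI[OF \<phi> nu'] KAA_eq[OF \<phi>] nu'[symmetric] mult.assoc[symmetric] r by simp
  qed
  show "dsupp (KC_tilde l (- rhoH - of_nat j) :: 'm space functional) = {0}"
    by (rule dsupp_0_iff[OF _ KC_eq[OF test_smooth]]) simp_all
  \<comment> \<open>The value of alpha at the special point is -(n + i + j - 2) / 2. Since i + j is
    odd, it is a nonpositive integer exactly for odd n, which separates the two cases of the
    support.\<close>
  define a where "a = al (- rho - of_nat i, - hdim TYPE('m) - of_nat j)"
  have a: "a = - (of_nat (n + i + j) - 2) / 2"
    unfolding a_def al_def hdr rho rhoH by (simp add: field_simps)
  have ak: "a = - of_nat k" if "2 * int k = int n + int i + int j - 2" for k :: nat
  proof -
    have "n + i + j = 2 * k + 2" using that by linarith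
    then show ?thesis unfolding a by simp
  qed
  show "dsupp (KAA_tilde j (- rho - of_nat i) :: 'm space functional) = (if even n then UNIV else {x. snd x = 0})"
  proof (cases "even n")
    case True
    have "rGamma a \<noteq> 0"
    proof
      assume "rGamma a = 0"
      then obtain k :: nat where "a = - of_nat k" by (auto simp: rGamma_eq_zero_iff elim: nonpos_Ints_cases')
      then have "of_nat (n + i + j) = (of_nat (2 * k + 2) :: complex)" unfolding a by (simp add: field_simps)
      then have "n + i + j = 2 * k + 2" by (simp only: of_nat_eq_iff)
      then have "n + 2 * j + 2 * l + 1 = 2 * k + 2" unfolding i by simp
      then show False using True by presburger
    qed
    then show ?thesis using True dsupp_KAA_UNIV[where 'm = 'm] by (simp add: a_def)
  next
    case False
    define k where "k = (n + i + j - 2) div 2"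
    have "2 * int k = int n + int i + int j - 2" unfolding k_def i using False n by presburger
    from ak[OF this] show ?thesis using False dsupp_KAA_hyperplane[where 'm = 'm] by (simp add: a_def)
  qed
  show "deq (KAA_tilde j (- rho - of_nat i) :: 'm space functional)
     (dscale ((-1) ^ (k + 1) * fact k / fact (2*k + 1)) (dmult (\<lambda>x. of_real (((norm (fst x))\<^sup>2 + (snd x)\<^sup>2) ^ j)) (delta_xn (2*k + 1))))"
    if "2 * int k = int n + int i + int j - 2" for k :: nat
    unfolding deq_def dscale_def dmult_def wj_def[symmetric]
  proof
    fix \<phi> :: "'m space cfun" assume \<phi>: "\<phi> \<in> test_functions"
    \<comment> \<open>\<open>KAA_neg\<close> carries the sign (-1)^k; the odd number 2k + 1 of
      derivatives of the Dirac distribution supplies the further factor -1.\<close>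
    show "KAA_tilde j (- rho - of_nat i) \<phi> = (-1) ^ (k + 1) * fact k / fact (2*k + 1) * delta_xn (2*k + 1) (\<lambda>x. wj j x * \<phi> x)"
      unfolding KAA_neg[OF \<phi> ak[OF that, unfolded a_def]] delta_xn_eq[OF smooth_mult[OF smooth_wj test_smooth[OF \<phi>]]]
      by (simp del: fact_Suc funpow.simps)
  qed
qed

end
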